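(* Let $s=s_1+is_2\in\mathbb C$ with $s_1>0$, $s_2\in\mathbb R$, let $c>0$, $h\in\mathbb R$, $L>0$, $\sigma_0>0$, let $m\ge1$ be an integer, and set $\overline L=\sigma_0L/(m+1)$. Let $\mathscr B$ be the Dirichlet-to-Neumann operator of the half-space problem and $\mathscr B_{pml}$ the Dirichlet-to-Neumann operator of the PML layer problem (both on $\Gamma_h=\{x\in\mathbb R^3:x_3=h\}$, defined in the context). Then $$\|\mathscr B-\mathscr B_{pml}\|_{L(H^{1/2}(\Gamma_h),H^{-1/2}(\Gamma_h))}\le \max\Big\{1,\frac{|s|}{c}\Big\}\,\frac{2e^{-2\overline L/c}}{1-e^{-2\overline L/c}}.$$
   Context: Write $x=(\tilde x,x_3)\in\mathbb R^3$, $\tilde x\in\mathbb R^2$; hats denote the Fourier transform in $\tilde x$: $\hat\phi(\xi)=\int_{\mathbb R^2}e^{-i\tilde x\cdot\xi}\phi(\tilde x)\,d\tilde x$, $\xi\in\mathbb R^2$. For real $r$, $\|\phi\|^2_{H^r(\Gamma_h)}=\int_{\mathbb R^2}(1+|\xi|^2)^r|\hat\phi(\xi)|^2d\xi$. $L(X,Y)$ denotes the bounded linear operators from $X$ to $Y$ with the operator norm. Let $\beta(\xi)=\sqrt{s^2/c^2+|\xi|^2}$ with $\operatorname{Re}\beta(\xi)>0$. The operator $\mathscr B=\mathscr B(s)$ is the Fourier multiplier $\widehat{\mathscr B\phi}(\xi)=-\beta(\xi)\hat\phi(\xi)$. The PML medium function is $\sigma(x_3)=1$ for $x_3\le h$,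 $\sigma(x_3)=1+s_1^{-1}\sigma_0\big(\frac{x_3-h}{L}\big)^m$ for $h<x_3\le h+L$, where $s_1=\operatorname{Re}(s)$. Let $\Delta_p:=\nabla\cdot(\mathbb D\nabla)$, $\mathbb D=\operatorname{diag}(\sigma,\sigma,1/\sigma)$, $\Omega_h^L:=\{x:h<x_3<h+L\}$, $\Gamma_{h+L}:=\{x:x_3=h+L\}$. For $\phi\in H^{1/2}(\Gamma_h)$, $\mathscr B_{pml}\phi:=\partial_{x_3}v|_{\Gamma_h}$, where $v\in H^1(\Omega_h^L)$ solves $\Delta_p v-\frac{s^2\sigma}{c^2}v=0$ in $\Omega_h^L$, $v=\phi$ on $\Gamma_h$, $v=0$ on $\Gamma_{h+L}$. Explicitly, with $\widetilde L=\big(1+\frac{s_1^{-1}\sigma_0}{m+1}\big)L$, $$\widehat{\mathscr B_{pml}\phi}(\xi)=-\beta(\xi)\,\frac{e^{\beta(\xi)\widetilde L}+e^{-\beta(\xi)\widetilde L}}{e^{\beta(\xi)\widetilde L}-e^{-\beta(\xi)\widetilde L}}\,\hat\phi(\xi).$$ *)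

theory Defs
  imports "HOL-Analysis.Analysis"
begin

section \<open>Smooth functions, Schwartz functions and tempered distributions\<close>

definition pd :: "'a::euclidean_space \<Rightarrow> ('a \<Rightarrow> complex) \<Rightarrow> 'a \<Rightarrow> complex" where
  "pd i f x = frechet_derivative f (at x) i"

fun partials :: "'a::euclidean_space list \<Rightarrow> ('a \<Rightarrow> complex) \<Rightarrow> 'a \<Rightarrow> complex" where
  "partials [] f = f"
| "partials (i # is) f = pd i (partials is f)"

definition smooth :: "('a::euclidean_space \<Rightarrow> complex) \<Rightarrow> bool" where
  "smooth f \<longleftrightarrow> (\<forall>is. set is \<subseteq> Basis \<longrightarrow> (\<forall>x. partials is f differentiable (at x)))"

definition C1 :: "('a::euclidean_space \<Rightarrow> complex) \<Rightarrow> bool" where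
  "C1 f \<longleftrightarrow> (\<forall>x. f differentiable (at x)) \<and> (\<forall>i\<in>Basis. continuous_on UNIV (pd i f))"

definition schwartz :: "('a::euclidean_space \<Rightarrow> complex) set" where
  "schwartz = {f. smooth f \<and>
     (\<forall>is k. set is \<subseteq> Basis \<longrightarrow> bounded (range (\<lambda>x. (1 + norm x) ^ k *\<^sub>R partials is f x)))}"

text \<open>
  A tempered distribution is a sequentially continuous (the Schwartz space being metrizable:
  continuous) complex-linear functional on the Schwartz space.  Functionals are HOL-total, so they
  are fixed to be 0 outside the Schwartz space; thus equality of distributions is HOL equality.
\<close>

definition schwartz_null_seq :: "(nat \<Rightarrow> 'a::euclidean_space \<Rightarrow> complex) \<Rightarrow> bool" where
  "schwartz_null_seq X \<longleftrightarrow> (\<forall>n. X n \<in> schwartz) \<and>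
     (\<forall>is k. set is \<subseteq> Basis \<longrightarrow>
        uniform_limit UNIV (\<lambda>n x. (1 + norm x) ^ k *\<^sub>R partials is (X n) x) (\<lambda>_. 0) sequentially)"

type_synonym 'a distr = "('a \<Rightarrow> complex) \<Rightarrow> complex"

definition tempered :: "'a::euclidean_space distr set" where
  "tempered = {T.
     (\<forall>\<psi>\<in>schwartz. \<forall>\<eta>\<in>schwartz. \<forall>a b. T (\<lambda>x. a * \<psi> x + b * \<eta> x) = a * T \<psi> + b * T \<eta>) \<and>
     (\<forall>X. schwartz_null_seq X \<longrightarrow> (\<lambda>n. T (X n)) \<longlonglongrightarrow> 0) \<and>
     (\<forall>\<psi>. \<psi> \<notin> schwartz \<longrightarrow> T \<psi> = 0)}"

definition regular_distr :: "('a::euclidean_space \<Rightarrow> complex) \<Rightarrow> 'a distr" where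
  "regular_distr f = (\<lambda>\<psi>. if \<psi> \<in> schwartz then LINT x|lborel. f x * \<psi> x else 0)"

section \<open>Fourier transform, Sobolev spaces and Fourier multipliers\<close>

definition fourier :: "('a::euclidean_space \<Rightarrow> complex) \<Rightarrow> 'a \<Rightarrow> complex" where
  "fourier \<phi> \<xi> = (LINT x|lborel. exp (- \<i> * complex_of_real (x \<bullet> \<xi>)) * \<phi> x)"

text \<open>
  \<open>is_fourier T f\<close>: the Fourier transform of \<open>T\<close>, defined by duality, is the
  function \<open>f\<close>.  Integrability is required because the Bochner integral of a
  non-integrable function is 0.  Such an \<open>f\<close> is unique up to null sets.
\<close>

definition is_fourier :: "'a::euclidean_space distr \<Rightarrow> ('a \<Rightarrow> complex) \<Rightarrow> bool" where
  "is_fourier T f \<longleftrightarrow> f \<in> borel_measurable borel \<and>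
     (\<forall>\<psi>\<in>schwartz. integrable lborel (\<lambda>\<xi>. f \<xi> * \<psi> \<xi>) \<and>
        T (fourier \<psi>) = (LINT \<xi>|lborel. f \<xi> * \<psi> \<xi>))"

definition fhat :: "'a::euclidean_space distr \<Rightarrow> 'a \<Rightarrow> complex" where
  "fhat T = (SOME f. is_fourier T f)"

definition sobolev :: "real \<Rightarrow> 'a::euclidean_space distr set" where
  "sobolev r = {T \<in> tempered. \<exists>f. is_fourier T f \<and>
     integrable lborel (\<lambda>\<xi>. (1 + (norm \<xi>)\<^sup>2) powr r * (norm (f \<xi>))\<^sup>2)}"

definition sobolev_norm :: "real \<Rightarrow> 'a::euclidean_space distr \<Rightarrow> real" where
  "sobolev_norm r T = sqrt (LINT \<xi>|lborel. (1 + (norm \<xi>)\<^sup>2) powr r * (norm (fhat T \<xi>))\<^sup>2)"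

definition fourier_multiplier :: "('a::euclidean_space \<Rightarrow> complex) \<Rightarrow> 'a distr \<Rightarrow> 'a distr" where
  "fourier_multiplier a T = (THE S. S \<in> tempered \<and> is_fourier S (\<lambda>\<xi>. a \<xi> * fhat T \<xi>))"

definition bounded_operator :: "real \<Rightarrow> real \<Rightarrow> ('a::euclidean_space distr \<Rightarrow> 'a distr) \<Rightarrow> bool" where
  "bounded_operator r q A \<longleftrightarrow>
     (\<forall>T\<in>sobolev r. A T \<in> sobolev q) \<and>
     (\<forall>S\<in>sobolev r. \<forall>T\<in>sobolev r. \<forall>a b.
        A (\<lambda>\<psi>. a * S \<psi> + b * T \<psi>) = (\<lambda>\<psi>. a * A S \<psi> + b * A T \<psi>)) \<and>
     (\<exists>K. \<forall>T\<in>sobolev r. sobolev_norm q (A T) \<le> K * sobolev_norm r T)"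

text \<open>As for \<^const>\<open>onorm\<close>, the zero element contributes \<open>0 / 0 = 0\<close>.\<close>

definition operator_norm :: "real \<Rightarrow> real \<Rightarrow> ('a::euclidean_space distr \<Rightarrow> 'a distr) \<Rightarrow> real" where
  "operator_norm r q A = (SUP T\<in>sobolev r. sobolev_norm q (A T) / sobolev_norm r T)"

section \<open>The space $H^1$ of an open set\<close>

definition test_functions :: "'a::euclidean_space set \<Rightarrow> ('a \<Rightarrow> complex) set" where
  "test_functions \<Omega> = {w. smooth w \<and> compact (closure {x. w x \<noteq> 0}) \<and> closure {x. w x \<noteq> 0} \<subseteq> \<Omega>}"

definition square_integrable :: "'a::euclidean_space set \<Rightarrow> ('a \<Rightarrow> complex) \<Rightarrow> bool" where
  "square_integrable \<Omega> v \<longleftrightarrow>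
     set_borel_measurable lborel \<Omega> v \<and> set_integrable lborel \<Omega> (\<lambda>x. (norm (v x))\<^sup>2)"

definition is_weak_pd ::
    "'a::euclidean_space set \<Rightarrow> 'a \<Rightarrow> ('a \<Rightarrow> complex) \<Rightarrow> ('a \<Rightarrow> complex) \<Rightarrow> bool" where
  "is_weak_pd \<Omega> i v g \<longleftrightarrow> square_integrable \<Omega> g \<and>
     (\<forall>w\<in>test_functions \<Omega>. (LINT x:\<Omega>|lborel. v x * pd i w x) = - (LINT x:\<Omega>|lborel. g x * w x))"

definition H1 :: "'a::euclidean_space set \<Rightarrow> ('a \<Rightarrow> complex) set" where
  "H1 \<Omega> = {v. square_integrable \<Omega> v \<and> (\<forall>i\<in>Basis. \<exists>g. is_weak_pd \<Omega> i v g)}"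

text \<open>Representatives of the weak partial derivatives; unique up to null sets for open \<open>\<Omega>\<close>.\<close>

definition weak_pd :: "'a::euclidean_space set \<Rightarrow> 'a \<Rightarrow> ('a \<Rightarrow> complex) \<Rightarrow> 'a \<Rightarrow> complex" where
  "weak_pd \<Omega> i v = (SOME g. is_weak_pd \<Omega> i v g)"

definition H1_norm :: "'a::euclidean_space set \<Rightarrow> ('a \<Rightarrow> complex) \<Rightarrow> real" where
  "H1_norm \<Omega> v = sqrt (LINT x:\<Omega>|lborel. (norm (v x))\<^sup>2 + (\<Sum>i\<in>Basis. (norm (weak_pd \<Omega> i v x))\<^sup>2))"

section \<open>The layer problem and the Dirichlet-to-Neumann operators\<close>

text \<open>
  Points of $\mathbb R^3$ are pairs $(\tilde x, x_3)$, and the planes $\Gamma_a = \{x_3 = a\}$ are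
  identified with $\mathbb R^2$ through $\tilde x$.
\<close>

type_synonym space3 = "(real^2) \<times> real"

definition layer :: "real \<Rightarrow> real \<Rightarrow> space3 set" where
  "layer h L = {x. h < snd x \<and> snd x < h + L}"

text \<open>
  \<open>has_trace \<Omega> v a T\<close>: the trace of \<open>v\<close> in $H^1(\Omega)$ on the boundary plane
  $\Gamma_a$ is \<open>T\<close>.  The trace operator is the continuous extension of the pointwise
  restriction of functions that are $C^1$ up to the boundary.
\<close>

definition has_trace :: "space3 set \<Rightarrow> (space3 \<Rightarrow> complex) \<Rightarrow> real \<Rightarrow> (real^2) distr \<Rightarrow> bool" where
  "has_trace \<Omega> v a T \<longleftrightarrow> T \<in> sobolev (1/2) \<and>
     (\<exists>u :: nat \<Rightarrow> space3 \<Rightarrow> complex.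
        (\<forall>n. C1 (u n) \<and> u n \<in> H1 \<Omega> \<and> regular_distr (\<lambda>y. u n (y, a)) \<in> sobolev (1/2)) \<and>
        (\<lambda>n. H1_norm \<Omega> (\<lambda>x. u n x - v x)) \<longlonglongrightarrow> 0 \<and>
        (\<lambda>n. sobolev_norm (1/2) (\<lambda>\<psi>. regular_distr (\<lambda>y. u n (y, a)) \<psi> - T \<psi>)) \<longlonglongrightarrow> 0)"

definition pml_\<sigma> :: "complex \<Rightarrow> real \<Rightarrow> real \<Rightarrow> real \<Rightarrow> nat \<Rightarrow> real \<Rightarrow> real" where
  "pml_\<sigma> s h L \<sigma>\<^sub>0 m x\<^sub>3 = (if x\<^sub>3 \<le> h then 1 else 1 + inverse (Re s) * \<sigma>\<^sub>0 * ((x\<^sub>3 - h) / L) ^ m)"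

definition pml_D :: "complex \<Rightarrow> real \<Rightarrow> real \<Rightarrow> real \<Rightarrow> nat \<Rightarrow> space3 \<Rightarrow> space3 \<Rightarrow> real" where
  "pml_D s h L \<sigma>\<^sub>0 m i x =
     (if i = (0, 1) then 1 / pml_\<sigma> s h L \<sigma>\<^sub>0 m (snd x) else pml_\<sigma> s h L \<sigma>\<^sub>0 m (snd x))"

text \<open>
  The bilinear form
  $\int_\Omega \mathbb D\nabla v\cdot\nabla w + \frac{s^2\sigma}{c^2}\, v w\,dx$
  of $-\Delta_p + s^2\sigma/c^2$ on the layer.
\<close>

definition pml_form :: "complex \<Rightarrow> real \<Rightarrow> real \<Rightarrow> real \<Rightarrow> real \<Rightarrow> nat \<Rightarrow>
    (space3 \<Rightarrow> complex) \<Rightarrow> (space3 \<Rightarrow> complex) \<Rightarrow> complex" where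
  "pml_form s c h L \<sigma>\<^sub>0 m v w =
     (LINT x:layer h L|lborel.
        (\<Sum>i\<in>Basis. of_real (pml_D s h L \<sigma>\<^sub>0 m i x) *
            weak_pd (layer h L) i v x * weak_pd (layer h L) i w x) +
        s\<^sup>2 * of_real (pml_\<sigma> s h L \<sigma>\<^sub>0 m (snd x)) / (of_real c)\<^sup>2 * v x * w x)"

text \<open>The equation $\Delta_p v - \frac{s^2\sigma}{c^2} v = 0$ in the sense of distributions,
  together with both boundary conditions.\<close>

definition pml_solution :: "complex \<Rightarrow> real \<Rightarrow> real \<Rightarrow> real \<Rightarrow> real \<Rightarrow> nat \<Rightarrow>
    (real^2) distr \<Rightarrow> (space3 \<Rightarrow> complex) \<Rightarrow> bool" where
  "pml_solution s c h L \<sigma>\<^sub>0 m \<phi> v \<longleftrightarrow>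
     v \<in> H1 (layer h L) \<and>
     (\<forall>w\<in>test_functions (layer h L). pml_form s c h L \<sigma>\<^sub>0 m v w = 0) \<and>
     has_trace (layer h L) v h \<phi> \<and>
     has_trace (layer h L) v (h + L) (\<lambda>\<psi>. 0)"

text \<open>
  The normal derivative $g = \partial_{x_3} v|_{\Gamma_h} \in H^{-1/2}(\Gamma_h)$ of an $H^1$ solution is
  given by Green's formula: for all \<open>w\<close> vanishing on $\Gamma_{h+L}$, the form equals
  $\int_{\Gamma_h} (\mathbb D\nabla v\cdot n)\, w$ with outer normal $n = -e_3$.  Since
  $\sigma(h) = 1$, we have $\mathbb D\nabla v\cdot n = -\partial_{x_3} v$ there.
\<close>

definition has_normal_deriv :: "complex \<Rightarrow> real \<Rightarrow> real \<Rightarrow> real \<Rightarrow> real \<Rightarrow> nat \<Rightarrow>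
    (space3 \<Rightarrow> complex) \<Rightarrow> (real^2) distr \<Rightarrow> bool" where
  "has_normal_deriv s c h L \<sigma>\<^sub>0 m v g \<longleftrightarrow> g \<in> sobolev (-1/2) \<and>
     (\<forall>w. C1 w \<and> w \<in> H1 (layer h L) \<and> (\<forall>y. w (y, h + L) = 0) \<and> (\<lambda>y. w (y, h)) \<in> schwartz
        \<longrightarrow> pml_form s c h L \<sigma>\<^sub>0 m v w = - g (\<lambda>y. w (y, h)))"

definition B_pml :: "complex \<Rightarrow> real \<Rightarrow> real \<Rightarrow> real \<Rightarrow> real \<Rightarrow> nat \<Rightarrow>
    (real^2) distr \<Rightarrow> (real^2) distr" where
  "B_pml s c h L \<sigma>\<^sub>0 m \<phi> =
     (THE g. \<exists>v. pml_solution s c h L \<sigma>\<^sub>0 m \<phi> v \<and> has_normal_deriv s c h L \<sigma>\<^sub>0 m v g)"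

text \<open>For \<open>Re s > 0\<close> the radicand is never in $(-\infty, 0]$, so the principal root
  \<^const>\<open>csqrt\<close> is the root with positive real part.\<close>

definition symbol_\<beta> :: "complex \<Rightarrow> real \<Rightarrow> real^2 \<Rightarrow> complex" where
  "symbol_\<beta> s c \<xi> = csqrt (s\<^sup>2 / (of_real c)\<^sup>2 + of_real ((norm \<xi>)\<^sup>2))"

definition B_half :: "complex \<Rightarrow> real \<Rightarrow> (real^2) distr \<Rightarrow> (real^2) distr" where
  "B_half s c = fourier_multiplier (\<lambda>\<xi>. - symbol_\<beta> s c \<xi>)"

end

theory Submission
  imports Defs "HOL-Complex_Analysis.Complex_Analysis"
begin

text \<open>
  In the Fourier variable $\xi$ both Dirichlet-to-Neumann operators are multipliers, $\mathscr B$ with symbol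
  $-\beta$ and $\mathscr B_{pml}$ with symbol $-\beta\coth(\beta\widetilde L)$.  The symbol of the difference
  is $\beta e^{-z}/\sinh z$ with $z=\beta\widetilde L$.  Its size is governed by two bounds on the square root:
  $|\beta|\le\max\{1,|s|/c\}\,(1+|\xi|^2)^{1/2}$ (\<open>norm_\<beta>_sq\<close>) and $\mathrm{Re}\,\beta\ge s_1/c$
  (\<open>Re_\<beta>_ge\<close>).  The second gives $\mathrm{Re}\,z\ge\overline L/c$, because $\widetilde L$ contains the
  summand $s_1^{-1}\overline L$, and then $|e^{-z}/\sinh z|\le 2e^{-2\overline L/c}/(1-e^{-2\overline L/c})$
  (\<open>dtn_difference\<close>).  The factor $(1+|\xi|^2)^{1/2}$ is exactly the distance between the weights of
  $H^{1/2}$ and $H^{-1/2}$ (\<open>order_one_multiplier\<close>).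

  The main work is to show that $\mathscr B_{pml}$, which is defined through weak solutions of the layer
  problem, is this multiplier (\<open>B_pml_eq\<close>).

  Existence: with $S(t)=\int_h^t\sigma$, the superposition of the waves
  $\sinh(\beta(\widetilde L-S))/\sinh(\beta\widetilde L)$ with boundary data $\hat\phi$ is a solution.  The
  Plancherel inequality on each horizontal plane, integrated over the height, shows that data in $H^{1/2}$ have
  finite energy, because the waves decay away from $\Gamma_h$ at a rate proportional to the frequency
  (\<open>decaying_symbol_energy\<close>).  Cutting off high frequencies gives $C^1$ functions that approximate the
  solution and its traces.  For them integration by parts yields Green's identity (\<open>green_identity\<close>), in
  which the flux through $\Gamma_h$ has the symbol $-\beta\coth(\beta\widetilde L)$.

  Uniqueness: let \<open>v\<close> be any weak solution and \<open>g\<close> its normal derivative.  The bilinear form is symmetric,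
  so \<open>v\<close> may be tested with the explicit waves.  Choosing the bottom data of the wave to be the transform of
  a test function $\eta$, Green's formula for \<open>v\<close> gives the pairing of $\hat g$ with $\eta$, while Green's
  identity for the wave, carried over to \<open>v\<close> along the approximating sequences that define its traces, gives
  the pairing of $-\beta\coth(\beta\widetilde L)\,\hat\phi$ with $\eta$.  So the two functions agree almost
  everywhere (\<open>normal_deriv_unique\<close>).

  Three general tools support this.  Bump functions that converge to indicators of boxes prove the fundamental lemma
  of the calculus of variations (\<open>AE_0_if_test_functions\<close>), and with it the uniqueness of weak derivatives
  and of Fourier transforms.  Gaussian convergence factors prove Fourier inversion on Schwartz functions
  (\<open>ft_inversion\<close>) and the Plancherel inequality (\<open>plancherel_inequality\<close>).  Finally, inversion represents every
  element of a Sobolev space by its transform (\<open>fourier_distr\<close>), so that statements about distributions become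
  statements about weighted $L^2$ functions.
\<close>

section \<open>Smooth functions\<close>

lemma partials_append: "partials (is @ js) f = partials is (partials js f)"
  by (induction "is") auto

lemma pd_eqI: "(f has_derivative f') (at x) \<Longrightarrow> pd i f x = f' i"
  unfolding pd_def by (metis frechet_derivative_at)

lemma has_derivative_pd:
  fixes f :: "'a::euclidean_space \<Rightarrow> complex"
  assumes "f differentiable (at x)"
  shows "(f has_derivative (\<lambda>h. \<Sum>i\<in>Basis. (h \<bullet> i) *\<^sub>R pd i f x)) (at x)"
proof -
  have D: "(f has_derivative frechet_derivative f (at x)) (at x)"
    using assms frechet_derivative_works by blast
  then interpret bounded_linear "frechet_derivative f (at x)"
    by (rule has_derivative_bounded_linear)
  have "frechet_derivative f (at x) h = (\<Sum>i\<in>Basis. (h \<bullet> i) *\<^sub>R pd i f x)" for h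
    by (subst euclidean_representation[of h, symmetric]) (simp add: sum scaleR pd_def)
  then show ?thesis using D by presburger
qed

text \<open>Closure of a class of functions under a single partial derivative replaces induction over iterated ones.\<close>

lemma smooth_coinduct:
  assumes "\<Phi> f"
    and diff: "\<And>f x. \<Phi> f \<Longrightarrow> f differentiable (at x)"
    and pd: "\<And>f i. \<Phi> f \<Longrightarrow> i \<in> Basis \<Longrightarrow> \<Phi> (pd i f)"
  shows "smooth f"
proof -
  have "set is \<subseteq> Basis \<Longrightarrow> \<Phi> (partials is f)" for "is"
    by (induction "is") (auto simp: assms)
  then show ?thesis by (auto simp: smooth_def diff)
qed

lemma smooth_differentiable: "smooth f \<Longrightarrow> f differentiable (at x)"
  unfolding smooth_def by (metis empty_set empty_subsetI partials.simps(1))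

lemma smooth_pd: 
  assumes "smooth f" "i \<in> Basis"
  shows "smooth (pd i f)"
proof -
  have "partials is (pd i f) = partials (is @ [i]) f" for "is"
    by (simp add: partials_append)
  then show ?thesis using assms by (auto simp: smooth_def)
qed

lemma smooth_continuous: "smooth f \<Longrightarrow> continuous_on S f"
  by (simp add: continuous_at_imp_continuous_on differentiable_imp_continuous_within smooth_differentiable)

lemma C1_smooth: "smooth f \<Longrightarrow> C1 f"
  by (simp add: C1_def smooth_differentiable smooth_continuous smooth_pd)

lemma pd_const: "pd i (\<lambda>_. c) x = 0"
  by (rule pd_eqI) auto

lemma pd_add:
  assumes "f differentiable (at x)" "g differentiable (at x)"
  shows "pd i (\<lambda>x. f x + g x) x = pd i f x + pd i g x"
  using has_derivative_add[OF assms[unfolded frechet_derivative_works]]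
  by (subst pd_eqI) (auto simp: pd_def)

lemma pd_mult:
  assumes "f differentiable (at x)" "g differentiable (at x)"
  shows "pd i (\<lambda>x. f x * g x) x = f x * pd i g x + pd i f x * g x"
  using has_derivative_mult[OF assms[unfolded frechet_derivative_works]]
  by (subst pd_eqI) (auto simp: pd_def)

lemma pd_holomorphic:
  assumes "z differentiable (at x)" "open S" "H holomorphic_on S" "z x \<in> S"
  shows "(\<lambda>x. H (z x)) differentiable (at x)" "pd i (\<lambda>x. H (z x)) x = deriv H (z x) * pd i z x"
proof -
  have "(H has_derivative (\<lambda>h. deriv H (z x) * h)) (at (z x))"
    using holomorphic_derivI[OF assms(3,2,4)] by (simp add: has_field_derivative_def)
  from diff_chain_at[OF assms(1)[unfolded frechet_derivative_works] this]
  have D: "((\<lambda>x. H (z x)) has_derivative (\<lambda>h. deriv H (z x) * frechet_derivative z (at x) h)) (at x)"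
    by (simp add: o_def)
  show "(\<lambda>x. H (z x)) differentiable (at x)" using D differentiable_def by blast
  show "pd i (\<lambda>x. H (z x)) x = deriv H (z x) * pd i z x"
    using pd_eqI[OF D] by (simp add: pd_def)
qed

text \<open>A derivative of a product or of a composition leaves the original form but stays in this class, so
  smoothness follows by coinduction, without formulas for iterated derivatives.\<close>

inductive smooth_closure :: "('a::euclidean_space \<Rightarrow> complex) \<Rightarrow> bool" where
  base: "smooth f \<Longrightarrow> smooth_closure f"
| add: "smooth_closure f \<Longrightarrow> smooth_closure g \<Longrightarrow> smooth_closure (\<lambda>x. f x + g x)"
| mult: "smooth_closure f \<Longrightarrow> smooth_closure g \<Longrightarrow> smooth_closure (\<lambda>x. f x * g x)"
| comp: "smooth_closure z \<Longrightarrow> open S \<Longrightarrow> H holomorphic_on S \<Longrightarrow> (\<forall>x. z x \<in> S) \<Longrightarrow>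
    smooth_closure (\<lambda>x. H (z x))"

lemma smooth_closure_imp_smooth:
  fixes f :: "'a::euclidean_space \<Rightarrow> complex"
  assumes "smooth_closure f"
  shows "smooth f"
proof (rule smooth_coinduct[of smooth_closure, OF assms])
  have *: "smooth_closure f \<Longrightarrow> (\<forall>x. f differentiable (at x)) \<and> (\<forall>i\<in>Basis. smooth_closure (pd i f))"
    for f :: "'a \<Rightarrow> complex"
  proof (induction rule: smooth_closure.induct)
    case (base f)
    then show ?case by (simp add: smooth_closure.base smooth_differentiable smooth_pd)
  next
    case (add f g)
    have "pd i (\<lambda>x. f x + g x) = (\<lambda>x. pd i f x + pd i g x)" for i
      using add by (intro ext pd_add) auto
    with add show ?case by (simp add: smooth_closure.add differentiable_add)
  next
    case (mult f g)
    have "pd i (\<lambda>x. f x * g x) = (\<lambda>x. f x * pd i g x + pd i f x * g x)" for i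
      using mult by (intro ext pd_mult) auto
    moreover have "smooth_closure (\<lambda>x. f x * pd i g x + pd i f x * g x)" if "i \<in> Basis" for i
      by (rule smooth_closure.add; rule smooth_closure.mult) (simp_all add: mult that)
    ultimately show ?case using mult by simp
  next
    case (comp z S H)
    have "pd i (\<lambda>x. H (z x)) = (\<lambda>x. deriv H (z x) * pd i z x)" for i
    proof
      fix x
      show "pd i (\<lambda>x. H (z x)) x = deriv H (z x) * pd i z x"
        by (rule pd_holomorphic(2)[of z x S H i]) (use comp in blast)+
    qed
    moreover have "smooth_closure (\<lambda>x. deriv H (z x) * pd i z x)" if "i \<in> Basis" for i
      by (rule smooth_closure.mult, rule smooth_closure.comp[where S=S])
        (simp_all add: comp that holomorphic_deriv)
    moreover have "(\<lambda>x. H (z x)) differentiable (at x)" for x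
      by (rule pd_holomorphic(1)[of z x S H]) (use comp in blast)+
    ultimately show ?case by simp
  qed
  fix f :: "'a \<Rightarrow> complex" and i x :: 'a
  assume "smooth_closure f"
  then show "f differentiable (at x)" "i \<in> Basis \<Longrightarrow> smooth_closure (pd i f)" using * by blast+
qed

lemma smooth_add: "smooth f \<Longrightarrow> smooth g \<Longrightarrow> smooth (\<lambda>x. f x + g x)"
  and smooth_mult: "smooth f \<Longrightarrow> smooth g \<Longrightarrow> smooth (\<lambda>x. f x * g x)"
  and smooth_holomorphic: "smooth z \<Longrightarrow> open S \<Longrightarrow> H holomorphic_on S \<Longrightarrow> (\<And>x. z x \<in> S) \<Longrightarrow>
    smooth (\<lambda>x. H (z x))"
  by (auto intro!: smooth_closure_imp_smooth smooth_closure.add smooth_closure.mult intro: smooth_closure.base)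
    (blast intro: smooth_closure.comp[where S=S] smooth_closure.base)

lemma smooth_const: "smooth (\<lambda>_. c)"
proof (rule smooth_coinduct[of "\<lambda>f. \<exists>c. f = (\<lambda>_. c)"])
  fix f :: "'a \<Rightarrow> complex" and i assume "\<exists>c. f = (\<lambda>_. c)"
  then show "\<exists>c. pd i f = (\<lambda>_. c)" by (metis pd_const)
qed auto

lemma smooth_prod: "finite A \<Longrightarrow> (\<And>a. a \<in> A \<Longrightarrow> smooth (f a)) \<Longrightarrow> smooth (\<lambda>x. \<Prod>a\<in>A. f a x)"
  by (induction A rule: finite_induct) (auto simp: smooth_const intro!: smooth_mult)

lemma smooth_sum: "finite A \<Longrightarrow> (\<And>a. a \<in> A \<Longrightarrow> smooth (f a)) \<Longrightarrow> smooth (\<lambda>x. \<Sum>a\<in>A. f a x)"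
  by (induction A rule: finite_induct) (auto simp: smooth_const intro!: smooth_add)

lemma pd_inner: "pd i (\<lambda>x. of_real (x \<bullet> b)) x = of_real (i \<bullet> b)"
  by (rule pd_eqI) (auto intro!: derivative_eq_intros)

lemma smooth_inner: "smooth (\<lambda>x. of_real (x \<bullet> b))"
proof (rule smooth_coinduct[of "\<lambda>f. f = (\<lambda>x. of_real (x \<bullet> b)) \<or> (\<exists>c. f = (\<lambda>_. c))"])
  fix f :: "'a \<Rightarrow> complex" and i x
  assume *: "f = (\<lambda>x. of_real (x \<bullet> b)) \<or> (\<exists>c. f = (\<lambda>_. c))"
  then show "pd i f = (\<lambda>x. of_real (x \<bullet> b)) \<or> (\<exists>c. pd i f = (\<lambda>_. c))"
    by (metis pd_const pd_inner)
  have "((\<lambda>x. complex_of_real (x \<bullet> b)) has_derivative (\<lambda>h. of_real (h \<bullet> b))) (at x)"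
    by (auto intro!: derivative_eq_intros)
  then show "f differentiable (at x)" using * by (metis differentiable_def differentiable_const)
qed auto

lemma smooth_norm_sq: "smooth (\<lambda>x. of_real ((norm x)\<^sup>2))"
proof -
  have "(\<lambda>x::'a. complex_of_real ((norm x)\<^sup>2)) = (\<lambda>x. \<Sum>b\<in>Basis. of_real (x \<bullet> b) * of_real (x \<bullet> b))"
    by (rule ext) (simp only: power2_norm_eq_inner of_real_mult[symmetric] of_real_sum[symmetric]
        euclidean_inner[symmetric])
  then show ?thesis using smooth_sum[OF finite_Basis, of "\<lambda>b x. of_real (x \<bullet> b) * of_real (x \<bullet> b)"]
    by (simp add: smooth_mult smooth_inner)
qed

section \<open>Bump functions\<close>

text \<open>The functions $p(1/t)e^{-1/t}$ for $t > 0$, continued by zero, are closed under differentiation,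
  which is why the flat function $e^{-1/t}$ is smooth across $0$.\<close>

definition flat :: "real poly \<Rightarrow> real \<Rightarrow> real" where
  "flat p t = (if t > 0 then poly p (1 / t) * exp (- (1 / t)) else 0)"

lemma poly_exp_tendsto_0: "((\<lambda>u::real. poly p u * exp (- u)) \<longlongrightarrow> 0) at_top"
proof -
  have "((\<lambda>u::real. \<Sum>i\<le>degree p. coeff p i * (u ^ i / exp u)) \<longlongrightarrow> (\<Sum>i\<le>degree p. coeff p i * 0)) at_top"
    by (intro tendsto_intros tendsto_power_div_exp_0)
  then show ?thesis by (simp add: poly_altdef sum_distrib_right exp_minus divide_inverse mult.assoc)
qed

lemma flat_has_derivative:
  "(flat p has_real_derivative flat ([:0,0,1:] * (p - pderiv p)) t) (at t)"
proof -
  consider "t > 0" | "t < 0" | "t = 0" by linarith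
  then show ?thesis
  proof cases
    case 1
    have "((\<lambda>t. poly p (1 / t) * exp (- (1 / t))) has_real_derivative
        flat ([:0,0,1:] * (p - pderiv p)) t) (at t)"
      using 1 unfolding flat_def
      by (auto intro!: derivative_eq_intros poly_DERIV[THEN DERIV_chain2]
          simp: power2_eq_square field_simps)
    then show ?thesis
      by (rule has_field_derivative_transform_within_open[where S="{0<..}"]) (use 1 in \<open>auto simp: flat_def\<close>)
  next
    case 2
    have "((\<lambda>t::real. 0) has_real_derivative 0) (at t)" by simp
    then have "(flat p has_real_derivative 0) (at t)"
      by (rule has_field_derivative_transform_within_open[where S="{..<0}"]) (use 2 in \<open>auto simp: flat_def\<close>)
    then show ?thesis using 2 by (simp add: flat_def)
  next
    case 3
    have "((\<lambda>t. poly (pCons 0 p) (1 / t) * exp (- (1 / t))) \<longlongrightarrow> 0) (at_right (0::real))"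
      using filterlim_compose[OF poly_exp_tendsto_0[of "pCons 0 p"] filterlim_inverse_at_top_right]
      by (simp add: inverse_eq_divide)
    then have "((\<lambda>t. flat p t / t) \<longlongrightarrow> 0) (at_right 0)"
      by (rule Lim_transform_eventually) (auto simp: eventually_at_filter flat_def)
    moreover have "((\<lambda>t. flat p t / t) \<longlongrightarrow> 0) (at_left 0)"
      by (rule Lim_transform_eventually[OF tendsto_const]) (auto simp: eventually_at_filter flat_def)
    ultimately have "((\<lambda>t. flat p t / t) \<longlongrightarrow> 0) (at 0)"
      by (simp add: filterlim_at_split)
    then show ?thesis using 3 by (simp add: has_field_derivative_iff flat_def)
  qed
qed

lemma smooth_flat: "smooth (\<lambda>x. of_real (flat p (x \<bullet> b - a)))"
proof (rule smooth_coinduct[of "\<lambda>f. \<exists>c p. f = (\<lambda>x. of_real (c * flat p (x \<bullet> b - a)))"])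
  show "\<exists>c q. (\<lambda>x. complex_of_real (flat p (x \<bullet> b - a))) = (\<lambda>x. complex_of_real (c * flat q (x \<bullet> b - a)))"
    by (rule exI[of _ 1], rule exI[of _ p]) simp
  fix f :: "'a \<Rightarrow> complex"
  assume "\<exists>c p. f = (\<lambda>x. of_real (c * flat p (x \<bullet> b - a)))"
  then obtain c p where f: "f = (\<lambda>x. of_real (c * flat p (x \<bullet> b - a)))" by blast
  define q where "q = [:0,0,1:] * (p - pderiv p)"
  have D: "(f has_derivative (\<lambda>h. of_real (c * ((h \<bullet> b) * flat q (x \<bullet> b - a))))) (at x)" for x
  proof -
    have "((\<lambda>x. flat p (x \<bullet> b - a)) has_derivative (\<lambda>h. (h \<bullet> b) * flat q (x \<bullet> b - a))) (at x)"
    proof -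
      have 1: "((\<lambda>x. x \<bullet> b - a) has_derivative (\<lambda>h. h \<bullet> b)) (at x)"
        by (auto intro!: derivative_eq_intros)
      have 2: "(flat p has_derivative (\<lambda>h. h * flat q (x \<bullet> b - a))) (at (x \<bullet> b - a))"
        using flat_has_derivative[of p "x \<bullet> b - a"]
        unfolding has_field_derivative_def q_def[symmetric]
        by (rule back_subst[where P="\<lambda>D. (_ has_derivative D) _"]) (simp add: fun_eq_iff mult.commute)
      show ?thesis using has_derivative_compose[OF 1 2] .
    qed
    then show ?thesis unfolding f by (intro has_derivative_of_real has_derivative_mult_right)
  qed
  show "f differentiable (at x)" for x using D differentiable_def by blast
  show "\<exists>c p. pd i f = (\<lambda>x. of_real (c * flat p (x \<bullet> b - a)))" for i
    by (rule exI[of _ "c * (i \<bullet> b)"], rule exI[of _ q]) (simp add: fun_eq_iff pd_eqI[OF D])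
qed

text \<open>Since $e^{-1/(nt)} \to 1$ for $t > 0$, the product tends to the indicator of the open box, and it is
  bounded by $1$.\<close>

definition box_bump :: "'a::euclidean_space \<Rightarrow> 'a \<Rightarrow> nat \<Rightarrow> 'a \<Rightarrow> real" where
  "box_bump l u n x =
     (\<Prod>i\<in>Basis. flat 1 (real (Suc n) * (x \<bullet> i - l \<bullet> i)) * flat 1 (real (Suc n) * (u \<bullet> i - x \<bullet> i)))"

lemma smooth_box_bump: "smooth (\<lambda>x. of_real (box_bump l u n x))"
proof -
  have "smooth (\<lambda>x. complex_of_real (flat 1 (real (Suc n) * (x \<bullet> i - l \<bullet> i))))" for i
    using smooth_flat[of 1 "real (Suc n) *\<^sub>R i" "real (Suc n) * (l \<bullet> i)"] by (simp add: algebra_simps)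
  moreover have "smooth (\<lambda>x. complex_of_real (flat 1 (real (Suc n) * (u \<bullet> i - x \<bullet> i))))" for i
    using smooth_flat[of 1 "- (real (Suc n) *\<^sub>R i)" "- (real (Suc n) * (u \<bullet> i))"] by (simp add: algebra_simps)
  ultimately show ?thesis unfolding box_bump_def of_real_prod of_real_mult
    by (intro smooth_prod smooth_mult) auto
qed

lemma flat_1_bounds: "0 \<le> flat 1 t" "flat 1 t \<le> 1"
  by (auto simp: flat_def)

lemma box_bump_bounds: "\<bar>box_bump l u n x\<bar> \<le> 1"
  unfolding box_bump_def abs_prod
  by (rule prod_le_1) (auto intro!: mult_le_one simp: abs_mult flat_1_bounds)

lemma box_bump_outside: "x \<notin> box l u \<Longrightarrow> box_bump l u n x = 0"
  by (force simp: box_bump_def box_def flat_def zero_less_mult_iff)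

lemma flat_1_tendsto: "(\<lambda>n. flat 1 (real (Suc n) * t)) \<longlonglongrightarrow> (if t > 0 then 1 else 0)"
proof (cases "t > 0")
  case True
  have "(\<lambda>n. exp (- (inverse (real (Suc n)) * (1/t)))) \<longlonglongrightarrow> exp (- (0 * (1/t)))"
    by (intro tendsto_intros LIMSEQ_inverse_real_of_nat)
  moreover have "flat 1 (real (Suc n) * t) = exp (- (inverse (real (Suc n)) * (1/t)))" for n
    unfolding flat_def using True by (subst if_P) (auto simp: divide_inverse mult.commute)
  ultimately show ?thesis using True by (simp del: of_nat_Suc)
qed (auto simp: flat_def zero_less_mult_iff)

lemma box_bump_tendsto: "(\<lambda>n. box_bump l u n x) \<longlonglongrightarrow> indicator (box l u) x"
proof -
  have "(\<lambda>n. box_bump l u n x) \<longlonglongrightarrow> (\<Prod>i\<in>Basis. (if x \<bullet> i - l \<bullet> i > 0 then 1 else 0) * (if u \<bullet> i - x \<bullet> i > 0 then 1 else 0))"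
    unfolding box_bump_def by (intro tendsto_intros flat_1_tendsto)
  also have "(\<Prod>i\<in>Basis. (if x \<bullet> i - l \<bullet> i > 0 then 1 else 0) * (if u \<bullet> i - x \<bullet> i > 0 then 1 else 0)) = (indicator (box l u) x :: real)"
    by (auto simp: box_def indicator_def prod_zero_iff intro!: prod.neutral)
  finally show ?thesis .
qed

lemma box_bump_test:
  assumes "cbox l u \<subseteq> \<Omega>"
  shows "(\<lambda>x. of_real (box_bump l u n x)) \<in> test_functions \<Omega>"
proof -
  have "closure {x. complex_of_real (box_bump l u n x) \<noteq> 0} \<subseteq> cbox l u"
    using box_bump_outside[of _ l u n] box_subset_cbox[of l u] by (intro closure_minimal closed_cbox) auto
  then show ?thesis using assms
    by (auto simp: test_functions_def smooth_box_bump compact_eq_bounded_closed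
        intro: bounded_subset[OF bounded_cbox])
qed

section \<open>The fundamental lemma of the calculus of variations\<close>

text \<open>The positive and the negative part are densities of two measures that agree on boxes, an
  intersection-stable generator of the Borel sets.\<close>

lemma real_AE_0_if_boxes:
  fixes h :: "'a::euclidean_space \<Rightarrow> real"
  assumes h: "integrable lborel h" and 0: "\<And>a b. (LINT x|lborel. indicator (box a b) x * h x) = 0"
  shows "AE x in lborel. h x = 0"
proof -
  have [measurable]: "h \<in> borel_measurable borel" using h by auto
  let ?M = "density lborel (\<lambda>x. ennreal (h x))" and ?N = "density lborel (\<lambda>x. ennreal (- h x))"
  let ?E = "range (\<lambda>(a, b). box a b::'a set)"
  let ?A = "\<lambda>n::nat. box (- (real n *\<^sub>R One)) (real n *\<^sub>R One) :: 'a set"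
  have eq: "emeasure ?M (box a b) = emeasure ?N (box a b)" and fin: "emeasure ?M (box a b) \<noteq> \<infinity>" for a b
  proof -
    have I: "integrable lborel (\<lambda>x. indicator (box a b) x * h x)"
      using integrable_mult_indicator[OF _ h, of "box a b"] by simp
    have M: "emeasure ?M (box a b) = (\<integral>\<^sup>+x. ennreal (indicator (box a b) x * h x) \<partial>lborel)"
      by (subst emeasure_density) (auto intro!: nn_integral_cong simp: indicator_def)
    have N: "emeasure ?N (box a b) = (\<integral>\<^sup>+x. ennreal (- (indicator (box a b) x * h x)) \<partial>lborel)"
      by (subst emeasure_density) (auto intro!: nn_integral_cong simp: indicator_def)
    have f: "(\<integral>\<^sup>+x. ennreal (indicator (box a b) x * h x) \<partial>lborel) \<noteq> \<infinity>"
        "(\<integral>\<^sup>+x. ennreal (- (indicator (box a b) x * h x)) \<partial>lborel) \<noteq> \<infinity>"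
      using I by (auto simp: real_integrable_def)
    then show "emeasure ?M (box a b) \<noteq> \<infinity>" using M by simp
    have "enn2real (\<integral>\<^sup>+x. ennreal (indicator (box a b) x * h x) \<partial>lborel) =
        enn2real (\<integral>\<^sup>+x. ennreal (- (indicator (box a b) x * h x)) \<partial>lborel)"
      using 0[of a b] real_lebesgue_integral_def[OF I] by simp
    then show "emeasure ?M (box a b) = emeasure ?N (box a b)"
      using M N f by (metis ennreal_enn2real infinity_ennreal_def less_top)
  qed
  have "?M = ?N"
  proof (rule measure_eqI_generator_eq)
    show "Int_stable ?E" by (auto simp: Int_stable_def box_Int_box)
    show "?E \<subseteq> Pow UNIV" "sets ?M = sigma_sets UNIV ?E" "sets ?N = sigma_sets UNIV ?E"
      by (simp_all add: borel_eq_box)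
    show "range ?A \<subseteq> ?E" "(\<Union>i. ?A i) = UNIV" unfolding UN_box_eq_UNIV by auto
    show "emeasure ?M (?A i) \<noteq> \<infinity>" for i by (rule fin)
    show "emeasure ?M X = emeasure ?N X" if "X \<in> ?E" for X using that eq by auto
  qed
  then have "AE x in lborel. ennreal (h x) = ennreal (- h x)"
    by (intro sigma_finite_measure.density_unique[OF sigma_finite_lborel]) auto
  then show ?thesis
    by eventually_elim (metis add.inverse_inverse ennreal_eq_0_iff ennreal_neg le_cases neg_0_le_iff_le order_antisym)
qed

lemma AE_0_if_boxes:
  fixes h :: "'a::euclidean_space \<Rightarrow> complex"
  assumes h: "integrable lborel h" and 0: "\<And>a b. (LINT x|lborel. of_real (indicator (box a b) x) * h x) = 0"
  shows "AE x in lborel. h x = 0"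
proof -
  have I: "integrable lborel (\<lambda>x. of_real (indicator (box a b) x) * h x)" for a b
    using integrable_mult_indicator[OF _ h, of "box a b"] by (simp add: scaleR_conv_of_real)
  have "(LINT x|lborel. indicator (box a b) x * Re (h x)) = 0" for a b
    using integral_Re[OF I[of a b]] 0[of a b] by simp
  moreover have "(LINT x|lborel. indicator (box a b) x * Im (h x)) = 0" for a b
    using integral_Im[OF I[of a b]] 0[of a b] by simp
  ultimately have "AE x in lborel. Re (h x) = 0" "AE x in lborel. Im (h x) = 0"
    using h by (auto intro!: real_AE_0_if_boxes)
  then show ?thesis by eventually_elim (simp add: complex_eq_iff)
qed

text \<open>Bump functions are test functions that converge boundedly to indicators of boxes, so the integral of
  \<open>k\<close> over every box with closure in \<open>\<Omega>\<close> vanishes.  Countably many boxes with rational corners exhaust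
  the open set.\<close>

lemma AE_0_if_test_functions:
  fixes k :: "'a::euclidean_space \<Rightarrow> complex"
  assumes "open \<Omega>" and loc: "\<And>a b. cbox a b \<subseteq> \<Omega> \<Longrightarrow> set_integrable lborel (cbox a b) k"
    and 0: "\<And>w. w \<in> test_functions \<Omega> \<Longrightarrow> (LINT x:\<Omega>|lborel. k x * w x) = 0"
  shows "AE x in lborel. x \<in> \<Omega> \<longrightarrow> k x = 0"
proof -
  have box0: "(LINT x|lborel. of_real (indicator (box a b) x) * k x) = 0" if ab: "cbox a b \<subseteq> \<Omega>" for a b
  proof -
    have I: "integrable lborel (\<lambda>x. indicator (cbox a b) x *\<^sub>R k x)"
      using loc[OF ab] by (simp add: set_integrable_def)
    have 1: "of_real (box_bump a b n x) * k x = indicator \<Omega> x *\<^sub>R (k x * of_real (box_bump a b n x))"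
       and 2: "of_real (box_bump a b n x) * k x = of_real (box_bump a b n x) * (indicator (cbox a b) x *\<^sub>R k x)"
       and 3: "of_real (indicator (box a b) x) * k x = of_real (indicator (box a b) x) * (indicator (cbox a b) x *\<^sub>R k x)" for n x
      using ab box_bump_outside[of x a b n] box_subset_cbox[of a b] by (auto simp: indicator_def)
    have "(\<lambda>n. LINT x|lborel. of_real (box_bump a b n x) * (indicator (cbox a b) x *\<^sub>R k x)) \<longlonglongrightarrow>
      (LINT x|lborel. of_real (indicator (box a b) x) * (indicator (cbox a b) x *\<^sub>R k x))"
    proof (rule integral_dominated_convergence[where w="\<lambda>x. norm (indicator (cbox a b) x *\<^sub>R k x)"])
      have [measurable]: "(\<lambda>x. indicator (cbox a b) x *\<^sub>R k x) \<in> borel_measurable borel" using I by auto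
      have [measurable]: "(\<lambda>x. complex_of_real (box_bump a b n x)) \<in> borel_measurable borel" for n
        by (intro borel_measurable_continuous_onI smooth_continuous smooth_box_bump)
      show "(\<lambda>x. of_real (indicator (box a b) x) * (indicator (cbox a b) x *\<^sub>R k x)) \<in> borel_measurable lborel" by measurable
      show "(\<lambda>x. of_real (box_bump a b n x) * (indicator (cbox a b) x *\<^sub>R k x)) \<in> borel_measurable lborel" for n by measurable
      show "integrable lborel (\<lambda>x. norm (indicator (cbox a b) x *\<^sub>R k x))" using I by (rule integrable_norm)
      show "AE x in lborel. (\<lambda>n. complex_of_real (box_bump a b n x) * (indicat_real (cbox a b) x *\<^sub>R k x))
         \<longlonglongrightarrow> complex_of_real (indicat_real (box a b) x) * (indicat_real (cbox a b) x *\<^sub>R k x)"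
        by (intro AE_I2 tendsto_intros box_bump_tendsto)
      show "AE x in lborel. norm (complex_of_real (box_bump a b n x) * (indicat_real (cbox a b) x *\<^sub>R k x))
         \<le> norm (indicat_real (cbox a b) x *\<^sub>R k x)" for n
        using box_bump_bounds[of a b n] by (intro AE_I2) (auto simp: norm_mult indicator_def intro!: mult_left_le_one_le)
    qed
    moreover have "(LINT x|lborel. of_real (box_bump a b n x) * (indicator (cbox a b) x *\<^sub>R k x)) = 0" for n
      using 0[OF box_bump_test[OF ab, of n]] unfolding 2[symmetric] 1 by (simp add: set_lebesgue_integral_def)
    ultimately show ?thesis unfolding 3 by (simp add: LIMSEQ_const_iff)
  qed
  obtain \<D> where D: "countable \<D>" "\<D> \<subseteq> Pow \<Omega>" "\<And>X. X \<in> \<D> \<Longrightarrow> \<exists>a b. X = box a b \<and> cbox a b \<subseteq> \<Omega>" "\<Union>\<D> = \<Omega>"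
  proof -
    define \<D> where "\<D> = (\<lambda>(a, b). box a b) ` {(a, b). a \<in> (\<lambda>f. \<Sum>i\<in>Basis. f i *\<^sub>R i) ` (Basis \<rightarrow>\<^sub>E \<rat>) \<and>
       b \<in> (\<lambda>f. \<Sum>i\<in>Basis. f i *\<^sub>R i) ` (Basis \<rightarrow>\<^sub>E \<rat>) \<and> cbox a b \<subseteq> \<Omega>}"
    have c: "countable ((\<lambda>f. \<Sum>i\<in>Basis. f i *\<^sub>R i) ` (Basis \<rightarrow>\<^sub>E \<rat>) :: 'a set)"
      by (intro countable_image countable_PiE) (auto simp: countable_rat)
    have "countable \<D>" unfolding \<D>_def
      by (rule countable_image, rule countable_subset[OF _ countable_SIGMA[OF c, of "\<lambda>_. (\<lambda>f. \<Sum>i\<in>Basis. f i *\<^sub>R i) ` (Basis \<rightarrow>\<^sub>E \<rat>)"]]) (auto simp: c)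
    moreover have "\<Union>\<D> = \<Omega>"
    proof
      show "\<Union>\<D> \<subseteq> \<Omega>" using box_subset_cbox by (fastforce simp: \<D>_def)
      show "\<Omega> \<subseteq> \<Union>\<D>"
      proof
        fix x assume "x \<in> \<Omega>"
        then obtain e where e: "e > 0" "ball x e \<subseteq> \<Omega>" using \<open>open \<Omega>\<close> open_contains_ball by blast
        obtain a b where ab: "\<forall>i\<in>Basis. a \<bullet> i \<in> \<rat> \<and> b \<bullet> i \<in> \<rat>" "x \<in> box a b" "box a b \<subseteq> ball x (e/2)"
          using rational_boxes[of "e/2" x] e(1) by auto
        have "cbox a b \<subseteq> closure (ball x (e/2))"
          using ab(2,3) closure_box[of a b] closure_mono by (metis empty_iff)
        also have "\<dots> \<subseteq> ball x e" using e(1) by auto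
        finally have "cbox a b \<subseteq> \<Omega>" using e(2) by blast
        moreover have "z \<in> (\<lambda>f. \<Sum>i\<in>Basis. f i *\<^sub>R i) ` (Basis \<rightarrow>\<^sub>E \<rat>)" if "\<forall>i\<in>Basis. z \<bullet> i \<in> \<rat>" for z :: 'a
          using that euclidean_representation[of z]
          by (intro image_eqI[where x="\<lambda>i\<in>Basis. z \<bullet> i"]) (auto simp: restrict_def)
        ultimately have "box a b \<in> \<D>" using ab(1) unfolding \<D>_def by fastforce
        then show "x \<in> \<Union>\<D>" using ab(2) by blast
      qed
    qed
    ultimately show ?thesis
      by (intro that[of \<D>]) (auto simp: \<D>_def)
  qed
  have "AE x in lborel. x \<in> X \<longrightarrow> k x = 0" if X: "X \<in> \<D>" for X
  proof -
    obtain a b where ab: "X = box a b" "cbox a b \<subseteq> \<Omega>" using D(3)[OF X] by blast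
    have "AE x in lborel. of_real (indicator (box a b) x) * k x = 0"
    proof (rule AE_0_if_boxes)
      have "set_integrable lborel (box a b) k"
        by (rule set_integrable_subset[OF loc[OF ab(2)]]) (auto simp: box_subset_cbox)
      then show "integrable lborel (\<lambda>x. of_real (indicator (box a b) x) * k x)"
        by (simp add: set_integrable_def scaleR_conv_of_real)
      fix c d
      obtain a' b' where ab': "box c d \<inter> box a b = box a' b'" using box_Int_box by blast
      have "(LINT x|lborel. of_real (indicator (box c d) x) * (of_real (indicator (box a b) x) * k x)) =
          (LINT x|lborel. of_real (indicator (box a' b') x) * k x)"
        unfolding ab'[symmetric] by (intro Bochner_Integration.integral_cong) (auto simp: indicator_def)
      also have "\<dots> = 0"
      proof (cases "box a' b' = {}")
        case False
        then have "cbox a' b' \<subseteq> cbox a b"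
          using ab' closure_box by (metis closure_box closure_mono inf.cobounded2 inf_bot_right)
        then show ?thesis using ab(2) by (intro box0) auto
      qed auto
      finally show "(LINT x|lborel. of_real (indicator (box c d) x) * (of_real (indicator (box a b) x) * k x)) = 0" .
    qed
    then show ?thesis unfolding ab(1) by eventually_elim (auto simp: indicator_def)
  qed
  then have "AE x in lborel. \<forall>X\<in>\<D>. x \<in> X \<longrightarrow> k x = 0" using D(1) by (subst AE_ball_countable) auto
  then show ?thesis by eventually_elim (use D(4) in blast)
qed

section \<open>Schwartz functions\<close>

definition rapidly_decreasing :: "('a::euclidean_space \<Rightarrow> complex) \<Rightarrow> bool" where
  "rapidly_decreasing f \<longleftrightarrow> (\<forall>k. \<exists>C. \<forall>x. (1 + norm x) ^ k * norm (f x) \<le> C)"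

lemma schwartz_iff:
  "f \<in> schwartz \<longleftrightarrow> smooth f \<and> (\<forall>is. set is \<subseteq> Basis \<longrightarrow> rapidly_decreasing (partials is f))"
proof -
  have "norm ((1 + norm x) ^ k *\<^sub>R y) = (1 + norm x) ^ k * norm y" for x :: 'a and y :: complex and k
    by simp
  then show ?thesis unfolding schwartz_def rapidly_decreasing_def bounded_iff by auto
qed

lemma schwartz_coinduct:
  assumes "\<Phi> f"
    and "\<And>f x. \<Phi> f \<Longrightarrow> f differentiable (at x)"
    and "\<And>f. \<Phi> f \<Longrightarrow> rapidly_decreasing f"
    and pd: "\<And>f i. \<Phi> f \<Longrightarrow> i \<in> Basis \<Longrightarrow> \<Phi> (pd i f)"
  shows "f \<in> schwartz"
proof -
  have "set is \<subseteq> Basis \<Longrightarrow> \<Phi> (partials is f)" for "is"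
    by (induction "is") (auto simp: assms(1) pd)
  with assms show ?thesis by (auto simp: schwartz_iff intro: smooth_coinduct[of \<Phi>])
qed

lemma schwartz_smooth: "f \<in> schwartz \<Longrightarrow> smooth f"
  by (simp add: schwartz_iff)

lemma schwartz_rapidly_decreasing: "f \<in> schwartz \<Longrightarrow> rapidly_decreasing f"
  unfolding schwartz_iff by (metis empty_set empty_subsetI partials.simps(1))

lemma schwartz_pd:
  assumes "f \<in> schwartz" "i \<in> Basis"
  shows "pd i f \<in> schwartz"
proof -
  have "partials is (pd i f) = partials (is @ [i]) f" for "is"
    by (simp add: partials_append)
  then show ?thesis using assms by (auto simp: schwartz_iff smooth_pd)
qed

lemma rapidly_decreasing_add:
  assumes "rapidly_decreasing f" "rapidly_decreasing g"
  shows "rapidly_decreasing (\<lambda>x. f x + g x)"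
  unfolding rapidly_decreasing_def
proof
  fix k
  obtain C D where C: "(1 + norm x) ^ k * norm (f x) \<le> C" and D: "(1 + norm x) ^ k * norm (g x) \<le> D" for x
    using assms unfolding rapidly_decreasing_def by metis
  have "(1 + norm x) ^ k * norm (f x + g x) \<le> (1 + norm x) ^ k * (norm (f x) + norm (g x))" for x
    by (intro mult_left_mono norm_triangle_ineq) auto
  then have "(1 + norm x) ^ k * norm (f x + g x) \<le> C + D" for x
    using C[of x] D[of x] by (smt (verit) distrib_left)
  then show "\<exists>C. \<forall>x. (1 + norm x) ^ k * norm (f x + g x) \<le> C" by blast
qed

lemma rapidly_decreasing_coord:
  assumes "rapidly_decreasing f"
  shows "rapidly_decreasing (\<lambda>x. of_real (x \<bullet> j) * f x)"
  unfolding rapidly_decreasing_def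
proof
  fix k
  obtain C where C: "(1 + norm x) ^ Suc k * norm (f x) \<le> C" for x
    using assms unfolding rapidly_decreasing_def by metis
  have "(1 + norm x) ^ k * norm (of_real (x \<bullet> j) * f x) \<le> norm j * C" for x
  proof -
    have "\<bar>x \<bullet> j\<bar> \<le> (1 + norm x) * norm j"
      using Cauchy_Schwarz_ineq2[of x j] by (smt (verit) mult_right_mono norm_ge_zero)
    then have "(1 + norm x) ^ k * (\<bar>x \<bullet> j\<bar> * norm (f x)) \<le> (1 + norm x) ^ k * ((1 + norm x) * norm j * norm (f x))"
      by (intro mult_left_mono mult_right_mono) auto
    also have "\<dots> = norm j * ((1 + norm x) ^ Suc k * norm (f x))" by simp
    also have "\<dots> \<le> norm j * C" by (intro mult_left_mono C) auto
    finally show ?thesis by (simp add: norm_mult)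
  qed
  then show "\<exists>C. \<forall>x. (1 + norm x) ^ k * norm (of_real (x \<bullet> j) * f x) \<le> C" by blast
qed

lemma rapidly_decreasing_cmult:
  assumes "rapidly_decreasing f"
  shows "rapidly_decreasing (\<lambda>x. c * f x)"
  unfolding rapidly_decreasing_def
proof
  fix k
  obtain C where C: "(1 + norm x) ^ k * norm (f x) \<le> C" for x
    using assms unfolding rapidly_decreasing_def by metis
  have "(1 + norm x) ^ k * norm (c * f x) \<le> norm c * C" for x
    using mult_left_mono[OF C[of x], of "norm c"] by (simp add: norm_mult ac_simps)
  then show "\<exists>C. \<forall>x. (1 + norm x) ^ k * norm (c * f x) \<le> C" by blast
qed

text \<open>The class is closed under derivatives as soon as the derivatives of its generators lie in it.  It serves
  for all Schwartz functions as generators, and for the Gaussian alone, whose derivatives are its products with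
  coordinates.\<close>

inductive decreasing_closure :: "('a::euclidean_space \<Rightarrow> complex) set \<Rightarrow> ('a \<Rightarrow> complex) \<Rightarrow> bool"
  for B where
  base: "f \<in> B \<Longrightarrow> decreasing_closure B f"
| add: "decreasing_closure B f \<Longrightarrow> decreasing_closure B g \<Longrightarrow> decreasing_closure B (\<lambda>x. f x + g x)"
| cmult: "decreasing_closure B f \<Longrightarrow> decreasing_closure B (\<lambda>x. c * f x)"
| coord: "decreasing_closure B f \<Longrightarrow> decreasing_closure B (\<lambda>x. of_real (x \<bullet> j) * f x)"

lemma decreasing_closure_schwartz:
  fixes f :: "'a::euclidean_space \<Rightarrow> complex"
  assumes "decreasing_closure B f"
    and B: "\<And>f. f \<in> B \<Longrightarrow> rapidly_decreasing f" "\<And>f x. f \<in> B \<Longrightarrow> f differentiable (at x)"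
      "\<And>f i. f \<in> B \<Longrightarrow> i \<in> Basis \<Longrightarrow> decreasing_closure B (pd i f)"
  shows "f \<in> schwartz"
proof (rule schwartz_coinduct[of "decreasing_closure B", OF assms(1)])
  have *: "rapidly_decreasing f \<and> (\<forall>x. f differentiable (at x)) \<and> (\<forall>i\<in>Basis. decreasing_closure B (pd i f))"
    if "decreasing_closure B f" for f
    using that
  proof induction
    case (base f)
    then show ?case using B by auto
  next
    case (add f g)
    have "pd i (\<lambda>x. f x + g x) = (\<lambda>x. pd i f x + pd i g x)" for i
      using add by (intro ext pd_add) auto
    with add show ?case
      by (simp add: decreasing_closure.add differentiable_add rapidly_decreasing_add)
  next
    case (cmult f c)
    have "pd i (\<lambda>x. c * f x) = (\<lambda>x. c * pd i f x)" for i
    proof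
      fix x show "pd i (\<lambda>x. c * f x) x = c * pd i f x"
        using pd_mult[of "\<lambda>_. c" x f i] cmult by (simp add: pd_const)
    qed
    with cmult show ?case
      by (simp add: decreasing_closure.cmult rapidly_decreasing_cmult)
  next
    case (coord f j)
    have d: "(\<lambda>x. complex_of_real (x \<bullet> j)) differentiable (at x)" for x
      by (intro smooth_differentiable smooth_inner)
    have "pd i (\<lambda>x. of_real (x \<bullet> j) * f x) = (\<lambda>x. of_real (x \<bullet> j) * pd i f x + of_real (i \<bullet> j) * f x)" for i
    proof
      fix x show "pd i (\<lambda>x. of_real (x \<bullet> j) * f x) x = of_real (x \<bullet> j) * pd i f x + of_real (i \<bullet> j) * f x"
        using pd_mult[of "\<lambda>x. of_real (x \<bullet> j)" x f i] coord d by (simp add: pd_inner)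
    qed
    moreover have "decreasing_closure B (\<lambda>x. of_real (x \<bullet> j) * pd i f x + of_real (i \<bullet> j) * f x)" if "i \<in> Basis" for i
      by (intro decreasing_closure.add decreasing_closure.cmult decreasing_closure.coord) (use coord that in auto)
    ultimately show ?case using coord d
      by (auto simp: rapidly_decreasing_coord intro: differentiable_mult)
  qed
  fix f :: "'a \<Rightarrow> complex" and i x :: 'a
  assume "decreasing_closure B f"
  then show "f differentiable (at x)" "rapidly_decreasing f" "i \<in> Basis \<Longrightarrow> decreasing_closure B (pd i f)"
    using * by blast+
qed

lemma schwartz_closure: "decreasing_closure schwartz f \<Longrightarrow> f \<in> schwartz"
  by (erule decreasing_closure_schwartz)
    (auto simp: schwartz_rapidly_decreasing schwartz_pd smooth_differentiable schwartz_smooth decreasing_closure.base)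

lemma schwartz_add: "f \<in> schwartz \<Longrightarrow> g \<in> schwartz \<Longrightarrow> (\<lambda>x. f x + g x) \<in> schwartz"
  and schwartz_cmult: "f \<in> schwartz \<Longrightarrow> (\<lambda>x. c * f x) \<in> schwartz"
  and schwartz_coord: "f \<in> schwartz \<Longrightarrow> (\<lambda>x. of_real (x \<bullet> j) * f x) \<in> schwartz"
  by (rule schwartz_closure, simp add: decreasing_closure.add decreasing_closure.cmult decreasing_closure.coord
      decreasing_closure.base)+

lemma schwartz_zero: "(\<lambda>x. 0) \<in> schwartz"
  by (rule schwartz_coinduct[of "\<lambda>f. f = (\<lambda>x. 0)"]) (auto simp: rapidly_decreasing_def pd_const)

lemma test_functions_smooth: "w \<in> test_functions \<Omega> \<Longrightarrow> smooth w"
  by (simp add: test_functions_def)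

lemma test_functions_pd:
  assumes "w \<in> test_functions \<Omega>" "i \<in> Basis"
  shows "pd i w \<in> test_functions \<Omega>"
proof -
  have w: "smooth w" using assms by (simp add: test_functions_def)
  have "pd i w x = 0" if "x \<notin> closure {x. w x \<noteq> 0}" for x
  proof -
    have "((\<lambda>_. 0) has_derivative (\<lambda>_. 0)) (at x)" by simp
    then have "(w has_derivative (\<lambda>_. 0)) (at x)"
      by (rule has_derivative_transform_within_open[where s="- closure {x. w x \<noteq> 0}"])
        (use that closure_subset[of "{x. w x \<noteq> 0}"] in auto)
    then show ?thesis by (rule pd_eqI)
  qed
  then have "closure {x. pd i w x \<noteq> 0} \<subseteq> closure {x. w x \<noteq> 0}"
    by (intro closure_minimal closed_closure) auto
  then show ?thesis using assms w
    by (auto simp: test_functions_def smooth_pd compact_eq_bounded_closed intro: bounded_subset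
        dest: closure_subset[THEN subset_trans])
qed

lemma test_function_bounded_support:
  assumes "w \<in> test_functions \<Omega>"
  obtains R where "R > 0" "\<And>x. w x \<noteq> 0 \<Longrightarrow> norm x \<le> R"
proof -
  have "bounded (closure {x. w x \<noteq> 0})" using assms by (auto simp: test_functions_def compact_imp_bounded)
  then obtain R where "R > 0" "\<forall>x\<in>closure {x. w x \<noteq> 0}. norm x \<le> R" using bounded_pos by blast
  then show ?thesis using that closure_subset[of "{x. w x \<noteq> 0}"] by blast
qed

lemma test_functions_rapidly_decreasing:
  assumes "w \<in> test_functions \<Omega>"
  shows "rapidly_decreasing w"
  unfolding rapidly_decreasing_def
proof
  fix k
  obtain R where R: "R > 0" "\<And>x. w x \<noteq> 0 \<Longrightarrow> norm x \<le> R" using test_function_bounded_support[OF assms] by blast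
  have "continuous_on (cball 0 R) (\<lambda>x. (1 + norm x) ^ k * norm (w x))"
    using assms by (intro continuous_intros smooth_continuous) (auto simp: test_functions_def)
  then have "bounded ((\<lambda>x. (1 + norm x) ^ k * norm (w x)) ` cball 0 R)"
    by (intro compact_imp_bounded compact_continuous_image) auto
  then obtain C where C: "C > 0" "\<And>x. x \<in> cball 0 R \<Longrightarrow> norm ((1 + norm x) ^ k * norm (w x)) \<le> C"
    unfolding bounded_pos by auto
  have "(1 + norm x) ^ k * norm (w x) \<le> C" for x
    using C(1) C(2)[of x] R(2)[of x] by (cases "w x = 0") (auto simp: abs_mult)
  then show "\<exists>C. \<forall>x. (1 + norm x) ^ k * norm (w x) \<le> C" by blast
qed

lemma test_functions_schwartz:
  assumes "w \<in> test_functions \<Omega>"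
  shows "w \<in> schwartz"
  by (rule schwartz_coinduct[of "\<lambda>w. w \<in> test_functions \<Omega>"])
    (use assms in \<open>simp_all add: test_functions_pd test_functions_rapidly_decreasing
      smooth_differentiable[of _ _, OF test_functions_smooth]\<close>)

text \<open>Summing over the balls of integer radius bounds the integral by $\sum_k k^n k^{-n-2}$.\<close>

lemma integrable_weight:
  "integrable lborel (\<lambda>x::'a::euclidean_space. 1 / (1 + norm x) ^ (DIM('a) + 2))"
proof -
  let ?n = "DIM('a)"
  define V where "V = measure lborel (cball (0::'a) 1)"
  have [measurable]: "cball (0::'a) r \<in> sets borel" for r by (intro borel_closed closed_cball)
  have bound: "ennreal (1 / (1 + norm x) ^ (?n + 2)) \<le>
      (\<Sum>k. ennreal (1 / real (Suc k) ^ (?n + 2)) * indicator (cball 0 (real (Suc k))) x)" for x :: 'a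
  proof -
    \<comment> \<open>the shell $k \le |x| < k+1$ lies in the ball of the \<open>k\<close>-th summand, where the weight is at most $(k+1)^{-n-2}$\<close>
    define k where "k = nat \<lfloor>norm x\<rfloor>"
    have k: "real k \<le> norm x" "norm x \<le> real (Suc k)" unfolding k_def by (auto simp: of_nat_nat) linarith+
    have "1 / (1 + norm x) ^ (?n + 2) \<le> 1 / real (Suc k) ^ (?n + 2)"
      using k by (intro divide_left_mono power_mono) (auto intro!: mult_pos_pos zero_less_power add_pos_nonneg)
    then have "ennreal (1 / (1 + norm x) ^ (?n + 2)) \<le> ennreal (1 / real (Suc k) ^ (?n + 2)) * indicator (cball 0 (real (Suc k))) x"
      using k by (simp add: ennreal_leI)
    also have "\<dots> \<le> (\<Sum>k. ennreal (1 / real (Suc k) ^ (?n + 2)) * indicator (cball 0 (real (Suc k))) x)"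
      using sum_le_suminf[of "\<lambda>k. ennreal (1 / real (Suc k) ^ (?n + 2)) * indicator (cball 0 (real (Suc k))) x" "{k}"]
      by (simp only: sum.insert[OF finite.emptyI] sum.empty empty_iff not_False_eq_True add_0_right finite.intros summableI zero_le simp_thms)
    finally show ?thesis .
  qed
  have ball: "emeasure lborel (cball (0::'a) r) = ennreal (r ^ ?n * V)" if "r > 0" for r
  proof -
    have "measure lborel (cball (0::'a) r) = r ^ ?n * V"
      using that unfolding V_def by (simp add: content_cball)
    then show ?thesis by (metis emeasure_eq_ennreal_measure emeasure_lborel_cball_finite less_top infinity_ennreal_def)
  qed
  have "(\<integral>\<^sup>+x. ennreal (1 / (1 + norm (x::'a)) ^ (?n + 2)) \<partial>lborel) \<le>
      (\<integral>\<^sup>+x. (\<Sum>k. ennreal (1 / real (Suc k) ^ (?n + 2)) * indicator (cball (0::'a) (real (Suc k))) x) \<partial>lborel)"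
    by (intro nn_integral_mono bound)
  also have "\<dots> = (\<Sum>k. ennreal (1 / real (Suc k) ^ (?n + 2)) * emeasure lborel (cball (0::'a) (real (Suc k))))"
    by (subst nn_integral_suminf) (measurable, simp add: nn_integral_cmult_indicator)
  also have "\<dots> = (\<Sum>k. ennreal (V * (1 / real (Suc k) ^ 2)))"
  proof (intro suminf_cong)
    fix k
    have "1 / real (Suc k) ^ (?n + 2) * (real (Suc k) ^ ?n * V) = V * (1 / real (Suc k) ^ 2)"
      by (simp add: power_add field_simps power2_eq_square del: of_nat_Suc)
    then show "ennreal (1 / real (Suc k) ^ (?n + 2)) * emeasure lborel (cball (0::'a) (real (Suc k))) = ennreal (V * (1 / real (Suc k) ^ 2))"
      by (subst ball) (auto simp: ennreal_mult'[symmetric] simp del: of_nat_Suc)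
  qed
  also have "\<dots> < \<infinity>"
  proof -
    have "summable (\<lambda>k. V * (1 / real (Suc k) ^ 2))"
      using inverse_power_summable[of 2, where 'a=real] summable_Suc_iff[of "\<lambda>n. inverse (real n ^ 2)"]
      by (intro summable_mult) (simp add: inverse_eq_divide)
    then show ?thesis by (subst suminf_ennreal2) (auto simp: V_def)
  qed
  finally show ?thesis
    by (intro integrableI_bounded) auto
qed

lemma rapidly_decreasing_integrable:
  assumes "rapidly_decreasing f" "f \<in> borel_measurable borel"
  shows "integrable lborel f"
proof -
  obtain C where C: "(1 + norm x) ^ (DIM('a) + 2) * norm (f x) \<le> C" for x
    using assms unfolding rapidly_decreasing_def by metis
  show ?thesis
  proof (rule Bochner_Integration.integrable_bound)
    show "integrable lborel (\<lambda>x::'a. C * (1 / (1 + norm x) ^ (DIM('a) + 2)))"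
      by (intro integrable_mult_right integrable_weight)
    have "norm (f x) \<le> \<bar>C\<bar> / (1 + norm x) ^ (DIM('a) + 2)" for x
      using C[of x] by (subst pos_le_divide_eq) (simp_all add: mult.commute zero_less_power add_pos_nonneg del: power_add power_Suc)
    then show "AE x in lborel. norm (f x) \<le> norm (C * (1 / (1 + norm x) ^ (DIM('a) + 2)))"
      by (intro AE_I2) (simp add: abs_mult power_abs)
  qed (use assms in auto)
qed

lemma schwartz_measurable: "f \<in> schwartz \<Longrightarrow> f \<in> borel_measurable borel"
  by (intro borel_measurable_continuous_onI smooth_continuous schwartz_smooth)

lemma schwartz_integrable: "f \<in> schwartz \<Longrightarrow> integrable lborel f"
  by (intro rapidly_decreasing_integrable schwartz_rapidly_decreasing schwartz_measurable)

section \<open>Differentiation under the integral, translation and scaling\<close>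

lemma norm_divideR: "0 \<le> r \<Longrightarrow> norm (z /\<^sub>R r) = norm z / r"
  by (simp add: divide_inverse mult.commute)

text \<open>Dominated convergence for the difference quotients, which the mean value inequality bounds by the
  majorant of the derivatives.\<close>

lemma has_derivative_integral:
  fixes k :: "'a::euclidean_space \<Rightarrow> 'b \<Rightarrow> complex"
  assumes e: "e > 0"
    and k: "\<And>x y. x \<in> ball x0 e \<Longrightarrow> y \<in> space M \<Longrightarrow>
      ((\<lambda>x. k x y) has_derivative (\<lambda>h. \<Sum>i\<in>Basis. (h \<bullet> i) *\<^sub>R d i x y)) (at x)"
    and B: "\<And>i x y. i \<in> Basis \<Longrightarrow> x \<in> ball x0 e \<Longrightarrow> y \<in> space M \<Longrightarrow> norm (d i x y) \<le> B y" "integrable M B"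
    and int: "\<And>x. x \<in> ball x0 e \<Longrightarrow> integrable M (k x)"
    and d: "\<And>i. i \<in> Basis \<Longrightarrow> d i x0 \<in> borel_measurable M"
  shows "((\<lambda>x. LINT y|M. k x y) has_derivative (\<lambda>h. \<Sum>i\<in>Basis. (h \<bullet> i) *\<^sub>R (LINT y|M. d i x0 y))) (at x0)"
proof -
  have x0: "x0 \<in> ball x0 e" using e by simp
  have di: "integrable M (d i x0)" if "i \<in> Basis" for i
    using B(1)[OF that x0] by (intro Bochner_Integration.integrable_bound[OF B(2) d[OF that]] AE_I2) force
  define D where "D = real DIM('a)"
  have Dk: "norm (\<Sum>i\<in>Basis. (h \<bullet> i) *\<^sub>R d i x y) \<le> D * B y * norm h" if "x \<in> ball x0 e" "y \<in> space M" for x y h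
  proof -
    have "norm (\<Sum>i\<in>Basis. (h \<bullet> i) *\<^sub>R d i x y) \<le> (\<Sum>i\<in>(Basis::'a set). norm h * B y)"
      using B(1)[OF _ that] by (intro sum_norm_le) (auto intro!: mult_mono Basis_le_norm)
    then show ?thesis by (simp add: D_def mult_ac)
  qed
  define q where "q h y = (k (x0 + h) y - k x0 y - (\<Sum>i\<in>Basis. (h \<bullet> i) *\<^sub>R d i x0 y)) /\<^sub>R norm h" for h y
  have q_le: "norm (q h y) \<le> 2 * D * B y" if h: "x0 + h \<in> ball x0 e" and y: "y \<in> space M" for h y
  proof (cases "h = 0")
    case True
    have "0 \<le> B y" using B(1)[OF SOME_Basis x0 y] norm_ge_zero order_trans by blast
    then show ?thesis by (simp add: q_def True D_def)
  next
    case False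
    have "norm (k (x0 + h) y - k x0 y) \<le> D * B y * norm (x0 + h - x0)"
    proof (rule differentiable_bound[where S="ball x0 e" and f="\<lambda>x. k x y"])
      show "((\<lambda>x. k x y) has_derivative (\<lambda>h. \<Sum>i\<in>Basis. (h \<bullet> i) *\<^sub>R d i x y)) (at x within ball x0 e)" if "x \<in> ball x0 e" for x
        using k[OF that y] by (rule has_derivative_at_withinI)
      show "onorm (\<lambda>h. \<Sum>i\<in>Basis. (h \<bullet> i) *\<^sub>R d i x y) \<le> D * B y" if "x \<in> ball x0 e" for x
        by (rule onorm_le) (use Dk[OF that y] in auto)
    qed (use h x0 in auto)
    moreover have "norm (\<Sum>i\<in>Basis. (h \<bullet> i) *\<^sub>R d i x0 y) \<le> D * B y * norm h" by (rule Dk[OF x0 y])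
    ultimately have "norm (k (x0 + h) y - k x0 y - (\<Sum>i\<in>Basis. (h \<bullet> i) *\<^sub>R d i x0 y)) \<le> 2 * D * B y * norm h"
      by (smt (verit) add_diff_cancel_left' distrib_right norm_triangle_ineq4)
    then show ?thesis using False by (simp add: q_def divide_simps mult.commute)
  qed
  have q_int: "integrable M (q h)" and q_eq: "(LINT y|M. q h y) = ((LINT y|M. k (x0 + h) y) - (LINT y|M. k x0 y) -
      (\<Sum>i\<in>Basis. (h \<bullet> i) *\<^sub>R (LINT y|M. d i x0 y))) /\<^sub>R norm h" if h: "x0 + h \<in> ball x0 e" for h
    using int[OF h] int[OF x0] di unfolding q_def by (simp_all add: integral_sum)
  have lim: "((\<lambda>h. LINT y|M. q h y) \<longlongrightarrow> 0) (at 0)"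
    unfolding tendsto_at_iff_sequentially
  proof (intro allI impI)
    fix X :: "nat \<Rightarrow> 'a" assume X: "\<forall>i. X i \<in> UNIV - {0}" "X \<longlonglongrightarrow> 0"
    have "\<forall>\<^sub>F n in sequentially. norm (X n) < e" using X(2) e by (auto simp: tendsto_iff dist_norm)
    then obtain N where N: "\<And>n. n \<ge> N \<Longrightarrow> x0 + X n \<in> ball x0 e" by (auto simp: eventually_sequentially dist_norm)
    have "(\<lambda>n. LINT y|M. q (X (n + N)) y) \<longlonglongrightarrow> (LINT y|M. 0)"
    proof (rule integral_dominated_convergence[where w="\<lambda>y. 2 * D * B y"])
      show "q (X (n + N)) \<in> borel_measurable M" for n using q_int[OF N] by auto
      show "AE y in M. (\<lambda>n. q (X (n + N)) y) \<longlonglongrightarrow> 0"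
      proof (rule AE_I2)
        fix y assume y: "y \<in> space M"
        have "((\<lambda>h. q h y) \<longlongrightarrow> 0) (at 0)"
        proof (rule tendsto_norm_zero_cancel)
          show "((\<lambda>h. norm (q h y)) \<longlongrightarrow> 0) (at 0)"
            using conjunct2[OF k[OF x0 y, unfolded has_derivative_at]] unfolding q_def
            by (simp only: norm_divideR norm_ge_zero)
        qed
        then have "(\<lambda>n. q (X n) y) \<longlonglongrightarrow> 0" using X unfolding tendsto_at_iff_sequentially o_def by auto
        then show "(\<lambda>n. q (X (n + N)) y) \<longlonglongrightarrow> 0" by (rule LIMSEQ_ignore_initial_segment)
      qed
      show "AE y in M. norm (q (X (n + N)) y) \<le> 2 * D * B y" for n
        by (intro AE_I2 q_le N) auto
    qed (use B(2) in auto)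
    then show "((\<lambda>h. LINT y|M. q h y) \<circ> X) \<longlonglongrightarrow> 0"
      unfolding o_def by - (rule LIMSEQ_offset[where k=N], simp)
  qed
  have "\<forall>\<^sub>F h in at 0. x0 + h \<in> ball x0 e"
    unfolding eventually_at using e by (intro exI[of _ e]) (auto simp: dist_norm)
  then have "\<forall>\<^sub>F h in at 0. (LINT y|M. q h y) = ((LINT y|M. k (x0 + h) y) - (LINT y|M. k x0 y) -
      (\<Sum>i\<in>Basis. (h \<bullet> i) *\<^sub>R (LINT y|M. d i x0 y))) /\<^sub>R norm h"
    by eventually_elim (rule q_eq)
  from tendsto_norm_zero[OF Lim_transform_eventually[OF lim this]]
  have "((\<lambda>h. norm ((LINT y|M. k (x0 + h) y) - (LINT y|M. k x0 y) -
      (\<Sum>i\<in>Basis. (h \<bullet> i) *\<^sub>R (LINT y|M. d i x0 y))) / norm h) \<longlongrightarrow> 0) (at 0)"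
    by (simp only: norm_divideR norm_ge_zero)
  moreover have "bounded_linear (\<lambda>h. \<Sum>i\<in>Basis. (h \<bullet> i) *\<^sub>R (LINT y|M. d i x0 y))"
    by (rule bounded_linear_sum) (rule bounded_linear_compose[OF bounded_linear_scaleR_left bounded_linear_inner_left])
  ultimately show ?thesis unfolding has_derivative_at by simp
qed

lemma lborel_affine_integrable:
  fixes f :: "'a::euclidean_space \<Rightarrow> complex"
  assumes "c \<noteq> 0" "integrable lborel f"
  shows "integrable lborel (\<lambda>x. f (t + c *\<^sub>R x))"
proof -
  have [measurable]: "f \<in> borel_measurable borel" using assms by auto
  have "integrable (density (distr lborel borel (\<lambda>x. t + c *\<^sub>R x)) (\<lambda>_. \<bar>c\<bar>^DIM('a))) f"
    using assms lborel_affine[of c t] by simp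
  then have "integrable lborel (\<lambda>x. \<bar>c\<bar>^DIM('a) *\<^sub>R f (t + c *\<^sub>R x))"
    by (subst (asm) integrable_density) (auto simp: integrable_distr_eq)
  then have "integrable lborel (\<lambda>x. inverse (\<bar>c\<bar>^DIM('a)) *\<^sub>R (\<bar>c\<bar>^DIM('a) *\<^sub>R f (t + c *\<^sub>R x)))"
    by (rule integrable_scaleR_right)
  then show ?thesis using assms(1) by simp
qed

lemma lborel_affine_integral:
  fixes f :: "'a::euclidean_space \<Rightarrow> complex"
  assumes "c \<noteq> 0" and [measurable]: "f \<in> borel_measurable borel"
  shows "(LINT x|lborel. f x) = \<bar>c\<bar>^DIM('a) *\<^sub>R (LINT x|lborel. f (t + c *\<^sub>R x))"
  by (subst lborel_affine[OF assms(1), of t])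
    (simp add: integral_density integral_distr)

lemma lborel_affine_nn_integral:
  fixes f :: "'a::euclidean_space \<Rightarrow> ennreal"
  assumes "c \<noteq> 0" and [measurable]: "f \<in> borel_measurable borel"
  shows "(\<integral>\<^sup>+x. f x \<partial>lborel) = ennreal (\<bar>c\<bar>^DIM('a)) * (\<integral>\<^sup>+x. f (t + c *\<^sub>R x) \<partial>lborel)"
  by (subst lborel_affine[OF assms(1), of t])
    (simp add: nn_integral_density nn_integral_distr nn_integral_cmult)

lemma lborel_shift_integrable:
  fixes f :: "'a::euclidean_space \<Rightarrow> complex"
  shows "integrable lborel f \<Longrightarrow> integrable lborel (\<lambda>x. f (x + a))"
  using lborel_affine_integrable[of 1 f a] by (simp add: add.commute)

lemma lborel_shift_integral:
  fixes f :: "'a::euclidean_space \<Rightarrow> complex"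
  shows "f \<in> borel_measurable borel \<Longrightarrow> (LINT x|lborel. f (x + a)) = (LINT x|lborel. f x)"
  using lborel_affine_integral[of 1 f a] by (simp add: add.commute)

text \<open>Integration by parts without boundary: by translation invariance
  $\int (p(x+i) - p(x))\,dx = 0$, and the integrand is $\int_0^1 p'(x+ri)\,dr$.\<close>

lemma integral_directional_derivative_eq_0:
  fixes p p' :: "'a::euclidean_space \<Rightarrow> complex"
  assumes p: "integrable lborel p" and p': "integrable lborel p'"
    and deriv: "\<And>x r. ((\<lambda>r. p (x + r *\<^sub>R i)) has_vector_derivative p' (x + r *\<^sub>R i)) (at r)"
    and cont: "\<And>x. continuous_on UNIV (\<lambda>r. p' (x + r *\<^sub>R i))"
  shows "(LINT x|lborel. p' x) = 0"
proof -
  have [measurable]: "p \<in> borel_measurable borel" "p' \<in> borel_measurable borel" using p p' by auto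
  define K where "K r x = indicator {0..1} r *\<^sub>R p' (x + r *\<^sub>R i)" for r x
  have [measurable]: "case_prod K \<in> borel_measurable (lborel \<Otimes>\<^sub>M lborel)" unfolding K_def by measurable
  have K: "integrable (lborel \<Otimes>\<^sub>M lborel) (case_prod K)"
  proof (rule lborel_pair.Fubini_integrable)
    have "(\<lambda>r. LINT x|lborel. norm (K r x)) = (\<lambda>r. indicator {0..1} r * (LINT x|lborel. norm (p' x)))"
    proof
      fix r
      have "(LINT x|lborel. complex_of_real (norm (p' (x + r *\<^sub>R i)))) = (LINT x|lborel. of_real (norm (p' x)))"
        by (rule lborel_shift_integral) simp
      then have "(LINT x|lborel. norm (p' (x + r *\<^sub>R i))) = (LINT x|lborel. norm (p' x))" by simp
      then show "(LINT x|lborel. norm (K r x)) = indicator {0..1} r * (LINT x|lborel. norm (p' x))"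
        unfolding K_def by simp
    qed
    then show "integrable lborel (\<lambda>r. LINT x|lborel. norm (case (r, x) of (r, x) \<Rightarrow> K r x))"
      by (simp add: integrable_mult_left)
    show "AE r in lborel. integrable lborel (\<lambda>x. case (r, x) of (r, x) \<Rightarrow> K r x)"
      unfolding K_def by (auto intro!: AE_I2 lborel_shift_integrable p')
  qed simp
  have inner: "(LINT r|lborel. K r x) = p (x + i) - p x" for x
  proof -
    have "(LINT r|lborel. indicator {0..1} r *\<^sub>R p' (x + r *\<^sub>R i)) = p (x + 1 *\<^sub>R i) - p (x + 0 *\<^sub>R i)"
    proof (rule integral_FTC_Icc)
      show "((\<lambda>r. p (x + r *\<^sub>R i)) has_vector_derivative p' (x + r *\<^sub>R i)) (at r within {0..1})" for r
        using deriv by (rule has_vector_derivative_at_within)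
      show "continuous_on {0..1} (\<lambda>r. p' (x + r *\<^sub>R i))" using cont continuous_on_subset by blast
    qed simp
    then show ?thesis by (simp add: K_def)
  qed
  have "(LINT x|lborel. LINT r|lborel. K r x) = (LINT r|lborel. LINT x|lborel. K r x)"
    using lborel_pair.Fubini_integral[OF K] .
  moreover have "(LINT x|lborel. LINT r|lborel. K r x) = 0"
    unfolding inner using p lborel_shift_integrable[OF p] by (simp add: lborel_shift_integral)
  moreover have "(LINT r|lborel. LINT x|lborel. K r x) = (LINT x|lborel. p' x)"
  proof -
    have "(LINT x|lborel. K r x) = indicator {0..1} r *\<^sub>R (LINT x|lborel. p' x)" for r
      unfolding K_def by (simp add: lborel_shift_integral)
    then show ?thesis by simp
  qed
  ultimately show ?thesis by simp
qed

lemma has_vector_derivative_line: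
  assumes "f differentiable (at (x + r *\<^sub>R i))"
  shows "((\<lambda>r. f (x + r *\<^sub>R i)) has_vector_derivative pd i f (x + r *\<^sub>R i)) (at r)"
proof -
  have D: "(f has_derivative frechet_derivative f (at (x + r *\<^sub>R i))) (at (x + r *\<^sub>R i))"
    using assms frechet_derivative_works by blast
  have "((\<lambda>r. x + r *\<^sub>R i) has_derivative (\<lambda>h. h *\<^sub>R i)) (at r)"
    by (auto intro!: derivative_eq_intros)
  from has_derivative_compose[OF this D]
  show ?thesis unfolding has_vector_derivative_def pd_def
    by (simp add: bounded_linear.linear[OF has_derivative_bounded_linear[OF D]] linear_scale)
qed

lemma integral_pd_eq_0:
  assumes "C1 p" "i \<in> Basis" "integrable lborel p" "integrable lborel (pd i p)"
  shows "(LINT x|lborel. pd i p x) = 0"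
proof (rule integral_directional_derivative_eq_0[OF assms(3,4)])
  show "((\<lambda>r. p (x + r *\<^sub>R i)) has_vector_derivative pd i p (x + r *\<^sub>R i)) (at r)" for x r
    using assms by (intro has_vector_derivative_line) (auto simp: C1_def)
  show "continuous_on UNIV (\<lambda>r. pd i p (x + r *\<^sub>R i))" for x
    by (rule continuous_on_compose2[of UNIV "pd i p"])
      (use assms in \<open>auto simp: C1_def intro!: continuous_intros\<close>)
qed

section \<open>The Fourier transform on Schwartz functions\<close>

text \<open>The real parameter \<open>e = \<plusminus>1\<close> treats the transform and its inverse together.\<close>

definition ft :: "real \<Rightarrow> ('a::euclidean_space \<Rightarrow> complex) \<Rightarrow> 'a \<Rightarrow> complex" where
  "ft e \<psi> \<xi> = (LINT x|lborel. exp (\<i> * of_real (e * (x \<bullet> \<xi>))) * \<psi> x)"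

lemma fourier_eq_ft: "fourier = ft (-1)"
  by (simp add: fun_eq_iff fourier_def ft_def)

lemma norm_exp_i [simp]: "norm (exp (\<i> * complex_of_real r)) = 1"
  by (simp add: norm_exp_eq_Re)

lemma exp_i_measurable [measurable]:
  "f \<in> borel_measurable M \<Longrightarrow> (\<lambda>x. exp (\<i> * complex_of_real (f x))) \<in> borel_measurable M"
  by (rule measurable_compose[where g="\<lambda>r. exp (\<i> * complex_of_real r)"])
    (auto intro!: borel_measurable_continuous_onI continuous_intros)

lemma integrable_character_mult:
  fixes \<psi> :: "'a \<Rightarrow> complex"
  assumes "integrable M \<psi>" and "f \<in> borel_measurable M"
  shows "integrable M (\<lambda>x. exp (\<i> * complex_of_real (f x)) * \<psi> x)"
  by (rule Bochner_Integration.integrable_bound[OF integrable_norm[OF assms(1)]])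
    (use assms in \<open>auto simp: norm_mult\<close>)

lemma norm_ft_le: "norm (ft e \<psi> \<xi>) \<le> (LINT x|lborel. norm (\<psi> x))"
proof -
  have "norm (ft e \<psi> \<xi>) \<le> (LINT x|lborel. norm (exp (\<i> * of_real (e * (x \<bullet> \<xi>))) * \<psi> x))"
    unfolding ft_def by (rule integral_norm_bound)
  then show ?thesis by (simp add: norm_mult)
qed

lemma ft_measurable [measurable]:
  assumes [measurable]: "\<psi> \<in> borel_measurable borel"
  shows "ft e \<psi> \<in> borel_measurable borel"
  unfolding ft_def[abs_def] by (rule lborel.borel_measurable_lebesgue_integral) measurable

lemma ft_add: "integrable lborel f \<Longrightarrow> integrable lborel g \<Longrightarrow> ft e (\<lambda>x. f x + g x) \<xi> = ft e f \<xi> + ft e g \<xi>"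
  unfolding ft_def distrib_left by (intro Bochner_Integration.integral_add integrable_character_mult) auto

lemma ft_cmult: "ft e (\<lambda>x. c * f x) \<xi> = c * ft e f \<xi>"
proof -
  have "ft e (\<lambda>x. c * f x) \<xi> = (LINT x|lborel. c * (exp (\<i> * of_real (e * (x \<bullet> \<xi>))) * f x))"
    unfolding ft_def by (intro Bochner_Integration.integral_cong) auto
  then show ?thesis by (simp add: ft_def)
qed

lemma has_derivative_character:
  "((\<lambda>\<eta>. exp (\<i> * of_real (e * (x \<bullet> \<eta>)))) has_derivative
      (\<lambda>h. (\<i> * of_real (e * (x \<bullet> h))) * exp (\<i> * of_real (e * (x \<bullet> \<eta>))))) (at \<eta>)"
proof -
  have 1: "((\<lambda>\<eta>. \<i> * complex_of_real (e * (x \<bullet> \<eta>))) has_derivative (\<lambda>h. \<i> * of_real (e * (x \<bullet> h)))) (at \<eta>)"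
    by (auto intro!: derivative_eq_intros)
  have 2: "(exp has_derivative (\<lambda>h. h * exp z)) (at z)" for z :: complex
    using DERIV_exp[of z] by (simp add: has_field_derivative_def mult_commute_abs)
  show ?thesis using has_derivative_compose[OF 1 2] .
qed

lemma ft_has_derivative:
  assumes "integrable lborel \<psi>" and "\<And>i. i \<in> Basis \<Longrightarrow> integrable lborel (\<lambda>x. of_real (x \<bullet> i) * \<psi> x)"
  shows "(ft e \<psi> has_derivative (\<lambda>h. \<Sum>i\<in>Basis. (h \<bullet> i) *\<^sub>R ft e (\<lambda>x. \<i> * of_real e * (of_real (x \<bullet> i) * \<psi> x)) \<xi>)) (at \<xi>)"
proof -
  have [measurable]: "\<psi> \<in> borel_measurable borel" using assms by auto
  show ?thesis unfolding ft_def[abs_def]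
  proof (rule has_derivative_integral[where e=1 and B="\<lambda>x. \<Sum>i\<in>Basis. \<bar>e\<bar> * norm (of_real (x \<bullet> i) * \<psi> x)"])
    fix \<eta> x :: 'a
    have D: "((\<lambda>\<eta>. exp (\<i> * of_real (e * (x \<bullet> \<eta>))) * \<psi> x) has_derivative
      (\<lambda>h. (\<i> * of_real (e * (x \<bullet> h))) * exp (\<i> * of_real (e * (x \<bullet> \<eta>))) * \<psi> x)) (at \<eta>)"
      by (intro has_derivative_mult_left has_derivative_character)
    have eq: "(\<i> * of_real (e * (x \<bullet> h))) * exp (\<i> * of_real (e * (x \<bullet> \<eta>))) * \<psi> x =
       (\<Sum>i\<in>Basis. (h \<bullet> i) *\<^sub>R (exp (\<i> * of_real (e * (x \<bullet> \<eta>))) * (\<i> * of_real e * (of_real (x \<bullet> i) * \<psi> x))))" for h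
      by (subst euclidean_inner[of x h]) (simp add: sum_distrib_left sum_distrib_right scaleR_conv_of_real mult_ac)
    show "((\<lambda>\<eta>. exp (\<i> * of_real (e * (x \<bullet> \<eta>))) * \<psi> x) has_derivative
      (\<lambda>h. \<Sum>i\<in>Basis. (h \<bullet> i) *\<^sub>R (exp (\<i> * of_real (e * (x \<bullet> \<eta>))) * (\<i> * of_real e * (of_real (x \<bullet> i) * \<psi> x))))) (at \<eta>)"
      using D unfolding eq .
    show "norm (exp (\<i> * of_real (e * (x \<bullet> \<eta>))) * (\<i> * of_real e * (of_real (x \<bullet> i) * \<psi> x)))
        \<le> (\<Sum>i\<in>Basis. \<bar>e\<bar> * norm (of_real (x \<bullet> i) * \<psi> x))" if "i \<in> Basis" for i
      using member_le_sum[OF that, of "\<lambda>i. \<bar>e\<bar> * norm (of_real (x \<bullet> i) * \<psi> x)"] by (simp add: norm_mult mult_ac)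
  next
    show "integrable lborel (\<lambda>x. \<Sum>i\<in>Basis. \<bar>e\<bar> * norm (of_real (x \<bullet> i) * \<psi> x))"
      by (intro Bochner_Integration.integrable_sum integrable_mult_right integrable_norm assms)
    show "integrable lborel (\<lambda>x. exp (\<i> * of_real (e * (x \<bullet> \<eta>))) * \<psi> x)" for \<eta>
      by (intro integrable_character_mult assms) simp
    show "(\<lambda>x. exp (\<i> * of_real (e * (x \<bullet> \<xi>))) * (\<i> * of_real e * (of_real (x \<bullet> i) * \<psi> x))) \<in> borel_measurable lborel" for i
      by measurable
  qed simp
qed

lemma ft_pd:
  assumes "\<psi> \<in> schwartz" "i \<in> Basis"
  shows "ft e \<psi> differentiable (at \<xi>)"
    and "pd i (ft e \<psi>) = ft e (\<lambda>x. \<i> * of_real e * (of_real (x \<bullet> i) * \<psi> x))"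
proof -
  have D: "(ft e \<psi> has_derivative (\<lambda>h. \<Sum>i\<in>Basis. (h \<bullet> i) *\<^sub>R ft e (\<lambda>x. \<i> * of_real e * (of_real (x \<bullet> i) * \<psi> x)) \<xi>)) (at \<xi>)" for \<xi>
    by (intro ft_has_derivative schwartz_integrable schwartz_coord assms)
  then show "ft e \<psi> differentiable (at \<xi>)" using differentiable_def by blast
  show "pd i (ft e \<psi>) = ft e (\<lambda>x. \<i> * of_real e * (of_real (x \<bullet> i) * \<psi> x))"
    by (rule ext, subst pd_eqI[OF D]) (simp add: inner_Basis assms if_distrib if_distribR cong: if_cong)
qed

lemma ft_of_pd:
  assumes "\<psi> \<in> schwartz" "i \<in> Basis"
  shows "ft e (pd i \<psi>) \<xi> = - (\<i> * of_real (e * (\<xi> \<bullet> i))) * ft e \<psi> \<xi>"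
proof -
  define E where "E x = exp (\<i> * complex_of_real (e * (x \<bullet> \<xi>)))" for x :: 'a
  have I: "integrable lborel (\<lambda>x. E x * \<psi> x)" "integrable lborel (\<lambda>x. E x * pd i \<psi> x)"
    unfolding E_def by (intro integrable_character_mult schwartz_integrable schwartz_pd assms, simp)+
  have "smooth (\<lambda>x. \<i> * of_real (x \<bullet> (e *\<^sub>R \<xi>)))"
    by (intro smooth_mult smooth_const smooth_inner)
  then have E: "smooth E" unfolding E_def using smooth_holomorphic[of _ UNIV exp] by (auto intro: holomorphic_intros)
  have pdE: "pd i E x = \<i> * of_real (e * (\<xi> \<bullet> i)) * E x" for x
    unfolding E_def using pd_eqI[OF has_derivative_character[of e \<xi> x], of i] by (simp only: inner_commute)
  have p: "pd i (\<lambda>x. E x * \<psi> x) = (\<lambda>x. E x * pd i \<psi> x + \<i> * of_real (e * (\<xi> \<bullet> i)) * (E x * \<psi> x))"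
    by (rule ext, subst pd_mult) (use E assms in \<open>auto simp: smooth_differentiable schwartz_smooth pdE\<close>)
  have "(LINT x|lborel. pd i (\<lambda>x. E x * \<psi> x) x) = 0"
  proof (rule integral_pd_eq_0)
    show "C1 (\<lambda>x. E x * \<psi> x)" by (intro C1_smooth smooth_mult E schwartz_smooth assms(1))
    show "integrable lborel (pd i (\<lambda>x. E x * \<psi> x))" unfolding p using I by simp
  qed (use assms I in auto)
  then have "(LINT x|lborel. E x * pd i \<psi> x) + \<i> * of_real (e * (\<xi> \<bullet> i)) * (LINT x|lborel. E x * \<psi> x) = 0"
    unfolding p using I by (subst (asm) Bochner_Integration.integral_add) auto
  then show ?thesis unfolding ft_def E_def by (simp add: add_eq_0_iff)
qed

text \<open>One power of the weight on the transform costs one derivative of the function.\<close>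

lemma weighted_ft_le:
  assumes "\<psi> \<in> schwartz" "\<bar>e\<bar> = 1"
  shows "(1 + norm \<xi>) ^ Suc k * norm (ft e \<psi> \<xi>) \<le>
    (1 + norm \<xi>) ^ k * norm (ft e \<psi> \<xi>) + (\<Sum>i\<in>Basis. (1 + norm \<xi>) ^ k * norm (ft e (pd i \<psi>) \<xi>))"
proof -
  have "(1 + norm \<xi>) * norm (ft e \<psi> \<xi>) \<le> norm (ft e \<psi> \<xi>) + (\<Sum>i\<in>Basis. \<bar>\<xi> \<bullet> i\<bar>) * norm (ft e \<psi> \<xi>)"
    using mult_right_mono[OF norm_le_l1[of \<xi>], of "norm (ft e \<psi> \<xi>)"] by (simp add: algebra_simps)
  also have "(\<Sum>i\<in>Basis. \<bar>\<xi> \<bullet> i\<bar>) * norm (ft e \<psi> \<xi>) = (\<Sum>i\<in>Basis. norm (ft e (pd i \<psi>) \<xi>))"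
    unfolding sum_distrib_right by (intro sum.cong) (use assms in \<open>auto simp: ft_of_pd norm_mult abs_mult\<close>)
  finally have "(1 + norm \<xi>) ^ k * ((1 + norm \<xi>) * norm (ft e \<psi> \<xi>)) \<le>
      (1 + norm \<xi>) ^ k * (norm (ft e \<psi> \<xi>) + (\<Sum>i\<in>Basis. norm (ft e (pd i \<psi>) \<xi>)))"
    by (rule mult_left_mono) auto
  then show ?thesis by (simp add: algebra_simps sum_distrib_left)
qed

lemma ft_rapidly_decreasing:
  assumes "\<psi> \<in> schwartz" "\<bar>e\<bar> = 1"
  shows "rapidly_decreasing (ft e \<psi>)"
proof -
  have "\<exists>C. \<forall>\<xi>. (1 + norm \<xi>) ^ k * norm (ft e \<psi> \<xi>) \<le> C" for k
    using assms(1)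
  proof (induction k arbitrary: \<psi>)
    case 0
    then show ?case using norm_ft_le[of e \<psi>] by auto
  next
    case (Suc k)
    obtain C where C: "\<And>\<xi>. (1 + norm \<xi>) ^ k * norm (ft e \<psi> \<xi>) \<le> C" using Suc by blast
    have "\<forall>i\<in>Basis. \<exists>D. \<forall>\<xi>. (1 + norm \<xi>) ^ k * norm (ft e (pd i \<psi>) \<xi>) \<le> D" using Suc schwartz_pd by blast
    then obtain D where D: "\<And>i \<xi>. i \<in> Basis \<Longrightarrow> (1 + norm \<xi>) ^ k * norm (ft e (pd i \<psi>) \<xi>) \<le> D i" by metis
    have "(1 + norm \<xi>) ^ Suc k * norm (ft e \<psi> \<xi>) \<le> C + (\<Sum>i\<in>Basis. D i)" for \<xi>
      using weighted_ft_le[OF Suc.prems assms(2), of \<xi> k] C[of \<xi>] sum_mono[of Basis _ D, OF D[of _ \<xi>]]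
      by (smt (verit))
    then show ?case by blast
  qed
  then show ?thesis unfolding rapidly_decreasing_def by blast
qed

lemma schwartz_ft:
  fixes \<psi> :: "'a::euclidean_space \<Rightarrow> complex"
  assumes "\<psi> \<in> schwartz" "\<bar>e\<bar> = 1"
  shows "ft e \<psi> \<in> schwartz"
proof (rule schwartz_coinduct[of "\<lambda>f. \<exists>\<psi>\<in>schwartz. f = ft e \<psi>"])
  fix f :: "'a \<Rightarrow> complex" and x i :: 'a
  assume "\<exists>\<psi>\<in>schwartz. f = ft e \<psi>"
  then obtain \<phi> where \<phi>: "\<phi> \<in> schwartz" "f = ft e \<phi>" by blast
  show "f differentiable at x" using ft_pd(1)[OF \<phi>(1) SOME_Basis] \<phi>(2) by simp
  show "rapidly_decreasing f" using \<phi> assms(2) ft_rapidly_decreasing by blast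
  assume "i \<in> Basis"
  then show "\<exists>\<psi>\<in>schwartz. pd i f = ft e \<psi>" using \<phi> ft_pd(2)[OF \<phi>(1)]
    by (metis schwartz_cmult schwartz_coord)
qed (use assms in auto)

subsection \<open>Null sequences\<close>

definition weighted_null :: "nat \<Rightarrow> (nat \<Rightarrow> 'a::euclidean_space \<Rightarrow> complex) \<Rightarrow> bool" where
  "weighted_null k X \<longleftrightarrow> (\<forall>\<epsilon>>0. \<forall>\<^sub>F n in sequentially. \<forall>x. (1 + norm x) ^ k * norm (X n x) \<le> \<epsilon>)"

lemma schwartz_null_seq_weighted_null:
  assumes "schwartz_null_seq X"
  shows "weighted_null k X"
  unfolding weighted_null_def
proof (intro allI impI)
  fix \<epsilon> :: real assume "\<epsilon> > 0"
  have "uniform_limit UNIV (\<lambda>n x. (1 + norm x) ^ k *\<^sub>R partials [] (X n) x) (\<lambda>_. 0) sequentially"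
    using conjunct2[OF assms[unfolded schwartz_null_seq_def], rule_format, of "[]" k] by simp
  then have "\<forall>\<^sub>F n in sequentially. \<forall>x\<in>UNIV. dist ((1 + norm x) ^ k *\<^sub>R partials [] (X n) x) 0 < \<epsilon>"
    using \<open>\<epsilon> > 0\<close> uniform_limitD by blast
  then show "\<forall>\<^sub>F n in sequentially. \<forall>x. (1 + norm x) ^ k * norm (X n x) \<le> \<epsilon>"
    by eventually_elim (auto simp: dist_norm less_imp_le)
qed

lemma schwartz_null_seq_pd:
  fixes X :: "nat \<Rightarrow> 'a::euclidean_space \<Rightarrow> complex"
  assumes "schwartz_null_seq X" "i \<in> Basis"
  shows "schwartz_null_seq (\<lambda>n. pd i (X n))"
proof -
  have "partials is (pd i f) = partials (is @ [i]) f" for "is" and f :: "'a \<Rightarrow> complex"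
    by (simp add: partials_append)
  then show ?thesis using assms by (auto simp: schwartz_null_seq_def schwartz_pd)
qed

text \<open>The transform is continuous on Schwartz space: the $L^1$ norm controls the unweighted case, and each power
  of the weight is traded for a derivative.\<close>

lemma weighted_null_ft:
  assumes "schwartz_null_seq X" "\<bar>e\<bar> = 1"
  shows "weighted_null k (\<lambda>n. ft e (X n))"
  using assms(1)
proof (induction k arbitrary: X)
  case 0
  define I where "I = (LINT x|lborel. 1 / (1 + norm (x::'a)) ^ (DIM('a) + 2))"
  have I: "I \<ge> 0" unfolding I_def by (intro Bochner_Integration.integral_nonneg) auto
  show ?case unfolding weighted_null_def
  proof (intro allI impI)
    fix \<epsilon> :: real assume "\<epsilon> > 0"
    then have "\<epsilon> / (I + 1) > 0" using I by simp
    then have "\<forall>\<^sub>F n in sequentially. \<forall>x. (1 + norm x) ^ (DIM('a) + 2) * norm (X n x) \<le> \<epsilon> / (I + 1)"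
      using schwartz_null_seq_weighted_null[OF 0] unfolding weighted_null_def by blast
    then show "\<forall>\<^sub>F n in sequentially. \<forall>x. (1 + norm x) ^ 0 * norm (ft e (X n) x) \<le> \<epsilon>"
    proof eventually_elim
      case (elim n)
      have Xn: "integrable lborel (X n)" using 0 by (auto simp: schwartz_null_seq_def schwartz_integrable)
      have "norm (X n x) \<le> \<epsilon> / (I + 1) * (1 / (1 + norm x) ^ (DIM('a) + 2))" for x
      proof -
        have "(1 + norm x) ^ (DIM('a) + 2) > 0" by (intro zero_less_power add_pos_nonneg) auto
        then have "norm (X n x) \<le> \<epsilon> / (I + 1) / (1 + norm x) ^ (DIM('a) + 2)"
          using elim[rule_format, of x] by (simp only: pos_le_divide_eq mult.commute)
        then show ?thesis by (simp only: times_divide_eq_right mult_1_right)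
      qed
      then have "(LINT x|lborel. norm (X n x)) \<le> (LINT x|lborel. \<epsilon> / (I + 1) * (1 / (1 + norm (x::'a)) ^ (DIM('a) + 2)))"
        by (intro integral_mono integrable_mult_right integrable_weight integrable_norm Xn)
      also have "\<dots> = \<epsilon> / (I + 1) * I" unfolding I_def by (rule integral_mult_right_zero)
      also have "\<dots> \<le> \<epsilon>" using I \<open>\<epsilon> > 0\<close> by (simp add: field_simps)
      finally show ?case using norm_ft_le[of e "X n"] order_trans by (auto simp: order_trans)
    qed
  qed
next
  case (Suc k)
  show ?case unfolding weighted_null_def
  proof (intro allI impI)
    fix \<epsilon> :: real assume "\<epsilon> > 0"
    then have d: "\<epsilon> / (real DIM('a) + 1) > 0" by simp
    have "\<forall>\<^sub>F n in sequentially. \<forall>i\<in>Basis. \<forall>x. (1 + norm x) ^ k * norm (ft e (pd i (X n)) x) \<le> \<epsilon> / (real DIM('a) + 1)"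
      using Suc.IH[OF schwartz_null_seq_pd[OF Suc.prems]] d unfolding weighted_null_def
      by (intro eventually_ball_finite) auto
    moreover have "\<forall>\<^sub>F n in sequentially. \<forall>x. (1 + norm x) ^ k * norm (ft e (X n) x) \<le> \<epsilon> / (real DIM('a) + 1)"
      using Suc.IH[OF Suc.prems] d unfolding weighted_null_def by blast
    ultimately show "\<forall>\<^sub>F n in sequentially. \<forall>x. (1 + norm x) ^ Suc k * norm (ft e (X n) x) \<le> \<epsilon>"
    proof eventually_elim
      case (elim n)
      show ?case
      proof
        fix x
        have "(\<Sum>i\<in>(Basis::'a set). (1 + norm x) ^ k * norm (ft e (pd i (X n)) x)) \<le> real DIM('a) * (\<epsilon> / (real DIM('a) + 1))"
          using elim(1) sum_bounded_above[of "Basis::'a set" _ "\<epsilon> / (real DIM('a) + 1)"] by auto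
        moreover have "\<epsilon> / (real DIM('a) + 1) + real DIM('a) * (\<epsilon> / (real DIM('a) + 1)) = \<epsilon>"
        proof -
          have "a + d * a = a * (d + 1)" for a d :: real by (simp add: algebra_simps)
          from this[of "\<epsilon> / (real DIM('a) + 1)" "real DIM('a)"]
          have "\<epsilon> / (real DIM('a) + 1) + real DIM('a) * (\<epsilon> / (real DIM('a) + 1)) = \<epsilon> / (real DIM('a) + 1) * (real DIM('a) + 1)" .
          then show ?thesis by simp
        qed
        ultimately show "(1 + norm x) ^ Suc k * norm (ft e (X n) x) \<le> \<epsilon>"
          using weighted_ft_le[of "X n" e x k] elim(2)[rule_format, of x] Suc.prems assms(2)
          unfolding schwartz_null_seq_def by (smt (verit))
      qed
    qed
  qed
qed

subsection \<open>The Gaussian\<close>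

definition gauss :: "'a::euclidean_space \<Rightarrow> complex" where
  "gauss x = of_real (exp (- ((norm x)\<^sup>2 / 2)))"

lemma smooth_gauss: "smooth gauss"
proof -
  have "smooth (\<lambda>x. (- 1 / 2) * of_real ((norm x)\<^sup>2))" by (intro smooth_mult smooth_const smooth_norm_sq)
  from smooth_holomorphic[OF this open_UNIV, of exp] show ?thesis
    unfolding gauss_def[abs_def] exp_of_real[symmetric] by (simp add: holomorphic_intros)
qed

lemma pd_gauss: "pd i gauss x = - 1 * (of_real (x \<bullet> i) * gauss x)"
proof (rule pd_eqI[THEN trans])
  show "(gauss has_derivative (\<lambda>h. of_real (- (x \<bullet> h) * exp (- (x \<bullet> x / 2))))) (at x)"
    unfolding gauss_def[abs_def] power2_norm_eq_inner
    by (auto intro!: derivative_eq_intros simp: inner_commute algebra_simps)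
qed (simp add: gauss_def power2_norm_eq_inner)

lemma gauss_rapidly_decreasing: "rapidly_decreasing gauss"
  unfolding rapidly_decreasing_def
proof
  fix k
  have "(1 + norm x) ^ k * norm (gauss x) \<le> fact k * exp (3/2)" for x :: 'a
  proof -
    have "(1 + norm x) ^ k / fact k \<le> exp (1 + norm x)"
      using sum_le_suminf[OF summable_exp_generic, of "{k}" "1 + norm x"]
      by (simp add: exp_def scaleR_conv_of_real divide_inverse mult.commute)
    then have "(1 + norm x) ^ k * exp (- ((norm x)\<^sup>2 / 2)) \<le> (fact k * exp (1 + norm x)) * exp (- ((norm x)\<^sup>2 / 2))"
      by (intro mult_right_mono) (auto simp: divide_simps mult.commute)
    also have "\<dots> = fact k * exp (1 + norm x - (norm x)\<^sup>2 / 2)" by (simp add: mult_exp_exp)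
    also have "\<dots> \<le> fact k * exp (3/2)"
      using zero_le_power2[of "norm x - 1"] by (intro mult_left_mono) (auto simp: power2_diff)
    finally show ?thesis by (simp add: gauss_def)
  qed
  then show "\<exists>C. \<forall>x::'a. (1 + norm x) ^ k * norm (gauss x) \<le> C" by blast
qed

lemma gauss_schwartz: "(gauss :: 'a::euclidean_space \<Rightarrow> complex) \<in> schwartz"
proof (rule decreasing_closure_schwartz[where B="{gauss}"])
  fix f :: "'a \<Rightarrow> complex" and i :: 'a
  assume "f \<in> {gauss}"
  moreover have "decreasing_closure {gauss} (\<lambda>x::'a. - 1 * (of_real (x \<bullet> i) * gauss x))"
    by (rule decreasing_closure.cmult, rule decreasing_closure.coord, rule decreasing_closure.base) simp
  ultimately show "decreasing_closure {gauss} (pd i f)"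
    using ext[of "pd i gauss", OF pd_gauss[of i]] by simp
qed (auto simp: gauss_rapidly_decreasing smooth_differentiable smooth_gauss intro: decreasing_closure.base)

lemma gauss_measurable [measurable]: "gauss \<in> borel_measurable borel"
  by (simp add: schwartz_measurable gauss_schwartz)

text \<open>The number $(2\pi)^{n/2}$, whose square normalizes the inverse transform.\<close>

definition gauss_mass :: "'a::euclidean_space itself \<Rightarrow> real" where
  "gauss_mass _ = (LINT x::'a|lborel. exp (- ((norm x)\<^sup>2 / 2)))"

lemma norm_gauss: "norm (gauss x) = exp (- ((norm x)\<^sup>2 / 2))"
  by (simp add: gauss_def)

lemma integral_gauss: "(LINT x::'a::euclidean_space|lborel. gauss x) = of_real (gauss_mass TYPE('a))"
  unfolding gauss_def gauss_mass_def by (rule integral_complex_of_real)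

lemma gauss_mass_pos: "gauss_mass TYPE('a::euclidean_space) > 0"
proof -
  have I: "integrable lborel (\<lambda>x::'a. exp (- ((norm x)\<^sup>2 / 2)))"
    unfolding norm_gauss[symmetric] by (intro integrable_norm schwartz_integrable gauss_schwartz)
  have "gauss_mass TYPE('a) \<noteq> 0"
  proof
    assume "gauss_mass TYPE('a) = 0"
    then have "AE x::'a in lborel. exp (- ((norm x)\<^sup>2 / 2)) = 0"
      using integral_nonneg_eq_0_iff_AE[OF I] by (simp add: gauss_mass_def)
    then have "AE x::'a in lborel. False" by simp
    then have "emeasure lborel (UNIV :: 'a set) = 0" by (simp add: AE_iff_null null_sets_def)
    then show False by (simp add: emeasure_lborel_UNIV)
  qed
  then show ?thesis unfolding gauss_mass_def
    by (smt (verit) Bochner_Integration.integral_nonneg exp_ge_zero)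
qed

text \<open>Both \<^const>\<open>gauss\<close> and its transform solve the equations $\partial_i u = -\xi_i u$, so their
  quotient is constant.\<close>

lemma ft_gauss:
  assumes "\<bar>e\<bar> = 1"
  shows "ft e gauss (\<xi>::'a::euclidean_space) = of_real (gauss_mass TYPE('a)) * gauss \<xi>"
proof -
  define q where "q \<xi> = of_real (exp ((norm \<xi>)\<^sup>2 / 2)) * ft e gauss \<xi>" for \<xi> :: 'a
  have ee: "complex_of_real e * of_real e = 1" using assms by (auto simp: abs_if split: if_splits)
  have pdft: "pd i (ft e gauss) \<xi> = - of_real (\<xi> \<bullet> i) * ft e gauss \<xi>" if "i \<in> Basis" for i \<xi> :: 'a
  proof -
    have "pd i (ft e gauss) \<xi> = ft e (\<lambda>x. (- (\<i> * of_real e)) * pd i gauss x) \<xi>"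
      by (simp add: ft_pd(2)[OF gauss_schwartz that] pd_gauss)
    also have "\<dots> = (- (\<i> * of_real e)) * (- (\<i> * of_real (e * (\<xi> \<bullet> i))) * ft e gauss \<xi>)"
      by (simp only: ft_cmult ft_of_pd[OF gauss_schwartz that])
    also have "\<dots> = - ((of_real e * of_real e) * of_real (\<xi> \<bullet> i)) * ft e gauss \<xi>"
      by (simp add: algebra_simps)
    finally show ?thesis unfolding ee by simp
  qed
  have "(q has_derivative (\<lambda>_. 0)) (at \<xi>)" for \<xi>
  proof -
    have "(ft e gauss has_derivative (\<lambda>h. \<Sum>i\<in>Basis. (h \<bullet> i) *\<^sub>R pd i (ft e gauss) \<xi>)) (at \<xi>)"
      by (rule has_derivative_pd, rule ft_pd(1)[OF gauss_schwartz SOME_Basis])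
    moreover have "(\<Sum>i\<in>Basis. (h \<bullet> i) *\<^sub>R pd i (ft e gauss) \<xi>) = - of_real (\<xi> \<bullet> h) * ft e gauss \<xi>" for h
      by (subst euclidean_inner[of \<xi> h]) (simp add: pdft sum_distrib_left scaleR_conv_of_real mult_ac sum_negf)
    ultimately have D: "(ft e gauss has_derivative (\<lambda>h. - of_real (\<xi> \<bullet> h) * ft e gauss \<xi>)) (at \<xi>)" by simp
    have "((\<lambda>\<xi>::'a. complex_of_real (exp (\<xi> \<bullet> \<xi> / 2))) has_derivative (\<lambda>h. of_real ((\<xi> \<bullet> h) * exp (\<xi> \<bullet> \<xi> / 2)))) (at \<xi>)"
      by (auto intro!: derivative_eq_intros simp: inner_commute algebra_simps)
    from has_derivative_mult[OF this D] show ?thesis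
      unfolding q_def[abs_def] power2_norm_eq_inner by (simp add: algebra_simps)
  qed
  then have "q \<xi> = q 0"
    using has_derivative_zero_unique[of UNIV q] by (auto intro: has_derivative_at_withinI)
  moreover have "q 0 = of_real (gauss_mass TYPE('a))"
    by (simp add: q_def ft_def integral_gauss)
  ultimately have "of_real (exp ((norm \<xi>)\<^sup>2 / 2)) * ft e gauss \<xi> = of_real (gauss_mass TYPE('a))"
    unfolding q_def by simp
  then have "gauss \<xi> * (of_real (exp ((norm \<xi>)\<^sup>2 / 2)) * ft e gauss \<xi>) = of_real (gauss_mass TYPE('a)) * gauss \<xi>"
    by simp
  then show ?thesis by (simp add: gauss_def mult.assoc[symmetric] of_real_mult[symmetric] exp_add[symmetric] del: of_real_mult)
qed

text \<open>The Gaussian approximate identity is the transform of a wide Gaussian.\<close>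

definition gauss_kernel :: "real \<Rightarrow> 'a::euclidean_space \<Rightarrow> complex" where
  "gauss_kernel \<epsilon> z = of_real (gauss_mass TYPE('a) / \<epsilon> ^ DIM('a)) * gauss (z /\<^sub>R \<epsilon>)"

lemma gauss_kernel_measurable [measurable]: "gauss_kernel \<epsilon> \<in> borel_measurable borel"
  unfolding gauss_kernel_def[abs_def] by measurable

lemma gauss_scaled_integrable: "\<epsilon> \<noteq> 0 \<Longrightarrow> integrable lborel (\<lambda>x. gauss (\<epsilon> *\<^sub>R x))"
  using lborel_affine_integrable[of \<epsilon> gauss 0] by (simp add: schwartz_integrable gauss_schwartz)

lemma ft_gauss_scaled:
  assumes "\<epsilon> > 0" "\<bar>e\<bar> = 1"
  shows "ft e (\<lambda>x. gauss (\<epsilon> *\<^sub>R x)) z = gauss_kernel \<epsilon> (z::'a::euclidean_space)"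
proof -
  have "ft e gauss (z /\<^sub>R \<epsilon>) = \<bar>\<epsilon>\<bar>^DIM('a) *\<^sub>R (LINT x|lborel. exp (\<i> * of_real (e * ((0 + \<epsilon> *\<^sub>R x) \<bullet> (z /\<^sub>R \<epsilon>)))) * gauss (0 + \<epsilon> *\<^sub>R x))"
    unfolding ft_def using assms(1) by (subst lborel_affine_integral[of \<epsilon> _ 0]) auto
  also have "\<dots> = \<epsilon>^DIM('a) *\<^sub>R ft e (\<lambda>x. gauss (\<epsilon> *\<^sub>R x)) z"
  proof -
    have "(0 + \<epsilon> *\<^sub>R x) \<bullet> (z /\<^sub>R \<epsilon>) = x \<bullet> z" for x using assms(1) by simp
    then show ?thesis using assms(1) unfolding ft_def by (simp only: add_0_left abs_of_pos)
  qed
  finally have "\<epsilon>^DIM('a) *\<^sub>R ft e (\<lambda>x. gauss (\<epsilon> *\<^sub>R x)) z = of_real (gauss_mass TYPE('a)) * gauss (z /\<^sub>R \<epsilon>)"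
    using ft_gauss[OF assms(2), of "z /\<^sub>R \<epsilon>"] by simp
  then show ?thesis using assms(1) by (simp add: gauss_kernel_def scaleR_conv_of_real field_simps)
qed

lemma nn_integral_gauss_kernel:
  assumes "\<epsilon> > 0"
  shows "(\<integral>\<^sup>+z. norm (gauss_kernel \<epsilon> ((t::'a::euclidean_space) - z)) \<partial>lborel) = ennreal ((gauss_mass TYPE('a))\<^sup>2)"
proof -
  let ?c = "gauss_mass TYPE('a)"
  have c: "?c > 0" by (rule gauss_mass_pos)
  have "(\<integral>\<^sup>+z. norm (gauss_kernel \<epsilon> (t - z)) \<partial>lborel) =
      \<bar>- \<epsilon>\<bar>^DIM('a) * (\<integral>\<^sup>+z. norm (gauss_kernel \<epsilon> (t - (t + (- \<epsilon>) *\<^sub>R z))) \<partial>lborel)"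
    using assms by (intro lborel_affine_nn_integral[where t=t and f="\<lambda>z. ennreal (norm (gauss_kernel \<epsilon> (t - z)))"]) auto
  also have "(\<integral>\<^sup>+z. norm (gauss_kernel \<epsilon> (t - (t + (- \<epsilon>) *\<^sub>R z))) \<partial>lborel) = (\<integral>\<^sup>+(z::'a). ennreal (?c / \<epsilon> ^ DIM('a) * exp (- ((norm z)\<^sup>2 / 2))) \<partial>lborel)"
    using assms c by (intro nn_integral_cong) (simp add: gauss_kernel_def norm_mult norm_gauss norm_divide norm_power)
  also have "\<dots> = ennreal (LINT z::'a|lborel. ?c / \<epsilon> ^ DIM('a) * exp (- ((norm z)\<^sup>2 / 2)))"
    using assms c unfolding norm_gauss[symmetric]
    by (intro nn_integral_eq_integral integrable_mult_right integrable_norm schwartz_integrable gauss_schwartz) auto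
  also have "\<dots> = ennreal (?c / \<epsilon> ^ DIM('a) * ?c)" unfolding gauss_mass_def by simp
  also have "ennreal (\<bar>- \<epsilon>\<bar>^DIM('a)) * ennreal (?c / \<epsilon> ^ DIM('a) * ?c) = ennreal (\<bar>- \<epsilon>\<bar>^DIM('a) * (?c / \<epsilon> ^ DIM('a) * ?c))"
    using assms c by (intro ennreal_mult[symmetric]) auto
  also have "\<bar>- \<epsilon>\<bar>^DIM('a) * (?c / \<epsilon> ^ DIM('a) * ?c) = ?c\<^sup>2"
    using assms by (simp add: power2_eq_square)
  finally show ?thesis .
qed

section \<open>Fourier inversion and the Plancherel inequality\<close>

lemma integrable_tensor:
  fixes f :: "'a::euclidean_space \<Rightarrow> complex" and g :: "'b::euclidean_space \<Rightarrow> complex"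
  assumes f: "integrable lborel f" and g: "integrable lborel g"
  shows "integrable (lborel \<Otimes>\<^sub>M lborel) (\<lambda>(x, y). f x * g y)"
proof (rule lborel_pair.Fubini_integrable)
  have [measurable]: "f \<in> borel_measurable borel" "g \<in> borel_measurable borel" using f g by auto
  show "(\<lambda>(x, y). f x * g y) \<in> borel_measurable (lborel \<Otimes>\<^sub>M lborel)" by measurable
  have "(LINT y|lborel. norm (f x * g y)) = norm (f x) * (LINT y|lborel. norm (g y))" for x
    by (simp add: norm_mult)
  then show "integrable lborel (\<lambda>x. LINT y|lborel. norm (case (x, y) of (x, y) \<Rightarrow> f x * g y))"
    using f by (simp add: integrable_mult_left)
  show "AE x in lborel. integrable lborel (\<lambda>y. case (x, y) of (x, y) \<Rightarrow> f x * g y)"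
    using g by simp
qed

text \<open>Fubini's theorem for the absolutely integrable kernel $f(x)\,g(\xi)\,e^{iex\cdot\xi}$.\<close>

lemma ft_multiplication:
  fixes f g :: "'a::euclidean_space \<Rightarrow> complex"
  assumes f: "integrable lborel f" and g: "integrable lborel g"
  shows "(LINT \<xi>|lborel. ft e f \<xi> * g \<xi>) = (LINT x|lborel. f x * ft e g x)"
proof -
  have [measurable]: "f \<in> borel_measurable borel" "g \<in> borel_measurable borel" using f g by auto
  define K where "K x \<xi> = exp (\<i> * complex_of_real (e * (x \<bullet> \<xi>))) * (f x * g \<xi>)" for x \<xi>
  have K: "integrable (lborel \<Otimes>\<^sub>M lborel) (case_prod K)"
  proof (rule Bochner_Integration.integrable_bound[OF integrable_norm[OF integrable_tensor[OF f g]]])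
    show "case_prod K \<in> borel_measurable (lborel \<Otimes>\<^sub>M lborel)" unfolding K_def by measurable
  qed (auto simp: K_def norm_mult)
  have "(LINT x|lborel. K x \<xi>) = ft e f \<xi> * g \<xi>" for \<xi>
  proof -
    have "(LINT x|lborel. K x \<xi>) = (LINT x|lborel. exp (\<i> * complex_of_real (e * (x \<bullet> \<xi>))) * f x * g \<xi>)"
      unfolding K_def by (simp only: mult.assoc)
    then show ?thesis unfolding ft_def by simp
  qed
  moreover have "(LINT \<xi>|lborel. K x \<xi>) = f x * ft e g x" for x
  proof -
    have "(LINT \<xi>|lborel. K x \<xi>) = (LINT \<xi>|lborel. f x * (exp (\<i> * complex_of_real (e * (\<xi> \<bullet> x))) * g \<xi>))"
      unfolding K_def by (simp only: inner_commute mult.left_commute)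
    then show ?thesis unfolding ft_def by simp
  qed
  ultimately show ?thesis using lborel_pair.Fubini_integral[OF K] by simp
qed

lemma gauss_small_tendsto: "(\<lambda>n. gauss (inverse (real (Suc n)) *\<^sub>R x)) \<longlonglongrightarrow> 1"
proof -
  have "(\<lambda>n. complex_of_real (exp (- ((norm (inverse (real (Suc n)) *\<^sub>R x))\<^sup>2 / 2)))) \<longlonglongrightarrow>
      of_real (exp (- ((norm (0 *\<^sub>R x))\<^sup>2 / 2)))"
    by (intro tendsto_intros LIMSEQ_inverse_real_of_nat) auto
  then show ?thesis by (simp add: gauss_def del: of_nat_Suc)
qed

lemma norm_gauss_le_1: "norm (gauss x) \<le> 1"
  by (simp add: norm_gauss)

text \<open>The transforms with opposite signs are inverse up to the factor
  $(\int\gamma)^2$: insert the convergence factor $\gamma(\varepsilon\xi)$, whose transform is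
  an approximate identity, and let $\varepsilon \to 0$.\<close>

theorem ft_inversion:
  fixes \<psi> :: "'a::euclidean_space \<Rightarrow> complex"
  assumes \<psi>: "\<psi> \<in> schwartz" and e: "\<bar>e\<bar> = 1"
  shows "ft (- e) (ft e \<psi>) x = of_real ((gauss_mass TYPE('a))\<^sup>2) * \<psi> x"
proof -
  let ?c = "gauss_mass TYPE('a)"
  define \<epsilon> where "\<epsilon> n = inverse (real (Suc n))" for n
  have \<epsilon>: "\<epsilon> n > 0" for n by (simp add: \<epsilon>_def)
  have [measurable]: "\<psi> \<in> borel_measurable borel" by (rule schwartz_measurable[OF \<psi>])
  have F: "ft e \<psi> \<in> schwartz" using \<psi> e by (rule schwartz_ft)
  \<comment> \<open>the inversion integral with convergence factor; its limit is computed in two ways\<close>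
  define A where "A n = (LINT \<xi>|lborel. (exp (\<i> * of_real (- e * (\<xi> \<bullet> x))) * ft e \<psi> \<xi>) * gauss (\<epsilon> n *\<^sub>R \<xi>))" for n
  have 1: "A \<longlonglongrightarrow> (LINT \<xi>|lborel. (exp (\<i> * of_real (- e * (\<xi> \<bullet> x))) * ft e \<psi> \<xi>) * 1)"
    unfolding A_def
  proof (rule integral_dominated_convergence[where w="\<lambda>\<xi>. norm (ft e \<psi> \<xi>)"])
    show "AE \<xi> in lborel. (\<lambda>n. exp (\<i> * complex_of_real (- e * (\<xi> \<bullet> x))) * ft e \<psi> \<xi> * gauss (\<epsilon> n *\<^sub>R \<xi>))
        \<longlonglongrightarrow> exp (\<i> * complex_of_real (- e * (\<xi> \<bullet> x))) * ft e \<psi> \<xi> * 1"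
      unfolding \<epsilon>_def by (intro AE_I2 tendsto_mult tendsto_const gauss_small_tendsto)
    show "integrable lborel (\<lambda>\<xi>. norm (ft e \<psi> \<xi>))" using F by (intro integrable_norm schwartz_integrable)
    show "AE \<xi> in lborel. norm (exp (\<i> * complex_of_real (- e * (\<xi> \<bullet> x))) * ft e \<psi> \<xi> * gauss (\<epsilon> n *\<^sub>R \<xi>)) \<le> norm (ft e \<psi> \<xi>)" for n
    proof (rule AE_I2)
      fix \<xi>
      show "norm (exp (\<i> * complex_of_real (- e * (\<xi> \<bullet> x))) * ft e \<psi> \<xi> * gauss (\<epsilon> n *\<^sub>R \<xi>)) \<le> norm (ft e \<psi> \<xi>)"
        unfolding norm_mult norm_exp_i mult_1_left by (rule mult_right_le_one_le) (auto intro: norm_gauss_le_1)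
    qed
  qed measurable
  have A_eq: "A n = (LINT z|lborel. \<psi> (x + \<epsilon> n *\<^sub>R z) * (of_real ?c * gauss z))" for n
  proof -
    define g where "g \<xi> = exp (\<i> * of_real (- e * (\<xi> \<bullet> x))) * gauss (\<epsilon> n *\<^sub>R \<xi>)" for \<xi> :: 'a
    have g: "integrable lborel g" unfolding g_def using \<epsilon>[of n]
      by (intro integrable_character_mult gauss_scaled_integrable) auto
    have ftg: "ft e g y = gauss_kernel (\<epsilon> n) (y - x)" for y
    proof -
      have "ft e g y = ft e (\<lambda>\<xi>. gauss (\<epsilon> n *\<^sub>R \<xi>)) (y - x)"
        unfolding ft_def g_def mult.assoc[symmetric] mult_exp_exp
        by (intro Bochner_Integration.integral_cong) (auto simp: algebra_simps inner_diff_right)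
      then show ?thesis by (simp add: ft_gauss_scaled[OF \<epsilon> e])
    qed
    have "A n = (LINT \<xi>|lborel. ft e \<psi> \<xi> * g \<xi>)"
      unfolding A_def g_def by (intro Bochner_Integration.integral_cong) auto
    also have "\<dots> = (LINT y|lborel. \<psi> y * gauss_kernel (\<epsilon> n) (y - x))"
      unfolding ft_multiplication[OF schwartz_integrable[OF \<psi>] g] ftg ..
    also have "\<dots> = \<bar>\<epsilon> n\<bar>^DIM('a) *\<^sub>R (LINT z|lborel. \<psi> (x + \<epsilon> n *\<^sub>R z) * gauss_kernel (\<epsilon> n) (x + \<epsilon> n *\<^sub>R z - x))"
      using \<epsilon>[of n] by (intro lborel_affine_integral) auto
    also have "\<dots> = (LINT z|lborel. \<bar>\<epsilon> n\<bar>^DIM('a) *\<^sub>R (\<psi> (x + \<epsilon> n *\<^sub>R z) * gauss_kernel (\<epsilon> n) (x + \<epsilon> n *\<^sub>R z - x)))"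
      by simp
    also have "\<dots> = (LINT z|lborel. \<psi> (x + \<epsilon> n *\<^sub>R z) * (of_real ?c * gauss z))"
      using \<epsilon>[of n] by (intro Bochner_Integration.integral_cong) (auto simp: gauss_kernel_def scaleR_conv_of_real)
    finally show ?thesis .
  qed
  have 2: "A \<longlonglongrightarrow> (LINT z::'a|lborel. \<psi> x * (of_real ?c * gauss z))"
  proof -
    obtain C where C: "\<And>x. (1 + norm x) ^ 0 * norm (\<psi> x) \<le> C"
      using schwartz_rapidly_decreasing[OF \<psi>] unfolding rapidly_decreasing_def by metis
    have "(\<lambda>n. LINT z|lborel. \<psi> (x + \<epsilon> n *\<^sub>R z) * (of_real ?c * gauss z)) \<longlonglongrightarrow> (LINT z::'a|lborel. \<psi> x * (of_real ?c * gauss z))"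
    proof (rule integral_dominated_convergence[where w="\<lambda>z::'a. C * norm (of_real ?c * gauss z)"])
      show "integrable lborel (\<lambda>z::'a. C * norm (complex_of_real ?c * gauss z))"
        by (intro integrable_mult_right integrable_norm schwartz_integrable gauss_schwartz)
      show "AE z in lborel. (\<lambda>n. \<psi> (x + \<epsilon> n *\<^sub>R z) * (of_real ?c * gauss z)) \<longlonglongrightarrow> \<psi> x * (of_real ?c * gauss z)"
      proof (rule AE_I2)
        fix z
        have "(\<lambda>n. x + \<epsilon> n *\<^sub>R z) \<longlonglongrightarrow> x + 0 *\<^sub>R z" unfolding \<epsilon>_def by (intro tendsto_intros LIMSEQ_inverse_real_of_nat)
        then have "(\<lambda>n. x + \<epsilon> n *\<^sub>R z) \<longlonglongrightarrow> x" by simp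
        from isCont_tendsto_compose[OF _ this, of \<psi>] have "(\<lambda>n. \<psi> (x + \<epsilon> n *\<^sub>R z)) \<longlonglongrightarrow> \<psi> x"
          using smooth_continuous[OF schwartz_smooth[OF \<psi>], of UNIV] by (simp add: continuous_on_eq_continuous_at)
        then show "(\<lambda>n. \<psi> (x + \<epsilon> n *\<^sub>R z) * (of_real ?c * gauss z)) \<longlonglongrightarrow> \<psi> x * (of_real ?c * gauss z)"
          by (intro tendsto_intros)
      qed
      show "AE z in lborel. norm (\<psi> (x + \<epsilon> n *\<^sub>R z) * (of_real ?c * gauss z)) \<le> C * norm (of_real ?c * gauss z)" for n
        unfolding norm_mult[of "\<psi> _"] using C by (intro AE_I2 mult_right_mono) auto
    qed measurable
    then show ?thesis by (subst ext[of A, OF A_eq])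
  qed
  have "ft (- e) (ft e \<psi>) x = (LINT z::'a|lborel. \<psi> x * (of_real ?c * gauss z))"
    using LIMSEQ_unique[OF 1 2] by (simp add: ft_def)
  also have "\<dots> = \<psi> x * (of_real ?c * of_real ?c)" by (simp add: integral_gauss)
  finally show ?thesis by (simp add: power2_eq_square)
qed

text \<open>For integrable \<open>f\<close>, $\int |\hat f|^2 \gamma(\varepsilon y)\,dy$ is a double integral of
  $f(\xi)\overline{f(\eta)}$ against the Gaussian kernel in $\xi-\eta$; Schur's test bounds it by
  $\|f\|_2^2$ times the mass of the kernel, which does not depend on $\varepsilon$.\<close>

theorem plancherel_inequality:
  fixes f :: "'a::euclidean_space \<Rightarrow> complex"
  assumes f: "integrable lborel f" and e: "\<bar>e\<bar> = 1"
  shows "(\<integral>\<^sup>+y. ennreal ((norm (ft e f y))\<^sup>2) \<partial>lborel) \<le>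
    ennreal ((gauss_mass TYPE('a))\<^sup>2) * (\<integral>\<^sup>+\<xi>. ennreal ((norm (f \<xi>))\<^sup>2) \<partial>lborel)"
proof -
  let ?c = "gauss_mass TYPE('a)" and ?N = "\<integral>\<^sup>+\<xi>. ennreal ((norm (f \<xi>))\<^sup>2) \<partial>lborel"
  have [measurable]: "f \<in> borel_measurable borel" using f by auto
  have bound: "(\<integral>\<^sup>+y. ennreal ((norm (ft e f y))\<^sup>2 * norm (gauss (\<epsilon> *\<^sub>R y))) \<partial>lborel) \<le> ennreal (?c\<^sup>2) * ?N"
    if \<epsilon>: "\<epsilon> > 0" for \<epsilon>
  proof -
    define M where "M = (lborel \<Otimes>\<^sub>M lborel :: ('a \<times> 'a) measure)"
    define F where "F p = f (fst p) * cnj (f (snd p))" for p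
    have F: "integrable M F"
      using integrable_tensor[OF f integrable_cnj[OF f]] unfolding M_def F_def by (simp add: case_prod_beta')
    have [measurable]: "F \<in> borel_measurable M" using F by auto
    have fst_m[measurable]: "fst \<in> M \<rightarrow>\<^sub>M borel" "snd \<in> M \<rightarrow>\<^sub>M borel" unfolding M_def by measurable
    have sq: "of_real ((norm (ft e f y))\<^sup>2) = (LINT p|M. exp (\<i> * of_real (e * ((fst p - snd p) \<bullet> y))) * F p)" for y
    proof -
      have I: "integrable M (\<lambda>p. exp (\<i> * of_real (e * ((fst p - snd p) \<bullet> y))) * F p)"
        by (intro integrable_character_mult F) measurable
      have "(LINT p|M. exp (\<i> * of_real (e * ((fst p - snd p) \<bullet> y))) * F p) =
        (LINT \<xi>|lborel. LINT \<eta>|lborel. exp (\<i> * of_real (e * ((\<xi> - \<eta>) \<bullet> y))) * F (\<xi>, \<eta>))"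
        using lborel_pair.integral_fst'[OF I[unfolded M_def]] unfolding M_def by simp
      also have "\<dots> = (LINT \<xi>|lborel. LINT \<eta>|lborel. (exp (\<i> * of_real (e * (\<xi> \<bullet> y))) * f \<xi>) * cnj (exp (\<i> * of_real (e * (\<eta> \<bullet> y))) * f \<eta>))"
      proof (intro Bochner_Integration.integral_cong refl)
        fix \<xi> \<eta> :: 'a
        have "exp (\<i> * complex_of_real (e * ((\<xi> - \<eta>) \<bullet> y))) = exp (\<i> * of_real (e * (\<xi> \<bullet> y))) * cnj (exp (\<i> * of_real (e * (\<eta> \<bullet> y))))"
          unfolding exp_cnj mult_exp_exp by (simp add: inner_diff_left algebra_simps)
        then show "exp (\<i> * of_real (e * ((\<xi> - \<eta>) \<bullet> y))) * F (\<xi>, \<eta>) =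
            (exp (\<i> * of_real (e * (\<xi> \<bullet> y))) * f \<xi>) * cnj (exp (\<i> * of_real (e * (\<eta> \<bullet> y))) * f \<eta>)"
          by (simp add: F_def)
      qed
      also have "\<dots> = ft e f y * cnj (ft e f y)"
        unfolding ft_def integral_mult_right_zero integral_mult_left_zero Bochner_Integration.integral_cnj ..
      finally show ?thesis by (simp only: complex_norm_square)
    qed
    define g where "g y = gauss (\<epsilon> *\<^sub>R y)" for y :: 'a
    have g: "integrable lborel g" unfolding g_def using \<epsilon> by (intro gauss_scaled_integrable) auto
    have [measurable]: "g \<in> borel_measurable borel" using g by auto
    define K where "K p y = exp (\<i> * complex_of_real (e * ((fst p - snd p) \<bullet> y))) * (F p * g y)" for p y
    interpret PM: pair_sigma_finite M "lborel :: 'a measure"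
      unfolding M_def by (intro pair_sigma_finite.intro sigma_finite_pair_measure sigma_finite_lborel)
    have K: "integrable (M \<Otimes>\<^sub>M lborel) (case_prod K)"
    proof (rule PM.Fubini_integrable)
      show "case_prod K \<in> borel_measurable (M \<Otimes>\<^sub>M lborel)" unfolding K_def by measurable
      have "(LINT y|lborel. norm (K p y)) = norm (F p) * (LINT y|lborel. norm (g y))" for p
        by (simp add: K_def norm_mult)
      then show "integrable M (\<lambda>p. LINT y|lborel. norm (case (p, y) of (p, y) \<Rightarrow> K p y))"
        using F by simp
      show "AE p in M. integrable lborel (\<lambda>y. case (p, y) of (p, y) \<Rightarrow> K p y)"
        unfolding K_def by (intro AE_I2, simp only: prod.case, intro integrable_character_mult integrable_mult_right g) measurable
    qed
    have "(LINT y|lborel. of_real ((norm (ft e f y))\<^sup>2) * g y) = (LINT y|lborel. LINT p|M. K p y)"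
    proof (intro Bochner_Integration.integral_cong refl)
      fix y
      have "(LINT p|M. K p y) = (LINT p|M. (exp (\<i> * complex_of_real (e * ((fst p - snd p) \<bullet> y))) * F p) * g y)"
        unfolding K_def by (simp only: mult.assoc)
      then show "of_real ((norm (ft e f y))\<^sup>2) * g y = (LINT p|M. K p y)" unfolding sq by simp
    qed
    also have "\<dots> = (LINT p|M. LINT y|lborel. K p y)" using PM.Fubini_integral[OF K] .
    also have "\<dots> = (LINT p|M. F p * gauss_kernel \<epsilon> (fst p - snd p))"
    proof (intro Bochner_Integration.integral_cong refl)
      fix p
      have "(LINT y|lborel. K p y) = (LINT y|lborel. F p * (exp (\<i> * of_real (e * (y \<bullet> (fst p - snd p)))) * g y))"
        unfolding K_def by (simp only: inner_commute mult.left_commute)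
      also have "\<dots> = F p * ft e g (fst p - snd p)" unfolding ft_def by simp
      finally show "(LINT y|lborel. K p y) = F p * gauss_kernel \<epsilon> (fst p - snd p)"
        unfolding g_def by (simp add: ft_gauss_scaled[OF \<epsilon> e])
    qed
    finally have eq: "(LINT y|lborel. of_real ((norm (ft e f y))\<^sup>2) * g y) = (LINT p|M. F p * gauss_kernel \<epsilon> (fst p - snd p))" .
    have gr: "of_real ((norm (ft e f y))\<^sup>2) * g y = of_real ((norm (ft e f y))\<^sup>2 * norm (g y))" for y
      by (simp add: g_def gauss_def)
    have I1: "integrable lborel (\<lambda>y. (norm (ft e f y))\<^sup>2 * norm (g y))"
    proof (rule Bochner_Integration.integrable_bound[OF integrable_mult_right[OF integrable_norm[OF g], of "(LINT x|lborel. norm (f x))\<^sup>2"]])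
      show "AE y in lborel. norm ((norm (ft e f y))\<^sup>2 * norm (g y)) \<le> norm ((LINT x|lborel. norm (f x))\<^sup>2 * norm (g y))"
        by (intro AE_I2) (simp, intro mult_right_mono power_mono norm_ft_le, auto)
    qed measurable
    have "(\<integral>\<^sup>+y. ennreal ((norm (ft e f y))\<^sup>2 * norm (g y)) \<partial>lborel) = ennreal (LINT y|lborel. (norm (ft e f y))\<^sup>2 * norm (g y))"
      by (intro nn_integral_eq_integral I1) auto
    also have "(LINT y|lborel. (norm (ft e f y))\<^sup>2 * norm (g y)) = norm (LINT p|M. F p * gauss_kernel \<epsilon> (fst p - snd p))"
    proof -
      have "(LINT y|lborel. (norm (ft e f y))\<^sup>2 * norm (g y)) \<ge> 0" by (intro Bochner_Integration.integral_nonneg) auto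
      then show ?thesis unfolding eq[symmetric] gr by (simp add: integral_complex_of_real del: of_real_mult)
    qed
    also have "ennreal \<dots> \<le> (\<integral>\<^sup>+p. ennreal (norm (F p * gauss_kernel \<epsilon> (fst p - snd p))) \<partial>M)"
    proof (rule integral_norm_bound_ennreal, rule Bochner_Integration.integrable_bound[OF integrable_mult_right[OF F, of "of_real (?c / \<epsilon> ^ DIM('a))"]])
      have kb: "norm (gauss_kernel \<epsilon> z) \<le> ?c / \<epsilon> ^ DIM('a)" for z :: 'a
        unfolding gauss_kernel_def norm_mult using gauss_mass_pos[where 'a='a] \<epsilon>
        by (simp add: norm_divide norm_power) (rule divide_right_mono, auto intro!: mult_right_le_one_le norm_gauss_le_1)
      show "AE p in M. norm (F p * gauss_kernel \<epsilon> (fst p - snd p)) \<le> norm (of_real (?c / \<epsilon> ^ DIM('a)) * F p)"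
      proof (rule AE_I2)
        fix p
        have "norm (F p) * norm (gauss_kernel \<epsilon> (fst p - snd p)) \<le> norm (F p) * (?c / \<epsilon> ^ DIM('a))"
          by (intro mult_left_mono kb) auto
        then show "norm (F p * gauss_kernel \<epsilon> (fst p - snd p)) \<le> norm (of_real (?c / \<epsilon> ^ DIM('a)) * F p)"
          using gauss_mass_pos[where 'a='a] \<epsilon> by (simp add: norm_mult norm_divide norm_power mult.commute)
      qed
    qed measurable
    also have "\<dots> \<le> (\<integral>\<^sup>+p. (ennreal ((norm (f (fst p)))\<^sup>2) * ennreal (norm (gauss_kernel \<epsilon> (fst p - snd p))) +
        ennreal ((norm (f (snd p)))\<^sup>2) * ennreal (norm (gauss_kernel \<epsilon> (fst p - snd p)))) / 2 \<partial>M)"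
    proof (intro nn_integral_mono)
      fix p
      let ?G = "norm (gauss_kernel \<epsilon> (fst p - snd p))" and ?a = "norm (f (fst p))" and ?b = "norm (f (snd p))"
      \<comment> \<open>Schur's test: each of the two squares is integrated against the kernel in the other variable\<close>
      have "?a * ?b \<le> (?a\<^sup>2 + ?b\<^sup>2) / 2" using sum_squares_bound[of ?a ?b] by simp
      then have "?a * ?b * ?G \<le> (?a\<^sup>2 + ?b\<^sup>2) / 2 * ?G" by (rule mult_right_mono) simp
      then have "ennreal (norm (F p * gauss_kernel \<epsilon> (fst p - snd p))) \<le> ennreal ((?a\<^sup>2 * ?G + ?b\<^sup>2 * ?G) / 2)"
        by (intro ennreal_leI) (simp add: F_def norm_mult algebra_simps)
      also have "\<dots> = (ennreal (?a\<^sup>2) * ennreal ?G + ennreal (?b\<^sup>2) * ennreal ?G) / 2"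
        by (simp add: ennreal_mult[symmetric] ennreal_plus[symmetric] divide_ennreal[symmetric] del: ennreal_plus)
      finally show "ennreal (norm (F p * gauss_kernel \<epsilon> (fst p - snd p))) \<le> (ennreal (?a\<^sup>2) * ennreal ?G + ennreal (?b\<^sup>2) * ennreal ?G) / 2" .
    qed
    also have "\<dots> = ((\<integral>\<^sup>+p. ennreal ((norm (f (fst p)))\<^sup>2) * ennreal (norm (gauss_kernel \<epsilon> (fst p - snd p))) \<partial>M) +
       (\<integral>\<^sup>+p. ennreal ((norm (f (snd p)))\<^sup>2) * ennreal (norm (gauss_kernel \<epsilon> (fst p - snd p))) \<partial>M)) / 2"
      unfolding divide_ennreal_def by (subst nn_integral_multc, measurable) (subst nn_integral_add, measurable)
    also have "(\<integral>\<^sup>+p. ennreal ((norm (f (fst p)))\<^sup>2) * ennreal (norm (gauss_kernel \<epsilon> (fst p - snd p))) \<partial>M) = ennreal (?c\<^sup>2) * ?N"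
    proof -
      have "(\<integral>\<^sup>+p. ennreal ((norm (f (fst p)))\<^sup>2) * ennreal (norm (gauss_kernel \<epsilon> (fst p - snd p))) \<partial>M) =
        (\<integral>\<^sup>+\<xi>. \<integral>\<^sup>+\<eta>. ennreal ((norm (f \<xi>))\<^sup>2) * ennreal (norm (gauss_kernel \<epsilon> (\<xi> - \<eta>))) \<partial>lborel \<partial>lborel)"
        unfolding M_def by (subst lborel.nn_integral_fst[symmetric]) auto
      also have "\<dots> = (\<integral>\<^sup>+\<xi>. ennreal ((norm (f \<xi>))\<^sup>2) * ennreal (?c\<^sup>2) \<partial>lborel)"
        by (simp add: nn_integral_cmult nn_integral_gauss_kernel[OF \<epsilon>])
      finally show ?thesis by (simp add: nn_integral_cmult nn_integral_multc mult.commute)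
    qed
    also have "(\<integral>\<^sup>+p. ennreal ((norm (f (snd p)))\<^sup>2) * ennreal (norm (gauss_kernel \<epsilon> (fst p - snd p))) \<partial>M) = ennreal (?c\<^sup>2) * ?N"
    proof -
      have ev: "gauss_kernel \<epsilon> (\<xi> - \<eta>) = gauss_kernel \<epsilon> (\<eta> - \<xi>)" for \<xi> \<eta> :: 'a
        unfolding gauss_kernel_def gauss_def by (simp add: norm_minus_commute)
      have "(\<integral>\<^sup>+p. ennreal ((norm (f (snd p)))\<^sup>2) * ennreal (norm (gauss_kernel \<epsilon> (fst p - snd p))) \<partial>M) =
        (\<integral>\<^sup>+\<eta>. \<integral>\<^sup>+\<xi>. ennreal ((norm (f \<eta>))\<^sup>2) * ennreal (norm (gauss_kernel \<epsilon> (\<xi> - \<eta>))) \<partial>lborel \<partial>lborel)"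
        unfolding M_def by (subst lborel_pair.nn_integral_snd[symmetric]) (auto simp: case_prod_beta')
      also have "\<dots> = (\<integral>\<^sup>+\<xi>. ennreal ((norm (f \<xi>))\<^sup>2) * ennreal (?c\<^sup>2) \<partial>lborel)"
      proof (intro nn_integral_cong)
        fix \<eta> :: 'a
        have "(\<integral>\<^sup>+\<xi>. ennreal (norm (gauss_kernel \<epsilon> (\<xi> - \<eta>))) \<partial>lborel) = ennreal (?c\<^sup>2)"
          using nn_integral_gauss_kernel[OF \<epsilon>, of \<eta>] by (simp add: ev[of \<eta>])
        then show "(\<integral>\<^sup>+\<xi>. ennreal ((norm (f \<eta>))\<^sup>2) * ennreal (norm (gauss_kernel \<epsilon> (\<xi> - \<eta>))) \<partial>lborel) =
            ennreal ((norm (f \<eta>))\<^sup>2) * ennreal (?c\<^sup>2)" by (simp add: nn_integral_cmult)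
      qed
      finally show ?thesis by (simp add: nn_integral_cmult nn_integral_multc mult.commute)
    qed
    also have "(ennreal (?c\<^sup>2) * ?N + ennreal (?c\<^sup>2) * ?N) / 2 = ennreal (?c\<^sup>2) * ?N"
      by (simp add: mult_2[symmetric] ennreal_mult_divide_eq mult.commute[of 2])
    finally show ?thesis unfolding g_def .
  qed
  define \<epsilon> where "\<epsilon> n = inverse (real (Suc n))" for n
  have "(\<integral>\<^sup>+y. ennreal ((norm (ft e f y))\<^sup>2) \<partial>lborel) =
      (\<integral>\<^sup>+y. liminf (\<lambda>n. ennreal ((norm (ft e f y))\<^sup>2 * norm (gauss (\<epsilon> n *\<^sub>R y)))) \<partial>lborel)"
  proof (intro nn_integral_cong)
    fix y
    have "(\<lambda>n. ennreal ((norm (ft e f y))\<^sup>2 * norm (gauss (\<epsilon> n *\<^sub>R y)))) \<longlonglongrightarrow> ennreal ((norm (ft e f y))\<^sup>2 * norm (1::complex))"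
      unfolding \<epsilon>_def by (intro tendsto_intros gauss_small_tendsto)
    from lim_imp_Liminf[OF sequentially_bot this]
    show "ennreal ((norm (ft e f y))\<^sup>2) = liminf (\<lambda>n. ennreal ((norm (ft e f y))\<^sup>2 * norm (gauss (\<epsilon> n *\<^sub>R y))))"
      by simp
  qed
  \<comment> \<open>Fatou's lemma removes the convergence factor\<close>
  also have "\<dots> \<le> liminf (\<lambda>n. \<integral>\<^sup>+y. ennreal ((norm (ft e f y))\<^sup>2 * norm (gauss (\<epsilon> n *\<^sub>R y))) \<partial>lborel)"
    by (rule nn_integral_liminf) measurable
  also have "\<dots> \<le> ennreal (?c\<^sup>2) * ?N"
    using bound by (intro order_trans[OF Liminf_le_Limsup Limsup_bounded]) (auto simp: \<epsilon>_def intro!: always_eventually)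
  finally show ?thesis .
qed

section \<open>Sobolev spaces on the Fourier side\<close>

definition weighted_L2 :: "real \<Rightarrow> ('a::euclidean_space \<Rightarrow> complex) \<Rightarrow> bool" where
  "weighted_L2 r f \<longleftrightarrow> f \<in> borel_measurable borel \<and>
     integrable lborel (\<lambda>\<xi>. (1 + (norm \<xi>)\<^sup>2) powr r * (norm (f \<xi>))\<^sup>2)"

definition weighted_norm_sq :: "real \<Rightarrow> ('a::euclidean_space \<Rightarrow> complex) \<Rightarrow> real" where
  "weighted_norm_sq r f = (LINT \<xi>|lborel. (1 + (norm \<xi>)\<^sup>2) powr r * (norm (f \<xi>))\<^sup>2)"

lemma weighted_norm_sq_nonneg: "0 \<le> weighted_norm_sq r f"
  unfolding weighted_norm_sq_def by (intro Bochner_Integration.integral_nonneg) auto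

lemma weighted_L2_measurable: "weighted_L2 r f \<Longrightarrow> f \<in> borel_measurable borel"
  by (simp add: weighted_L2_def)

lemma weighted_L2_bound:
  assumes "weighted_L2 r f" and [measurable]: "g \<in> borel_measurable borel"
    and le: "\<And>\<xi>. (1 + (norm \<xi>)\<^sup>2) powr q * (norm (g \<xi>))\<^sup>2 \<le> C * ((1 + (norm \<xi>)\<^sup>2) powr r * (norm (f \<xi>))\<^sup>2)"
  shows "weighted_L2 q g" "weighted_norm_sq q g \<le> C * weighted_norm_sq r f"
proof -
  have I: "integrable lborel (\<lambda>\<xi>. C * ((1 + (norm \<xi>)\<^sup>2) powr r * (norm (f \<xi>))\<^sup>2))"
    using assms(1) by (simp add: weighted_L2_def)
  have Ig: "integrable lborel (\<lambda>\<xi>. (1 + (norm \<xi>)\<^sup>2) powr q * (norm (g \<xi>))\<^sup>2)"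
  proof (rule Bochner_Integration.integrable_bound[OF I])
    show "AE \<xi> in lborel. norm ((1 + (norm \<xi>)\<^sup>2) powr q * (norm (g \<xi>))\<^sup>2) \<le> norm (C * ((1 + (norm \<xi>)\<^sup>2) powr r * (norm (f \<xi>))\<^sup>2))"
      by (intro AE_I2 order_trans[OF _ abs_ge_self, THEN order_trans[OF _ eq_refl[OF real_norm_def[symmetric]]]])
        (use le in simp)
  qed measurable
  then show "weighted_L2 q g" by (simp add: weighted_L2_def)
  show "weighted_norm_sq q g \<le> C * weighted_norm_sq r f"
    unfolding weighted_norm_sq_def integral_mult_right_zero[symmetric]
    by (intro integral_mono Ig I le)
qed

lemma weighted_L2_lincomb:
  assumes f: "weighted_L2 r f" and g: "weighted_L2 r g"
  shows "weighted_L2 r (\<lambda>\<xi>. a * f \<xi> + b * g \<xi>)"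
proof -
  have [measurable]: "f \<in> borel_measurable borel" "g \<in> borel_measurable borel"
    using f g by (auto simp: weighted_L2_def)
  have I: "integrable lborel (\<lambda>\<xi>. 2 * (norm a)\<^sup>2 * ((1 + (norm \<xi>)\<^sup>2) powr r * (norm (f \<xi>))\<^sup>2) +
      2 * (norm b)\<^sup>2 * ((1 + (norm \<xi>)\<^sup>2) powr r * (norm (g \<xi>))\<^sup>2))"
    using f g unfolding weighted_L2_def by (intro Bochner_Integration.integrable_add integrable_mult_right) auto
  have "integrable lborel (\<lambda>\<xi>. (1 + (norm \<xi>)\<^sup>2) powr r * (norm (a * f \<xi> + b * g \<xi>))\<^sup>2)"
  proof (rule Bochner_Integration.integrable_bound[OF I])
    show "AE \<xi> in lborel. norm ((1 + (norm \<xi>)\<^sup>2) powr r * (norm (a * f \<xi> + b * g \<xi>))\<^sup>2) \<le>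
      norm (2 * (norm a)\<^sup>2 * ((1 + (norm \<xi>)\<^sup>2) powr r * (norm (f \<xi>))\<^sup>2) +
      2 * (norm b)\<^sup>2 * ((1 + (norm \<xi>)\<^sup>2) powr r * (norm (g \<xi>))\<^sup>2))"
    proof (rule AE_I2)
      fix \<xi>
      let ?w = "(1 + (norm \<xi>)\<^sup>2) powr r" and ?x = "norm a * norm (f \<xi>)" and ?y = "norm b * norm (g \<xi>)"
      have "norm (a * f \<xi> + b * g \<xi>) \<le> ?x + ?y" by (rule norm_triangle_le) (simp add: norm_mult)
      then have "(norm (a * f \<xi> + b * g \<xi>))\<^sup>2 \<le> (?x + ?y)\<^sup>2" by (rule power_mono) simp
      also have "\<dots> \<le> 2 * ?x\<^sup>2 + 2 * ?y\<^sup>2" using sum_squares_bound[of ?x ?y] by (simp add: power2_sum)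
      finally have "?w * (norm (a * f \<xi> + b * g \<xi>))\<^sup>2 \<le> ?w * (2 * ?x\<^sup>2 + 2 * ?y\<^sup>2)" by (rule mult_left_mono) simp
      also have "\<dots> = 2 * (norm a)\<^sup>2 * (?w * (norm (f \<xi>))\<^sup>2) + 2 * (norm b)\<^sup>2 * (?w * (norm (g \<xi>))\<^sup>2)"
        by (simp add: algebra_simps power_mult_distrib)
      finally show "norm (?w * (norm (a * f \<xi> + b * g \<xi>))\<^sup>2) \<le> norm (2 * (norm a)\<^sup>2 * (?w * (norm (f \<xi>))\<^sup>2) + 2 * (norm b)\<^sup>2 * (?w * (norm (g \<xi>))\<^sup>2))"
        by simp
    qed
  qed measurable
  then show ?thesis by (simp add: weighted_L2_def)
qed

lemma weighted_L2_diff: "weighted_L2 r f \<Longrightarrow> weighted_L2 r g \<Longrightarrow> weighted_L2 r (\<lambda>\<xi>. f \<xi> - g \<xi>)"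
  using weighted_L2_lincomb[of r f g 1 "-1"] by simp

lemma weighted_L2_AE_cong:
  assumes "AE \<xi> in lborel. f \<xi> = g \<xi>" "f \<in> borel_measurable borel" "g \<in> borel_measurable borel"
  shows "weighted_L2 r f = weighted_L2 r g" "weighted_norm_sq r f = weighted_norm_sq r g"
proof -
  note [measurable] = assms(2,3)
  have *: "AE \<xi> in lborel. (1 + (norm \<xi>)\<^sup>2) powr r * (norm (f \<xi>))\<^sup>2 = (1 + (norm \<xi>)\<^sup>2) powr r * (norm (g \<xi>))\<^sup>2"
    using assms(1) by eventually_elim simp
  show "weighted_L2 r f = weighted_L2 r g"
    using assms integrable_cong_AE[OF _ _ *] by (simp add: weighted_L2_def)
  show "weighted_norm_sq r f = weighted_norm_sq r g"
    unfolding weighted_norm_sq_def by (rule integral_cong_AE[OF _ _ *]) auto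
qed

subsection \<open>Pairing with rapidly decreasing functions\<close>

definition weight_integral :: "'a::euclidean_space itself \<Rightarrow> real" where
  "weight_integral _ = (LINT x::'a|lborel. 1 / (1 + norm x) ^ (DIM('a) + 2))"

lemma weight_integral_nonneg: "weight_integral T \<ge> 0"
  unfolding weight_integral_def by (intro Bochner_Integration.integral_nonneg) auto

text \<open>Cauchy-Schwarz with the weight split between the two factors: \<open>k\<close> powers of the decay of \<open>\<psi>\<close> absorb
  the weight $(1+|x|^2)^{-r/2}$, and the remaining $n+2$ make the square integrable.\<close>

lemma weighted_L2_pairing:
  fixes f \<psi> :: "'a::euclidean_space \<Rightarrow> complex"
  assumes f: "weighted_L2 r f" and [measurable]: "\<psi> \<in> borel_measurable borel"
    and C: "\<And>x. (1 + norm x) ^ (k + DIM('a) + 2) * norm (\<psi> x) \<le> C" and k: "\<bar>r\<bar> \<le> real k"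
  shows "integrable lborel (\<lambda>x. f x * \<psi> x)"
    "norm (LINT x|lborel. f x * \<psi> x) \<le> sqrt (weighted_norm_sq r f) * (C * sqrt (weight_integral TYPE('a)))"
proof -
  let ?N = "DIM('a) + 2"
  have [measurable]: "f \<in> borel_measurable borel" using f by (simp add: weighted_L2_def)
  have C0: "C \<ge> 0" by (rule order_trans[OF _ C[of 0]]) simp
  define u v where "u x = (1 + (norm x)\<^sup>2) powr (r/2) * norm (f x)"
    and "v x = (1 + (norm x)\<^sup>2) powr (- r/2) * norm (\<psi> x)" for x
  have uv: "u x * v x = norm (f x * \<psi> x)" for x
  proof -
    have "(1 + (norm x)\<^sup>2) powr (r/2) * (1 + (norm x)\<^sup>2) powr (- r/2) = 1"
      using zero_le_power2[of "norm x"] by (subst powr_add[symmetric]) (simp add: add_nonneg_eq_0_iff)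
    then show ?thesis unfolding u_def v_def norm_mult by (metis mult.assoc mult.left_commute mult.left_neutral)
  qed
  have u2: "(u x)\<^sup>2 = (1 + (norm x)\<^sup>2) powr r * (norm (f x))\<^sup>2" for x
    unfolding u_def power_mult_distrib power2_eq_square[of "_ powr _"] powr_add[symmetric] by simp
  have v2: "(v x)\<^sup>2 \<le> C\<^sup>2 * (1 / (1 + norm x) ^ ?N)" for x
  proof -
    have p: "1 \<le> 1 + norm x" by simp
    have "(1 + (norm x)\<^sup>2) powr (- r/2) \<le> (1 + norm x) ^ k"
    proof -
      have "(1 + (norm x)\<^sup>2) powr (- r/2) \<le> (1 + (norm x)\<^sup>2) powr (real k / 2)"
        using k by (intro powr_mono) auto
      also have "\<dots> \<le> ((1 + norm x)\<^sup>2) powr (real k / 2)"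
        by (intro powr_mono2) (auto simp: power2_sum)
      also have "\<dots> = (1 + norm x) powr real k" 
      proof -
        have "(1 + norm x)\<^sup>2 = (1 + norm x) powr 2" by (simp add: add_pos_nonneg)
        then show ?thesis by (simp only: powr_powr) simp
      qed
      also have "\<dots> = (1 + norm x) ^ k" by (simp add: powr_realpow add_pos_nonneg)
      finally show ?thesis .
    qed
    then have "v x \<le> (1 + norm x) ^ k * norm (\<psi> x)" unfolding v_def by (rule mult_right_mono) simp
    then have "v x * (1 + norm x) ^ ?N \<le> (1 + norm x) ^ k * norm (\<psi> x) * (1 + norm x) ^ ?N"
      by (rule mult_right_mono) simp
    also have "\<dots> \<le> C" using C[of x] by (simp add: power_add mult_ac)
    finally have *: "v x * (1 + norm x) ^ ?N \<le> C" .
    have v0: "0 \<le> v x" by (simp add: v_def)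
    have P: "1 \<le> (1 + norm x) ^ ?N" using p by (rule one_le_power)
    have "(v x)\<^sup>2 * (1 + norm x) ^ ?N \<le> (v x * (1 + norm x) ^ ?N)\<^sup>2"
      using P v0 mult_left_mono[of 1 "(1 + norm x) ^ ?N" "(v x)\<^sup>2 * (1 + norm x) ^ ?N"]
      unfolding power_mult_distrib power2_eq_square[of "(1 + norm x) ^ ?N"] by (simp only: mult_1_right mult.assoc) force
    also have "\<dots> \<le> C\<^sup>2" using * v0 P by (intro power_mono mult_nonneg_nonneg) auto
    finally show ?thesis using P by (simp only: times_divide_eq_right mult_1_right) (subst pos_le_divide_eq, auto)
  qed
  have "(\<integral>\<^sup>+x. ennreal (norm (f x * \<psi> x)) \<partial>lborel)\<^sup>2 \<le> (\<integral>\<^sup>+x. (ennreal (u x))\<^sup>2 \<partial>lborel) * (\<integral>\<^sup>+x. (ennreal (v x))\<^sup>2 \<partial>lborel)"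
  proof -
    have [measurable]: "u \<in> borel_measurable borel" "v \<in> borel_measurable borel" unfolding u_def v_def by measurable
    have "(\<integral>\<^sup>+x. ennreal (norm (f x * \<psi> x)) \<partial>lborel) = (\<integral>\<^sup>+x. ennreal (u x) * ennreal (v x) \<partial>lborel)"
      unfolding uv[symmetric] by (intro nn_integral_cong ennreal_mult) (auto simp: u_def v_def)
    then show ?thesis using Cauchy_Schwarz_nn_integral[of "\<lambda>x. ennreal (u x)" lborel "\<lambda>x. ennreal (v x)"] by simp
  qed
  also have "(\<integral>\<^sup>+x. (ennreal (u x))\<^sup>2 \<partial>lborel) = ennreal (weighted_norm_sq r f)"
    using f unfolding weighted_norm_sq_def weighted_L2_def u2[symmetric]
    by (subst nn_integral_eq_integral[symmetric]) (auto simp: ennreal_power u_def)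
  also have "(\<integral>\<^sup>+x. (ennreal (v x))\<^sup>2 \<partial>lborel) \<le> (\<integral>\<^sup>+(x::'a). ennreal (C\<^sup>2 * (1 / (1 + norm x) ^ ?N)) \<partial>lborel)"
  proof (intro nn_integral_mono)
    fix x :: 'a
    show "(ennreal (v x))\<^sup>2 \<le> ennreal (C\<^sup>2 * (1 / (1 + norm x) ^ ?N))"
      using v2[of x] by (subst ennreal_power) (auto simp: v_def intro!: ennreal_leI)
  qed
  also have "(\<integral>\<^sup>+(x::'a). ennreal (C\<^sup>2 * (1 / (1 + norm x) ^ ?N)) \<partial>lborel) = ennreal (C\<^sup>2 * weight_integral TYPE('a))"
    unfolding weight_integral_def integral_mult_right_zero[symmetric]
    by (intro nn_integral_eq_integral integrable_mult_right integrable_weight) auto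
  finally have CS: "(\<integral>\<^sup>+x. ennreal (norm (f x * \<psi> x)) \<partial>lborel)\<^sup>2 \<le> ennreal (weighted_norm_sq r f * (C\<^sup>2 * weight_integral TYPE('a)))"
    by (subst ennreal_mult) (simp_all only: weighted_norm_sq_nonneg weight_integral_nonneg mult_nonneg_nonneg zero_le_power2 mult_left_mono zero_le)
  then have fin: "(\<integral>\<^sup>+x. ennreal (norm (f x * \<psi> x)) \<partial>lborel) < \<infinity>"
  proof -
    assume "(\<integral>\<^sup>+x. ennreal (norm (f x * \<psi> x)) \<partial>lborel)\<^sup>2 \<le> ennreal (weighted_norm_sq r f * (C\<^sup>2 * weight_integral TYPE('a)))"
    from order.strict_trans1[OF this ennreal_less_top] show ?thesis
      by (simp add: power_less_top_ennreal)
  qed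
  show I: "integrable lborel (\<lambda>x. f x * \<psi> x)" using fin by (intro integrableI_bounded) auto
  let ?J = "LINT x|lborel. norm (f x * \<psi> x)"
  have J: "(\<integral>\<^sup>+x. ennreal (norm (f x * \<psi> x)) \<partial>lborel) = ennreal ?J"
    by (intro nn_integral_eq_integral integrable_norm I) auto
  have J0: "?J \<ge> 0" by (intro Bochner_Integration.integral_nonneg) auto
  have "?J\<^sup>2 \<le> weighted_norm_sq r f * (C\<^sup>2 * weight_integral TYPE('a))"
    using CS J0 unfolding J by (simp add: ennreal_power ennreal_le_iff weighted_norm_sq_nonneg weight_integral_nonneg)
  then have "?J \<le> sqrt (weighted_norm_sq r f * (C\<^sup>2 * weight_integral TYPE('a)))"
    by (rule real_le_rsqrt)
  also have "\<dots> = sqrt (weighted_norm_sq r f) * (C * sqrt (weight_integral TYPE('a)))"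
    using C0 by (simp add: real_sqrt_mult)
  finally show "norm (LINT x|lborel. f x * \<psi> x) \<le> sqrt (weighted_norm_sq r f) * (C * sqrt (weight_integral TYPE('a)))"
    using integral_norm_bound[of lborel "\<lambda>x. f x * \<psi> x"] by linarith
qed

lemma schwartz_pairing_bound:
  fixes \<psi> :: "'a::euclidean_space \<Rightarrow> complex"
  assumes "\<psi> \<in> schwartz"
  obtains C where "\<And>f. weighted_L2 r f \<Longrightarrow> integrable lborel (\<lambda>x. f x * \<psi> x) \<and>
    norm (LINT x|lborel. f x * \<psi> x) \<le> sqrt (weighted_norm_sq r f) * C"
proof -
  obtain k where k: "\<bar>r\<bar> \<le> real k" using real_arch_simple by blast
  obtain C where "\<And>x. (1 + norm x) ^ (k + DIM('a) + 2) * norm (\<psi> x) \<le> C"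
    using schwartz_rapidly_decreasing[OF assms] unfolding rapidly_decreasing_def by metis
  from weighted_L2_pairing[OF _ schwartz_measurable[OF assms] this k] show ?thesis
    by (intro that[of "C * sqrt (weight_integral TYPE('a))"]) auto
qed

subsection \<open>Distributions with a given Fourier transform\<close>

lemma test_functions_mult:
  assumes "w \<in> test_functions \<Omega>" "smooth g"
  shows "(\<lambda>x. g x * w x) \<in> test_functions \<Omega>"
proof -
  have w: "smooth w" "compact (closure {x. w x \<noteq> 0})" "closure {x. w x \<noteq> 0} \<subseteq> \<Omega>"
    using assms(1) by (simp_all add: test_functions_def)
  have sub: "closure {x. g x * w x \<noteq> 0} \<subseteq> closure {x. w x \<noteq> 0}" by (rule closure_mono) auto
  have "compact (closure {x. g x * w x \<noteq> 0})"
    using compact_Int_closed[OF w(2) closed_closure[of "{x. g x * w x \<noteq> 0}"]] sub by (simp add: inf.absorb2)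
  then show ?thesis using sub w(3) smooth_mult[OF assms(2) w(1)] unfolding test_functions_def by blast
qed

text \<open>The Gaussian factor makes an arbitrary function that pairs with all Schwartz functions
  integrable.\<close>

lemma AE_eq_if_test_functions:
  fixes f g :: "'a::euclidean_space \<Rightarrow> complex"
  assumes f: "\<And>\<psi>. \<psi> \<in> schwartz \<Longrightarrow> integrable lborel (\<lambda>\<xi>. f \<xi> * \<psi> \<xi>)"
    and g: "\<And>\<psi>. \<psi> \<in> schwartz \<Longrightarrow> integrable lborel (\<lambda>\<xi>. g \<xi> * \<psi> \<xi>)"
    and eq: "\<And>\<psi>. \<psi> \<in> test_functions UNIV \<Longrightarrow> (LINT \<xi>|lborel. f \<xi> * \<psi> \<xi>) = (LINT \<xi>|lborel. g \<xi> * \<psi> \<xi>)"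
  shows "AE \<xi> in lborel. f \<xi> = g \<xi>"
proof -
  have I: "integrable lborel (\<lambda>\<xi>. (f \<xi> - g \<xi>) * \<psi> \<xi>)" if "\<psi> \<in> schwartz" for \<psi>
    unfolding left_diff_distrib using f[OF that] g[OF that] by simp
  have "AE \<xi> in lborel. \<xi> \<in> UNIV \<longrightarrow> (f \<xi> - g \<xi>) * gauss \<xi> = 0"
  proof (rule AE_0_if_test_functions)
    show "set_integrable lborel (cbox a b) (\<lambda>\<xi>. (f \<xi> - g \<xi>) * gauss \<xi>)" for a b
      unfolding set_integrable_def by (intro integrable_mult_indicator I gauss_schwartz) auto
    fix w :: "'a \<Rightarrow> complex" assume "w \<in> test_functions UNIV"
    then have w: "(\<lambda>x. gauss x * w x) \<in> test_functions UNIV" by (intro test_functions_mult smooth_gauss)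
    have "(LINT \<xi>:UNIV|lborel. (f \<xi> - g \<xi>) * gauss \<xi> * w \<xi>) =
        (LINT \<xi>|lborel. f \<xi> * (gauss \<xi> * w \<xi>) - g \<xi> * (gauss \<xi> * w \<xi>))"
      by (simp add: set_lebesgue_integral_def algebra_simps)
    also have "\<dots> = 0"
      using f[OF test_functions_schwartz[OF w]] g[OF test_functions_schwartz[OF w]] eq[OF w] by simp
    finally show "(LINT \<xi>:UNIV|lborel. (f \<xi> - g \<xi>) * gauss \<xi> * w \<xi>) = 0" .
  qed auto
  then show ?thesis by eventually_elim (simp add: gauss_def)
qed

lemma is_fourier_AE_unique:
  assumes "is_fourier T f" "is_fourier T g"
  shows "AE \<xi> in lborel. f \<xi> = g \<xi>"
  using assms by (intro AE_eq_if_test_functions) (auto simp: is_fourier_def test_functions_schwartz)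

lemma fourier_surj:
  fixes \<psi> :: "'a::euclidean_space \<Rightarrow> complex"
  assumes "\<psi> \<in> schwartz"
  obtains \<zeta> where "\<zeta> \<in> schwartz" "\<psi> = fourier \<zeta>"
proof -
  define \<zeta> where "\<zeta> \<xi> = of_real (1 / (gauss_mass TYPE('a))\<^sup>2) * ft 1 \<psi> \<xi>" for \<xi>
  have "fourier \<zeta> x = \<psi> x" for x
    unfolding fourier_eq_ft \<zeta>_def ft_cmult using ft_inversion[OF assms, of 1] gauss_mass_pos[where 'a='a] by simp
  moreover have "\<zeta> \<in> schwartz" unfolding \<zeta>_def by (intro schwartz_cmult schwartz_ft assms) auto
  ultimately show ?thesis using that by (metis ext)
qed

text \<open>Every Schwartz function is a Fourier transform, so a tempered distribution is determined by its own.\<close>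

lemma tempered_eqI:
  assumes "S \<in> tempered" "T \<in> tempered" "is_fourier S f" "is_fourier T g" "AE \<xi> in lborel. f \<xi> = g \<xi>"
  shows "S = T"
proof
  fix \<psi>
  show "S \<psi> = T \<psi>"
  proof (cases "\<psi> \<in> schwartz")
    case True
    then obtain \<zeta> where \<zeta>: "\<zeta> \<in> schwartz" "\<psi> = fourier \<zeta>" by (rule fourier_surj)
    have [measurable]: "f \<in> borel_measurable borel" "g \<in> borel_measurable borel" "\<zeta> \<in> borel_measurable borel"
      using assms \<zeta> by (auto simp: is_fourier_def schwartz_measurable)
    have "AE \<xi> in lborel. f \<xi> * \<zeta> \<xi> = g \<xi> * \<zeta> \<xi>" using assms(5) by eventually_elim simp
    then have "(LINT \<xi>|lborel. f \<xi> * \<zeta> \<xi>) = (LINT \<xi>|lborel. g \<xi> * \<zeta> \<xi>)"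
      by (intro integral_cong_AE) auto
    then show ?thesis using assms \<zeta> by (simp add: is_fourier_def)
  qed (use assms in \<open>auto simp: tempered_def\<close>)
qed

text \<open>The inverse transform of \<open>f\<close>, applied to \<open>\<psi>\<close> by duality; the factor is $(2\pi)^{-n}$.\<close>

definition fourier_distr :: "('a::euclidean_space \<Rightarrow> complex) \<Rightarrow> 'a distr" where
  "fourier_distr f = (\<lambda>\<psi>. if \<psi> \<in> schwartz
     then of_real (1 / (gauss_mass TYPE('a))\<^sup>2) * (LINT \<xi>|lborel. f \<xi> * ft 1 \<psi> \<xi>) else 0)"

lemma is_fourier_fourier_distr:
  fixes f :: "'a::euclidean_space \<Rightarrow> complex"
  assumes f: "weighted_L2 r f"
  shows "is_fourier (fourier_distr f) f"
  unfolding is_fourier_def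
proof (intro conjI ballI)
  show "f \<in> borel_measurable borel" using f by (rule weighted_L2_measurable)
  fix \<psi> :: "'a \<Rightarrow> complex" assume \<psi>: "\<psi> \<in> schwartz"
  show "integrable lborel (\<lambda>\<xi>. f \<xi> * \<psi> \<xi>)" using schwartz_pairing_bound[OF \<psi>] f by metis
  have "ft 1 (ft (-1) \<psi>) \<xi> = of_real ((gauss_mass TYPE('a))\<^sup>2) * \<psi> \<xi>" for \<xi>
    using ft_inversion[OF \<psi>, of "-1"] by simp
  then have "(LINT \<xi>|lborel. f \<xi> * ft 1 (ft (-1) \<psi>) \<xi>) = (LINT \<xi>|lborel. of_real ((gauss_mass TYPE('a))\<^sup>2) * (f \<xi> * \<psi> \<xi>))"
    by (simp add: mult.left_commute)
  then show "fourier_distr f (fourier \<psi>) = (LINT \<xi>|lborel. f \<xi> * \<psi> \<xi>)"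
    using \<psi> gauss_mass_pos[where 'a='a] by (simp add: fourier_distr_def fourier_eq_ft schwartz_ft)
qed

lemma tempered_fourier_distr:
  fixes f :: "'a::euclidean_space \<Rightarrow> complex"
  assumes f: "weighted_L2 r f"
  shows "fourier_distr f \<in> tempered"
  unfolding tempered_def
proof (intro CollectI conjI allI impI ballI)
  have I: "integrable lborel (\<lambda>\<xi>. f \<xi> * ft 1 \<psi> \<xi>)" if "\<psi> \<in> schwartz" for \<psi>
    using schwartz_pairing_bound[OF schwartz_ft[OF that, of 1]] f by (metis abs_one)
  fix \<psi> \<eta> :: "'a \<Rightarrow> complex" and a b
  assume *: "\<psi> \<in> schwartz" "\<eta> \<in> schwartz"
  have "ft 1 (\<lambda>x. a * \<psi> x + b * \<eta> x) \<xi> = a * ft 1 \<psi> \<xi> + b * ft 1 \<eta> \<xi>" for \<xi>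
    using * by (simp add: ft_add ft_cmult schwartz_integrable)
  then have "(LINT \<xi>|lborel. f \<xi> * ft 1 (\<lambda>x. a * \<psi> x + b * \<eta> x) \<xi>) =
      (LINT \<xi>|lborel. a * (f \<xi> * ft 1 \<psi> \<xi>) + b * (f \<xi> * ft 1 \<eta> \<xi>))"
    by (simp add: algebra_simps)
  also have "\<dots> = a * (LINT \<xi>|lborel. f \<xi> * ft 1 \<psi> \<xi>) + b * (LINT \<xi>|lborel. f \<xi> * ft 1 \<eta> \<xi>)"
    using I * by simp
  finally show "fourier_distr f (\<lambda>x. a * \<psi> x + b * \<eta> x) = a * fourier_distr f \<psi> + b * fourier_distr f \<eta>"
    using * by (simp add: fourier_distr_def schwartz_add schwartz_cmult algebra_simps)
next
  fix X :: "nat \<Rightarrow> 'a \<Rightarrow> complex" assume X: "schwartz_null_seq X"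
  then have S: "X n \<in> schwartz" for n by (simp add: schwartz_null_seq_def)
  obtain k where k: "\<bar>r\<bar> \<le> real k" using real_arch_simple by blast
  define A where "A = 1 / (gauss_mass TYPE('a))\<^sup>2"
  define D where "D = A * (sqrt (weighted_norm_sq r f) * sqrt (weight_integral TYPE('a))) + 1"
  have A: "A \<ge> 0" by (simp add: A_def)
  have D: "D > 0" unfolding D_def
    by (intro add_nonneg_pos mult_nonneg_nonneg A) (auto simp: weighted_norm_sq_nonneg weight_integral_nonneg)
  show "(\<lambda>n. fourier_distr f (X n)) \<longlonglongrightarrow> 0"
  proof (rule tendstoI)
    fix e :: real assume "e > 0"
    then have "e / D / 2 > 0" using D by simp
    then have "\<forall>\<^sub>F n in sequentially. \<forall>x. (1 + norm x) ^ (k + DIM('a) + 2) * norm (ft 1 (X n) x) \<le> e / D / 2"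
      using weighted_null_ft[OF X abs_one, of "k + DIM('a) + 2"] unfolding weighted_null_def by blast
    then show "\<forall>\<^sub>F n in sequentially. dist (fourier_distr f (X n)) 0 < e"
    proof eventually_elim
      case (elim n)
      have "norm (LINT \<xi>|lborel. f \<xi> * ft 1 (X n) \<xi>) \<le> sqrt (weighted_norm_sq r f) * (e / D / 2 * sqrt (weight_integral TYPE('a)))"
        using elim by (intro weighted_L2_pairing(2)[OF f _ _ k] schwartz_measurable schwartz_ft S) auto
      then have "A * norm (LINT \<xi>|lborel. f \<xi> * ft 1 (X n) \<xi>) \<le> A * (sqrt (weighted_norm_sq r f) * (e / D / 2 * sqrt (weight_integral TYPE('a))))"
        using A by (rule mult_left_mono)
      also have "\<dots> = (D - 1) * (e / D / 2)" by (simp add: D_def)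
      also have "\<dots> < D * (e / D)" using D \<open>e > 0\<close> by (intro mult_strict_mono') (auto simp: field_simps, (simp add: D_def A weighted_norm_sq_nonneg weight_integral_nonneg)?)
      finally show ?case using D S[of n] by (simp add: fourier_distr_def A_def norm_mult norm_divide norm_power)
    qed
  qed
qed (simp add: fourier_distr_def)

subsection \<open>Membership, norm and convergence\<close>

lemma sobolevI:
  assumes "T \<in> tempered" "is_fourier T f" "weighted_L2 r f"
  shows "T \<in> sobolev r" "AE \<xi> in lborel. fhat T \<xi> = f \<xi>" "sobolev_norm r T = sqrt (weighted_norm_sq r f)"
proof -
  show "T \<in> sobolev r" using assms by (auto simp: sobolev_def weighted_L2_def)
  have F: "is_fourier T (fhat T)" unfolding fhat_def by (rule someI[of "is_fourier T", OF assms(2)])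
  then show AE: "AE \<xi> in lborel. fhat T \<xi> = f \<xi>" using assms(2) by (rule is_fourier_AE_unique)
  show "sobolev_norm r T = sqrt (weighted_norm_sq r f)"
    using weighted_L2_AE_cong(2)[OF AE] F assms(2)
    by (simp add: sobolev_norm_def weighted_norm_sq_def is_fourier_def)
qed

lemma sobolevD:
  assumes "T \<in> sobolev r"
  shows "T \<in> tempered" "is_fourier T (fhat T)" "weighted_L2 r (fhat T)"
    "sobolev_norm r T = sqrt (weighted_norm_sq r (fhat T))"
proof -
  obtain f where f: "T \<in> tempered" "is_fourier T f" "weighted_L2 r f"
    using assms by (auto simp: sobolev_def weighted_L2_def is_fourier_def)
  then show "T \<in> tempered" by simp
  show F: "is_fourier T (fhat T)" unfolding fhat_def by (rule someI[of "is_fourier T", OF f(2)])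
  show "weighted_L2 r (fhat T)"
    using weighted_L2_AE_cong(1)[OF sobolevI(2)[OF f]] F f(2,3) by (simp add: is_fourier_def)
  show "sobolev_norm r T = sqrt (weighted_norm_sq r (fhat T))"
    by (simp add: sobolev_norm_def weighted_norm_sq_def)
qed

lemma sobolev_fourier_distr:
  assumes "weighted_L2 r f"
  shows "fourier_distr f \<in> sobolev r" "AE \<xi> in lborel. fhat (fourier_distr f) \<xi> = f \<xi>"
    "sobolev_norm r (fourier_distr f) = sqrt (weighted_norm_sq r f)"
  using sobolevI[OF tempered_fourier_distr[OF assms] is_fourier_fourier_distr[OF assms] assms] by auto

lemma tempered_eq_fourier_distr:
  assumes "T \<in> tempered" "is_fourier T f" "weighted_L2 r f"
  shows "T = fourier_distr f"
  by (rule tempered_eqI[OF assms(1) tempered_fourier_distr[OF assms(3)] assms(2) is_fourier_fourier_distr[OF assms(3)]]) simp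

lemma fourier_distr_AE_cong:
  assumes "AE \<xi> in lborel. f \<xi> = g \<xi>" "weighted_L2 r f" "weighted_L2 q g"
  shows "fourier_distr f = fourier_distr g"
  using tempered_eqI tempered_fourier_distr is_fourier_fourier_distr assms by blast

lemma fourier_distr_lincomb:
  fixes f g :: "'a::euclidean_space \<Rightarrow> complex"
  assumes f: "weighted_L2 r f" and g: "weighted_L2 r g"
  shows "fourier_distr (\<lambda>\<xi>. a * f \<xi> + b * g \<xi>) = (\<lambda>\<psi>. a * fourier_distr f \<psi> + b * fourier_distr g \<psi>)"
proof
  fix \<psi> :: "'a \<Rightarrow> complex"
  show "fourier_distr (\<lambda>\<xi>. a * f \<xi> + b * g \<xi>) \<psi> = a * fourier_distr f \<psi> + b * fourier_distr g \<psi>"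
  proof (cases "\<psi> \<in> schwartz")
    case True
    have I: "integrable lborel (\<lambda>\<xi>. h \<xi> * ft 1 \<psi> \<xi>)" if "weighted_L2 r h" for h
      using schwartz_pairing_bound[OF schwartz_ft[OF True, of 1]] that by (metis abs_one)
    have "(LINT \<xi>|lborel. (a * f \<xi> + b * g \<xi>) * ft 1 \<psi> \<xi>) =
       (LINT \<xi>|lborel. a * (f \<xi> * ft 1 \<psi> \<xi>) + b * (g \<xi> * ft 1 \<psi> \<xi>))"
      by (simp add: algebra_simps)
    also have "\<dots> = a * (LINT \<xi>|lborel. f \<xi> * ft 1 \<psi> \<xi>) + b * (LINT \<xi>|lborel. g \<xi> * ft 1 \<psi> \<xi>)"
      using I[OF f] I[OF g] by simp
    finally show ?thesis using True by (simp add: fourier_distr_def algebra_simps)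
  qed (simp add: fourier_distr_def)
qed

lemma fourier_distr_0: "fourier_distr (\<lambda>_. 0) = (\<lambda>_. 0)"
  by (rule ext) (simp add: fourier_distr_def)

lemma weighted_L2_0: "weighted_L2 r (\<lambda>_. 0)" "weighted_norm_sq r (\<lambda>_. 0) = 0"
  by (simp_all add: weighted_L2_def weighted_norm_sq_def)

lemma sobolev_eq_fourier_distr: "T \<in> sobolev r \<Longrightarrow> T = fourier_distr (fhat T)"
  by (rule tempered_eq_fourier_distr) (auto dest: sobolevD)

lemma sobolev_lincomb:
  assumes S: "S \<in> sobolev r" and T: "T \<in> sobolev r"
  shows "(\<lambda>\<psi>. a * S \<psi> + b * T \<psi>) \<in> sobolev r"
    and "AE \<xi> in lborel. fhat (\<lambda>\<psi>. a * S \<psi> + b * T \<psi>) \<xi> = a * fhat S \<xi> + b * fhat T \<xi>"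
proof -
  have eq: "(\<lambda>\<psi>. a * S \<psi> + b * T \<psi>) = fourier_distr (\<lambda>\<xi>. a * fhat S \<xi> + b * fhat T \<xi>)"
    unfolding fourier_distr_lincomb[OF sobolevD(3)[OF S] sobolevD(3)[OF T]]
    by (rule ext) (use sobolev_eq_fourier_distr[OF S] sobolev_eq_fourier_distr[OF T] in metis)
  have "weighted_L2 r (\<lambda>\<xi>. a * fhat S \<xi> + b * fhat T \<xi>)"
    by (intro weighted_L2_lincomb sobolevD(3) S T)
  from sobolev_fourier_distr[OF this] show "(\<lambda>\<psi>. a * S \<psi> + b * T \<psi>) \<in> sobolev r"
    "AE \<xi> in lborel. fhat (\<lambda>\<psi>. a * S \<psi> + b * T \<psi>) \<xi> = a * fhat S \<xi> + b * fhat T \<xi>"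
    unfolding eq by auto
qed

lemma fourier_distr_converges:
  assumes lim: "(\<lambda>n. weighted_norm_sq r (\<lambda>\<xi>. g n \<xi> - g' \<xi>)) \<longlonglongrightarrow> 0" and g: "\<And>n. weighted_L2 r (g n)" "weighted_L2 r g'"
  shows "(\<lambda>n. sobolev_norm r (\<lambda>\<psi>. fourier_distr (g n) \<psi> - fourier_distr g' \<psi>)) \<longlonglongrightarrow> 0"
proof -
  have "sobolev_norm r (\<lambda>\<psi>. fourier_distr (g n) \<psi> - fourier_distr g' \<psi>) = sqrt (weighted_norm_sq r (\<lambda>\<xi>. g n \<xi> - g' \<xi>))" for n
    using fourier_distr_lincomb[OF g(1)[of n] g(2), of 1 "-1"] sobolev_fourier_distr(3)[OF weighted_L2_diff[OF g(1)[of n] g(2)]] by simp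
  then show ?thesis using tendsto_real_sqrt[OF lim] by simp
qed

lemma fourier_multiplier_eq:
  assumes "weighted_L2 r (\<lambda>\<xi>. a \<xi> * fhat T \<xi>)"
  shows "fourier_multiplier a T = fourier_distr (\<lambda>\<xi>. a \<xi> * fhat T \<xi>)"
  unfolding fourier_multiplier_def
proof (rule the_equality)
  show "fourier_distr (\<lambda>\<xi>. a \<xi> * fhat T \<xi>) \<in> tempered \<and> is_fourier (fourier_distr (\<lambda>\<xi>. a \<xi> * fhat T \<xi>)) (\<lambda>\<xi>. a \<xi> * fhat T \<xi>)"
    using assms by (simp add: tempered_fourier_distr is_fourier_fourier_distr)
qed (use assms in \<open>auto intro: tempered_eq_fourier_distr\<close>)

text \<open>Pairing with a Schwartz function is a bounded functional in every Sobolev norm.\<close>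

lemma sobolev_convergence:
  fixes \<psi> :: "'a::euclidean_space \<Rightarrow> complex"
  assumes T: "\<And>n. T n \<in> sobolev r" and S: "S \<in> sobolev r"
    and lim: "(\<lambda>n. sobolev_norm r (\<lambda>\<psi>. T n \<psi> - S \<psi>)) \<longlonglongrightarrow> 0" and \<psi>: "\<psi> \<in> schwartz"
  shows "(\<lambda>n. T n \<psi>) \<longlonglongrightarrow> S \<psi>"
proof -
  let ?c = "complex_of_real (1 / (gauss_mass TYPE('a))\<^sup>2)"
  obtain C where C: "\<And>f. weighted_L2 r f \<Longrightarrow> integrable lborel (\<lambda>x. f x * ft 1 \<psi> x) \<and>
      norm (LINT x|lborel. f x * ft 1 \<psi> x) \<le> sqrt (weighted_norm_sq r f) * C"
    using schwartz_pairing_bound[OF schwartz_ft[OF \<psi>, of 1]] by (metis abs_one)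
  have A: "norm (T n \<psi> - S \<psi>) \<le> norm ?c * (sobolev_norm r (\<lambda>\<psi>. T n \<psi> - S \<psi>) * C)" for n
  proof -
    have D: "(\<lambda>\<psi>. T n \<psi> - S \<psi>) \<in> sobolev r" using sobolev_lincomb(1)[OF T S, of 1 n "-1"] by simp
    have "T n \<psi> - S \<psi> = ?c * (LINT x|lborel. fhat (\<lambda>\<psi>. T n \<psi> - S \<psi>) x * ft 1 \<psi> x)"
      using fun_cong[OF sobolev_eq_fourier_distr[OF D], of \<psi>] \<psi> unfolding fourier_distr_def by (simp only: if_True)
    then have "norm (T n \<psi> - S \<psi>) = norm ?c * norm (LINT x|lborel. fhat (\<lambda>\<psi>. T n \<psi> - S \<psi>) x * ft 1 \<psi> x)"
      by (simp only: norm_mult)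
    also have "\<dots> \<le> norm ?c * (sobolev_norm r (\<lambda>\<psi>. T n \<psi> - S \<psi>) * C)"
      using C[OF sobolevD(3)[OF D]] unfolding sobolevD(4)[OF D] by (intro mult_left_mono) auto
    finally show ?thesis .
  qed
  have B: "(\<lambda>n. norm ?c * (sobolev_norm r (\<lambda>\<psi>. T n \<psi> - S \<psi>) * C)) \<longlonglongrightarrow> norm ?c * (0 * C)"
    by (intro tendsto_intros lim)
  have "(\<lambda>n. T n \<psi> - S \<psi>) \<longlonglongrightarrow> 0"
    by (rule Lim_null_comparison[OF always_eventually[OF allI[OF A]] B[unfolded mult_zero_left mult_zero_right]])
  then show ?thesis by (rule LIM_zero_cancel)
qed

section \<open>Square integrable functions and weak derivatives\<close>

definition L2_sq :: "'a::euclidean_space set \<Rightarrow> ('a \<Rightarrow> complex) \<Rightarrow> real" where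
  "L2_sq \<Omega> v = (LINT x:\<Omega>|lborel. (norm (v x))\<^sup>2)"

lemma square_integrable_iff:
  "square_integrable \<Omega> v \<longleftrightarrow> (\<lambda>x. indicator \<Omega> x *\<^sub>R v x) \<in> borel_measurable borel \<and>
     integrable lborel (\<lambda>x. (norm (indicator \<Omega> x *\<^sub>R v x))\<^sup>2)"
proof -
  have "indicator \<Omega> x *\<^sub>R (norm (v x))\<^sup>2 = (norm (indicator \<Omega> x *\<^sub>R v x))\<^sup>2" for x
    by (simp add: indicator_def)
  then show ?thesis
    by (simp add: square_integrable_def set_borel_measurable_def set_integrable_def)
qed

lemma L2_sq_eq: "L2_sq \<Omega> v = (LINT x|lborel. (norm (indicator \<Omega> x *\<^sub>R v x))\<^sup>2)"
  unfolding L2_sq_def set_lebesgue_integral_def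
  by (intro Bochner_Integration.integral_cong) (auto simp: indicator_def)

lemma L2_sq_nonneg: "0 \<le> L2_sq \<Omega> v"
  unfolding L2_sq_eq by (intro Bochner_Integration.integral_nonneg) auto

lemma nn_integral_L2_sq:
  assumes "square_integrable \<Omega> v"
  shows "(\<integral>\<^sup>+x. ennreal ((norm (indicator \<Omega> x *\<^sub>R v x))\<^sup>2) \<partial>lborel) = ennreal (L2_sq \<Omega> v)"
  using assms unfolding L2_sq_eq square_integrable_iff by (intro nn_integral_eq_integral) auto

lemma square_integrableI_nn:
  assumes [measurable]: "(\<lambda>x. indicator \<Omega> x *\<^sub>R v x) \<in> borel_measurable borel"
    and le: "(\<integral>\<^sup>+x. ennreal ((norm (indicator \<Omega> x *\<^sub>R v x))\<^sup>2) \<partial>lborel) \<le> ennreal C" and "C \<ge> 0"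
  shows "square_integrable \<Omega> v" "L2_sq \<Omega> v \<le> C"
proof -
  show v: "square_integrable \<Omega> v" unfolding square_integrable_iff
  proof (intro conjI integrableI_bounded)
    have "(\<integral>\<^sup>+x. ennreal (norm ((norm (indicator \<Omega> x *\<^sub>R v x))\<^sup>2)) \<partial>lborel) =
        (\<integral>\<^sup>+x. ennreal ((norm (indicator \<Omega> x *\<^sub>R v x))\<^sup>2) \<partial>lborel)"
      by (simp only: real_norm_def abs_power2)
    with le show "(\<integral>\<^sup>+x. ennreal (norm ((norm (indicator \<Omega> x *\<^sub>R v x))\<^sup>2)) \<partial>lborel) < \<infinity>"
      by (simp only: order.strict_trans1[OF _ ennreal_less_top] infinity_ennreal_def)
  qed (use assms(1) in measurable)
  show "L2_sq \<Omega> v \<le> C"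
    using le nn_integral_L2_sq[OF v] \<open>C \<ge> 0\<close> by (simp add: ennreal_le_iff)
qed

lemma square_integrable_lincomb:
  assumes "square_integrable \<Omega> u" "square_integrable \<Omega> v"
  shows "square_integrable \<Omega> (\<lambda>x. a * u x + b * v x)"
proof -
  let ?u = "\<lambda>x. indicator \<Omega> x *\<^sub>R u x" and ?v = "\<lambda>x. indicator \<Omega> x *\<^sub>R v x"
  have [measurable]: "?u \<in> borel_measurable borel" "?v \<in> borel_measurable borel"
    and I: "integrable lborel (\<lambda>x. (norm (?u x))\<^sup>2)" "integrable lborel (\<lambda>x. (norm (?v x))\<^sup>2)"
    using assms by (auto simp: square_integrable_iff)
  have eq: "indicator \<Omega> x *\<^sub>R (a * u x + b * v x) = a * ?u x + b * ?v x" for x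
    by (simp add: indicator_def)
  have M: "(\<lambda>x. a * ?u x + b * ?v x) \<in> borel_measurable borel" by measurable
  have S: "integrable lborel (\<lambda>x. (norm (a * ?u x + b * ?v x))\<^sup>2)"
  proof (rule Bochner_Integration.integrable_bound)
    show "integrable lborel (\<lambda>x. 2 * (norm a)\<^sup>2 * (norm (?u x))\<^sup>2 + 2 * (norm b)\<^sup>2 * (norm (?v x))\<^sup>2)"
      by (intro Bochner_Integration.integrable_add integrable_mult_right I)
    show "AE x in lborel. norm ((norm (a * ?u x + b * ?v x))\<^sup>2) \<le>
        norm (2 * (norm a)\<^sup>2 * (norm (?u x))\<^sup>2 + 2 * (norm b)\<^sup>2 * (norm (?v x))\<^sup>2)"
    proof (rule AE_I2)
      fix x
      let ?x = "norm a * norm (?u x)" and ?y = "norm b * norm (?v x)"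
      have "norm (a * ?u x + b * ?v x) \<le> ?x + ?y" by (rule norm_triangle_le) (simp add: norm_mult)
      then have "(norm (a * ?u x + b * ?v x))\<^sup>2 \<le> (?x + ?y)\<^sup>2" by (rule power_mono) simp
      also have "\<dots> \<le> 2 * ?x\<^sup>2 + 2 * ?y\<^sup>2" using sum_squares_bound[of ?x ?y] unfolding power2_sum by linarith
      finally show "norm ((norm (a * ?u x + b * ?v x))\<^sup>2) \<le> norm (2 * (norm a)\<^sup>2 * (norm (?u x))\<^sup>2 + 2 * (norm b)\<^sup>2 * (norm (?v x))\<^sup>2)"
        unfolding power_mult_distrib real_norm_def by (simp add: mult.assoc)
    qed
  qed measurable
  show ?thesis unfolding square_integrable_iff eq by (intro conjI M S)
qed

lemma square_integrable_diff:
  "square_integrable \<Omega> u \<Longrightarrow> square_integrable \<Omega> v \<Longrightarrow> square_integrable \<Omega> (\<lambda>x. u x - v x)"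
  using square_integrable_lincomb[of \<Omega> u v 1 "-1"] by simp

lemma square_integrable_bounded_mult:
  assumes v: "square_integrable \<Omega> v" and g[measurable]: "(\<lambda>x. indicator \<Omega> x *\<^sub>R g x) \<in> borel_measurable borel"
    and B: "\<And>x. x \<in> \<Omega> \<Longrightarrow> norm (g x) \<le> B"
  shows "square_integrable \<Omega> (\<lambda>x. g x * v x)"
proof -
  let ?v = "\<lambda>x. indicator \<Omega> x *\<^sub>R v x" and ?g = "\<lambda>x. indicator \<Omega> x *\<^sub>R g x"
  have [measurable]: "?v \<in> borel_measurable borel" and I: "integrable lborel (\<lambda>x. (norm (?v x))\<^sup>2)"
    using v by (auto simp: square_integrable_iff)
  have eq: "indicator \<Omega> x *\<^sub>R (g x * v x) = ?g x * ?v x" for x by (simp add: indicator_def)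
  have M: "(\<lambda>x. ?g x * ?v x) \<in> borel_measurable borel" by measurable
  have S: "integrable lborel (\<lambda>x. (norm (?g x * ?v x))\<^sup>2)"
  proof (rule Bochner_Integration.integrable_bound)
    show "integrable lborel (\<lambda>x. B\<^sup>2 * (norm (?v x))\<^sup>2)" by (intro integrable_mult_right I)
    show "AE x in lborel. norm ((norm (?g x * ?v x))\<^sup>2) \<le> norm (B\<^sup>2 * (norm (?v x))\<^sup>2)"
    proof (rule AE_I2)
      fix x
      have "(norm (?g x))\<^sup>2 * (norm (?v x))\<^sup>2 \<le> B\<^sup>2 * (norm (?v x))\<^sup>2"
        using B[of x] by (intro mult_right_mono) (auto simp: indicator_def intro: power_mono)
      then show "norm ((norm (?g x * ?v x))\<^sup>2) \<le> norm (B\<^sup>2 * (norm (?v x))\<^sup>2)"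
        by (simp only: norm_mult power_mult_distrib real_norm_def abs_mult abs_power2 abs_norm_cancel)
    qed
  qed measurable
  show ?thesis unfolding square_integrable_iff eq by (intro conjI M S)
qed

lemma square_integrable_product:
  assumes u: "square_integrable \<Omega> u" and v: "square_integrable \<Omega> v"
  shows "set_integrable lborel \<Omega> (\<lambda>x. u x * v x)"
    and "norm (LINT x:\<Omega>|lborel. u x * v x) \<le> sqrt (L2_sq \<Omega> u) * sqrt (L2_sq \<Omega> v)"
proof -
  let ?u = "\<lambda>x. indicator \<Omega> x *\<^sub>R u x" and ?v = "\<lambda>x. indicator \<Omega> x *\<^sub>R v x"
  have [measurable]: "?u \<in> borel_measurable borel" "?v \<in> borel_measurable borel"
    using assms by (auto simp: square_integrable_iff)
  have eq: "indicator \<Omega> x *\<^sub>R (u x * v x) = ?u x * ?v x" for x by (simp add: indicator_def)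
  have CS: "(\<integral>\<^sup>+x. ennreal (norm (?u x * ?v x)) \<partial>lborel)\<^sup>2 \<le> ennreal (L2_sq \<Omega> u) * ennreal (L2_sq \<Omega> v)"
  proof -
    have "(\<integral>\<^sup>+x. ennreal (norm (?u x * ?v x)) \<partial>lborel)\<^sup>2 = (\<integral>\<^sup>+x. ennreal (norm (?u x)) * ennreal (norm (?v x)) \<partial>lborel)\<^sup>2"
      by (simp only: norm_mult ennreal_mult norm_ge_zero)
    also have "\<dots> \<le> (\<integral>\<^sup>+x. (ennreal (norm (?u x)))\<^sup>2 \<partial>lborel) * (\<integral>\<^sup>+x. (ennreal (norm (?v x)))\<^sup>2 \<partial>lborel)"
      by (rule Cauchy_Schwarz_nn_integral) measurable
    also have "\<dots> = ennreal (L2_sq \<Omega> u) * ennreal (L2_sq \<Omega> v)"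
      using nn_integral_L2_sq[OF u] nn_integral_L2_sq[OF v] by (simp only: ennreal_power norm_ge_zero)
    finally show ?thesis .
  qed
  then have "(\<integral>\<^sup>+x. ennreal (norm (?u x * ?v x)) \<partial>lborel)\<^sup>2 < \<infinity>"
    by (rule order.strict_trans1) (simp add: ennreal_mult_less_top)
  then have fin: "(\<integral>\<^sup>+x. ennreal (norm (?u x * ?v x)) \<partial>lborel) < \<infinity>"
    by (simp add: power_less_top_ennreal)
  have I: "integrable lborel (\<lambda>x. ?u x * ?v x)" by (rule integrableI_bounded[OF _ fin]) measurable
  then show "set_integrable lborel \<Omega> (\<lambda>x. u x * v x)" unfolding set_integrable_def eq .
  let ?J = "LINT x|lborel. norm (?u x * ?v x)"
  have J: "(\<integral>\<^sup>+x. ennreal (norm (?u x * ?v x)) \<partial>lborel) = ennreal ?J"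
    by (intro nn_integral_eq_integral integrable_norm I) auto
  have J0: "?J \<ge> 0" by (intro Bochner_Integration.integral_nonneg) auto
  have "ennreal (?J\<^sup>2) \<le> ennreal (L2_sq \<Omega> u * L2_sq \<Omega> v)"
    using CS J0 unfolding J by (simp only: ennreal_power ennreal_mult L2_sq_nonneg)
  then have "?J\<^sup>2 \<le> L2_sq \<Omega> u * L2_sq \<Omega> v"
    by (subst (asm) ennreal_le_iff) (auto simp: L2_sq_nonneg)
  then have "?J \<le> sqrt (L2_sq \<Omega> u) * sqrt (L2_sq \<Omega> v)" unfolding real_sqrt_mult[symmetric] by (rule real_le_rsqrt)
  then show "norm (LINT x:\<Omega>|lborel. u x * v x) \<le> sqrt (L2_sq \<Omega> u) * sqrt (L2_sq \<Omega> v)"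
    using integral_norm_bound[of lborel "\<lambda>x. ?u x * ?v x"] unfolding set_lebesgue_integral_def eq by linarith
qed

lemma L2_pairing_convergence:
  assumes a: "square_integrable \<Omega> a" and b: "\<And>n. square_integrable \<Omega> (b n)" "square_integrable \<Omega> b'"
    and lim: "(\<lambda>n. L2_sq \<Omega> (\<lambda>x. b n x - b' x)) \<longlonglongrightarrow> 0"
  shows "(\<lambda>n. LINT x:\<Omega>|lborel. a x * b n x) \<longlonglongrightarrow> (LINT x:\<Omega>|lborel. a x * b' x)"
proof -
  have A: "norm ((LINT x:\<Omega>|lborel. a x * b n x) - (LINT x:\<Omega>|lborel. a x * b' x)) \<le>
      sqrt (L2_sq \<Omega> a) * sqrt (L2_sq \<Omega> (\<lambda>x. b n x - b' x))" for n
  proof -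
    have "(LINT x:\<Omega>|lborel. a x * b n x) - (LINT x:\<Omega>|lborel. a x * b' x) = (LINT x:\<Omega>|lborel. a x * (b n x - b' x))"
      unfolding right_diff_distrib
      by (rule set_integral_diff(2)[symmetric]) (intro square_integrable_product a b)+
    then show ?thesis
      using square_integrable_product(2)[OF a square_integrable_diff[OF b(1) b(2)]] by simp
  qed
  have "(\<lambda>n. sqrt (L2_sq \<Omega> a) * sqrt (L2_sq \<Omega> (\<lambda>x. b n x - b' x))) \<longlonglongrightarrow> sqrt (L2_sq \<Omega> a) * sqrt 0"
    by (intro tendsto_intros lim)
  then have B: "(\<lambda>n. sqrt (L2_sq \<Omega> a) * sqrt (L2_sq \<Omega> (\<lambda>x. b n x - b' x))) \<longlonglongrightarrow> 0" by simp
  show ?thesis by (rule LIM_zero_cancel, rule Lim_null_comparison[OF always_eventually[OF allI[OF A]] B])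
qed

lemma test_function_square_integrable:
  assumes "w \<in> test_functions \<Omega>" "\<Omega> \<in> sets borel"
  shows "square_integrable \<Omega> w"
proof -
  have [measurable]: "w \<in> borel_measurable borel" "\<Omega> \<in> sets borel"
    using assms by (auto intro: schwartz_measurable test_functions_schwartz)
  obtain C where C: "\<And>x. (1 + norm x) ^ 0 * norm (w x) \<le> C"
    using test_functions_rapidly_decreasing[OF assms(1)] unfolding rapidly_decreasing_def by metis
  have "integrable lborel (\<lambda>x. (norm (indicator \<Omega> x *\<^sub>R w x))\<^sup>2)"
  proof (rule Bochner_Integration.integrable_bound[OF integrable_mult_right[OF integrable_norm[OF schwartz_integrable[OF test_functions_schwartz[OF assms(1)]]], of C]])
    show "AE x in lborel. norm ((norm (indicator \<Omega> x *\<^sub>R w x))\<^sup>2) \<le> norm (C * norm (w x))"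
    proof (rule AE_I2)
      fix x
      have "norm (w x) * norm (w x) \<le> C * norm (w x)" using C[of x] by (intro mult_right_mono) auto
      then show "norm ((norm (indicator \<Omega> x *\<^sub>R w x))\<^sup>2) \<le> norm (C * norm (w x))"
        by (auto simp: indicator_def power2_eq_square)
    qed
  qed measurable
  then show ?thesis by (simp add: square_integrable_iff)
qed

lemma square_integrable_imp_locally_integrable:
  assumes "square_integrable \<Omega> v" "cbox a b \<subseteq> \<Omega>"
  shows "set_integrable lborel (cbox a b) v"
proof -
  let ?v = "\<lambda>x. indicator \<Omega> x *\<^sub>R v x"
  have [measurable]: "?v \<in> borel_measurable borel" and I: "integrable lborel (\<lambda>x. (norm (?v x))\<^sup>2)"
    using assms by (auto simp: square_integrable_iff)
  have [measurable]: "cbox a b \<in> sets borel" by simp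
  have eq: "indicator (cbox a b) x *\<^sub>R v x = indicator (cbox a b) x *\<^sub>R ?v x" for x
    using assms(2) by (auto simp: indicator_def)
  have "integrable lborel (\<lambda>x. indicator (cbox a b) x *\<^sub>R ?v x)"
  proof (rule Bochner_Integration.integrable_bound)
    show "integrable lborel (\<lambda>x. indicator (cbox a b) x + (norm (?v x))\<^sup>2)"
      by (intro Bochner_Integration.integrable_add I integrable_real_indicator[OF _ emeasure_lborel_cbox_finite]) simp
    show "AE x in lborel. norm (indicator (cbox a b) x *\<^sub>R ?v x) \<le> norm (indicator (cbox a b) x + (norm (?v x))\<^sup>2)"
    proof (rule AE_I2)
      fix x
      have "2 * norm (?v x) \<le> 1 + (norm (?v x))\<^sup>2" using sum_squares_bound[of 1 "norm (?v x)"] by simp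
      then have "norm (?v x) \<le> 1 + (norm (?v x))\<^sup>2" using norm_ge_zero[of "?v x"] by linarith
      then show "norm (indicator (cbox a b) x *\<^sub>R ?v x) \<le> norm (indicator (cbox a b) x + (norm (?v x))\<^sup>2)"
        by (cases "x \<in> cbox a b") auto
    qed
  qed measurable
  then show ?thesis unfolding set_integrable_def eq .
qed

text \<open>Local integrability is assumed in place of square integrability, because for the classical derivative of
  a $C^1$ function in $H^1$ the latter is a conclusion (\<open>C1_H1_weak_pd\<close>).\<close>

lemma is_weak_pd_AE_unique:
  assumes "open \<Omega>"
    and int: "\<And>a b. cbox a b \<subseteq> \<Omega> \<Longrightarrow> set_integrable lborel (cbox a b) g"
      "\<And>a b. cbox a b \<subseteq> \<Omega> \<Longrightarrow> set_integrable lborel (cbox a b) k"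
    and intw: "\<And>w. w \<in> test_functions \<Omega> \<Longrightarrow> set_integrable lborel \<Omega> (\<lambda>x. g x * w x)"
      "\<And>w. w \<in> test_functions \<Omega> \<Longrightarrow> set_integrable lborel \<Omega> (\<lambda>x. k x * w x)"
    and eq: "\<And>w. w \<in> test_functions \<Omega> \<Longrightarrow> (LINT x:\<Omega>|lborel. g x * w x) = (LINT x:\<Omega>|lborel. k x * w x)"
  shows "AE x in lborel. x \<in> \<Omega> \<longrightarrow> g x = k x"
proof -
  have "AE x in lborel. x \<in> \<Omega> \<longrightarrow> g x - k x = 0"
  proof (rule AE_0_if_test_functions[OF assms(1)])
    show "set_integrable lborel (cbox a b) (\<lambda>x. g x - k x)" if "cbox a b \<subseteq> \<Omega>" for a b
      using int[OF that] by (rule set_integral_diff(1))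
    show "(LINT x:\<Omega>|lborel. (g x - k x) * w x) = 0" if "w \<in> test_functions \<Omega>" for w
      unfolding left_diff_distrib using set_integral_diff(2)[OF intw[OF that]] eq[OF that] by simp
  qed
  then show ?thesis by simp
qed

lemma is_weak_pd_AE_eq:
  assumes "open \<Omega>" and g: "is_weak_pd \<Omega> i v g" and k: "is_weak_pd \<Omega> i v k"
  shows "AE x in lborel. x \<in> \<Omega> \<longrightarrow> g x = k x"
proof (rule is_weak_pd_AE_unique[OF assms(1)])
  have B: "\<Omega> \<in> sets borel" using assms(1) by (rule borel_open)
  show "set_integrable lborel \<Omega> (\<lambda>x. g x * w x)" "set_integrable lborel \<Omega> (\<lambda>x. k x * w x)"
    "(LINT x:\<Omega>|lborel. g x * w x) = (LINT x:\<Omega>|lborel. k x * w x)" if "w \<in> test_functions \<Omega>" for w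
    using assms that test_function_square_integrable[OF that B]
    by (auto simp: is_weak_pd_def intro: square_integrable_product(1))
qed (use g k in \<open>auto simp: is_weak_pd_def intro: square_integrable_imp_locally_integrable\<close>)

lemma H1_weak_pd: "v \<in> H1 \<Omega> \<Longrightarrow> i \<in> Basis \<Longrightarrow> is_weak_pd \<Omega> i v (weak_pd \<Omega> i v)"
  unfolding weak_pd_def H1_def by (metis (mono_tags, lifting) mem_Collect_eq someI_ex)

lemma weak_pd_AE_eq:
  assumes "open \<Omega>" "is_weak_pd \<Omega> i v g"
  shows "AE x in lborel. x \<in> \<Omega> \<longrightarrow> weak_pd \<Omega> i v x = g x"
proof -
  have "is_weak_pd \<Omega> i v (weak_pd \<Omega> i v)" unfolding weak_pd_def by (rule someI[of "is_weak_pd \<Omega> i v", OF assms(2)])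
  then show ?thesis using is_weak_pd_AE_eq assms by blast
qed

lemma is_weak_pd_diff:
  assumes "open \<Omega>" "square_integrable \<Omega> u" "square_integrable \<Omega> v" "i \<in> Basis"
    and g: "is_weak_pd \<Omega> i u g" and k: "is_weak_pd \<Omega> i v k"
  shows "is_weak_pd \<Omega> i (\<lambda>x. u x - v x) (\<lambda>x. g x - k x)"
  unfolding is_weak_pd_def
proof (intro conjI ballI)
  have gk: "square_integrable \<Omega> g" "square_integrable \<Omega> k" using g k by (auto simp: is_weak_pd_def)
  then show "square_integrable \<Omega> (\<lambda>x. g x - k x)" by (rule square_integrable_diff)
  fix w assume w: "w \<in> test_functions \<Omega>"
  have B: "\<Omega> \<in> sets borel" using assms(1) by (rule borel_open)
  note W = test_function_square_integrable[OF w B] test_function_square_integrable[OF test_functions_pd[OF w assms(4)] B]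
  have "(LINT x:\<Omega>|lborel. (u x - v x) * pd i w x) = (LINT x:\<Omega>|lborel. u x * pd i w x) - (LINT x:\<Omega>|lborel. v x * pd i w x)"
    unfolding left_diff_distrib by (rule set_integral_diff(2)) (intro square_integrable_product(1) assms W)+
  also have "\<dots> = - (LINT x:\<Omega>|lborel. g x * w x) + (LINT x:\<Omega>|lborel. k x * w x)"
    using g k w by (simp add: is_weak_pd_def)
  also have "\<dots> = - (LINT x:\<Omega>|lborel. (g x - k x) * w x)"
    unfolding left_diff_distrib by (subst set_integral_diff(2)) (auto intro!: square_integrable_product(1) gk W)
  finally show "(LINT x:\<Omega>|lborel. (u x - v x) * pd i w x) = - (LINT x:\<Omega>|lborel. (g x - k x) * w x)" .
qed

subsection \<open>Functions of class $C^1$\<close>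

lemma C1_continuous: "C1 u \<Longrightarrow> continuous_on S u"
  by (simp add: C1_def continuous_at_imp_continuous_on differentiable_imp_continuous_within)

lemma test_function_outside:
  assumes "w \<in> test_functions \<Omega>" "x \<notin> \<Omega>"
  shows "w x = 0"
proof (rule ccontr)
  assume "w x \<noteq> 0"
  then have "x \<in> closure {x. w x \<noteq> 0}" by (intro subsetD[OF closure_subset]) simp
  then show False using assms by (auto simp: test_functions_def)
qed

lemma continuous_mult_test_integrable:
  assumes "continuous_on UNIV f" "w \<in> test_functions \<Omega>"
  shows "integrable lborel (\<lambda>x. f x * w x)"
proof -
  obtain R where R: "R > 0" "\<And>x. w x \<noteq> 0 \<Longrightarrow> norm x \<le> R" using test_function_bounded_support[OF assms(2)] by blast
  have "continuous_on (cball 0 R) (\<lambda>x. f x * w x)"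
    by (rule continuous_on_mult[OF continuous_on_subset[OF assms(1) subset_UNIV] smooth_continuous[OF test_functions_smooth[OF assms(2)]]])
  then have "integrable lborel (\<lambda>x. indicator (cball 0 R) x *\<^sub>R (f x * w x))"
    using borel_integrable_compact[OF compact_cball] by blast
  moreover have "indicator (cball 0 R) x *\<^sub>R (f x * w x) = f x * w x" for x
    using R(2)[of x] by (auto simp: indicator_def)
  ultimately show ?thesis by simp
qed

lemma C1_integration_by_parts:
  assumes "C1 u" "w \<in> test_functions \<Omega>" "i \<in> Basis"
  shows "(LINT x:\<Omega>|lborel. u x * pd i w x) = - (LINT x:\<Omega>|lborel. pd i u x * w x)"
proof -
  have w: "smooth w" "C1 w" using assms by (auto intro: test_functions_smooth C1_smooth)
  have c: "continuous_on UNIV u" "continuous_on UNIV (pd i u)" using assms by (auto simp: C1_continuous) (auto simp: C1_def)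
  have P: "pd i (\<lambda>x. u x * w x) = (\<lambda>x. u x * pd i w x + pd i u x * w x)" if "i \<in> Basis" for i
    by (rule ext, rule pd_mult) (use assms w in \<open>auto simp: C1_def\<close>)
  have I: "integrable lborel (\<lambda>x. u x * w x)" "integrable lborel (\<lambda>x. u x * pd i w x)" "integrable lborel (\<lambda>x. pd i u x * w x)"
    using continuous_mult_test_integrable[OF _ assms(2)] continuous_mult_test_integrable[OF _ test_functions_pd[OF assms(2,3)]] c by auto
  have C: "C1 (\<lambda>x. u x * w x)" unfolding C1_def
  proof (intro conjI allI ballI)
    show "(\<lambda>x. u x * w x) differentiable (at x)" for x using assms w by (intro differentiable_mult) (auto simp: C1_def)
    fix j :: 'a assume j: "j \<in> Basis"
    show "continuous_on UNIV (pd j (\<lambda>x. u x * w x))" unfolding P[OF j]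
    proof -
      have "continuous_on UNIV (pd j u)" using assms(1) j by (simp add: C1_def)
      then show "continuous_on UNIV (\<lambda>x. u x * pd j w x + pd j u x * w x)"
        by (intro continuous_on_add continuous_on_mult c smooth_continuous[OF smooth_pd[OF w(1) j]] smooth_continuous[OF w(1)])
    qed
  qed
  have "(LINT x|lborel. u x * pd i w x + pd i u x * w x) = 0"
    using integral_pd_eq_0[OF C assms(3)] I unfolding P[OF assms(3)] by simp
  then have 0: "(LINT x|lborel. u x * pd i w x) + (LINT x|lborel. pd i u x * w x) = 0"
    using I by simp
  note S = test_function_outside[OF assms(2)] test_function_outside[OF test_functions_pd[OF assms(2,3)]]
  have 1: "indicator \<Omega> x *\<^sub>R (u x * pd i w x) = u x * pd i w x" for x using S by (auto simp: indicator_def)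
  have 2: "indicator \<Omega> x *\<^sub>R (pd i u x * w x) = pd i u x * w x" for x using S by (auto simp: indicator_def)
  show ?thesis unfolding set_lebesgue_integral_def 1 2 using 0 by (simp add: add_eq_0_iff2)
qed

lemma C1_is_weak_pd:
  assumes "C1 u" "i \<in> Basis" "square_integrable \<Omega> (pd i u)"
  shows "is_weak_pd \<Omega> i u (pd i u)"
  using assms by (auto simp: is_weak_pd_def C1_integration_by_parts)

text \<open>The classical derivative agrees almost everywhere with a square integrable weak one, hence is itself square
  integrable.\<close>

lemma C1_H1_weak_pd:
  assumes "open \<Omega>" "C1 u" "u \<in> H1 \<Omega>" "i \<in> Basis"
  shows "is_weak_pd \<Omega> i u (pd i u)"
proof (rule C1_is_weak_pd[OF assms(2,4)])
  let ?g = "weak_pd \<Omega> i u"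
  have g: "is_weak_pd \<Omega> i u ?g" using assms by (intro H1_weak_pd)
  have B[measurable]: "\<Omega> \<in> sets borel" using assms(1) by (rule borel_open)
  have c: "continuous_on UNIV (pd i u)" using assms by (auto simp: C1_def)
  have [measurable]: "pd i u \<in> borel_measurable borel" using c by (rule borel_measurable_continuous_onI)
  have AE: "AE x in lborel. x \<in> \<Omega> \<longrightarrow> ?g x = pd i u x"
  proof (rule is_weak_pd_AE_unique[OF assms(1)])
    show "set_integrable lborel (cbox a b) (pd i u)" for a b
      unfolding set_integrable_def by (intro borel_integrable_compact compact_cbox continuous_on_subset[OF c]) auto
    fix w assume w: "w \<in> test_functions \<Omega>"
    show "set_integrable lborel \<Omega> (\<lambda>x. ?g x * w x)"
      using g by (auto simp: is_weak_pd_def intro!: square_integrable_product(1) test_function_square_integrable w)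
    show "set_integrable lborel \<Omega> (\<lambda>x. pd i u x * w x)"
      unfolding set_integrable_def by (intro integrable_mult_indicator continuous_mult_test_integrable[OF c w]) auto
    show "(LINT x:\<Omega>|lborel. ?g x * w x) = (LINT x:\<Omega>|lborel. pd i u x * w x)"
      using g w C1_integration_by_parts[OF assms(2) w assms(4)] by (simp add: is_weak_pd_def)
  qed (use g in \<open>auto simp: is_weak_pd_def intro: square_integrable_imp_locally_integrable\<close>)
  have *: "AE x in lborel. (norm (indicator \<Omega> x *\<^sub>R ?g x))\<^sup>2 = (norm (indicator \<Omega> x *\<^sub>R pd i u x))\<^sup>2"
    using AE by eventually_elim (auto simp: indicator_def)
  have gm[measurable]: "(\<lambda>x. indicator \<Omega> x *\<^sub>R ?g x) \<in> borel_measurable borel" and I: "integrable lborel (\<lambda>x. (norm (indicator \<Omega> x *\<^sub>R ?g x))\<^sup>2)"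
    using g by (auto simp: is_weak_pd_def square_integrable_iff)
  show "square_integrable \<Omega> (pd i u)" unfolding square_integrable_iff
    using integrable_cong_AE[OF _ _ *] I by simp
qed

lemma C1_in_H1:
  assumes "C1 u" "square_integrable \<Omega> u" "\<And>i. i \<in> Basis \<Longrightarrow> square_integrable \<Omega> (pd i u)"
  shows "u \<in> H1 \<Omega>"
  using C1_is_weak_pd[OF assms(1)] assms(2,3) unfolding H1_def by blast

lemma test_function_H1:
  assumes "w \<in> test_functions \<Omega>" "\<Omega> \<in> sets borel"
  shows "C1 w" "w \<in> H1 \<Omega>"
proof -
  show C: "C1 w" by (rule C1_smooth[OF test_functions_smooth[OF assms(1)]])
  show "w \<in> H1 \<Omega>"
    by (intro C1_in_H1[OF C] test_function_square_integrable test_functions_pd assms)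
qed

lemma set_integral_AE_cong:
  fixes f g :: "'a::euclidean_space \<Rightarrow> complex"
  assumes "AE x in lborel. x \<in> \<Omega> \<longrightarrow> f x = g x"
    "(\<lambda>x. indicator \<Omega> x *\<^sub>R f x) \<in> borel_measurable borel" "(\<lambda>x. indicator \<Omega> x *\<^sub>R g x) \<in> borel_measurable borel"
  shows "(LINT x:\<Omega>|lborel. f x) = (LINT x:\<Omega>|lborel. g x)"
  unfolding set_lebesgue_integral_def
  by (rule integral_cong_AE) (use assms in \<open>auto elim!: eventually_mono simp: indicator_def\<close>)

lemma H1_norm_eq:
  assumes "open \<Omega>" "square_integrable \<Omega> v" and g: "\<And>i. i \<in> Basis \<Longrightarrow> is_weak_pd \<Omega> i v (g i)"
  shows "(H1_norm \<Omega> v)\<^sup>2 = L2_sq \<Omega> v + (\<Sum>i\<in>Basis. L2_sq \<Omega> (g i))"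
proof -
  have wp: "is_weak_pd \<Omega> i v (weak_pd \<Omega> i v)" if "i \<in> Basis" for i
    unfolding weak_pd_def by (rule someI[of "is_weak_pd \<Omega> i v", OF g[OF that]])
  have I: "set_integrable lborel \<Omega> (\<lambda>x. (norm (v x))\<^sup>2)" "\<And>i. i \<in> Basis \<Longrightarrow> set_integrable lborel \<Omega> (\<lambda>x. (norm (weak_pd \<Omega> i v x))\<^sup>2)"
    using assms wp by (auto simp: is_weak_pd_def square_integrable_def)
  have "(LINT x:\<Omega>|lborel. (norm (v x))\<^sup>2 + (\<Sum>i\<in>Basis. (norm (weak_pd \<Omega> i v x))\<^sup>2)) =
      L2_sq \<Omega> v + (\<Sum>i\<in>Basis. L2_sq \<Omega> (weak_pd \<Omega> i v))"
    using I unfolding L2_sq_def set_integrable_def set_lebesgue_integral_def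
    by (simp only: scaleR_add_right scaleR_sum_right Bochner_Integration.integral_add
        Bochner_Integration.integrable_sum Bochner_Integration.integral_sum)
  also have "(\<Sum>i\<in>Basis. L2_sq \<Omega> (weak_pd \<Omega> i v)) = (\<Sum>i\<in>Basis. L2_sq \<Omega> (g i))"
  proof (intro sum.cong refl)
    fix i :: 'a assume i: "i \<in> Basis"
    have [measurable]: "(\<lambda>x. indicator \<Omega> x *\<^sub>R weak_pd \<Omega> i v x) \<in> borel_measurable borel" "(\<lambda>x. indicator \<Omega> x *\<^sub>R g i x) \<in> borel_measurable borel"
      using wp[OF i] g[OF i] by (auto simp: is_weak_pd_def square_integrable_iff)
    show "L2_sq \<Omega> (weak_pd \<Omega> i v) = L2_sq \<Omega> (g i)" unfolding L2_sq_eq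
    proof (rule integral_cong_AE)
      show "AE x in lborel. (norm (indicator \<Omega> x *\<^sub>R weak_pd \<Omega> i v x))\<^sup>2 = (norm (indicator \<Omega> x *\<^sub>R g i x))\<^sup>2"
        using is_weak_pd_AE_eq[OF assms(1) wp[OF i] g[OF i]] by eventually_elim (auto simp: indicator_def)
    qed measurable
  qed
  finally show ?thesis unfolding H1_norm_def
    by (subst real_sqrt_pow2) (auto simp: L2_sq_nonneg intro!: add_nonneg_nonneg sum_nonneg)
qed

text \<open>Frees convergence in $H^1$ from the representatives chosen by \<^const>\<open>weak_pd\<close>.\<close>

lemma H1_convergence:
  assumes "open \<Omega>" and u: "\<And>n. square_integrable \<Omega> (u n)" "\<And>n i. i \<in> Basis \<Longrightarrow> is_weak_pd \<Omega> i (u n) (k i n)"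
    and v: "square_integrable \<Omega> v" "\<And>i. i \<in> Basis \<Longrightarrow> is_weak_pd \<Omega> i v (g i)"
  shows "(\<lambda>n. H1_norm \<Omega> (\<lambda>x. u n x - v x)) \<longlonglongrightarrow> 0 \<longleftrightarrow>
    (\<lambda>n. L2_sq \<Omega> (\<lambda>x. u n x - v x)) \<longlonglongrightarrow> 0 \<and> (\<forall>i\<in>Basis. (\<lambda>n. L2_sq \<Omega> (\<lambda>x. k i n x - g i x)) \<longlonglongrightarrow> 0)"
proof -
  let ?N = "\<lambda>n. H1_norm \<Omega> (\<lambda>x. u n x - v x)"
  have eq: "(?N n)\<^sup>2 = L2_sq \<Omega> (\<lambda>x. u n x - v x) + (\<Sum>i\<in>Basis. L2_sq \<Omega> (\<lambda>x. k i n x - g i x))" for n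
    by (rule H1_norm_eq) (auto intro!: assms square_integrable_diff is_weak_pd_diff)
  have N0: "0 \<le> ?N n" for n unfolding H1_norm_def set_lebesgue_integral_def
    by (auto intro!: Bochner_Integration.integral_nonneg mult_nonneg_nonneg add_nonneg_nonneg sum_nonneg)
  have S0: "0 \<le> (\<Sum>i\<in>Basis. L2_sq \<Omega> (\<lambda>x. k i n x - g i x))" for n by (intro sum_nonneg L2_sq_nonneg)
  show ?thesis
  proof
    assume "?N \<longlonglongrightarrow> 0"
    then have "(\<lambda>n. (?N n)\<^sup>2) \<longlonglongrightarrow> 0\<^sup>2" by (intro tendsto_intros)
    then have N: "(\<lambda>n. (?N n)\<^sup>2) \<longlonglongrightarrow> 0" by simp
    have "(\<lambda>n. L2_sq \<Omega> (\<lambda>x. u n x - v x)) \<longlonglongrightarrow> 0"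
      by (rule tendsto_sandwich[OF _ _ tendsto_const N]) (auto simp: eq L2_sq_nonneg S0)
    moreover have "(\<lambda>n. L2_sq \<Omega> (\<lambda>x. k i n x - g i x)) \<longlonglongrightarrow> 0" if "i \<in> Basis" for i
    proof (rule tendsto_sandwich[OF _ _ tendsto_const N])
      have "L2_sq \<Omega> (\<lambda>x. k i n x - g i x) \<le> (?N n)\<^sup>2" for n
      proof -
        have "L2_sq \<Omega> (\<lambda>x. k i n x - g i x) \<le> (\<Sum>i\<in>Basis. L2_sq \<Omega> (\<lambda>x. k i n x - g i x))"
          by (rule member_le_sum[OF that]) (auto simp: L2_sq_nonneg)
        then show ?thesis unfolding eq using L2_sq_nonneg[of \<Omega> "\<lambda>x. u n x - v x"] by linarith
      qed
      then show "\<forall>\<^sub>F n in sequentially. L2_sq \<Omega> (\<lambda>x. k i n x - g i x) \<le> (?N n)\<^sup>2" by simp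
    qed (simp add: L2_sq_nonneg)
    ultimately show "(\<lambda>n. L2_sq \<Omega> (\<lambda>x. u n x - v x)) \<longlonglongrightarrow> 0 \<and> (\<forall>i\<in>Basis. (\<lambda>n. L2_sq \<Omega> (\<lambda>x. k i n x - g i x)) \<longlonglongrightarrow> 0)" by blast
  next
    assume *: "(\<lambda>n. L2_sq \<Omega> (\<lambda>x. u n x - v x)) \<longlonglongrightarrow> 0 \<and> (\<forall>i\<in>Basis. (\<lambda>n. L2_sq \<Omega> (\<lambda>x. k i n x - g i x)) \<longlonglongrightarrow> 0)"
    then have "(\<lambda>n. (?N n)\<^sup>2) \<longlonglongrightarrow> 0 + (\<Sum>i\<in>(Basis::'a set). 0)"
      unfolding eq by (intro tendsto_add tendsto_sum) auto
    then have "(\<lambda>n. sqrt ((?N n)\<^sup>2)) \<longlonglongrightarrow> sqrt 0" by (intro tendsto_intros) simp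
    then show "?N \<longlonglongrightarrow> 0" using N0 by simp
  qed
qed

section \<open>Integration over the layer\<close>

lemma layer_open: "open (layer h L)"
proof -
  have "layer h L = snd -` {h<..<h + L}" by (auto simp: layer_def)
  then show ?thesis by (simp add: open_vimage continuous_on_snd[OF continuous_on_id, unfolded id_def])
qed

lemma layer_measurable [measurable]: "layer h L \<in> sets borel"
  by (intro borel_open layer_open)

lemma indicator_layer: "indicator (layer h L) (y, t) = indicator {h<..<h + L} t"
  by (simp add: layer_def indicator_def)

lemma sum_Basis_space3:
  fixes g :: "space3 \<Rightarrow> 'b::comm_monoid_add"
  shows "(\<Sum>i\<in>Basis. g i) = (\<Sum>j\<in>Basis. g (j, 0)) + g (0, 1)"
  unfolding Basis_prod_def by (subst sum.union_disjoint) (auto simp: sum.reindex inj_on_def)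

lemma pair_has_vector_derivative:
  fixes u :: "space3 \<Rightarrow> complex"
  assumes "C1 u"
  shows "((\<lambda>t. u (y, t)) has_vector_derivative pd (0, 1) u (y, t)) (at t)"
  using has_vector_derivative_line[of u "(y, 0)" t "(0, 1)"] assms by (simp add: C1_def)

text \<open>Fubini's theorem and the fundamental theorem of calculus on vertical segments.  Fubini's theorem yields
  integrability only for the difference of the boundary values.\<close>

lemma layer_vertical_integral:
  fixes p q :: "space3 \<Rightarrow> complex"
  assumes deriv: "\<And>y t. ((\<lambda>t. p (y, t)) has_vector_derivative q (y, t)) (at t)"
    and cont: "\<And>y. continuous_on UNIV (\<lambda>t. q (y, t))"
    and int: "set_integrable lborel (layer h L) q" and L: "L > 0"
  shows "integrable lborel (\<lambda>y. p (y, h + L) - p (y, h))"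
    and "(LINT y|lborel. p (y, h + L) - p (y, h)) = (LINT x:layer h L|lborel. q x)"
proof -
  have I: "integrable (lborel \<Otimes>\<^sub>M lborel) (\<lambda>x. indicator (layer h L) x *\<^sub>R q x)"
    using int unfolding set_integrable_def by (simp add: lborel_prod)
  have inner: "(LINT t|lborel. indicator (layer h L) (y, t) *\<^sub>R q (y, t)) = p (y, h + L) - p (y, h)" for y
  proof -
    have "(LINT t|lborel. indicator {h<..<h + L} t *\<^sub>R q (y, t)) = (LINT t|lborel. indicator {h..h + L} t *\<^sub>R q (y, t))"
    proof (rule integral_cong_AE)
      have [measurable]: "(\<lambda>t. q (y, t)) \<in> borel_measurable borel" by (intro borel_measurable_continuous_onI cont)
      show "(\<lambda>t. indicator {h<..<h + L} t *\<^sub>R q (y, t)) \<in> borel_measurable lborel"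
        "(\<lambda>t. indicator {h..h + L} t *\<^sub>R q (y, t)) \<in> borel_measurable lborel" by measurable
      show "AE t in lborel. indicator {h<..<h + L} t *\<^sub>R q (y, t) = indicator {h..h + L} t *\<^sub>R q (y, t)"
        using AE_lborel_singleton[of h] AE_lborel_singleton[of "h + L"] by eventually_elim (auto simp: indicator_def)
    qed
    also have "\<dots> = p (y, h + L) - p (y, h)"
    proof (rule integral_FTC_Icc)
      show "((\<lambda>t. p (y, t)) has_vector_derivative q (y, t)) (at t within {h..h + L})" for t
        using deriv by (rule has_vector_derivative_at_within)
      show "continuous_on {h..h + L} (\<lambda>t. q (y, t))" using cont continuous_on_subset by blast
    qed (use L in simp)
    finally show ?thesis by (simp only: indicator_layer)
  qed
  show "integrable lborel (\<lambda>y. p (y, h + L) - p (y, h))"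
    using lborel_pair.integrable_fst'[OF I] unfolding inner .
  show "(LINT y|lborel. p (y, h + L) - p (y, h)) = (LINT x:layer h L|lborel. q x)"
    using lborel_pair.integral_fst'[OF I] unfolding inner set_lebesgue_integral_def by (simp add: lborel_prod)
qed

text \<open>The factor $(h+L-t)/L$ vanishes on the upper boundary, so \<open>layer_vertical_integral\<close> applied to the
  product makes the lower boundary value integrable, and then the upper one.\<close>

lemma layer_divergence:
  fixes p q :: "space3 \<Rightarrow> complex"
  assumes deriv: "\<And>y t. ((\<lambda>t. p (y, t)) has_vector_derivative q (y, t)) (at t)"
    and cont: "\<And>y. continuous_on UNIV (\<lambda>t. q (y, t))" and contp: "\<And>y. continuous_on UNIV (\<lambda>t. p (y, t))"
    and q: "set_integrable lborel (layer h L) q" and p: "set_integrable lborel (layer h L) p" and L: "L > 0"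
  shows "integrable lborel (\<lambda>y. p (y, h))" "integrable lborel (\<lambda>y. p (y, h + L))"
    "(LINT x:layer h L|lborel. q x) = (LINT y|lborel. p (y, h + L)) - (LINT y|lborel. p (y, h))"
proof -
  define \<theta> where "\<theta> t = complex_of_real ((h + L - t) / L)" for t
  have "integrable lborel (\<lambda>y. p (y, h + L) * \<theta> (h + L) - p (y, h) * \<theta> h)"
  proof (rule layer_vertical_integral(1)[where p="\<lambda>x. p x * \<theta> (snd x)" and h=h and L=L
        and q="\<lambda>x. p x * of_real (- 1 / L) + q x * \<theta> (snd x)", simplified snd_conv])
    show "((\<lambda>t. p (y, t) * \<theta> t) has_vector_derivative p (y, t) * of_real (- 1 / L) + q (y, t) * \<theta> t) (at t)" for y t
    proof (rule has_vector_derivative_mult[OF deriv])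
      have "((\<lambda>t. (h + L - t) / L) has_vector_derivative (- 1 / L)) (at t)"
        using L by (auto intro!: derivative_eq_intros simp: has_real_derivative_iff_has_vector_derivative[symmetric])
      then show "(\<theta> has_vector_derivative of_real (- 1 / L)) (at t)"
        unfolding \<theta>_def[abs_def] by (rule bounded_linear.has_vector_derivative[OF bounded_linear_of_real])
    qed
    show "continuous_on UNIV (\<lambda>t. p (y, t) * of_real (- 1 / L) + q (y, t) * \<theta> t)" for y
      unfolding \<theta>_def using L by (intro continuous_intros cont contp) auto
    have m: "(\<lambda>x. indicator (layer h L) x *\<^sub>R q x) \<in> borel_measurable borel" using q by (auto simp: set_integrable_def)
    have "set_integrable lborel (layer h L) (\<lambda>x. q x * \<theta> (snd x))"
      unfolding set_integrable_def
    proof (rule Bochner_Integration.integrable_bound)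
      show "integrable lborel (\<lambda>x. indicator (layer h L) x *\<^sub>R q x)" using q by (simp add: set_integrable_def)
      have "(\<lambda>x. (indicator (layer h L) x *\<^sub>R q x) * \<theta> (snd x)) \<in> borel_measurable borel"
      proof (rule borel_measurable_times[OF m])
        show "(\<lambda>x::space3. \<theta> (snd x)) \<in> borel_measurable borel"
          unfolding \<theta>_def using L by (intro borel_measurable_continuous_onI continuous_intros) auto
      qed
      then show "(\<lambda>x. indicator (layer h L) x *\<^sub>R (q x * \<theta> (snd x))) \<in> borel_measurable lborel" by simp
      show "AE x in lborel. norm (indicator (layer h L) x *\<^sub>R (q x * \<theta> (snd x))) \<le> norm (indicator (layer h L) x *\<^sub>R q x)"
      proof (rule AE_I2)
        fix x :: space3
        show "norm (indicator (layer h L) x *\<^sub>R (q x * \<theta> (snd x))) \<le> norm (indicator (layer h L) x *\<^sub>R q x)"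
        proof (cases "x \<in> layer h L")
          case True
          then have "norm (\<theta> (snd x)) \<le> 1" using L unfolding \<theta>_def norm_of_real by (auto simp: layer_def abs_if field_simps)
          then have "norm (q x) * norm (\<theta> (snd x)) \<le> norm (q x)" by (intro mult_right_le_one_le) auto
          then show ?thesis using True by (simp add: norm_mult)
        qed simp
      qed
    qed
    moreover have "set_integrable lborel (layer h L) (\<lambda>x. p x * of_real (- 1 / L))"
      using p by (rule set_integrable_mult_left)
    ultimately show "set_integrable lborel (layer h L) (\<lambda>x. p x * of_real (- 1 / L) + q x * \<theta> (snd x))"
      by (intro set_integral_add(1))
  qed (use L in auto)
  moreover have "\<theta> (h + L) = 0" "\<theta> h = 1" using L by (auto simp: \<theta>_def)
  ultimately have "integrable lborel (\<lambda>y. - p (y, h))" by simp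
  then show 1: "integrable lborel (\<lambda>y. p (y, h))" by simp
  note V = layer_vertical_integral[OF deriv cont q L]
  from Bochner_Integration.integrable_add[OF V(1) 1] show 2: "integrable lborel (\<lambda>y. p (y, h + L))" by simp
  show "(LINT x:layer h L|lborel. q x) = (LINT y|lborel. p (y, h + L)) - (LINT y|lborel. p (y, h))"
    using V(2) 1 2 by simp
qed

lemma layer_tangential_integral:
  fixes p q :: "space3 \<Rightarrow> complex"
  assumes deriv: "\<And>y t r. ((\<lambda>r. p (y + r *\<^sub>R j, t)) has_vector_derivative q (y + r *\<^sub>R j, t)) (at r)"
    and cont: "\<And>y t. continuous_on UNIV (\<lambda>r. q (y + r *\<^sub>R j, t))"
    and p: "set_integrable lborel (layer h L) p" and q: "set_integrable lborel (layer h L) q"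
  shows "(LINT x:layer h L|lborel. q x) = 0"
  unfolding set_lebesgue_integral_def
proof (rule integral_directional_derivative_eq_0[where p="\<lambda>x. indicator (layer h L) x *\<^sub>R p x" and i="(j, 0)"])
  fix x :: space3 and r :: real
  obtain y t where x: "x = (y, t)" by (cases x)
  have ind: "indicator (layer h L) (x + r *\<^sub>R (j, 0)) = (indicator (layer h L) x :: real)" for r
    by (simp add: x indicator_layer)
  show "((\<lambda>r. indicator (layer h L) (x + r *\<^sub>R (j, 0)) *\<^sub>R p (x + r *\<^sub>R (j, 0))) has_vector_derivative
     indicator (layer h L) (x + r *\<^sub>R (j, 0)) *\<^sub>R q (x + r *\<^sub>R (j, 0))) (at r)"
    unfolding ind using bounded_linear.has_vector_derivative[OF bounded_linear_scaleR_right deriv[of y t r]]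
    by (simp add: x)
  show "continuous_on UNIV (\<lambda>r. indicator (layer h L) (x + r *\<^sub>R (j, 0)) *\<^sub>R q (x + r *\<^sub>R (j, 0)))"
    unfolding ind using cont[of y t] by (auto simp: x intro!: continuous_intros)
qed (use p q in \<open>auto simp: set_integrable_def\<close>)

section \<open>Superposition of waves\<close>

text \<open>The function on $\mathbb R^3$ whose tangential Fourier transform at height $t$ is
  $a(t,\xi) f(\xi)$.\<close>

definition wave :: "(real \<Rightarrow> real^2 \<Rightarrow> complex) \<Rightarrow> (real^2 \<Rightarrow> complex) \<Rightarrow> space3 \<Rightarrow> complex" where
  "wave a f x = of_real (1 / (gauss_mass TYPE(real^2))\<^sup>2) * ft 1 (\<lambda>\<xi>. a (snd x) \<xi> * f \<xi>) (fst x)"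

text \<open>The symbols of the layer problem grow exponentially with the frequency below the layer.  Bounded
  frequencies make the wave continuously differentiable on the whole space, as the definition of traces by
  \<^const>\<open>C1\<close> functions asks.\<close>

definition band_limited :: "('a::euclidean_space \<Rightarrow> complex) \<Rightarrow> bool" where
  "band_limited f \<longleftrightarrow> integrable lborel f \<and> integrable lborel (\<lambda>\<xi>. (norm (f \<xi>))\<^sup>2) \<and>
     (\<exists>R. \<forall>\<xi>. f \<xi> \<noteq> 0 \<longrightarrow> norm \<xi> \<le> R)"

lemma band_limited_bound:
  fixes a :: "real \<Rightarrow> 'a::euclidean_space \<Rightarrow> complex"
  assumes "band_limited f" "continuous_on UNIV (case_prod a)"
  obtains A where "A \<ge> 0" "\<And>t \<xi>. \<bar>t - t0\<bar> \<le> r \<Longrightarrow> norm (a t \<xi> * f \<xi>) \<le> A * norm (f \<xi>)"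
    "\<And>t \<xi>. \<bar>t - t0\<bar> \<le> r \<Longrightarrow> norm (norm \<xi> * a t \<xi> * f \<xi>) \<le> A * norm (f \<xi>)"
proof -
  obtain R where R: "\<And>\<xi>. f \<xi> \<noteq> 0 \<Longrightarrow> norm \<xi> \<le> R" using assms by (auto simp: band_limited_def)
  have "continuous_on (cball t0 r \<times> cball 0 R) (\<lambda>p. (1 + norm (snd p)) *\<^sub>R case_prod a p)"
    by (intro continuous_intros continuous_on_subset[OF assms(2)]) auto
  then have "bounded ((\<lambda>p. (1 + norm (snd p)) *\<^sub>R case_prod a p) ` (cball t0 r \<times> cball 0 R))"
    by (intro compact_imp_bounded compact_continuous_image compact_Times) auto
  then obtain A where A: "A > 0" "\<And>p. p \<in> cball t0 r \<times> cball 0 R \<Longrightarrow> norm ((1 + norm (snd p)) *\<^sub>R case_prod a p) \<le> A"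
    unfolding bounded_pos by auto
  have le: "(1 + norm \<xi>) * norm (a t \<xi>) \<le> A" if "\<bar>t - t0\<bar> \<le> r" "f \<xi> \<noteq> 0" for t \<xi>
    using A(2)[of "(t, \<xi>)"] R[OF that(2)] that(1) by (simp add: dist_real_def abs_minus_commute)
  have *: "norm (a t \<xi>) \<le> A" "norm \<xi> * norm (a t \<xi>) \<le> A" if "\<bar>t - t0\<bar> \<le> r" "f \<xi> \<noteq> 0" for t \<xi>
    using le[OF that] mult_nonneg_nonneg[OF norm_ge_zero[of \<xi>] norm_ge_zero[of "a t \<xi>"]] norm_ge_zero[of "a t \<xi>"]
    unfolding distrib_right by linarith+
  show ?thesis
  proof (rule that[of A])
    fix t \<xi> assume t: "\<bar>t - t0\<bar> \<le> r"
    show "norm (a t \<xi> * f \<xi>) \<le> A * norm (f \<xi>)"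
      using *(1)[OF t] by (cases "f \<xi> = 0") (auto simp: norm_mult intro: mult_right_mono)
    show "norm (norm \<xi> * a t \<xi> * f \<xi>) \<le> A * norm (f \<xi>)"
      using *(2)[OF t] by (cases "f \<xi> = 0") (auto simp: norm_mult intro: mult_right_mono)
  qed (use A in simp)
qed

lemma continuous_section:
  assumes "continuous_on UNIV (case_prod a)"
  shows "continuous_on UNIV (\<lambda>\<xi>. a t \<xi>)" "continuous_on UNIV (\<lambda>t. a t \<xi>)"
proof -
  have "continuous_on UNIV (\<lambda>\<xi>. case_prod a (t, \<xi>))"
    by (rule continuous_on_compose2[OF assms continuous_on_Pair[OF continuous_on_const continuous_on_id]]) simp
  then show "continuous_on UNIV (\<lambda>\<xi>. a t \<xi>)" by simp
  have "continuous_on UNIV (\<lambda>t. case_prod a (t, \<xi>))"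
    by (rule continuous_on_compose2[OF assms continuous_on_Pair[OF continuous_on_id continuous_on_const]]) simp
  then show "continuous_on UNIV (\<lambda>t. a t \<xi>)" by simp
qed

lemma symbol_measurable:
  fixes a :: "real \<Rightarrow> real^2 \<Rightarrow> complex"
  assumes "continuous_on UNIV (case_prod a)"
  shows "(\<lambda>\<xi>. a t \<xi>) \<in> borel_measurable borel"
  by (rule borel_measurable_continuous_onI[OF continuous_section(1)[OF assms]])

lemma layer_symbol_measurable:
  fixes a :: "real \<Rightarrow> real^2 \<Rightarrow> complex"
  assumes "continuous_on UNIV (case_prod a)"
  shows "(\<lambda>p. indicator {h<..<h + L} (fst p) * a (fst p) (snd p)) \<in> borel_measurable (borel :: (real \<times> (real^2)) measure)"
proof (rule borel_measurable_times)
  have [measurable]: "fst \<in> borel_measurable (borel :: (real \<times> (real^2)) measure)"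
    by (intro borel_measurable_continuous_onI continuous_on_fst continuous_on_id)
  show "(\<lambda>p :: real \<times> (real^2). indicator {h<..<h + L} (fst p) :: complex) \<in> borel_measurable borel" by measurable
  show "(\<lambda>p. a (fst p) (snd p)) \<in> borel_measurable borel"
    using borel_measurable_continuous_onI[OF assms] by (simp add: case_prod_beta')
qed

lemma wave_symbol_integrable:
  fixes a :: "real \<Rightarrow> real^2 \<Rightarrow> complex"
  assumes "band_limited f" "continuous_on UNIV (case_prod a)"
  shows "integrable lborel (\<lambda>\<xi>. a t \<xi> * f \<xi>)"
proof -
  have f: "integrable lborel f" using assms by (simp add: band_limited_def)
  then have [measurable]: "f \<in> borel_measurable borel" by auto
  note [measurable] = symbol_measurable[OF assms(2)]
  obtain A where A: "\<And>s \<xi>. \<bar>s - t\<bar> \<le> 0 \<Longrightarrow> norm (a s \<xi> * f \<xi>) \<le> A * norm (f \<xi>)"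
    using band_limited_bound[OF assms, of t 0] by metis
  show ?thesis
  proof (rule Bochner_Integration.integrable_bound)
    show "integrable lborel (\<lambda>\<xi>. A * norm (f \<xi>))" by (intro integrable_mult_right integrable_norm f)
    show "AE \<xi> in lborel. norm (a t \<xi> * f \<xi>) \<le> norm (A * norm (f \<xi>))"
      by (intro AE_I2 order_trans[OF A]) auto
  qed measurable
qed

text \<open>The symbol of the derivative in direction \<open>i\<close>, where \<open>a'\<close> is the derivative of \<open>a\<close> in the height.\<close>

definition pd_symbol ::
  "(real \<Rightarrow> real^2 \<Rightarrow> complex) \<Rightarrow> (real \<Rightarrow> real^2 \<Rightarrow> complex) \<Rightarrow> space3 \<Rightarrow> real \<Rightarrow> real^2 \<Rightarrow> complex" where
  "pd_symbol a a' i t \<xi> = \<i> * of_real (\<xi> \<bullet> fst i) * a t \<xi> + of_real (snd i) * a' t \<xi>"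

lemma continuous_pd_symbol:
  assumes "continuous_on UNIV (case_prod a)" "continuous_on UNIV (case_prod a')"
  shows "continuous_on UNIV (case_prod (pd_symbol a a' i))"
  using assms unfolding pd_symbol_def[abs_def] case_prod_beta' by (intro continuous_intros) auto

lemma wave_has_derivative:
  fixes f :: "real^2 \<Rightarrow> complex"
  assumes f: "band_limited f" and a: "continuous_on UNIV (case_prod a)" and a': "continuous_on UNIV (case_prod a')"
    and deriv: "\<And>t \<xi>. ((\<lambda>t. a t \<xi>) has_vector_derivative a' t \<xi>) (at t)"
  shows "(wave a f has_derivative (\<lambda>h. \<Sum>i\<in>Basis. (h \<bullet> i) *\<^sub>R wave (pd_symbol a a' i) f x0)) (at x0)"
proof -
  let ?c = "complex_of_real (1 / (gauss_mass TYPE(real^2))\<^sup>2)"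
  have fi: "integrable lborel f" using f by (simp add: band_limited_def)
  then have [measurable]: "f \<in> borel_measurable borel" by auto
  obtain A where A: "A \<ge> 0" "\<And>t \<xi>. \<bar>t - snd x0\<bar> \<le> 1 \<Longrightarrow> norm (norm \<xi> * a t \<xi> * f \<xi>) \<le> A * norm (f \<xi>)"
    using band_limited_bound[OF f a, of "snd x0" 1] by metis
  obtain A' where A': "A' \<ge> 0" "\<And>t \<xi>. \<bar>t - snd x0\<bar> \<le> 1 \<Longrightarrow> norm (a' t \<xi> * f \<xi>) \<le> A' * norm (f \<xi>)"
    using band_limited_bound[OF f a', of "snd x0" 1] by metis
  define E where "E \<xi> x = exp (\<i> * complex_of_real (1 * (\<xi> \<bullet> fst x)))" for \<xi> and x :: space3
  define d where "d i x \<xi> = E \<xi> x * (pd_symbol a a' i (snd x) \<xi> * f \<xi>)" for i x \<xi>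
  have "((\<lambda>x. LINT \<xi>|lborel. E \<xi> x * (a (snd x) \<xi> * f \<xi>)) has_derivative
      (\<lambda>h. \<Sum>i\<in>Basis. (h \<bullet> i) *\<^sub>R (LINT \<xi>|lborel. d i x0 \<xi>))) (at x0)"
  proof (rule has_derivative_integral[where e=1 and B="\<lambda>\<xi>. (A + A') * norm (f \<xi>)"])
    fix x :: space3 and \<xi> :: "real^2" assume x: "x \<in> ball x0 1"
    have E: "((\<lambda>x. E \<xi> x) has_derivative (\<lambda>h. (\<i> * of_real (1 * (\<xi> \<bullet> fst h))) * E \<xi> x)) (at x)"
      unfolding E_def
      by (rule has_derivative_compose[OF has_derivative_fst[OF has_derivative_ident] has_derivative_character[of 1 \<xi> "fst x"]])
    have "((\<lambda>x. a (snd x) \<xi>) has_derivative (\<lambda>h. snd h *\<^sub>R a' (snd x) \<xi>)) (at x)"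
      by (rule has_derivative_compose[OF has_derivative_snd[OF has_derivative_ident] deriv[unfolded has_vector_derivative_def]])
    from has_derivative_mult[OF E has_derivative_mult_left[OF this, of "f \<xi>"]]
    have D: "((\<lambda>x. E \<xi> x * (a (snd x) \<xi> * f \<xi>)) has_derivative (\<lambda>h. d h x \<xi>)) (at x)"
      by (rule has_derivative_eq_rhs) (simp add: fun_eq_iff d_def pd_symbol_def scaleR_conv_of_real algebra_simps)
    have eq: "d h x \<xi> = (\<Sum>i\<in>Basis. (h \<bullet> i) *\<^sub>R d i x \<xi>)" for h
    proof -
      have lin: "linear (\<lambda>h. d h x \<xi>)" using has_derivative_linear[OF D] .
      have "d h x \<xi> = d (\<Sum>i\<in>Basis. (h \<bullet> i) *\<^sub>R i) x \<xi>" by (simp add: euclidean_representation)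
      also have "\<dots> = (\<Sum>i\<in>Basis. d ((h \<bullet> i) *\<^sub>R i) x \<xi>)" using linear_sum[OF lin] by simp
      also have "\<dots> = (\<Sum>i\<in>Basis. (h \<bullet> i) *\<^sub>R d i x \<xi>)" using linear_scale[OF lin] by simp
      finally show ?thesis .
    qed
    show "((\<lambda>x. E \<xi> x * (a (snd x) \<xi> * f \<xi>)) has_derivative (\<lambda>h. \<Sum>i\<in>Basis. (h \<bullet> i) *\<^sub>R d i x \<xi>)) (at x)"
      by (rule has_derivative_eq_rhs[OF D], rule ext, rule eq)
    show "norm (d i x \<xi>) \<le> (A + A') * norm (f \<xi>)" if i: "i \<in> Basis" for i
    proof -
      have t: "\<bar>snd x - snd x0\<bar> \<le> 1" using x dist_snd_le[of x x0] by (simp add: dist_real_def dist_commute)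
      have n: "norm (fst i) \<le> 1" "\<bar>snd i\<bar> \<le> 1"
        using norm_Basis[OF i] norm_fst_le[of "fst i" "snd i"] norm_snd_le[of "snd i" "fst i"] by auto
      have "\<bar>\<xi> \<bullet> fst i\<bar> \<le> norm \<xi>"
        using Cauchy_Schwarz_ineq2[of \<xi> "fst i"] n(1) by (meson mult_right_le_one_le norm_ge_zero order_trans)
      then have "\<bar>\<xi> \<bullet> fst i\<bar> * norm (a (snd x) \<xi> * f \<xi>) \<le> norm \<xi> * norm (a (snd x) \<xi> * f \<xi>)" by (rule mult_right_mono) simp
      also have "\<dots> \<le> A * norm (f \<xi>)" using A(2)[OF t, of \<xi>] by (simp add: norm_mult mult.assoc)
      finally have 1: "norm (\<i> * of_real (\<xi> \<bullet> fst i) * a (snd x) \<xi> * f \<xi>) \<le> A * norm (f \<xi>)" by (simp add: norm_mult mult.assoc)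
      have "\<bar>snd i\<bar> * norm (a' (snd x) \<xi> * f \<xi>) \<le> 1 * norm (a' (snd x) \<xi> * f \<xi>)" using n(2) by (rule mult_right_mono) simp
      also have "\<dots> \<le> A' * norm (f \<xi>)" using A'(2)[OF t, of \<xi>] by simp
      finally have 2: "norm (of_real (snd i) * a' (snd x) \<xi> * f \<xi>) \<le> A' * norm (f \<xi>)" by (simp add: norm_mult mult.assoc)
      have "norm (d i x \<xi>) = norm (\<i> * of_real (\<xi> \<bullet> fst i) * a (snd x) \<xi> * f \<xi> + of_real (snd i) * a' (snd x) \<xi> * f \<xi>)"
        unfolding d_def E_def norm_mult norm_exp_i mult_1_left pd_symbol_def distrib_right[symmetric] by simp
      also have "\<dots> \<le> (A + A') * norm (f \<xi>)" unfolding distrib_right by (rule norm_triangle_mono[OF 1 2])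
      finally show ?thesis .
    qed
  next
    show "integrable lborel (\<lambda>\<xi>. (A + A') * norm (f \<xi>))" by (intro integrable_mult_right integrable_norm fi)
    show "integrable lborel (\<lambda>\<xi>. E \<xi> x * (a (snd x) \<xi> * f \<xi>))" for x
      unfolding E_def by (intro integrable_character_mult wave_symbol_integrable f a) simp
    show "d i x0 \<in> borel_measurable lborel" for i
      unfolding d_def E_def using symbol_measurable[OF continuous_pd_symbol[OF a a']] by measurable
  qed simp
  from has_derivative_mult_right[OF this, of ?c]
  have "((\<lambda>x. ?c * (LINT \<xi>|lborel. E \<xi> x * (a (snd x) \<xi> * f \<xi>))) has_derivative
      (\<lambda>h. \<Sum>i\<in>Basis. (h \<bullet> i) *\<^sub>R (?c * (LINT \<xi>|lborel. d i x0 \<xi>)))) (at x0)"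
    by (rule has_derivative_eq_rhs) (simp only: sum_distrib_left mult_scaleR_right)
  then show ?thesis unfolding wave_def[abs_def] ft_def d_def E_def .
qed

lemma wave_continuous:
  fixes f :: "real^2 \<Rightarrow> complex"
  assumes f: "band_limited f" and a: "continuous_on UNIV (case_prod a)"
  shows "continuous_on UNIV (wave a f)"
proof -
  have fi: "integrable lborel f" using f by (simp add: band_limited_def)
  then have [measurable]: "f \<in> borel_measurable borel" by auto
  note [measurable] = symbol_measurable[OF a]
  have "isCont (wave a f) x0" for x0
    unfolding isCont_def tendsto_at_iff_sequentially
  proof (intro allI impI)
    fix X assume X: "X \<longlonglongrightarrow> x0"
    obtain A where A: "\<And>t \<xi>. \<bar>t - snd x0\<bar> \<le> 1 \<Longrightarrow> norm (a t \<xi> * f \<xi>) \<le> A * norm (f \<xi>)"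
      using band_limited_bound[OF f a, of "snd x0" 1] by metis
    have sX: "(\<lambda>n. snd (X n)) \<longlonglongrightarrow> snd x0" using X by (rule tendsto_snd)
    then have "\<forall>\<^sub>F n in sequentially. dist (snd (X n)) (snd x0) < 1" by (rule tendstoD) simp
    then obtain N where N: "\<And>n. n \<ge> N \<Longrightarrow> \<bar>snd (X n) - snd x0\<bar> \<le> 1"
      unfolding eventually_sequentially dist_real_def by (metis less_imp_le)
    have "(\<lambda>n. ft 1 (\<lambda>\<xi>. a (snd (X (n + N))) \<xi> * f \<xi>) (fst (X (n + N)))) \<longlonglongrightarrow> ft 1 (\<lambda>\<xi>. a (snd x0) \<xi> * f \<xi>) (fst x0)"
      unfolding ft_def
    proof (rule integral_dominated_convergence[where w="\<lambda>\<xi>. A * norm (f \<xi>)"])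
      show "AE \<xi> in lborel. (\<lambda>n. exp (\<i> * complex_of_real (1 * (\<xi> \<bullet> fst (X (n + N))))) * (a (snd (X (n + N))) \<xi> * f \<xi>))
        \<longlonglongrightarrow> exp (\<i> * complex_of_real (1 * (\<xi> \<bullet> fst x0))) * (a (snd x0) \<xi> * f \<xi>)"
      proof (rule AE_I2)
        fix \<xi>
        have XN: "(\<lambda>n. X (n + N)) \<longlonglongrightarrow> x0" using X by (rule LIMSEQ_ignore_initial_segment)
        have "isCont (\<lambda>t. a t \<xi>) (snd x0)" using continuous_section(2)[OF a, of \<xi>] by (simp add: continuous_on_eq_continuous_at)
        from isCont_tendsto_compose[OF this tendsto_snd[OF XN]]
        show "(\<lambda>n. exp (\<i> * complex_of_real (1 * (\<xi> \<bullet> fst (X (n + N))))) * (a (snd (X (n + N))) \<xi> * f \<xi>))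
          \<longlonglongrightarrow> exp (\<i> * complex_of_real (1 * (\<xi> \<bullet> fst x0))) * (a (snd x0) \<xi> * f \<xi>)"
          by (intro tendsto_intros tendsto_fst[OF XN])
      qed
      show "AE \<xi> in lborel. norm (exp (\<i> * complex_of_real (1 * (\<xi> \<bullet> fst (X (n + N))))) * (a (snd (X (n + N))) \<xi> * f \<xi>)) \<le> A * norm (f \<xi>)" for n
      proof (rule AE_I2)
        fix \<xi>
        show "norm (exp (\<i> * complex_of_real (1 * (\<xi> \<bullet> fst (X (n + N))))) * (a (snd (X (n + N))) \<xi> * f \<xi>)) \<le> A * norm (f \<xi>)"
          using A[OF N[of "n + N"], of \<xi>] unfolding norm_mult[of "exp _"] norm_exp_i by simp
      qed
      show "integrable lborel (\<lambda>\<xi>. A * norm (f \<xi>))" by (intro integrable_mult_right integrable_norm fi)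
    qed measurable
    then have "(\<lambda>n. wave a f (X (n + N))) \<longlonglongrightarrow> wave a f x0"
      unfolding wave_def by (intro tendsto_intros)
    then show "(wave a f \<circ> X) \<longlonglongrightarrow> wave a f x0" unfolding o_def by (rule LIMSEQ_offset)
  qed
  then show ?thesis by (simp add: continuous_on_eq_continuous_at)
qed

lemma wave_C1:
  fixes f :: "real^2 \<Rightarrow> complex"
  assumes f: "band_limited f" and a: "continuous_on UNIV (case_prod a)" and a': "continuous_on UNIV (case_prod a')"
    and deriv: "\<And>t \<xi>. ((\<lambda>t. a t \<xi>) has_vector_derivative a' t \<xi>) (at t)"
  shows "C1 (wave a f)" "\<And>i. i \<in> Basis \<Longrightarrow> pd i (wave a f) = wave (pd_symbol a a' i) f"
proof -
  note D = wave_has_derivative[OF assms]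
  show pd: "pd i (wave a f) = wave (pd_symbol a a' i) f" if "i \<in> Basis" for i
    by (rule ext, subst pd_eqI[OF D]) (simp add: inner_Basis that if_distrib if_distribR cong: if_cong)
  show "C1 (wave a f)" unfolding C1_def
    using D pd by (auto simp: differentiable_def intro: wave_continuous[OF f continuous_pd_symbol[OF a a']])
qed

lemma wave_measurable:
  fixes f :: "real^2 \<Rightarrow> complex"
  assumes [measurable]: "(\<lambda>p. indicator {h<..<h + L} (fst p) * a (fst p) (snd p)) \<in> borel_measurable borel" "f \<in> borel_measurable borel"
  shows "(\<lambda>x. indicator (layer h L) x *\<^sub>R wave a f x) \<in> borel_measurable borel"
proof -
  define b where "b p = indicator {h<..<h + L} (fst p) * a (fst p) (snd p)" for p :: "real \<times> (real^2)"
  have [measurable]: "b \<in> borel_measurable borel" unfolding b_def by measurable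
  have "(\<lambda>x. of_real (1 / (gauss_mass TYPE(real^2))\<^sup>2) * ft 1 (\<lambda>\<xi>. b (snd x, \<xi>) * f \<xi>) (fst x)) \<in> borel_measurable (borel :: space3 measure)"
  proof -
    have "(\<lambda>x. LINT \<xi>|lborel. exp (\<i> * of_real (1 * (\<xi> \<bullet> fst x))) * (b (snd x, \<xi>) * f \<xi>)) \<in> borel_measurable (borel :: space3 measure)"
    proof (rule lborel.borel_measurable_lebesgue_integral)
      have [measurable]: "snd \<in> borel_measurable (borel :: space3 measure)" "fst \<in> borel_measurable (borel :: space3 measure)"
        by (intro borel_measurable_continuous_onI continuous_on_snd continuous_on_fst continuous_on_id)+
      have [measurable]: "(\<lambda>p. b (snd (fst p), snd p)) \<in> borel_measurable ((borel :: space3 measure) \<Otimes>\<^sub>M lborel)"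
      proof -
        have "(\<lambda>p. (snd (fst p), snd p)) \<in> (borel :: space3 measure) \<Otimes>\<^sub>M lborel \<rightarrow>\<^sub>M (borel :: real measure) \<Otimes>\<^sub>M (borel :: (real^2) measure)"
          by measurable
        then have "(\<lambda>p. (snd (fst p), snd p)) \<in> (borel :: space3 measure) \<Otimes>\<^sub>M lborel \<rightarrow>\<^sub>M (borel :: (real \<times> (real^2)) measure)"
          by (simp only: borel_prod)
        from measurable_compose[OF this \<open>b \<in> borel_measurable borel\<close>] show ?thesis .
      qed
      show "(\<lambda>(x, \<xi>). exp (\<i> * of_real (1 * (\<xi> \<bullet> fst x))) * (b (snd x, \<xi>) * f \<xi>)) \<in> borel_measurable ((borel :: space3 measure) \<Otimes>\<^sub>M lborel)"
        unfolding case_prod_beta' by measurable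
    qed
    then show ?thesis unfolding ft_def by measurable
  qed
  moreover have "indicator (layer h L) x *\<^sub>R wave a f x = of_real (1 / (gauss_mass TYPE(real^2))\<^sup>2) * ft 1 (\<lambda>\<xi>. b (snd x, \<xi>) * f \<xi>) (fst x)" for x
    by (cases "x \<in> layer h L") (auto simp: wave_def b_def layer_def ft_def)
  ultimately show ?thesis by simp
qed

text \<open>The Plancherel inequality on every horizontal plane, integrated over the height.\<close>

lemma wave_energy:
  fixes f :: "real^2 \<Rightarrow> complex"
  assumes m: "(\<lambda>p. indicator {h<..<h + L} (fst p) * a (fst p) (snd p)) \<in> borel_measurable borel" "f \<in> borel_measurable borel"
    and int: "\<And>t. h < t \<Longrightarrow> t < h + L \<Longrightarrow> integrable lborel (\<lambda>\<xi>. a t \<xi> * f \<xi>)"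
  shows "(\<integral>\<^sup>+x. ennreal ((norm (indicator (layer h L) x *\<^sub>R wave a f x))\<^sup>2) \<partial>lborel) \<le>
    ennreal (1 / (gauss_mass TYPE(real^2))\<^sup>2) *
      (\<integral>\<^sup>+t. \<integral>\<^sup>+\<xi>. indicator {h<..<h + L} t * ennreal ((norm (a t \<xi> * f \<xi>))\<^sup>2) \<partial>lborel \<partial>lborel)"
proof -
  let ?K = "(gauss_mass TYPE(real^2))\<^sup>2"
  have K: "?K > 0" using gauss_mass_pos[where 'a="real^2"] by simp
  note [measurable] = wave_measurable[OF m]
  have plane: "(\<integral>\<^sup>+y. ennreal ((norm (indicator (layer h L) (y, t) *\<^sub>R wave a f (y, t)))\<^sup>2) \<partial>lborel) \<le>
    ennreal (1 / ?K) * (\<integral>\<^sup>+\<xi>. indicator {h<..<h + L} t * ennreal ((norm (a t \<xi> * f \<xi>))\<^sup>2) \<partial>lborel)" for t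
  proof (cases "h < t \<and> t < h + L")
    case True
    note I = int[OF conjunct1[OF True] conjunct2[OF True]]
    have [measurable]: "(\<lambda>\<xi>. a t \<xi> * f \<xi>) \<in> borel_measurable borel" using I by auto
    have "(\<integral>\<^sup>+y. ennreal ((norm (indicator (layer h L) (y, t) *\<^sub>R wave a f (y, t)))\<^sup>2) \<partial>lborel) =
       (\<integral>\<^sup>+y. ennreal ((1 / ?K)\<^sup>2) * ennreal ((norm (ft 1 (\<lambda>\<xi>. a t \<xi> * f \<xi>) y))\<^sup>2) \<partial>lborel)"
      using True by (intro nn_integral_cong)
        (simp add: indicator_layer wave_def norm_mult power_mult_distrib norm_divide norm_power power_divide ennreal_mult[symmetric])
    also have "\<dots> = ennreal ((1 / ?K)\<^sup>2) * (\<integral>\<^sup>+y. ennreal ((norm (ft 1 (\<lambda>\<xi>. a t \<xi> * f \<xi>) y))\<^sup>2) \<partial>lborel)"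
      by (rule nn_integral_cmult) measurable
    also have "\<dots> \<le> ennreal ((1 / ?K)\<^sup>2) * (ennreal ?K * (\<integral>\<^sup>+\<xi>. ennreal ((norm (a t \<xi> * f \<xi>))\<^sup>2) \<partial>lborel))"
      by (intro mult_left_mono plancherel_inequality I) auto
    also have "\<dots> = ennreal ((1 / ?K)\<^sup>2 * ?K) * (\<integral>\<^sup>+\<xi>. ennreal ((norm (a t \<xi> * f \<xi>))\<^sup>2) \<partial>lborel)"
      by (subst ennreal_mult) (auto simp: mult.assoc)
    also have "(1 / ?K)\<^sup>2 * ?K = 1 / ?K" using K by (simp add: power2_eq_square)
    finally show ?thesis using True by simp
  qed (auto simp: indicator_layer)
  define G where "G x = ennreal ((norm (indicator (layer h L) x *\<^sub>R wave a f x))\<^sup>2)" for x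
  have "G \<in> borel_measurable borel" unfolding G_def by measurable
  then have G: "G \<in> borel_measurable (lborel \<Otimes>\<^sub>M lborel)" by (simp add: lborel_prod)
  have "(\<integral>\<^sup>+x. ennreal ((norm (indicator (layer h L) x *\<^sub>R wave a f x))\<^sup>2) \<partial>lborel) =
      (\<integral>\<^sup>+t. \<integral>\<^sup>+y. ennreal ((norm (indicator (layer h L) (y, t) *\<^sub>R wave a f (y, t)))\<^sup>2) \<partial>lborel \<partial>lborel)"
    using lborel_pair.nn_integral_snd[OF G, symmetric] unfolding lborel_prod G_def .
  also have "\<dots> \<le> (\<integral>\<^sup>+t. ennreal (1 / ?K) * (\<integral>\<^sup>+\<xi>. indicator {h<..<h + L} t * ennreal ((norm (a t \<xi> * f \<xi>))\<^sup>2) \<partial>lborel) \<partial>lborel)"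
    by (intro nn_integral_mono plane)
  also have "\<dots> = ennreal (1 / ?K) *
      (\<integral>\<^sup>+t. \<integral>\<^sup>+\<xi>. indicator {h<..<h + L} t * ennreal ((norm (a t \<xi> * f \<xi>))\<^sup>2) \<partial>lborel \<partial>lborel)"
  proof (rule nn_integral_cmult)
    have "(\<lambda>(t, \<xi>). indicator {h<..<h + L} t * ennreal ((norm (a t \<xi> * f \<xi>))\<^sup>2)) =
        (\<lambda>p. ennreal ((norm ((indicator {h<..<h + L} (fst p) * a (fst p) (snd p)) * f (snd p)))\<^sup>2))"
      by (auto simp: fun_eq_iff indicator_def)
    moreover have "(\<lambda>p. indicator {h<..<h + L} (fst p) * a (fst p) (snd p)) \<in> borel_measurable (lborel \<Otimes>\<^sub>M (lborel :: (real^2) measure))"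
      using m(1) by (simp add: lborel_prod)
    ultimately have "(\<lambda>(t, \<xi>). indicator {h<..<h + L} t * ennreal ((norm (a t \<xi> * f \<xi>))\<^sup>2)) \<in> borel_measurable (lborel \<Otimes>\<^sub>M lborel)"
      using m(2) by simp
    then show "(\<lambda>t. \<integral>\<^sup>+\<xi>. indicator {h<..<h + L} t * ennreal ((norm (a t \<xi> * f \<xi>))\<^sup>2) \<partial>lborel) \<in> borel_measurable lborel"
      by (rule lborel.borel_measurable_nn_integral)
  qed
  finally show ?thesis .
qed

section \<open>The stretched coordinate and the symbol of the layer\<close>

text \<open>An exponent greater than $1$ removes the corner of the positive part, which makes the stretched height
  differentiable across the lower boundary.\<close>

lemma max_power_has_derivative:
  assumes "m \<ge> 1"
  shows "((\<lambda>u::real. (max 0 u) ^ Suc m) has_real_derivative real (Suc m) * (max 0 u) ^ m) (at u)"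
proof -
  consider "u > 0" | "u < 0" | "u = 0" by linarith
  then show ?thesis
  proof cases
    case 1
    have "((\<lambda>u::real. u ^ Suc m) has_real_derivative real (Suc m) * (max 0 u) ^ m) (at u)"
      using 1 DERIV_pow[of "Suc m" u] by simp
    then show ?thesis
      by (rule has_field_derivative_transform_within_open[where S="{0<..}"]) (use 1 in auto)
  next
    case 2
    have "((\<lambda>u::real. 0) has_real_derivative real (Suc m) * (max 0 u) ^ m) (at u)"
      using 2 assms by (simp add: power_0_left)
    then show ?thesis
      by (rule has_field_derivative_transform_within_open[where S="{..<0}"]) (use 2 in auto)
  next
    case 3
    have "((\<lambda>h::real. \<bar>h\<bar> ^ m) \<longlongrightarrow> \<bar>0\<bar> ^ m) (at 0)" by (intro tendsto_intros)
    then have lim: "((\<lambda>h::real. \<bar>h\<bar> ^ m) \<longlongrightarrow> 0) (at 0)" using assms by (simp add: power_0_left)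
    have "((\<lambda>h::real. (max 0 h) ^ Suc m / h) \<longlongrightarrow> 0) (at 0)"
      by (rule Lim_null_comparison[OF _ lim]) (auto intro!: always_eventually simp: max_def)
    then show ?thesis using 3 assms by (simp add: has_field_derivative_iff power_0_left)
  qed
qed

lemma norm_sinh_le: "norm (sinh z) \<le> exp \<bar>Re z\<bar>" and norm_cosh_le: "norm (cosh z) \<le> exp \<bar>Re z\<bar>"
  for z :: complex
proof -
  have e: "norm (exp z) \<le> exp \<bar>Re z\<bar>" "norm (exp (- z)) \<le> exp \<bar>Re z\<bar>" by (auto simp: norm_exp_eq_Re)
  have "norm (exp z - exp (- z)) \<le> 2 * exp \<bar>Re z\<bar>" "norm (exp z + exp (- z)) \<le> 2 * exp \<bar>Re z\<bar>"
    using norm_triangle_ineq4[of "exp z" "exp (- z)"] norm_triangle_ineq[of "exp z" "exp (- z)"] e by linarith+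
  then show "norm (sinh z) \<le> exp \<bar>Re z\<bar>" "norm (cosh z) \<le> exp \<bar>Re z\<bar>"
    unfolding sinh_def cosh_def by auto
qed

lemma norm_sinh_ge: "(exp (Re z) - exp (- Re z)) / 2 \<le> norm (sinh z)" for z :: complex
  unfolding sinh_def using norm_triangle_ineq2[of "exp z" "exp (- z)"] by (simp add: norm_exp_eq_Re)

locale pml_layer =
  fixes s :: complex and c h L \<sigma>\<^sub>0 :: real and m :: nat
  assumes Re_s: "Re s > 0" and c_pos: "c > 0" and L_pos: "L > 0" and \<sigma>\<^sub>0_pos: "\<sigma>\<^sub>0 > 0" and m_ge_1: "m \<ge> 1"
begin

abbreviation "\<sigma> \<equiv> pml_\<sigma> s h L \<sigma>\<^sub>0 m"
abbreviation "\<Omega> \<equiv> layer h L"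
abbreviation "\<beta> \<equiv> symbol_\<beta> s c"
abbreviation "form \<equiv> pml_form s c h L \<sigma>\<^sub>0 m"

definition \<sigma>_max :: real where "\<sigma>_max = 1 + inverse (Re s) * \<sigma>\<^sub>0"

text \<open>The stretched height $\int_h^t \sigma$, which is $t - h$ below the layer.\<close>

definition S :: "real \<Rightarrow> real" where
  "S t = (t - h) + inverse (Re s) * \<sigma>\<^sub>0 * L / (real m + 1) * (max 0 ((t - h) / L)) ^ Suc m"

text \<open>The stretched thickness $\widetilde L$.\<close>

definition Lt :: real where "Lt = (1 + inverse (Re s) * \<sigma>\<^sub>0 / (real m + 1)) * L"

lemma \<sigma>_eq: "\<sigma> t = 1 + inverse (Re s) * \<sigma>\<^sub>0 * (max 0 ((t - h) / L)) ^ m"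
  using L_pos m_ge_1 by (auto simp: pml_\<sigma>_def max_def divide_simps)

lemma \<sigma>_ge_1: "\<sigma> t \<ge> 1"
  unfolding \<sigma>_eq using Re_s \<sigma>\<^sub>0_pos by simp

lemma \<sigma>_le: "t \<le> h + L \<Longrightarrow> \<sigma> t \<le> \<sigma>_max"
  unfolding \<sigma>_eq \<sigma>_max_def using Re_s \<sigma>\<^sub>0_pos L_pos
  by (auto intro!: mult_right_le_one_le power_le_one simp: divide_simps)

lemma \<sigma>_max_ge_1: "\<sigma>_max \<ge> 1"
  unfolding \<sigma>_max_def using Re_s \<sigma>\<^sub>0_pos by simp

lemma \<sigma>_continuous: "continuous_on A \<sigma>"
proof -
  have "continuous_on A (\<lambda>t. 1 + inverse (Re s) * \<sigma>\<^sub>0 * (max 0 ((t - h) / L)) ^ m)"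
    using L_pos by (intro continuous_intros) auto
  then show ?thesis by (simp add: \<sigma>_eq[abs_def])
qed

lemma \<sigma>_measurable [measurable]: "\<sigma> \<in> borel_measurable borel"
  by (rule borel_measurable_continuous_onI[OF \<sigma>_continuous])

lemma S_has_derivative: "(S has_real_derivative \<sigma> t) (at t)"
proof -
  have 1: "((\<lambda>t. (t - h) / L) has_real_derivative 1 / L) (at t)"
    using L_pos by (auto intro!: derivative_eq_intros)
  have "((\<lambda>t. (t - h) + inverse (Re s) * \<sigma>\<^sub>0 * L / (real m + 1) * (max 0 ((t - h) / L)) ^ Suc m) has_real_derivative
      1 + inverse (Re s) * \<sigma>\<^sub>0 * L / (real m + 1) * (real (Suc m) * (max 0 ((t - h) / L)) ^ m * (1 / L))) (at t)"
    by (intro DERIV_add DERIV_cmult DERIV_chain2[OF max_power_has_derivative[OF m_ge_1] 1])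
      (auto intro!: derivative_eq_intros)
  moreover have "1 + inverse (Re s) * \<sigma>\<^sub>0 * L / (real m + 1) * (real (Suc m) * (max 0 ((t - h) / L)) ^ m * (1 / L)) = \<sigma> t"
  proof -
    have "A * L / M * (M * x * (1 / L)) = A * x" if "M \<noteq> 0" for A M x :: real using that L_pos by simp
    from this[of "real m + 1"] show ?thesis unfolding \<sigma>_eq by (simp only: of_nat_Suc add.commute[of 1])
  qed
  ultimately show ?thesis unfolding S_def[abs_def] by simp
qed

lemma S_continuous: "continuous_on A S"
  by (auto intro!: continuous_at_imp_continuous_on DERIV_isCont S_has_derivative)

lemma S_h [simp]: "S h = 0" and S_top [simp]: "S (h + L) = Lt"
  using L_pos m_ge_1 by (auto simp: S_def Lt_def algebra_simps)

lemma S_ge: "t - h \<le> S t"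
  unfolding S_def using Re_s \<sigma>\<^sub>0_pos L_pos by simp

lemma S_le: "t \<le> h + L \<Longrightarrow> S t \<le> Lt"
proof -
  assume t: "t \<le> h + L"
  have "(max 0 ((t - h) / L)) ^ Suc m \<le> 1" using t L_pos by (intro power_le_one) (auto simp: divide_simps)
  then have "inverse (Re s) * \<sigma>\<^sub>0 * L / (real m + 1) * (max 0 ((t - h) / L)) ^ Suc m \<le> inverse (Re s) * \<sigma>\<^sub>0 * L / (real m + 1)"
    using Re_s \<sigma>\<^sub>0_pos L_pos by (intro mult_right_le_one_le) auto
  moreover have "Lt = L + inverse (Re s) * \<sigma>\<^sub>0 * L / (real m + 1)" by (simp add: Lt_def algebra_simps)
  ultimately show ?thesis using t unfolding S_def by linarith
qed

lemma Lt_pos: "Lt > 0"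
  using S_ge[of "h + L"] L_pos by simp

subsection \<open>The square root\<close>

definition radicand :: "real^2 \<Rightarrow> complex" where
  "radicand \<xi> = s\<^sup>2 / (of_real c)\<^sup>2 + of_real ((norm \<xi>)\<^sup>2)"

lemma \<beta>_def: "\<beta> \<xi> = csqrt (radicand \<xi>)"
  by (simp add: symbol_\<beta>_def radicand_def)

lemma \<beta>_squared: "(\<beta> \<xi>)\<^sup>2 = radicand \<xi>"
  by (simp add: \<beta>_def)

lemma Re_radicand: "Re (radicand \<xi>) = ((Re s)\<^sup>2 - (Im s)\<^sup>2) / c\<^sup>2 + (norm \<xi>)\<^sup>2"
  and Im_radicand: "Im (radicand \<xi>) = 2 * Re s * Im s / c\<^sup>2"
proof -
  have "s\<^sup>2 / (of_real c)\<^sup>2 = s\<^sup>2 / of_real (c\<^sup>2)" by simp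
  then show "Re (radicand \<xi>) = ((Re s)\<^sup>2 - (Im s)\<^sup>2) / c\<^sup>2 + (norm \<xi>)\<^sup>2" "Im (radicand \<xi>) = 2 * Re s * Im s / c\<^sup>2"
    unfolding radicand_def by (simp_all only: plus_complex.sel Re_divide_of_real Im_divide_of_real Re_complex_of_real
      Im_complex_of_real Re_power2 Im_power2 add_0_right)
qed

lemma radicand_slit: "radicand \<xi> \<notin> \<real>\<^sub>\<le>\<^sub>0"
proof
  assume *: "radicand \<xi> \<in> \<real>\<^sub>\<le>\<^sub>0"
  then have "Im s = 0" using Im_radicand[of \<xi>] Re_s c_pos by (simp add: complex_nonpos_Reals_iff)
  then have "Re (radicand \<xi>) > 0" unfolding Re_radicand using Re_s c_pos by (intro add_pos_nonneg) auto
  then show False using * by (simp add: complex_nonpos_Reals_iff)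
qed

lemma Re_\<beta>_pos: "Re (\<beta> \<xi>) > 0"
proof -
  have "Re (\<beta> \<xi>) \<noteq> 0"
  proof
    assume "Re (\<beta> \<xi>) = 0"
    then have "Im (radicand \<xi>) = 0" "Re (radicand \<xi>) \<le> 0" unfolding \<beta>_squared[symmetric] by (auto simp: Re_power2 Im_power2)
    then show False using radicand_slit[of \<xi>] by (simp add: complex_nonpos_Reals_iff)
  qed
  then show ?thesis using Re_csqrt[of "radicand \<xi>"] unfolding \<beta>_def by linarith
qed

lemma Re_Im_\<beta>: "(Re (\<beta> \<xi>))\<^sup>2 - (Im (\<beta> \<xi>))\<^sup>2 = ((Re s)\<^sup>2 - (Im s)\<^sup>2) / c\<^sup>2 + (norm \<xi>)\<^sup>2"
  "Re (\<beta> \<xi>) * Im (\<beta> \<xi>) = Re s * Im s / c\<^sup>2"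
  using arg_cong[OF \<beta>_squared[of \<xi>], of Re] arg_cong[OF \<beta>_squared[of \<xi>], of Im]
  unfolding Re_radicand Im_radicand Re_power2 Im_power2 by auto

text \<open>Put $x = s_1/c$ and $y = s_2/c$.  The imaginary part of $\beta^2$ gives
  $\mathrm{Re}\,\beta\,\mathrm{Im}\,\beta = xy$.  If $\mathrm{Re}\,\beta < x$, then
  $|\mathrm{Im}\,\beta| \ge |y|$, and $(\mathrm{Re}\,\beta)^2 - (\mathrm{Im}\,\beta)^2 < x^2 - y^2$
  contradicts the real part.\<close>

lemma Re_\<beta>_ge: "Re s / c \<le> Re (\<beta> \<xi>)"
proof (rule ccontr)
  let ?b = "Re (\<beta> \<xi>)" and ?d = "Im (\<beta> \<xi>)" and ?x = "Re s / c" and ?y = "Im s / c"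
  assume "\<not> ?x \<le> ?b"
  then have lt: "?b < ?x" by simp
  have b: "?b > 0" by (rule Re_\<beta>_pos)
  have b2: "?b\<^sup>2 < ?x\<^sup>2" using lt b by (intro power_strict_mono) auto
  have prod: "?b * ?d = ?x * ?y" unfolding Re_Im_\<beta>(2) by (simp add: power2_eq_square)
  have diff: "?b\<^sup>2 - ?d\<^sup>2 = ?x\<^sup>2 - ?y\<^sup>2 + (norm \<xi>)\<^sup>2"
    unfolding Re_Im_\<beta>(1) by (simp add: power_divide diff_divide_distrib)
  have "?b\<^sup>2 * ?d\<^sup>2 = ?x\<^sup>2 * ?y\<^sup>2" using prod by (metis power_mult_distrib)
  moreover have "?b\<^sup>2 * ?y\<^sup>2 \<le> ?x\<^sup>2 * ?y\<^sup>2" using b2 by (intro mult_right_mono) auto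
  ultimately have "?b\<^sup>2 * ?y\<^sup>2 \<le> ?b\<^sup>2 * ?d\<^sup>2" by simp
  then have "?y\<^sup>2 \<le> ?d\<^sup>2" using b by (simp add: mult_le_cancel_left)
  then show False using diff b2 zero_le_power2[of "norm \<xi>"] by linarith
qed

lemma norm_\<beta>_sq: "(norm (\<beta> \<xi>))\<^sup>2 \<le> (max 1 (norm s / c))\<^sup>2 * (1 + (norm \<xi>)\<^sup>2)"
proof -
  let ?m = "max 1 (norm s / c)"
  have m: "1 \<le> ?m\<^sup>2" "(norm s / c)\<^sup>2 \<le> ?m\<^sup>2" using c_pos by (auto intro!: one_le_power power_mono)
  have "(norm (\<beta> \<xi>))\<^sup>2 = norm (radicand \<xi>)" unfolding \<beta>_squared[symmetric] by (simp add: norm_power)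
  also have "\<dots> \<le> (norm s / c)\<^sup>2 + (norm \<xi>)\<^sup>2" unfolding radicand_def
    by (rule norm_triangle_mono) (use c_pos in \<open>auto simp: norm_divide norm_power power_divide\<close>)
  also have "\<dots> \<le> ?m\<^sup>2 * 1 + ?m\<^sup>2 * (norm \<xi>)\<^sup>2"
    using m mult_right_mono[OF m(1), of "(norm \<xi>)\<^sup>2"] by (intro add_mono) auto
  finally show ?thesis by (simp add: distrib_left)
qed

text \<open>A convex combination of $(\mathrm{Re}\,\beta)^2 \ge s_1^2/c^2$ and
  $(\mathrm{Re}\,\beta)^2 \ge \mathrm{Re}\,\beta^2$: the first is positive and the second grows like $|\xi|^2$.\<close>

lemma Re_\<beta>_growth:
  obtains \<delta> where "\<delta> > 0" "\<And>\<xi>. \<delta> * sqrt (1 + (norm \<xi>)\<^sup>2) \<le> Re (\<beta> \<xi>)"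
proof -
  let ?x = "(Re s / c)\<^sup>2" and ?y = "(Im s / c)\<^sup>2"
  have x: "?x > 0" using Re_s c_pos by simp
  \<comment> \<open>half of $x/(x+y)$, so that the possibly negative second bound costs at most half of the first\<close>
  define l where "l = ?x / (2 * (?x + ?y))"
  have xy: "?x + ?y > 0" using x by (intro add_pos_nonneg) auto
  have "X \<le> 2 * (X + Y)" if "0 < X" "0 \<le> Y" for X Y :: real using that by auto
  from this[OF x zero_le_power2[of "Im s / c"]] have "?x \<le> 2 * (?x + ?y)" .
  then have l: "0 < l" "l \<le> 1" using x xy unfolding l_def by (simp_all only: divide_pos_pos divide_le_eq_1_pos mult_pos_pos zero_less_numeral)
  have ly: "l * ?y \<le> ?x / 2"
  proof -
    have "Y / (X + Y) \<le> 1" if "0 < X" "0 \<le> Y" for X Y :: real using that by (simp add: divide_simps)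
    from this[OF x zero_le_power2[of "Im s / c"]] have "?y / (?x + ?y) \<le> 1" .
    then have "?x / 2 * (?y / (?x + ?y)) \<le> ?x / 2" using x by (intro mult_right_le_one_le) auto
    then show ?thesis by (simp add: l_def)
  qed
  define q where "q = min (?x / 2) l"
  have q: "q > 0" using x l by (simp add: q_def)
  have "sqrt q * sqrt (1 + (norm \<xi>)\<^sup>2) \<le> Re (\<beta> \<xi>)" for \<xi>
  proof -
    let ?b = "Re (\<beta> \<xi>)" and ?n = "(norm \<xi>)\<^sup>2"
    have 1: "?x \<le> ?b\<^sup>2" using Re_\<beta>_ge[of \<xi>] Re_s c_pos by (intro power_mono) auto
    have 2: "?x - ?y + ?n \<le> ?b\<^sup>2"
      using Re_Im_\<beta>(1)[of \<xi>] zero_le_power2[of "Im (\<beta> \<xi>)"] unfolding power_divide diff_divide_distrib by linarith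
    have "(1 - l) * ?x + l * (?x - ?y + ?n) \<le> (1 - l) * ?b\<^sup>2 + l * ?b\<^sup>2"
      using l 1 2 by (intro add_mono mult_left_mono) auto
    then have "?x - l * ?y + l * ?n \<le> ?b\<^sup>2" by (simp add: algebra_simps)
    then have "?x / 2 + l * ?n \<le> ?b\<^sup>2" using ly by linarith
    moreover have "q * (1 + ?n) \<le> ?x / 2 + l * ?n"
      unfolding distrib_left using q_def by (intro add_mono mult_right_mono) auto
    ultimately have "q * (1 + ?n) \<le> ?b\<^sup>2" by linarith
    then have "sqrt (q * (1 + ?n)) \<le> sqrt (?b\<^sup>2)" by (rule real_sqrt_le_mono)
    then show ?thesis using Re_\<beta>_pos[of \<xi>] by (simp add: real_sqrt_mult)
  qed
  then show ?thesis using that[of "sqrt q"] q by simp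
qed

lemma radicand_continuous: "continuous_on A radicand"
  unfolding radicand_def[abs_def] by (intro continuous_intros) (use c_pos in auto)

lemma \<beta>_continuous: "continuous_on A \<beta>"
  unfolding \<beta>_def[abs_def]
  by (rule continuous_on_compose2[OF continuous_on_csqrt radicand_continuous]) (auto simp: radicand_slit)

lemma sinh_nonzero: "Re z > 0 \<Longrightarrow> sinh (z * of_real Lt) \<noteq> 0"
proof -
  assume "Re z > 0"
  then have "Re (z * of_real Lt) > 0" using Lt_pos by simp
  then have "exp (- Re (z * of_real Lt)) < exp (Re (z * of_real Lt))" by simp
  then show ?thesis using norm_sinh_ge[of "z * of_real Lt"] by auto
qed

lemma sinh_\<beta>_nonzero: "sinh (\<beta> \<xi> * of_real Lt) \<noteq> 0"
  by (rule sinh_nonzero[OF Re_\<beta>_pos])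

subsection \<open>The wave solving the layer problem\<close>

text \<open>In the stretched height $r = S(t)$ this solves $u'' = \beta^2 u$ with $u(0) = 1$ and
  $u(\widetilde L) = 0$.\<close>

definition sol :: "real \<Rightarrow> real^2 \<Rightarrow> complex" where
  "sol t \<xi> = sinh (\<beta> \<xi> * of_real (Lt - S t)) / sinh (\<beta> \<xi> * of_real Lt)"

text \<open>The derivative of \<^const>\<open>sol\<close> with respect to the stretched height, which is the symbol of the
  conormal derivative $\sigma^{-1}\partial_{x_3} v$.\<close>

definition flux :: "real \<Rightarrow> real^2 \<Rightarrow> complex" where
  "flux t \<xi> = - \<beta> \<xi> * cosh (\<beta> \<xi> * of_real (Lt - S t)) / sinh (\<beta> \<xi> * of_real Lt)"

lemma S_of_real_has_derivative:
  "((\<lambda>t. \<beta> \<xi> * of_real (Lt - S t)) has_vector_derivative - (\<beta> \<xi> * of_real (\<sigma> t))) (at t)"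
proof -
  have "((\<lambda>t. Lt - S t) has_real_derivative - \<sigma> t) (at t)"
    using DERIV_diff[OF DERIV_const S_has_derivative, of Lt] by simp
  then have "((\<lambda>t. complex_of_real (Lt - S t)) has_vector_derivative of_real (- \<sigma> t)) (at t)"
    unfolding has_real_derivative_iff_has_vector_derivative by (rule bounded_linear.has_vector_derivative[OF bounded_linear_of_real])
  then have "((\<lambda>t. \<beta> \<xi> * complex_of_real (Lt - S t)) has_vector_derivative \<beta> \<xi> * of_real (- \<sigma> t)) (at t)"
    by (rule has_vector_derivative_mult_right)
  then show ?thesis by simp
qed

lemma sol_has_derivative: "((\<lambda>t. sol t \<xi>) has_vector_derivative of_real (\<sigma> t) * flux t \<xi>) (at t)"
proof -
  have "((\<lambda>z. sinh z / sinh (\<beta> \<xi> * of_real Lt)) has_field_derivative cosh z / sinh (\<beta> \<xi> * of_real Lt)) (at z)" for z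
    by (intro DERIV_cdivide) (auto intro!: derivative_eq_intros)
  from field_vector_diff_chain_at[OF S_of_real_has_derivative this]
  show ?thesis unfolding sol_def flux_def o_def by (rule has_vector_derivative_eq_rhs) simp
qed

lemma flux_has_derivative: "((\<lambda>t. flux t \<xi>) has_vector_derivative of_real (\<sigma> t) * (radicand \<xi> * sol t \<xi>)) (at t)"
proof -
  have "((\<lambda>z. - \<beta> \<xi> * cosh z / sinh (\<beta> \<xi> * of_real Lt)) has_field_derivative - \<beta> \<xi> * sinh z / sinh (\<beta> \<xi> * of_real Lt)) (at z)" for z
    by (intro DERIV_cdivide) (auto intro!: derivative_eq_intros)
  from field_vector_diff_chain_at[OF S_of_real_has_derivative this]
  show ?thesis unfolding sol_def flux_def o_def \<beta>_squared[symmetric]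
    by (rule has_vector_derivative_eq_rhs) (simp add: power2_eq_square)
qed

lemma continuous_on_fst_snd_intros:
  "continuous_on UNIV (\<lambda>p :: real \<times> (real^2). \<beta> (snd p))"
  "continuous_on UNIV (\<lambda>p :: real \<times> (real^2). S (fst p))"
  "continuous_on UNIV (\<lambda>p :: real \<times> (real^2). \<sigma> (fst p))"
  "continuous_on UNIV (\<lambda>p :: real \<times> (real^2). radicand (snd p))"
  by (rule continuous_on_compose2[OF \<beta>_continuous] continuous_on_compose2[OF S_continuous]
      continuous_on_compose2[OF \<sigma>_continuous] continuous_on_compose2[OF radicand_continuous];
      auto intro!: continuous_on_fst continuous_on_snd continuous_on_id)+

lemma sol_continuous: "continuous_on UNIV (case_prod sol)"
  and flux_continuous: "continuous_on UNIV (case_prod flux)"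
  unfolding sol_def[abs_def] flux_def[abs_def] case_prod_beta'
  by (intro continuous_intros continuous_on_fst_snd_intros; simp add: sinh_\<beta>_nonzero)+

lemma continuous_symbol_mult:
  fixes g :: "real \<Rightarrow> real^2 \<Rightarrow> complex"
  assumes "continuous_on UNIV (case_prod g)"
  shows "continuous_on UNIV (case_prod (\<lambda>t \<xi>. of_real (\<sigma> t) * g t \<xi>))"
    "continuous_on UNIV (case_prod (\<lambda>t \<xi>. radicand \<xi> * g t \<xi>))"
    "continuous_on UNIV (case_prod (\<lambda>t \<xi>. \<i> * of_real (\<xi> \<bullet> j) * g t \<xi>))"
  using assms unfolding case_prod_beta' by (intro continuous_intros continuous_on_fst_snd_intros; simp)+

lemma sol_top [simp]: "sol (h + L) \<xi> = 0" and sol_bottom [simp]: "sol h \<xi> = 1"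
  using sinh_\<beta>_nonzero[of \<xi>] by (simp_all add: sol_def)

end

lemma wave_add:
  assumes "band_limited f" "continuous_on UNIV (case_prod a)" "continuous_on UNIV (case_prod b)"
  shows "wave (\<lambda>t \<xi>. a t \<xi> + b t \<xi>) f x = wave a f x + wave b f x"
proof -
  have "ft 1 (\<lambda>\<xi>. a (snd x) \<xi> * f \<xi> + b (snd x) \<xi> * f \<xi>) (fst x) =
      ft 1 (\<lambda>\<xi>. a (snd x) \<xi> * f \<xi>) (fst x) + ft 1 (\<lambda>\<xi>. b (snd x) \<xi> * f \<xi>) (fst x)"
    by (intro ft_add wave_symbol_integrable assms)
  then show ?thesis unfolding wave_def distrib_right by (simp only: distrib_left)
qed

lemma wave_cmult: "wave (\<lambda>t \<xi>. k t * a t \<xi>) f x = k (snd x) * wave a f x"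
  unfolding wave_def mult.assoc ft_cmult by (simp only: mult.left_commute)

lemma wave_sum:
  assumes "band_limited f" "finite A" "\<And>i. i \<in> A \<Longrightarrow> continuous_on UNIV (case_prod (a i))"
  shows "wave (\<lambda>t \<xi>. \<Sum>i\<in>A. a i t \<xi>) f x = (\<Sum>i\<in>A. wave (a i) f x)"
  using assms(2,3)
proof (induction A rule: finite_induct)
  case empty
  then show ?case by (simp add: wave_def ft_def)
next
  case (insert i A)
  have "continuous_on UNIV (case_prod (\<lambda>t \<xi>. \<Sum>i\<in>A. a i t \<xi>))"
    using insert unfolding case_prod_beta' by (intro continuous_on_sum) auto
  with insert show ?case by (simp add: wave_add[OF assms(1)])
qed

text \<open>On bounded frequencies and heights a continuous symbol is bounded, so the energy is at most a multiple of
  $\|f\|_2^2$.\<close>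

lemma wave_band_limited_L2:
  assumes f: "band_limited f" and a: "continuous_on UNIV (case_prod a)" and L: "L > 0"
  shows "square_integrable (layer h L) (wave a f)"
proof -
  have fm[measurable]: "f \<in> borel_measurable borel" and f2: "integrable lborel (\<lambda>\<xi>. (norm (f \<xi>))\<^sup>2)"
    using f by (auto simp: band_limited_def)
  note am = layer_symbol_measurable[OF a, of h L]
  obtain A where A: "A \<ge> 0" "\<And>t \<xi>. \<bar>t - (h + L/2)\<bar> \<le> L/2 \<Longrightarrow> norm (a t \<xi> * f \<xi>) \<le> A * norm (f \<xi>)"
    using band_limited_bound[OF f a, of "h + L/2" "L/2"] by metis
  define N where "N = (LINT \<xi>|lborel. (norm (f \<xi>))\<^sup>2)"
  have N: "N \<ge> 0" unfolding N_def by (intro Bochner_Integration.integral_nonneg) auto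
  let ?K = "1 / (gauss_mass TYPE(real^2))\<^sup>2"
  have "(\<integral>\<^sup>+x. ennreal ((norm (indicator (layer h L) x *\<^sub>R wave a f x))\<^sup>2) \<partial>lborel) \<le>
    ennreal ?K * (\<integral>\<^sup>+t. \<integral>\<^sup>+\<xi>. indicator {h<..<h + L} t * ennreal ((norm (a t \<xi> * f \<xi>))\<^sup>2) \<partial>lborel \<partial>lborel)"
    by (rule wave_energy[OF am fm wave_symbol_integrable[OF f a]])
  also have "\<dots> \<le> ennreal ?K * (\<integral>\<^sup>+t. indicator {h<..<h + L} t * ennreal (A\<^sup>2 * N) \<partial>lborel)"
  proof (intro mult_left_mono nn_integral_mono)
    fix t
    show "(\<integral>\<^sup>+\<xi>. indicator {h<..<h + L} t * ennreal ((norm (a t \<xi> * f \<xi>))\<^sup>2) \<partial>lborel) \<le> indicator {h<..<h + L} t * ennreal (A\<^sup>2 * N)"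
    proof (cases "t \<in> {h<..<h + L}")
      case True
      then have t: "\<bar>t - (h + L/2)\<bar> \<le> L/2" by (auto simp: abs_if)
      have "(\<integral>\<^sup>+\<xi>. ennreal ((norm (a t \<xi> * f \<xi>))\<^sup>2) \<partial>lborel) \<le> (\<integral>\<^sup>+\<xi>. ennreal (A\<^sup>2 * (norm (f \<xi>))\<^sup>2) \<partial>lborel)"
      proof (intro nn_integral_mono ennreal_leI)
        fix \<xi>
        show "(norm (a t \<xi> * f \<xi>))\<^sup>2 \<le> A\<^sup>2 * (norm (f \<xi>))\<^sup>2"
          using power_mono[OF A(2)[OF t, of \<xi>], of 2] by (simp add: power_mult_distrib)
      qed
      also have "\<dots> = ennreal (A\<^sup>2 * N)"
        unfolding N_def integral_mult_right_zero[symmetric] by (intro nn_integral_eq_integral integrable_mult_right f2) auto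
      finally show ?thesis using True by simp
    qed simp
  qed auto
  also have "\<dots> = ennreal (?K * (L * (A\<^sup>2 * N)))"
  proof -
    have "(\<integral>\<^sup>+t. indicator {h<..<h + L} t * ennreal (A\<^sup>2 * N) \<partial>lborel) = ennreal L * ennreal (A\<^sup>2 * N)"
      using L by (subst nn_integral_multc) auto
    moreover have "ennreal (?K * (L * (A\<^sup>2 * N))) = ennreal ?K * ennreal (L * (A\<^sup>2 * N))"
      by (rule ennreal_mult) (use L N in auto)
    moreover have "ennreal (L * (A\<^sup>2 * N)) = ennreal L * ennreal (A\<^sup>2 * N)"
      by (rule ennreal_mult) (use L N in auto)
    ultimately show ?thesis by (simp only:)
  qed
  finally have le: "(\<integral>\<^sup>+x. ennreal ((norm (indicator (layer h L) x *\<^sub>R wave a f x))\<^sup>2) \<partial>lborel) \<le> ennreal (?K * (L * (A\<^sup>2 * N)))" .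
  have "?K * (L * (A\<^sup>2 * N)) \<ge> 0" using L N by simp
  from square_integrableI_nn(1)[OF wave_measurable[OF am fm] le this] show ?thesis .
qed

section \<open>The bilinear form and Green's identity\<close>

context pml_layer
begin

definition \<kappa> :: complex where "\<kappa> = s\<^sup>2 / (of_real c)\<^sup>2"

definition coeff :: "space3 \<Rightarrow> space3 \<Rightarrow> complex" where
  "coeff i x = of_real (pml_D s h L \<sigma>\<^sub>0 m i x)"

lemma coeff_tangential: "j \<in> Basis \<Longrightarrow> coeff (j, 0) x = of_real (\<sigma> (snd x))"
  and coeff_vertical: "coeff (0, 1) x = of_real (1 / \<sigma> (snd x))"
  by (auto simp: coeff_def pml_D_def)

lemma snd_measurable [measurable]: "snd \<in> borel_measurable (borel :: space3 measure)"
  by (intro borel_measurable_continuous_onI continuous_on_snd continuous_on_id)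

lemma coeff_measurable [measurable]: "coeff i \<in> borel_measurable borel"
  unfolding coeff_def pml_D_def by (cases "i = (0, 1)") simp_all

lemma norm_coeff_le: "x \<in> \<Omega> \<Longrightarrow> norm (coeff i x) \<le> \<sigma>_max"
proof -
  assume "x \<in> \<Omega>"
  then have "\<sigma> (snd x) \<le> \<sigma>_max" by (intro \<sigma>_le) (simp add: layer_def)
  moreover have "1 \<le> \<sigma> (snd x)" by (rule \<sigma>_ge_1)
  moreover have "1 / \<sigma> (snd x) \<le> \<sigma>_max" using \<open>1 \<le> \<sigma> (snd x)\<close> \<sigma>_max_ge_1
    by (intro order_trans[OF _ \<sigma>_max_ge_1]) simp
  ultimately show ?thesis by (auto simp: coeff_def pml_D_def)
qed

lemma L2_coeff: "square_integrable \<Omega> v \<Longrightarrow> square_integrable \<Omega> (\<lambda>x. coeff i x * v x)"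
  by (rule square_integrable_bounded_mult[where B=\<sigma>_max]) (auto simp: norm_coeff_le)

lemma L2_\<sigma>: "square_integrable \<Omega> v \<Longrightarrow> square_integrable \<Omega> (\<lambda>x. of_real (\<sigma> (snd x)) * v x)"
  using \<sigma>_ge_1 by (intro square_integrable_bounded_mult[where B=\<sigma>_max])
    (auto simp: layer_def intro!: \<sigma>_le order_trans[of 0 1] simp: abs_of_nonneg[OF order_trans[OF zero_le_one \<sigma>_ge_1]])

lemma L2_cmult: "square_integrable X v \<Longrightarrow> square_integrable X (\<lambda>x. a * v x)"
  using square_integrable_lincomb[of X v v a 0] by simp

lemma weak_pd_L2: "is_weak_pd X i v g \<Longrightarrow> square_integrable X g"
  by (simp add: is_weak_pd_def)

text \<open>The weak derivatives may be replaced by any others; the grouping of the coefficients with \<open>w\<close> exhibits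
  the form as a sum of $L^2$ pairings with \<open>v\<close> and its derivatives.\<close>

lemma pml_form_eq:
  assumes v: "square_integrable \<Omega> v" "\<And>i. i \<in> Basis \<Longrightarrow> is_weak_pd \<Omega> i v (g i)"
    and w: "square_integrable \<Omega> w" "\<And>i. i \<in> Basis \<Longrightarrow> is_weak_pd \<Omega> i w (k i)"
  shows "form v w = (\<Sum>i\<in>Basis. LINT x:\<Omega>|lborel. (coeff i x * k i x) * g i x) +
      (LINT x:\<Omega>|lborel. (\<kappa> * (of_real (\<sigma> (snd x)) * w x)) * v x)"
proof -
  have I1: "set_integrable lborel \<Omega> (\<lambda>x. (coeff i x * k i x) * g i x)" if "i \<in> Basis" for i
    by (rule square_integrable_product(1)[OF L2_coeff[OF weak_pd_L2[OF w(2)[OF that]]] weak_pd_L2[OF v(2)[OF that]]])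
  have I2: "set_integrable lborel \<Omega> (\<lambda>x. (\<kappa> * (of_real (\<sigma> (snd x)) * w x)) * v x)"
    by (rule square_integrable_product(1)[OF L2_cmult[OF L2_\<sigma>[OF w(1)]] v(1)])
  have m: "(\<lambda>x. indicator \<Omega> x *\<^sub>R g x) \<in> borel_measurable borel" if "square_integrable \<Omega> g" for g
    using that by (simp add: square_integrable_iff)
  define F where "F x = (\<Sum>i\<in>Basis. coeff i x * weak_pd \<Omega> i v x * weak_pd \<Omega> i w x) +
        s\<^sup>2 * of_real (\<sigma> (snd x)) / (of_real c)\<^sup>2 * v x * w x" for x
  define G where "G x = (\<Sum>i\<in>Basis. (coeff i x * k i x) * g i x) + (\<kappa> * (of_real (\<sigma> (snd x)) * w x)) * v x" for x
  have "AE x in lborel. \<forall>i\<in>Basis. x \<in> \<Omega> \<longrightarrow> weak_pd \<Omega> i v x = g i x \<and> weak_pd \<Omega> i w x = k i x"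
  proof (subst AE_ball_countable)
    show "\<forall>i\<in>Basis. AE x in lborel. x \<in> \<Omega> \<longrightarrow> weak_pd \<Omega> i v x = g i x \<and> weak_pd \<Omega> i w x = k i x"
    proof
      fix i :: space3 assume i: "i \<in> Basis"
      show "AE x in lborel. x \<in> \<Omega> \<longrightarrow> weak_pd \<Omega> i v x = g i x \<and> weak_pd \<Omega> i w x = k i x"
        using weak_pd_AE_eq[OF layer_open v(2)[OF i]] weak_pd_AE_eq[OF layer_open w(2)[OF i]] by eventually_elim simp
    qed
  qed (simp add: countable_finite)
  then have AE: "AE x in lborel. x \<in> \<Omega> \<longrightarrow> F x = G x"
    by eventually_elim (simp add: F_def G_def \<kappa>_def algebra_simps)
  have vH: "v \<in> H1 \<Omega>" and wH: "w \<in> H1 \<Omega>" using v w unfolding H1_def by blast+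
  have [measurable]: "(\<lambda>x. indicator \<Omega> x *\<^sub>R weak_pd \<Omega> i v x) \<in> borel_measurable borel"
    "(\<lambda>x. indicator \<Omega> x *\<^sub>R weak_pd \<Omega> i w x) \<in> borel_measurable borel" if "i \<in> Basis" for i
    using H1_weak_pd[OF vH that] H1_weak_pd[OF wH that] by (auto intro: m weak_pd_L2)
  have [measurable]: "(\<lambda>x. indicator \<Omega> x *\<^sub>R v x) \<in> borel_measurable borel" "(\<lambda>x. indicator \<Omega> x *\<^sub>R w x) \<in> borel_measurable borel"
    using v w by (auto intro: m)
  have "(\<lambda>x. (\<Sum>i\<in>Basis. coeff i x * (indicator \<Omega> x *\<^sub>R weak_pd \<Omega> i v x) * (indicator \<Omega> x *\<^sub>R weak_pd \<Omega> i w x)) +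
      s\<^sup>2 * of_real (\<sigma> (snd x)) / (of_real c)\<^sup>2 * (indicator \<Omega> x *\<^sub>R v x) * (indicator \<Omega> x *\<^sub>R w x)) \<in> borel_measurable borel"
    by (intro borel_measurable_add borel_measurable_sum) measurable
  moreover have "indicator \<Omega> x *\<^sub>R F x = (\<Sum>i\<in>Basis. coeff i x * (indicator \<Omega> x *\<^sub>R weak_pd \<Omega> i v x) * (indicator \<Omega> x *\<^sub>R weak_pd \<Omega> i w x)) +
      s\<^sup>2 * of_real (\<sigma> (snd x)) / (of_real c)\<^sup>2 * (indicator \<Omega> x *\<^sub>R v x) * (indicator \<Omega> x *\<^sub>R w x)" for x
    by (cases "x \<in> \<Omega>") (simp_all add: F_def)
  ultimately have Fm: "(\<lambda>x. indicator \<Omega> x *\<^sub>R F x) \<in> borel_measurable borel" by simp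
  have IG: "set_integrable lborel \<Omega> G" unfolding G_def
    using I1 I2 unfolding set_integrable_def
    by (simp only: scaleR_add_right scaleR_sum_right Bochner_Integration.integrable_add Bochner_Integration.integrable_sum)
  have "form v w = (LINT x:\<Omega>|lborel. F x)" unfolding pml_form_def F_def coeff_def ..
  also have "\<dots> = (LINT x:\<Omega>|lborel. G x)"
    using set_integral_AE_cong[OF AE Fm] IG by (auto simp: set_integrable_def)
  also have "\<dots> = (\<Sum>i\<in>Basis. LINT x:\<Omega>|lborel. (coeff i x * k i x) * g i x) +
      (LINT x:\<Omega>|lborel. (\<kappa> * (of_real (\<sigma> (snd x)) * w x)) * v x)"
    using I1 I2 unfolding G_def set_integrable_def set_lebesgue_integral_def
    by (simp only: scaleR_add_right scaleR_sum_right Bochner_Integration.integral_add Bochner_Integration.integrable_sum Bochner_Integration.integral_sum)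
  finally show ?thesis .
qed

lemma pml_form_commute: "form v w = form w v"
  unfolding pml_form_def by (simp only: mult.assoc mult.commute[of "weak_pd \<Omega> _ v _"] mult.commute[of "v _"])

lemma pml_form_converges:
  assumes v: "\<And>n. v n \<in> H1 \<Omega>" "v' \<in> H1 \<Omega>" and w: "w \<in> H1 \<Omega>"
    and lim: "(\<lambda>n. H1_norm \<Omega> (\<lambda>x. v n x - v' x)) \<longlonglongrightarrow> 0"
  shows "(\<lambda>n. form (v n) w) \<longlonglongrightarrow> form v' w"
proof -
  have L2: "square_integrable \<Omega> u" if "u \<in> H1 \<Omega>" for u using that by (simp add: H1_def)
  note wp = H1_weak_pd
  from lim have conv: "(\<lambda>n. L2_sq \<Omega> (\<lambda>x. v n x - v' x)) \<longlonglongrightarrow> 0"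
    "\<And>i. i \<in> Basis \<Longrightarrow> (\<lambda>n. L2_sq \<Omega> (\<lambda>x. weak_pd \<Omega> i (v n) x - weak_pd \<Omega> i v' x)) \<longlonglongrightarrow> 0"
    using H1_convergence[OF layer_open L2[OF v(1)] wp[OF v(1)] L2[OF v(2)] wp[OF v(2)]] by auto
  have form: "form u w = (\<Sum>i\<in>Basis. LINT x:\<Omega>|lborel. (coeff i x * weak_pd \<Omega> i w x) * weak_pd \<Omega> i u x) +
      (LINT x:\<Omega>|lborel. (\<kappa> * (of_real (\<sigma> (snd x)) * w x)) * u x)" if u: "u \<in> H1 \<Omega>" for u
    by (rule pml_form_eq[OF L2[OF u] wp[OF u] L2[OF w] wp[OF w]])
  show ?thesis unfolding form[OF v(1)] form[OF v(2)]
  proof (intro tendsto_add tendsto_sum)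
    fix i :: space3 assume i: "i \<in> Basis"
    show "(\<lambda>n. LINT x:\<Omega>|lborel. (coeff i x * weak_pd \<Omega> i w x) * weak_pd \<Omega> i (v n) x) \<longlonglongrightarrow>
        (LINT x:\<Omega>|lborel. (coeff i x * weak_pd \<Omega> i w x) * weak_pd \<Omega> i v' x)"
      by (rule L2_pairing_convergence[OF L2_coeff[OF weak_pd_L2[OF wp[OF w i]]] weak_pd_L2[OF wp[OF v(1) i]] weak_pd_L2[OF wp[OF v(2) i]] conv(2)[OF i]])
  next
    show "(\<lambda>n. LINT x:\<Omega>|lborel. (\<kappa> * (of_real (\<sigma> (snd x)) * w x)) * v n x) \<longlonglongrightarrow>
        (LINT x:\<Omega>|lborel. (\<kappa> * (of_real (\<sigma> (snd x)) * w x)) * v' x)"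
      by (rule L2_pairing_convergence[OF L2_cmult[OF L2_\<sigma>[OF L2[OF w]]] L2[OF v(1)] L2[OF v(2)] conv(1)])
  qed
qed

lemma sol_wave:
  assumes f: "band_limited f"
  shows "C1 (wave sol f)" "wave sol f \<in> H1 \<Omega>" "square_integrable \<Omega> (wave sol f)"
    "\<And>i. i \<in> Basis \<Longrightarrow> pd i (wave sol f) = wave (pd_symbol sol (\<lambda>t \<xi>. of_real (\<sigma> t) * flux t \<xi>) i) f"
    "\<And>i. i \<in> Basis \<Longrightarrow> is_weak_pd \<Omega> i (wave sol f) (pd i (wave sol f))"
proof -
  note c = sol_continuous continuous_symbol_mult(1)[OF flux_continuous]
  note C = wave_C1[OF f c sol_has_derivative]
  show 1: "C1 (wave sol f)" by (rule C(1))
  show pd: "pd i (wave sol f) = wave (pd_symbol sol (\<lambda>t \<xi>. of_real (\<sigma> t) * flux t \<xi>) i) f" if "i \<in> Basis" for i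
    by (rule C(2)[OF that])
  show 2: "square_integrable \<Omega> (wave sol f)" by (rule wave_band_limited_L2[OF f sol_continuous L_pos])
  have 3: "square_integrable \<Omega> (pd i (wave sol f))" if "i \<in> Basis" for i
    unfolding pd[OF that] by (rule wave_band_limited_L2[OF f continuous_pd_symbol[OF c] L_pos])
  show "wave sol f \<in> H1 \<Omega>" by (rule C1_in_H1[OF 1 2 3])
  show "is_weak_pd \<Omega> i (wave sol f) (pd i (wave sol f))" if "i \<in> Basis" for i
    by (rule C1_is_weak_pd[OF 1 that 3[OF that]])
qed

lemma C1_line_continuous:
  fixes u :: "space3 \<Rightarrow> complex"
  assumes "C1 u" "j \<in> Basis"
  shows "continuous_on UNIV (\<lambda>r. u (y + r *\<^sub>R k, t))" "continuous_on UNIV (\<lambda>r. pd j u (y + r *\<^sub>R k, t))"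
    "continuous_on UNIV (\<lambda>t. u (y, t))" "continuous_on UNIV (\<lambda>t. pd j u (y, t))"
proof -
  have c: "continuous_on UNIV u" "continuous_on UNIV (pd j u)"
    using C1_continuous[OF assms(1)] assms by (simp_all add: C1_def)
  have p: "continuous_on UNIV (\<lambda>r::real. (y + r *\<^sub>R k, t))" "continuous_on UNIV (\<lambda>t::real. (y, t))"
    by (intro continuous_intros)+
  show "continuous_on UNIV (\<lambda>r. u (y + r *\<^sub>R k, t))" "continuous_on UNIV (\<lambda>r. pd j u (y + r *\<^sub>R k, t))"
    "continuous_on UNIV (\<lambda>t. u (y, t))" "continuous_on UNIV (\<lambda>t. pd j u (y, t))"
    by (rule continuous_on_compose2[OF c(1) p(1)] continuous_on_compose2[OF c(2) p(1)]
        continuous_on_compose2[OF c(1) p(2)] continuous_on_compose2[OF c(2) p(2)]; simp)+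
qed

lemma tangential_parts:
  assumes f: "band_limited f" and w: "C1 w" "w \<in> H1 \<Omega>" and j: "j \<in> Basis"
  defines "b \<equiv> (\<lambda>t \<xi>. \<i> * of_real (\<xi> \<bullet> j) * sol t \<xi>)"
  shows "(LINT x:\<Omega>|lborel. (of_real (\<sigma> (snd x)) * pd (j, 0) w x) * wave b f x) =
    - (LINT x:\<Omega>|lborel. (of_real (\<sigma> (snd x)) * w x) * wave (\<lambda>t \<xi>. \<i> * of_real (\<xi> \<bullet> j) * b t \<xi>) f x)"
proof -
  have jB: "(j, 0) \<in> (Basis :: space3 set)" using j by (simp add: Basis_prod_def)
  define b' where "b' = (\<lambda>t \<xi>. \<i> * of_real (\<xi> \<bullet> j) * (of_real (\<sigma> t) * flux t \<xi>))"
  define d where "d = (\<lambda>t \<xi>. \<i> * of_real (\<xi> \<bullet> j) * b t \<xi>)"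
  have cb: "continuous_on UNIV (case_prod b)" unfolding b_def by (rule continuous_symbol_mult(3)[OF sol_continuous])
  have cb': "continuous_on UNIV (case_prod b')" unfolding b'_def
    by (rule continuous_symbol_mult(3)[OF continuous_symbol_mult(1)[OF flux_continuous]])
  have cd: "continuous_on UNIV (case_prod d)" unfolding d_def by (rule continuous_symbol_mult(3)[OF cb])
  have "((\<lambda>t. b t \<xi>) has_vector_derivative b' t \<xi>) (at t)" for t \<xi>
    unfolding b_def b'_def by (rule has_vector_derivative_mult_right[OF sol_has_derivative])
  note B = wave_C1[OF f cb cb' this]
  have pdB: "pd (j, 0) (wave b f) = wave d f"
    unfolding B(2)[OF jB] d_def pd_symbol_def[abs_def] by simp
  have wL2: "square_integrable \<Omega> w" using w(2) by (simp add: H1_def)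
  have pwL2: "square_integrable \<Omega> (pd (j, 0) w)" by (rule weak_pd_L2[OF C1_H1_weak_pd[OF layer_open w jB]])
  have bL2: "square_integrable \<Omega> (wave b f)" "square_integrable \<Omega> (wave d f)"
    by (rule wave_band_limited_L2[OF f cb L_pos], rule wave_band_limited_L2[OF f cd L_pos])
  have I: "set_integrable lborel \<Omega> (\<lambda>x. (of_real (\<sigma> (snd x)) * w x) * wave b f x)"
    "set_integrable lborel \<Omega> (\<lambda>x. (of_real (\<sigma> (snd x)) * w x) * wave d f x)"
    "set_integrable lborel \<Omega> (\<lambda>x. (of_real (\<sigma> (snd x)) * pd (j, 0) w x) * wave b f x)"
    by (rule square_integrable_product(1)[OF L2_\<sigma>[OF wL2] bL2(1)] square_integrable_product(1)[OF L2_\<sigma>[OF wL2] bL2(2)]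
        square_integrable_product(1)[OF L2_\<sigma>[OF pwL2] bL2(1)])+
  have line: "((\<lambda>r. u (y + r *\<^sub>R j, t)) has_vector_derivative pd (j, 0) u (y + r *\<^sub>R j, t)) (at r)" if "C1 u" for u y t r
    using has_vector_derivative_line[of u "(y, t)" r "(j, 0)"] that by (simp add: C1_def)
  have "(LINT x:\<Omega>|lborel. (of_real (\<sigma> (snd x)) * w x) * wave d f x + (of_real (\<sigma> (snd x)) * pd (j, 0) w x) * wave b f x) = 0"
  proof (rule layer_tangential_integral[where p="\<lambda>x. (of_real (\<sigma> (snd x)) * w x) * wave b f x" and j=j])
    fix y t r
    show "((\<lambda>r. (of_real (\<sigma> (snd (y + r *\<^sub>R j, t))) * w (y + r *\<^sub>R j, t)) * wave b f (y + r *\<^sub>R j, t)) has_vector_derivative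
      (of_real (\<sigma> (snd (y + r *\<^sub>R j, t))) * w (y + r *\<^sub>R j, t)) * wave d f (y + r *\<^sub>R j, t) +
      (of_real (\<sigma> (snd (y + r *\<^sub>R j, t))) * pd (j, 0) w (y + r *\<^sub>R j, t)) * wave b f (y + r *\<^sub>R j, t)) (at r)"
      unfolding snd_conv pdB[symmetric]
      by (rule has_vector_derivative_mult[OF has_vector_derivative_mult_right[OF line[OF w(1)]] line[OF B(1)]])
  next
    fix y t
    have "continuous_on UNIV (\<lambda>r. wave d f (y + r *\<^sub>R j, t))"
      unfolding pdB[symmetric] by (rule C1_line_continuous(2)[OF B(1) jB])
    then show "continuous_on UNIV (\<lambda>r. (of_real (\<sigma> (snd (y + r *\<^sub>R j, t))) * w (y + r *\<^sub>R j, t)) * wave d f (y + r *\<^sub>R j, t) +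
      (of_real (\<sigma> (snd (y + r *\<^sub>R j, t))) * pd (j, 0) w (y + r *\<^sub>R j, t)) * wave b f (y + r *\<^sub>R j, t))"
      unfolding snd_conv
      by (intro continuous_on_add continuous_on_mult continuous_on_const C1_line_continuous(1)[OF w(1) jB]
          C1_line_continuous(2)[OF w(1) jB] C1_line_continuous(1)[OF B(1) jB])
  qed (use I in \<open>auto intro: set_integral_add(1)\<close>)
  then have "(LINT x:\<Omega>|lborel. (of_real (\<sigma> (snd x)) * w x) * wave d f x) +
      (LINT x:\<Omega>|lborel. (of_real (\<sigma> (snd x)) * pd (j, 0) w x) * wave b f x) = 0"
    using set_integral_add(2)[OF I(2,3)] by simp
  then show ?thesis unfolding d_def by (simp add: add_eq_0_iff)
qed

lemma vertical_parts:
  assumes f: "band_limited f" and w: "C1 w" "w \<in> H1 \<Omega>"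
  shows "integrable lborel (\<lambda>y. wave flux f (y, h) * w (y, h))"
    "integrable lborel (\<lambda>y. wave flux f (y, h + L) * w (y, h + L))"
    "(LINT x:\<Omega>|lborel. pd (0, 1) w x * wave flux f x) =
      (LINT y|lborel. wave flux f (y, h + L) * w (y, h + L)) - (LINT y|lborel. wave flux f (y, h) * w (y, h))
      - (LINT x:\<Omega>|lborel. (of_real (\<sigma> (snd x)) * w x) * wave (\<lambda>t \<xi>. radicand \<xi> * sol t \<xi>) f x)"
proof -
  have B3: "(0, 1) \<in> (Basis :: space3 set)" by (simp add: Basis_prod_def)
  define d where "d = (\<lambda>t \<xi>. radicand \<xi> * sol t \<xi>)"
  have cd: "continuous_on UNIV (case_prod d)" unfolding d_def by (rule continuous_symbol_mult(2)[OF sol_continuous])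
  have cd': "continuous_on UNIV (case_prod (\<lambda>t \<xi>. of_real (\<sigma> t) * d t \<xi>))" by (rule continuous_symbol_mult(1)[OF cd])
  have "((\<lambda>t. flux t \<xi>) has_vector_derivative of_real (\<sigma> t) * d t \<xi>) (at t)" for t \<xi>
    unfolding d_def by (rule flux_has_derivative)
  note F = wave_C1[OF f flux_continuous cd' this]
  have pdF: "pd (0, 1) (wave flux f) x = of_real (\<sigma> (snd x)) * wave d f x" for x
    unfolding F(2)[OF B3] pd_symbol_def[abs_def] by (simp add: wave_cmult[of "\<lambda>t. complex_of_real (\<sigma> t)"])
  have wL2: "square_integrable \<Omega> w" using w(2) by (simp add: H1_def)
  have pwL2: "square_integrable \<Omega> (pd (0, 1) w)" by (rule weak_pd_L2[OF C1_H1_weak_pd[OF layer_open w B3]])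
  have L2: "square_integrable \<Omega> (wave flux f)" "square_integrable \<Omega> (wave d f)"
    by (rule wave_band_limited_L2[OF f flux_continuous L_pos], rule wave_band_limited_L2[OF f cd L_pos])
  have I: "set_integrable lborel \<Omega> (\<lambda>x. wave flux f x * w x)"
    "set_integrable lborel \<Omega> (\<lambda>x. pd (0, 1) w x * wave flux f x)"
    "set_integrable lborel \<Omega> (\<lambda>x. (of_real (\<sigma> (snd x)) * w x) * wave d f x)"
    by (rule square_integrable_product(1)[OF L2(1) wL2] square_integrable_product(1)[OF pwL2 L2(1)]
        square_integrable_product(1)[OF L2_\<sigma>[OF wL2] L2(2)])+
  let ?p = "\<lambda>x. wave flux f x * w x"
  let ?q = "\<lambda>x. pd (0, 1) w x * wave flux f x + (of_real (\<sigma> (snd x)) * w x) * wave d f x"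
  have deriv: "((\<lambda>t. ?p (y, t)) has_vector_derivative ?q (y, t)) (at t)" for y t
    by (rule has_vector_derivative_eq_rhs[OF has_vector_derivative_mult[OF pair_has_vector_derivative[OF F(1)] pair_has_vector_derivative[OF w(1)]]])
      (simp add: pdF algebra_simps)
  have cp: "continuous_on UNIV (\<lambda>t. ?p (y, t))" for y
    by (intro continuous_on_mult C1_line_continuous(3)[OF F(1) B3] C1_line_continuous(3)[OF w(1) B3])
  have cq: "continuous_on UNIV (\<lambda>t. ?q (y, t))" for y
  proof -
    have "continuous_on UNIV (\<lambda>t. pd (0, 1) w (y, t) * wave flux f (y, t) + w (y, t) * pd (0, 1) (wave flux f) (y, t))"
      by (intro continuous_on_add continuous_on_mult C1_line_continuous(3,4)[OF F(1) B3] C1_line_continuous(3,4)[OF w(1) B3])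
    then show ?thesis by (simp add: pdF mult_ac)
  qed
  note D = layer_divergence[OF deriv cq cp set_integral_add(1)[OF I(2,3)] I(1) L_pos]
  show "integrable lborel (\<lambda>y. wave flux f (y, h) * w (y, h))" by (rule D(1))
  show "integrable lborel (\<lambda>y. wave flux f (y, h + L) * w (y, h + L))" by (rule D(2))
  show "(LINT x:\<Omega>|lborel. pd (0, 1) w x * wave flux f x) =
      (LINT y|lborel. wave flux f (y, h + L) * w (y, h + L)) - (LINT y|lborel. wave flux f (y, h) * w (y, h))
      - (LINT x:\<Omega>|lborel. (of_real (\<sigma> (snd x)) * w x) * wave (\<lambda>t \<xi>. radicand \<xi> * sol t \<xi>) f x)"
    using D(3) set_integral_add(2)[OF I(2,3)] by (simp add: d_def algebra_simps)
qed

text \<open>Integrating by parts, the interior terms combine to the symbol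
  $|\xi|^2 - \beta^2 + s^2/c^2 = 0$ applied to $\sigma v w$.\<close>

theorem green_identity:
  assumes f: "band_limited f" and w: "C1 w" "w \<in> H1 \<Omega>"
  shows "form (wave sol f) w =
    (LINT y|lborel. wave flux f (y, h + L) * w (y, h + L)) - (LINT y|lborel. wave flux f (y, h) * w (y, h))"
proof -
  note V = sol_wave[OF f]
  have wL2: "square_integrable \<Omega> w" using w(2) by (simp add: H1_def)
  have B3: "(0, 1) \<in> (Basis :: space3 set)" by (simp add: Basis_prod_def)
  let ?sw = "\<lambda>x. of_real (\<sigma> (snd x)) * w x"
  define b where "b j = (\<lambda>t \<xi>. \<i> * of_real (\<xi> \<bullet> j) * sol t \<xi>)" for j
  define d where "d j = (\<lambda>t \<xi>. \<i> * of_real (\<xi> \<bullet> j) * b j t \<xi>)" for j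
  have cd: "continuous_on UNIV (case_prod (d j))" for j
    unfolding d_def b_def by (rule continuous_symbol_mult(3)[OF continuous_symbol_mult(3)[OF sol_continuous]])
  have cr: "continuous_on UNIV (case_prod (\<lambda>t \<xi>. radicand \<xi> * sol t \<xi>))"
    by (rule continuous_symbol_mult(2)[OF sol_continuous])
  have tang: "(LINT x:\<Omega>|lborel. (coeff (j, 0) x * pd (j, 0) w x) * pd (j, 0) (wave sol f) x) =
      - (LINT x:\<Omega>|lborel. ?sw x * wave (d j) f x)" if j: "j \<in> Basis" for j
  proof -
    have jB: "(j, 0) \<in> (Basis :: space3 set)" using j by (simp add: Basis_prod_def)
    have "pd (j, 0) (wave sol f) = wave (b j) f" unfolding V(4)[OF jB] b_def pd_symbol_def[abs_def] by simp
    then show ?thesis using tangential_parts[OF f w j] by (simp add: coeff_tangential[OF j] b_def d_def)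
  qed
  have vert: "(LINT x:\<Omega>|lborel. (coeff (0, 1) x * pd (0, 1) w x) * pd (0, 1) (wave sol f) x) =
      (LINT x:\<Omega>|lborel. pd (0, 1) w x * wave flux f x)"
  proof -
    have "pd (0, 1) (wave sol f) x = of_real (\<sigma> (snd x)) * wave flux f x" for x
      unfolding V(4)[OF B3] pd_symbol_def[abs_def] by (simp add: wave_cmult[of "\<lambda>t. complex_of_real (\<sigma> t)"])
    moreover have "complex_of_real (\<sigma> (snd x)) \<noteq> 0" for x :: space3 using \<sigma>_ge_1[of "snd x"] by simp
    ultimately show ?thesis by (simp add: coeff_vertical)
  qed
  have I: "set_integrable lborel \<Omega> (\<lambda>x. ?sw x * wave (d j) f x)" for j
    by (rule square_integrable_product(1)[OF L2_\<sigma>[OF wL2] wave_band_limited_L2[OF f cd L_pos]])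
  have Ir: "set_integrable lborel \<Omega> (\<lambda>x. ?sw x * wave (\<lambda>t \<xi>. radicand \<xi> * sol t \<xi>) f x)"
    by (rule square_integrable_product(1)[OF L2_\<sigma>[OF wL2] wave_band_limited_L2[OF f cr L_pos]])
  have interior: "(LINT x:\<Omega>|lborel. (\<kappa> * ?sw x) * wave sol f x) =
     (\<Sum>j\<in>Basis. LINT x:\<Omega>|lborel. ?sw x * wave (d j) f x) + (LINT x:\<Omega>|lborel. ?sw x * wave (\<lambda>t \<xi>. radicand \<xi> * sol t \<xi>) f x)"
  proof -
    have eq: "\<kappa> * wave sol f x = (\<Sum>j\<in>Basis. wave (d j) f x) + wave (\<lambda>t \<xi>. radicand \<xi> * sol t \<xi>) f x" for x
    proof -
      have symb: "\<kappa> * sol t \<xi> = (\<Sum>j\<in>Basis. d j t \<xi>) + radicand \<xi> * sol t \<xi>" for t \<xi>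
      proof -
        have "(\<Sum>j\<in>Basis. d j t \<xi>) = (\<Sum>j\<in>Basis. - (of_real (\<xi> \<bullet> j) * of_real (\<xi> \<bullet> j)) * sol t \<xi>)"
          by (intro sum.cong refl) (simp add: d_def b_def algebra_simps)
        also have "\<dots> = - of_real (\<Sum>j\<in>Basis. (\<xi> \<bullet> j) * (\<xi> \<bullet> j)) * sol t \<xi>"
          by (simp add: sum_distrib_right[symmetric] sum_negf)
        also have "(\<Sum>j\<in>Basis. (\<xi> \<bullet> j) * (\<xi> \<bullet> j)) = (norm \<xi>)\<^sup>2"
          by (simp only: power2_norm_eq_inner euclidean_inner[symmetric])
        finally show ?thesis by (simp add: radicand_def \<kappa>_def algebra_simps)
      qed
      have "\<kappa> * wave sol f x = wave (\<lambda>t \<xi>. \<kappa> * sol t \<xi>) f x" by (simp add: wave_cmult[of "\<lambda>_. \<kappa>"])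
      also have "\<dots> = wave (\<lambda>t \<xi>. (\<Sum>j\<in>Basis. d j t \<xi>) + radicand \<xi> * sol t \<xi>) f x" unfolding symb ..
      also have "\<dots> = wave (\<lambda>t \<xi>. \<Sum>j\<in>Basis. d j t \<xi>) f x + wave (\<lambda>t \<xi>. radicand \<xi> * sol t \<xi>) f x"
        using cd by (intro wave_add[OF f _ cr]) (simp only: case_prod_beta', intro continuous_on_sum, simp add: case_prod_beta')
      also have "wave (\<lambda>t \<xi>. \<Sum>j\<in>Basis. d j t \<xi>) f x = (\<Sum>j\<in>Basis. wave (d j) f x)"
        by (rule wave_sum[OF f finite_Basis cd])
      finally show ?thesis .
    qed
    have "(\<kappa> * ?sw x) * wave sol f x = (\<Sum>j\<in>Basis. ?sw x * wave (d j) f x) + ?sw x * wave (\<lambda>t \<xi>. radicand \<xi> * sol t \<xi>) f x" for x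
    proof -
      have "(\<kappa> * ?sw x) * wave sol f x = ?sw x * (\<kappa> * wave sol f x)" by (simp only: mult_ac)
      then show ?thesis unfolding eq by (simp only: distrib_left sum_distrib_left)
    qed
    then show ?thesis
      using I Ir unfolding set_integrable_def set_lebesgue_integral_def
      by (simp only: scaleR_add_right scaleR_sum_right Bochner_Integration.integral_add Bochner_Integration.integrable_sum Bochner_Integration.integral_sum)
  qed
  have "form (wave sol f) w = (\<Sum>i\<in>Basis. LINT x:\<Omega>|lborel. (coeff i x * pd i w x) * pd i (wave sol f) x) +
      (LINT x:\<Omega>|lborel. (\<kappa> * ?sw x) * wave sol f x)"
    by (rule pml_form_eq[OF V(3,5) wL2 C1_H1_weak_pd[OF layer_open w]])
  also have "\<dots> = (\<Sum>j\<in>Basis. - (LINT x:\<Omega>|lborel. ?sw x * wave (d j) f x)) + (LINT x:\<Omega>|lborel. pd (0, 1) w x * wave flux f x) +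
      (LINT x:\<Omega>|lborel. (\<kappa> * ?sw x) * wave sol f x)"
    unfolding sum_Basis_space3 vert using tang by simp
  also have "\<dots> = (LINT y|lborel. wave flux f (y, h + L) * w (y, h + L)) - (LINT y|lborel. wave flux f (y, h) * w (y, h))"
    unfolding interior vertical_parts(3)[OF f w] by (simp add: sum_negf)
  finally show ?thesis .
qed

end

section \<open>Waves with data in $H^{1/2}$\<close>

text \<open>The Japanese bracket $\langle\xi\rangle$.\<close>

abbreviation jbr :: "'a::real_normed_vector \<Rightarrow> real" where
  "jbr \<xi> \<equiv> sqrt (1 + (norm \<xi>)\<^sup>2)"

lemma jbr_ge: "1 \<le> jbr \<xi>" "norm \<xi> \<le> jbr \<xi>" "jbr \<xi> \<le> 1 + norm \<xi>" "1 + norm \<xi> \<le> 2 * jbr \<xi>"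
proof -
  show 1: "1 \<le> jbr \<xi>" by simp
  show 2: "norm \<xi> \<le> jbr \<xi>" by (rule real_le_rsqrt) simp
  show "jbr \<xi> \<le> 1 + norm \<xi>" by (rule real_le_lsqrt) (auto simp: power2_sum)
  show "1 + norm \<xi> \<le> 2 * jbr \<xi>" using 1 2 by linarith
qed

lemma powr_half_jbr: "(1 + (norm \<xi>)\<^sup>2) powr (1/2) = jbr \<xi>"
  by (rule powr_half_sqrt) simp

lemma powr_minus_half_jbr: "(1 + (norm \<xi>)\<^sup>2) powr (- 1 / 2) = 1 / jbr \<xi>"
proof -
  have "(1 + (norm \<xi>)\<^sup>2) powr (- 1 / 2) = inverse ((1 + (norm \<xi>)\<^sup>2) powr (1/2))"
    by (simp add: powr_minus[symmetric])
  then show ?thesis unfolding powr_half_jbr by (simp add: inverse_eq_divide)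
qed

lemma jbr_exp_bound:
  fixes r :: real
  assumes "r > 0"
  obtains C where "\<And>\<xi>::'a::real_normed_vector. (1 + norm \<xi>) ^ k * (jbr \<xi> * exp (- (r * jbr \<xi>))) \<le> C"
proof (rule that[of "2 ^ k * (fact (Suc k) / r ^ Suc k)"])
  fix \<xi> :: 'a
  let ?b = "jbr \<xi>"
  have b: "?b \<ge> 1" by (rule jbr_ge)
  have "(1 + norm \<xi>) ^ k \<le> (2 * ?b) ^ k" using jbr_ge(4) by (intro power_mono) auto
  then have "(1 + norm \<xi>) ^ k * (?b * exp (- (r * ?b))) \<le> (2 * ?b) ^ k * (?b * exp (- (r * ?b)))"
    using b by (intro mult_right_mono) auto
  also have "\<dots> = 2 ^ k * (?b ^ Suc k * exp (- (r * ?b)))" by (simp add: power_mult_distrib)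
  also have "\<dots> \<le> 2 ^ k * (fact (Suc k) / r ^ Suc k)"
  proof (rule mult_left_mono)
    \<comment> \<open>a single term of the exponential series\<close>
    have "(r * ?b) ^ Suc k / fact (Suc k) \<le> exp (r * ?b)"
      using sum_le_suminf[OF summable_exp_generic, of "{Suc k}" "r * ?b"] assms b
      by (simp add: exp_def divide_inverse mult.commute del: fact_Suc power_Suc)
    then have "?b ^ Suc k \<le> fact (Suc k) / r ^ Suc k * exp (r * ?b)"
      using assms unfolding power_mult_distrib by (simp add: field_simps del: fact_Suc power_Suc)
    then have "?b ^ Suc k * exp (- (r * ?b)) \<le> fact (Suc k) / r ^ Suc k * exp (r * ?b) * exp (- (r * ?b))"
      by (rule mult_right_mono) simp
    then show "?b ^ Suc k * exp (- (r * ?b)) \<le> fact (Suc k) / r ^ Suc k"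
      by (simp only: mult.assoc mult_exp_exp add.right_inverse exp_zero mult_1_right)
  qed simp
  finally show "(1 + norm \<xi>) ^ k * (jbr \<xi> * exp (- (r * jbr \<xi>))) \<le> 2 ^ k * (fact (Suc k) / r ^ Suc k)" .
qed

text \<open>The order of the multiplier makes up for the difference of the weights:
  $\langle\xi\rangle^{-1}\,(C\langle\xi\rangle)^2 = C^2\langle\xi\rangle$.\<close>

lemma order_one_multiplier:
  assumes f: "weighted_L2 (1/2) f" and d[measurable]: "d \<in> borel_measurable borel" and le: "\<And>\<xi>. norm (d \<xi>) \<le> C * jbr \<xi>"
  shows "weighted_L2 (- 1 / 2) (\<lambda>\<xi>. d \<xi> * f \<xi>)" "weighted_norm_sq (- 1 / 2) (\<lambda>\<xi>. d \<xi> * f \<xi>) \<le> C\<^sup>2 * weighted_norm_sq (1/2) f"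
proof -
  have [measurable]: "f \<in> borel_measurable borel" using f by (rule weighted_L2_measurable)
  have *: "(1 + (norm \<xi>)\<^sup>2) powr (- 1 / 2) * (norm (d \<xi> * f \<xi>))\<^sup>2 \<le> C\<^sup>2 * ((1 + (norm \<xi>)\<^sup>2) powr (1/2) * (norm (f \<xi>))\<^sup>2)" for \<xi>
  proof -
    have j: "jbr \<xi> > 0" using jbr_ge(1)[of \<xi>] by linarith
    have "(norm (d \<xi> * f \<xi>))\<^sup>2 = (norm (d \<xi>))\<^sup>2 * (norm (f \<xi>))\<^sup>2" by (simp add: norm_mult power_mult_distrib)
    also have "\<dots> \<le> (C * jbr \<xi>)\<^sup>2 * (norm (f \<xi>))\<^sup>2" by (intro mult_right_mono power_mono le) auto
    finally have "1 / jbr \<xi> * (norm (d \<xi> * f \<xi>))\<^sup>2 \<le> 1 / jbr \<xi> * ((C * jbr \<xi>)\<^sup>2 * (norm (f \<xi>))\<^sup>2)"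
      using j by (intro mult_left_mono) auto
    also have "\<dots> = C\<^sup>2 * (jbr \<xi> * (norm (f \<xi>))\<^sup>2)"
    proof -
      have "1 / j * ((C * j)\<^sup>2 * n) = C\<^sup>2 * (j * n)" if "j \<noteq> 0" for j n :: real
        using that by (simp add: power2_eq_square)
      from this[OF less_imp_neq[OF j, symmetric]] show ?thesis .
    qed
    finally show ?thesis unfolding powr_half_jbr powr_minus_half_jbr .
  qed
  show "weighted_L2 (- 1 / 2) (\<lambda>\<xi>. d \<xi> * f \<xi>)" "weighted_norm_sq (- 1 / 2) (\<lambda>\<xi>. d \<xi> * f \<xi>) \<le> C\<^sup>2 * weighted_norm_sq (1/2) f"
    by (rule weighted_L2_bound[OF f _ *], measurable)+
qed

text \<open>Symbols that decay away from the lower boundary at a rate proportional to the frequency.  The factor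
  $\langle\xi\rangle$ admits the first derivatives of the solution.\<close>

definition decaying_symbol :: "real \<Rightarrow> real \<Rightarrow> (real \<Rightarrow> real^2 \<Rightarrow> complex) \<Rightarrow> bool" where
  "decaying_symbol h L a \<longleftrightarrow> continuous_on UNIV (case_prod a) \<and>
     (\<exists>A \<delta>. A \<ge> 0 \<and> \<delta> > 0 \<and> (\<forall>t \<xi>. h < t \<longrightarrow> t < h + L \<longrightarrow>
        norm (a t \<xi>) \<le> A * (jbr \<xi> * exp (- (\<delta> * (t - h) * jbr \<xi>)))))"

lemma decaying_symbol_integrable:
  assumes a: "decaying_symbol h L a" and f: "weighted_L2 (1/2) f" and t: "h < t" "t < h + L"
  shows "integrable lborel (\<lambda>\<xi>. a t \<xi> * f \<xi>)"
proof -
  obtain A \<delta> where A: "A \<ge> 0" "\<delta> > 0" "\<And>\<xi>. norm (a t \<xi>) \<le> A * (jbr \<xi> * exp (- (\<delta> * (t - h) * jbr \<xi>)))"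
    using a t unfolding decaying_symbol_def by blast
  have m: "a t \<in> borel_measurable borel" using a by (auto simp: decaying_symbol_def intro: symbol_measurable)
  \<comment> \<open>the summand $1$ bounds the order $1/2$, as \<open>weighted_L2_pairing\<close> requires\<close>
  let ?k = "1 + DIM(real^2) + 2"
  obtain C where C: "\<And>\<xi>::real^2. (1 + norm \<xi>) ^ ?k * (jbr \<xi> * exp (- (\<delta> * (t - h) * jbr \<xi>))) \<le> C"
    using jbr_exp_bound[of "\<delta> * (t - h)" ?k] A t by (metis diff_gt_0_iff_gt mult_pos_pos)
  have "(1 + norm \<xi>) ^ ?k * norm (a t \<xi>) \<le> A * C" for \<xi>
  proof -
    have "(1 + norm \<xi>) ^ ?k * norm (a t \<xi>) \<le> (1 + norm \<xi>) ^ ?k * (A * (jbr \<xi> * exp (- (\<delta> * (t - h) * jbr \<xi>))))"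
      by (intro mult_left_mono A(3)) auto
    also have "\<dots> = A * ((1 + norm \<xi>) ^ ?k * (jbr \<xi> * exp (- (\<delta> * (t - h) * jbr \<xi>))))" by (rule mult.left_commute)
    also have "\<dots> \<le> A * C" using C A(1) by (rule mult_left_mono)
    finally show ?thesis .
  qed
  from weighted_L2_pairing(1)[OF f m this] show ?thesis by (simp add: mult.commute)
qed

lemma nn_integral_exp_decay:
  assumes "k > 0" "L > 0"
  shows "(\<integral>\<^sup>+t. indicator {h<..<h + L} t * ennreal (exp (- (k * (t - h)))) \<partial>lborel) \<le> ennreal (1 / k)"
proof -
  have "(\<integral>\<^sup>+t. indicator {h<..<h + L} t * ennreal (exp (- (k * (t - h)))) \<partial>lborel) \<le>
      (\<integral>\<^sup>+t. ennreal (exp (- (k * (t - h)))) * indicator {h..h + L} t \<partial>lborel)"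
    by (intro nn_integral_mono) (auto simp: indicator_def)
  also have "\<dots> = ennreal (- exp (- (k * (h + L - h))) / k - (- exp (- (k * (h - h))) / k))"
    by (rule nn_integral_FTC_Icc) (use assms in \<open>auto intro!: derivative_eq_intros\<close>)
  also have "\<dots> \<le> ennreal (1 / k)" using assms by (intro ennreal_leI) simp
  finally show ?thesis .
qed

text \<open>By Tonelli's theorem the height is integrated first, and
  $\int_h^{h+L} \langle\xi\rangle^2 e^{-2\delta\langle\xi\rangle(t-h)}\,dt \le \langle\xi\rangle/(2\delta)$
  leaves exactly the weight of $H^{1/2}$.\<close>

lemma decaying_symbol_energy:
  assumes a: "decaying_symbol h L a" and L: "L > 0"
  obtains C where "C \<ge> 0" "\<And>f. weighted_L2 (1/2) f \<Longrightarrow>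
    square_integrable (layer h L) (wave a f) \<and> L2_sq (layer h L) (wave a f) \<le> C * weighted_norm_sq (1/2) f"
proof -
  obtain A \<delta> where A: "A \<ge> 0" "\<delta> > 0"
    "\<And>t \<xi>. h < t \<Longrightarrow> t < h + L \<Longrightarrow> norm (a t \<xi>) \<le> A * (jbr \<xi> * exp (- (\<delta> * (t - h) * jbr \<xi>)))"
    using a unfolding decaying_symbol_def by blast
  have am: "(\<lambda>p. indicator {h<..<h + L} (fst p) * a (fst p) (snd p)) \<in> borel_measurable borel"
    using a by (intro layer_symbol_measurable) (simp add: decaying_symbol_def)
  let ?K = "1 / (gauss_mass TYPE(real^2))\<^sup>2"
  define C where "C = ?K * (A\<^sup>2 / (2 * \<delta>))"
  have C: "C \<ge> 0" using A by (simp add: C_def)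
  have "square_integrable (layer h L) (wave a f) \<and> L2_sq (layer h L) (wave a f) \<le> C * weighted_norm_sq (1/2) f"
    if f: "weighted_L2 (1/2) f" for f
  proof -
    have fm[measurable]: "f \<in> borel_measurable borel" using f by (rule weighted_L2_measurable)
    let ?I = "\<lambda>t. indicator {h<..<h + L} t :: ennreal"
    have energy: "(\<integral>\<^sup>+x. ennreal ((norm (indicator (layer h L) x *\<^sub>R wave a f x))\<^sup>2) \<partial>lborel) \<le>
      ennreal ?K * (\<integral>\<^sup>+t. \<integral>\<^sup>+\<xi>. ?I t * ennreal ((norm (a t \<xi> * f \<xi>))\<^sup>2) \<partial>lborel \<partial>lborel)"
      by (rule wave_energy[OF am fm decaying_symbol_integrable[OF a f]])
    have "(\<integral>\<^sup>+t. \<integral>\<^sup>+\<xi>. ?I t * ennreal ((norm (a t \<xi> * f \<xi>))\<^sup>2) \<partial>lborel \<partial>lborel) \<le>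
      (\<integral>\<^sup>+t. \<integral>\<^sup>+\<xi>. ennreal (A\<^sup>2 * (jbr \<xi> * norm (f \<xi>))\<^sup>2) * (?I t * ennreal (exp (- (2 * \<delta> * jbr \<xi> * (t - h))))) \<partial>lborel \<partial>lborel)"
    proof (intro nn_integral_mono)
      fix t and \<xi> :: "real^2"
      show "?I t * ennreal ((norm (a t \<xi> * f \<xi>))\<^sup>2) \<le>
          ennreal (A\<^sup>2 * (jbr \<xi> * norm (f \<xi>))\<^sup>2) * (?I t * ennreal (exp (- (2 * \<delta> * jbr \<xi> * (t - h)))))"
      proof (cases "t \<in> {h<..<h + L}")
        case True
        let ?e = "exp (- (\<delta> * (t - h) * jbr \<xi>))"
        have "norm (a t \<xi> * f \<xi>) \<le> A * (jbr \<xi> * ?e) * norm (f \<xi>)"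
          unfolding norm_mult using True by (intro mult_right_mono A(3)) auto
        then have "(norm (a t \<xi> * f \<xi>))\<^sup>2 \<le> (A * (jbr \<xi> * ?e) * norm (f \<xi>))\<^sup>2" by (rule power_mono) simp
        also have "\<dots> = A\<^sup>2 * (jbr \<xi> * norm (f \<xi>))\<^sup>2 * ?e\<^sup>2" by (simp only: power_mult_distrib mult_ac)
        also have "?e\<^sup>2 = exp (- (2 * \<delta> * jbr \<xi> * (t - h)))"
          unfolding power2_eq_square mult_exp_exp by (simp add: algebra_simps)
        finally show ?thesis using True by (simp add: ennreal_mult[symmetric] ennreal_leI)
      qed simp
    qed
    also have "\<dots> =
      (\<integral>\<^sup>+\<xi>. \<integral>\<^sup>+t. ennreal (A\<^sup>2 * (jbr \<xi> * norm (f \<xi>))\<^sup>2) * (?I t * ennreal (exp (- (2 * \<delta> * jbr \<xi> * (t - h))))) \<partial>lborel \<partial>lborel)"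
      by (rule lborel_pair.Fubini') measurable
    also have "\<dots> \<le> (\<integral>\<^sup>+\<xi>. ennreal (A\<^sup>2 / (2 * \<delta>) * ((1 + (norm \<xi>)\<^sup>2) powr (1/2) * (norm (f \<xi>))\<^sup>2)) \<partial>lborel)"
    proof (intro nn_integral_mono)
      fix \<xi> :: "real^2"
      let ?B = "A\<^sup>2 * (jbr \<xi> * norm (f \<xi>))\<^sup>2"
      have j: "jbr \<xi> > 0" using jbr_ge(1)[of \<xi>] by linarith
      have "(\<integral>\<^sup>+t. ennreal ?B * (?I t * ennreal (exp (- (2 * \<delta> * jbr \<xi> * (t - h))))) \<partial>lborel) =
          ennreal ?B * (\<integral>\<^sup>+t. ?I t * ennreal (exp (- (2 * \<delta> * jbr \<xi> * (t - h)))) \<partial>lborel)"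
        by (rule nn_integral_cmult) measurable
      also have "\<dots> \<le> ennreal ?B * ennreal (1 / (2 * \<delta> * jbr \<xi>))"
        using A j L by (intro mult_left_mono nn_integral_exp_decay) auto
      also have "\<dots> = ennreal (?B * (1 / (2 * \<delta> * jbr \<xi>)))" using A j by (intro ennreal_mult[symmetric]) auto
      also have "?B * (1 / (2 * \<delta> * jbr \<xi>)) = A\<^sup>2 / (2 * \<delta>) * (jbr \<xi> * (norm (f \<xi>))\<^sup>2)"
      proof -
        have "A\<^sup>2 * (j * n)\<^sup>2 * (1 / (2 * \<delta> * j)) = A\<^sup>2 / (2 * \<delta>) * (j * n\<^sup>2)" if "j \<noteq> 0" for j n :: real
          using that A(2) by (simp add: power_mult_distrib power2_eq_square)
        from this[of "jbr \<xi>" "norm (f \<xi>)", OF less_imp_neq[OF j, symmetric]] show ?thesis .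
      qed
      finally show "(\<integral>\<^sup>+t. ennreal ?B * (?I t * ennreal (exp (- (2 * \<delta> * jbr \<xi> * (t - h))))) \<partial>lborel) \<le>
          ennreal (A\<^sup>2 / (2 * \<delta>) * ((1 + (norm \<xi>)\<^sup>2) powr (1/2) * (norm (f \<xi>))\<^sup>2))"
        unfolding powr_half_jbr .
    qed
    also have "\<dots> = ennreal (A\<^sup>2 / (2 * \<delta>) * weighted_norm_sq (1/2) f)"
      unfolding weighted_norm_sq_def integral_mult_right_zero[symmetric]
      using f A by (intro nn_integral_eq_integral integrable_mult_right) (auto simp: weighted_L2_def)
    finally have inner: "(\<integral>\<^sup>+t. \<integral>\<^sup>+\<xi>. ?I t * ennreal ((norm (a t \<xi> * f \<xi>))\<^sup>2) \<partial>lborel \<partial>lborel) \<le>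
      ennreal (A\<^sup>2 / (2 * \<delta>) * weighted_norm_sq (1/2) f)" .
    have "ennreal ?K * ennreal (A\<^sup>2 / (2 * \<delta>) * weighted_norm_sq (1/2) f) = ennreal (C * weighted_norm_sq (1/2) f)"
      unfolding C_def mult.assoc using A by (intro ennreal_mult[symmetric]) (auto simp: weighted_norm_sq_nonneg)
    with order_trans[OF energy mult_left_mono[OF inner zero_le]]
    have le: "(\<integral>\<^sup>+x. ennreal ((norm (indicator (layer h L) x *\<^sub>R wave a f x))\<^sup>2) \<partial>lborel) \<le> ennreal (C * weighted_norm_sq (1/2) f)"
      by (simp only:)
    have "0 \<le> C * weighted_norm_sq (1/2) f" using C by (simp add: weighted_norm_sq_nonneg)
    from square_integrableI_nn[OF wave_measurable[OF am fm] le this] show ?thesis by blast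
  qed
  then show ?thesis using C that by blast
qed

subsection \<open>Frequency truncation\<close>

definition truncate :: "(real^2 \<Rightarrow> complex) \<Rightarrow> nat \<Rightarrow> real^2 \<Rightarrow> complex" where
  "truncate f n \<xi> = (if norm \<xi> \<le> real n then f \<xi> else 0)"

lemma truncate_measurable [measurable]: "f \<in> borel_measurable borel \<Longrightarrow> truncate f n \<in> borel_measurable borel"
proof -
  assume [measurable]: "f \<in> borel_measurable borel"
  have "truncate f n = (\<lambda>\<xi>. indicator (cball 0 (real n)) \<xi> *\<^sub>R f \<xi>)"
    by (auto simp: truncate_def indicator_def)
  moreover have [measurable]: "cball 0 (real n) \<in> sets (borel :: (real^2) measure)" by (intro borel_closed closed_cball)
  have "(\<lambda>\<xi>. indicator (cball 0 (real n)) \<xi> *\<^sub>R f \<xi>) \<in> borel_measurable borel" by measurable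
  ultimately show ?thesis by (simp only:)
qed

lemma weighted_L2_truncate: "weighted_L2 r f \<Longrightarrow> weighted_L2 r (truncate f n)"
  by (rule weighted_L2_bound(1)[where C=1 and r=r and f=f])
    (auto simp: weighted_L2_def truncate_def[abs_def])

lemma band_limited_truncate:
  assumes f: "weighted_L2 (1/2) f"
  shows "band_limited (truncate f n)"
proof -
  have [measurable]: "f \<in> borel_measurable borel" using f by (rule weighted_L2_measurable)
  have I: "integrable lborel (\<lambda>\<xi>. jbr \<xi> * (norm (f \<xi>))\<^sup>2)" using f unfolding weighted_L2_def powr_half_jbr by simp
  have le: "(norm (truncate f n \<xi>))\<^sup>2 \<le> jbr \<xi> * (norm (f \<xi>))\<^sup>2" for \<xi>
    using mult_right_mono[OF jbr_ge(1)[of \<xi>], of "(norm (f \<xi>))\<^sup>2"] by (auto simp: truncate_def)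
  have I2: "integrable lborel (\<lambda>\<xi>. (norm (truncate f n \<xi>))\<^sup>2)"
    by (rule Bochner_Integration.integrable_bound[OF I]) (use le in \<open>auto intro!: AE_I2\<close>)
  have "integrable lborel (truncate f n)"
  proof (rule Bochner_Integration.integrable_bound)
    show "integrable lborel (\<lambda>\<xi>. indicator (cball 0 (real n)) \<xi> + (norm (truncate f n \<xi>))\<^sup>2)"
      by (intro Bochner_Integration.integrable_add I2 integrable_real_indicator[OF _ emeasure_lborel_cball_finite]) simp
    show "AE \<xi> in lborel. norm (truncate f n \<xi>) \<le> norm (indicator (cball 0 (real n)) \<xi> + (norm (truncate f n \<xi>))\<^sup>2)"
    proof (rule AE_I2)
      fix \<xi> :: "real^2"
      have "2 * norm (f \<xi>) \<le> 1 + (norm (f \<xi>))\<^sup>2" using sum_squares_bound[of 1 "norm (f \<xi>)"] by simp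
      then have "norm (f \<xi>) \<le> 1 + (norm (f \<xi>))\<^sup>2" using norm_ge_zero[of "f \<xi>"] by linarith
      then show "norm (truncate f n \<xi>) \<le> norm (indicator (cball 0 (real n)) \<xi> + (norm (truncate f n \<xi>))\<^sup>2)"
        by (auto simp: truncate_def)
    qed
  qed measurable
  then show ?thesis using I2 unfolding band_limited_def
    by (auto simp: truncate_def intro!: exI[of _ "real n"] split: if_splits)
qed

lemma truncate_converges:
  assumes f: "weighted_L2 r f"
  shows "(\<lambda>n. weighted_norm_sq r (\<lambda>\<xi>. truncate f n \<xi> - f \<xi>)) \<longlonglongrightarrow> 0"
proof -
  have [measurable]: "f \<in> borel_measurable borel" using f by (rule weighted_L2_measurable)
  have "(\<lambda>n. LINT \<xi>|lborel. (1 + (norm \<xi>)\<^sup>2) powr r * (norm (truncate f n \<xi> - f \<xi>))\<^sup>2) \<longlonglongrightarrow> (LINT (\<xi>::real^2)|lborel. 0)"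
  proof (rule integral_dominated_convergence[where w="\<lambda>\<xi>. (1 + (norm \<xi>)\<^sup>2) powr r * (norm (f \<xi>))\<^sup>2"])
    show "integrable lborel (\<lambda>\<xi>. (1 + (norm \<xi>)\<^sup>2) powr r * (norm (f \<xi>))\<^sup>2)" using f by (simp add: weighted_L2_def)
    show "AE \<xi> in lborel. (\<lambda>n. (1 + (norm \<xi>)\<^sup>2) powr r * (norm (truncate f n \<xi> - f \<xi>))\<^sup>2) \<longlonglongrightarrow> 0"
    proof (rule AE_I2)
      fix \<xi> :: "real^2"
      obtain N where N: "norm \<xi> \<le> real N" using real_arch_simple by blast
      have "\<forall>\<^sub>F n in sequentially. (1 + (norm \<xi>)\<^sup>2) powr r * (norm (truncate f n \<xi> - f \<xi>))\<^sup>2 = 0"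
        using eventually_ge_at_top[of N] by eventually_elim (use N in \<open>auto simp: truncate_def\<close>)
      then show "(\<lambda>n. (1 + (norm \<xi>)\<^sup>2) powr r * (norm (truncate f n \<xi> - f \<xi>))\<^sup>2) \<longlonglongrightarrow> 0"
        by (rule tendsto_eventually)
    qed
    show "AE \<xi> in lborel. norm ((1 + (norm \<xi>)\<^sup>2) powr r * (norm (truncate f n \<xi> - f \<xi>))\<^sup>2) \<le> (1 + (norm \<xi>)\<^sup>2) powr r * (norm (f \<xi>))\<^sup>2" for n
      by (intro AE_I2) (auto simp: truncate_def)
  qed measurable
  then show ?thesis by (simp add: weighted_norm_sq_def)
qed

lemma wave_diff_data:
  assumes "integrable lborel (\<lambda>\<xi>. a (snd x) \<xi> * f \<xi>)" "integrable lborel (\<lambda>\<xi>. a (snd x) \<xi> * g \<xi>)"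
  shows "wave a f x - wave a g x = wave a (\<lambda>\<xi>. f \<xi> - g \<xi>) x"
proof -
  have "ft 1 (\<lambda>\<xi>. a (snd x) \<xi> * (f \<xi> - g \<xi>)) (fst x) = ft 1 (\<lambda>\<xi>. a (snd x) \<xi> * f \<xi> + (- 1) * (a (snd x) \<xi> * g \<xi>)) (fst x)"
    by (simp add: algebra_simps)
  also have "\<dots> = ft 1 (\<lambda>\<xi>. a (snd x) \<xi> * f \<xi>) (fst x) + (- 1) * ft 1 (\<lambda>\<xi>. a (snd x) \<xi> * g \<xi>) (fst x)"
    by (subst ft_add) (use assms in \<open>simp_all only: ft_cmult integrable_mult_right\<close>)
  finally have E: "ft 1 (\<lambda>\<xi>. a (snd x) \<xi> * (f \<xi> - g \<xi>)) (fst x) =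
      ft 1 (\<lambda>\<xi>. a (snd x) \<xi> * f \<xi>) (fst x) + (- 1) * ft 1 (\<lambda>\<xi>. a (snd x) \<xi> * g \<xi>) (fst x)" .
  have "k * F - k * G = k * (F + (- 1) * G)" for k F G :: complex by (simp add: algebra_simps)
  then show ?thesis unfolding wave_def E .
qed

lemma wave_truncate_converges:
  assumes a: "decaying_symbol h L a" and L: "L > 0" and f: "weighted_L2 (1/2) f"
  shows "(\<lambda>n. L2_sq (layer h L) (\<lambda>x. wave a (truncate f n) x - wave a f x)) \<longlonglongrightarrow> 0"
proof -
  obtain C where C: "C \<ge> 0" "\<And>f. weighted_L2 (1/2) f \<Longrightarrow> L2_sq (layer h L) (wave a f) \<le> C * weighted_norm_sq (1/2) f"
    using decaying_symbol_energy[OF a L] by metis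
  have le: "L2_sq (layer h L) (\<lambda>x. wave a (truncate f n) x - wave a f x) \<le> C * weighted_norm_sq (1/2) (\<lambda>\<xi>. truncate f n \<xi> - f \<xi>)" for n
  proof -
    have "L2_sq (layer h L) (\<lambda>x. wave a (truncate f n) x - wave a f x) = L2_sq (layer h L) (wave a (\<lambda>\<xi>. truncate f n \<xi> - f \<xi>))"
      unfolding L2_sq_eq
    proof (intro Bochner_Integration.integral_cong refl)
      fix x :: space3
      show "(norm (indicator (layer h L) x *\<^sub>R (wave a (truncate f n) x - wave a f x)))\<^sup>2 =
          (norm (indicator (layer h L) x *\<^sub>R wave a (\<lambda>\<xi>. truncate f n \<xi> - f \<xi>) x))\<^sup>2"
      proof (cases "x \<in> layer h L")
        case True
        then have "h < snd x" "snd x < h + L" by (auto simp: layer_def)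
        then show ?thesis
          by (subst wave_diff_data) (auto intro: decaying_symbol_integrable[OF a] weighted_L2_truncate f)
      qed simp
    qed
    also have "\<dots> \<le> C * weighted_norm_sq (1/2) (\<lambda>\<xi>. truncate f n \<xi> - f \<xi>)"
      by (intro C(2) weighted_L2_diff weighted_L2_truncate f)
    finally show ?thesis .
  qed
  have "(\<lambda>n. C * weighted_norm_sq (1/2) (\<lambda>\<xi>. truncate f n \<xi> - f \<xi>)) \<longlonglongrightarrow> C * 0"
    by (intro tendsto_intros truncate_converges f)
  then have lim: "(\<lambda>n. C * weighted_norm_sq (1/2) (\<lambda>\<xi>. truncate f n \<xi> - f \<xi>)) \<longlonglongrightarrow> 0" by simp
  show ?thesis
    by (rule tendsto_sandwich[OF _ _ tendsto_const lim]) (auto simp: le L2_sq_nonneg)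
qed

text \<open>The multiplication formula moves the transform to the test function, as in the definition of
  \<^const>\<open>fourier_distr\<close>.\<close>

lemma regular_distr_wave:
  assumes "integrable lborel (\<lambda>\<xi>. a t \<xi> * f \<xi>)"
  shows "regular_distr (\<lambda>y. wave a f (y, t)) = fourier_distr (\<lambda>\<xi>. a t \<xi> * f \<xi>)"
proof
  fix \<psi> :: "real^2 \<Rightarrow> complex"
  show "regular_distr (\<lambda>y. wave a f (y, t)) \<psi> = fourier_distr (\<lambda>\<xi>. a t \<xi> * f \<xi>) \<psi>"
  proof (cases "\<psi> \<in> schwartz")
    case True
    have "(LINT y|lborel. wave a f (y, t) * \<psi> y) = of_real (1 / (gauss_mass TYPE(real^2))\<^sup>2) * (LINT y|lborel. ft 1 (\<lambda>\<xi>. a t \<xi> * f \<xi>) y * \<psi> y)"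
      unfolding wave_def by (simp add: mult.assoc)
    then show ?thesis
      using True ft_multiplication[OF assms schwartz_integrable[OF True], of 1]
      by (simp add: regular_distr_def fourier_distr_def)
  qed (simp add: regular_distr_def fourier_distr_def)
qed

context pml_layer
begin

text \<open>As $\mathrm{Re}\,\beta \ge s_1/c$, the modulus of $\sinh(\beta\widetilde L)$ is at least a fixed multiple of
  $e^{\mathrm{Re}\,\beta\,\widetilde L}$ for all $\xi$.  Both quotients are therefore of size
  $e^{-\mathrm{Re}\,\beta\,S(t)}$, where $S(t) \ge t - h$ and $\mathrm{Re}\,\beta \ge \delta\langle\xi\rangle$.\<close>

lemma kernel_bounds:
  obtains C \<delta> where "C \<ge> 0" "\<delta> > 0"
    "\<And>t \<xi>. h \<le> t \<Longrightarrow> t \<le> h + L \<Longrightarrow> norm (sol t \<xi>) \<le> C * exp (- (\<delta> * (t - h) * jbr \<xi>))"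
    "\<And>t \<xi>. h \<le> t \<Longrightarrow> t \<le> h + L \<Longrightarrow> norm (flux t \<xi>) \<le> C * (jbr \<xi> * exp (- (\<delta> * (t - h) * jbr \<xi>)))"
proof -
  obtain \<delta> where \<delta>: "\<delta> > 0" "\<And>\<xi>. \<delta> * jbr \<xi> \<le> Re (\<beta> \<xi>)" using Re_\<beta>_growth by blast
  define q where "q = exp (- (2 * (Re s / c * Lt)))"
  have q: "0 < q" "q < 1" using Re_s c_pos Lt_pos by (auto simp: q_def)
  define C0 where "C0 = 2 / (1 - q)"
  have C0: "C0 > 0" using q by (simp add: C0_def)
  define Mx where "Mx = max 1 (norm s / c)"
  have Mx: "Mx \<ge> 1" by (simp add: Mx_def)
  have \<beta>_le: "norm (\<beta> \<xi>) \<le> Mx * jbr \<xi>" for \<xi>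
  proof (rule power2_le_imp_le)
    show "(norm (\<beta> \<xi>))\<^sup>2 \<le> (Mx * jbr \<xi>)\<^sup>2"
      using norm_\<beta>_sq[of \<xi>] by (simp add: Mx_def power_mult_distrib)
  qed (use Mx in simp)
  have quot: "x / norm (sinh (\<beta> \<xi> * of_real Lt)) \<le> C0 * exp (- (\<delta> * (t - h) * jbr \<xi>))"
    if t: "h \<le> t" "t \<le> h + L" and x: "x \<le> exp \<bar>Re (\<beta> \<xi> * of_real (Lt - S t))\<bar>" for x t \<xi>
  proof -
    let ?b = "Re (\<beta> \<xi>)"
    have b: "?b > 0" by (rule Re_\<beta>_pos)
    have "x \<le> exp (?b * (Lt - S t))" using x b S_le[OF t(2)] by simp
    moreover have "exp (?b * Lt) / C0 \<le> norm (sinh (\<beta> \<xi> * of_real Lt))"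
    proof -
      have "exp (- (2 * (?b * Lt))) \<le> q"
        unfolding q_def using mult_right_mono[OF Re_\<beta>_ge[of \<xi>] less_imp_le[OF Lt_pos]]
        by (simp only: exp_le_cancel_iff neg_le_iff_le mult_le_cancel_left_pos zero_less_numeral)
      then have "exp (?b * Lt) * (1 - q) \<le> exp (?b * Lt) * (1 - exp (- (2 * (?b * Lt))))" by (intro mult_left_mono) auto
      also have "\<dots> = exp (?b * Lt) - exp (- (?b * Lt))" unfolding right_diff_distrib mult_exp_exp by simp
      also have "\<dots> \<le> 2 * norm (sinh (\<beta> \<xi> * of_real Lt))" using norm_sinh_ge[of "\<beta> \<xi> * of_real Lt"] by simp
      finally show ?thesis by (simp add: C0_def)
    qed
    ultimately have "x / norm (sinh (\<beta> \<xi> * of_real Lt)) \<le> exp (?b * (Lt - S t)) / (exp (?b * Lt) / C0)"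
      using C0 by (intro frac_le) auto
    also have "\<dots> = C0 * exp (- (?b * S t))" by (simp add: exp_diff exp_minus right_diff_distrib field_simps)
    also have "\<dots> \<le> C0 * exp (- (\<delta> * (t - h) * jbr \<xi>))"
    proof -
      have "\<delta> * jbr \<xi> * (t - h) \<le> ?b * S t" using \<delta>(2)[of \<xi>] S_ge[of t] t b by (intro mult_mono) auto
      then show ?thesis using C0 by (simp add: mult_ac)
    qed
    finally show ?thesis .
  qed
  show ?thesis
  proof (rule that[of "C0 * Mx" \<delta>])
    fix t \<xi> assume t: "h \<le> t" "t \<le> h + L"
    have "norm (sol t \<xi>) \<le> C0 * exp (- (\<delta> * (t - h) * jbr \<xi>))"
      unfolding sol_def norm_divide by (rule quot[OF t norm_sinh_le])
    also have "\<dots> \<le> C0 * Mx * exp (- (\<delta> * (t - h) * jbr \<xi>))" using C0 Mx by simp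
    finally show "norm (sol t \<xi>) \<le> C0 * Mx * exp (- (\<delta> * (t - h) * jbr \<xi>))" .
    have "norm (flux t \<xi>) = norm (\<beta> \<xi>) * (norm (cosh (\<beta> \<xi> * of_real (Lt - S t))) / norm (sinh (\<beta> \<xi> * of_real Lt)))"
      unfolding flux_def by (simp add: norm_mult norm_divide)
    also have "\<dots> \<le> (Mx * jbr \<xi>) * (C0 * exp (- (\<delta> * (t - h) * jbr \<xi>)))"
      by (intro mult_mono \<beta>_le quot[OF t norm_cosh_le]) (use Mx in auto)
    finally show "norm (flux t \<xi>) \<le> C0 * Mx * (jbr \<xi> * exp (- (\<delta> * (t - h) * jbr \<xi>)))" by (simp only: mult_ac)
  qed (use C0 Mx \<delta> in auto)
qed

lemma sol_decaying: "decaying_symbol h L sol"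
proof -
  obtain C \<delta> where C: "C \<ge> 0" "\<delta> > 0"
    "\<And>t \<xi>. h \<le> t \<Longrightarrow> t \<le> h + L \<Longrightarrow> norm (sol t \<xi>) \<le> C * exp (- (\<delta> * (t - h) * jbr \<xi>))"
    using kernel_bounds by metis
  have "norm (sol t \<xi>) \<le> C * (jbr \<xi> * exp (- (\<delta> * (t - h) * jbr \<xi>)))" if "h < t" "t < h + L" for t \<xi>
  proof -
    have "1 * exp (- (\<delta> * (t - h) * jbr \<xi>)) \<le> jbr \<xi> * exp (- (\<delta> * (t - h) * jbr \<xi>))"
      by (rule mult_right_mono[OF jbr_ge(1)]) simp
    then have "C * (1 * exp (- (\<delta> * (t - h) * jbr \<xi>))) \<le> C * (jbr \<xi> * exp (- (\<delta> * (t - h) * jbr \<xi>)))"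
      using C(1) by (rule mult_left_mono)
    then show ?thesis using C(3)[of t \<xi>] that by simp
  qed
  then show ?thesis unfolding decaying_symbol_def using sol_continuous C by blast
qed

abbreviation "sol_pd i \<equiv> pd_symbol sol (\<lambda>t \<xi>. of_real (\<sigma> t) * flux t \<xi>) i"

lemma sol_pd_decaying:
  assumes i: "i \<in> (Basis :: space3 set)"
  shows "decaying_symbol h L (sol_pd i)"
proof -
  obtain C \<delta> where C: "C \<ge> 0" "\<delta> > 0"
    "\<And>t \<xi>. h \<le> t \<Longrightarrow> t \<le> h + L \<Longrightarrow> norm (sol t \<xi>) \<le> C * exp (- (\<delta> * (t - h) * jbr \<xi>))"
    "\<And>t \<xi>. h \<le> t \<Longrightarrow> t \<le> h + L \<Longrightarrow> norm (flux t \<xi>) \<le> C * (jbr \<xi> * exp (- (\<delta> * (t - h) * jbr \<xi>)))"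
    using kernel_bounds by metis
  have n: "norm (fst i) \<le> 1" "\<bar>snd i\<bar> \<le> 1"
    using norm_Basis[OF i] norm_fst_le[of "fst i" "snd i"] norm_snd_le[of "snd i" "fst i"] by auto
  have "norm (sol_pd i t \<xi>) \<le> (C + \<sigma>_max * C) * (jbr \<xi> * exp (- (\<delta> * (t - h) * jbr \<xi>)))" if t: "h < t" "t < h + L" for t \<xi>
  proof -
    let ?e = "exp (- (\<delta> * (t - h) * jbr \<xi>))"
    have "\<bar>\<xi> \<bullet> fst i\<bar> \<le> norm \<xi> * 1"
      using Cauchy_Schwarz_ineq2[of \<xi> "fst i"] n(1) by (meson mult_left_mono norm_ge_zero order_trans)
    then have 1: "\<bar>\<xi> \<bullet> fst i\<bar> \<le> jbr \<xi>" using jbr_ge(2)[of \<xi>] by linarith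
    have "norm (\<i> * of_real (\<xi> \<bullet> fst i) * sol t \<xi>) = \<bar>\<xi> \<bullet> fst i\<bar> * norm (sol t \<xi>)" by (simp add: norm_mult)
    also have "\<dots> \<le> jbr \<xi> * (C * ?e)" using C t by (intro mult_mono 1) auto
    finally have A: "norm (\<i> * of_real (\<xi> \<bullet> fst i) * sol t \<xi>) \<le> C * (jbr \<xi> * ?e)" by (simp only: mult_ac)
    have 2: "\<bar>snd i\<bar> * \<sigma> t \<le> 1 * \<sigma>_max" using n(2) \<sigma>_le[of t] \<sigma>_ge_1[of t] t by (intro mult_mono) auto
    have "norm (of_real (snd i) * (of_real (\<sigma> t) * flux t \<xi>)) = (\<bar>snd i\<bar> * \<sigma> t) * norm (flux t \<xi>)"
      using \<sigma>_ge_1[of t] by (simp add: norm_mult)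
    also have "\<dots> \<le> \<sigma>_max * (C * (jbr \<xi> * ?e))" using C t 2 \<sigma>_max_ge_1 by (intro mult_mono) auto
    finally have B: "norm (of_real (snd i) * (of_real (\<sigma> t) * flux t \<xi>)) \<le> \<sigma>_max * C * (jbr \<xi> * ?e)" by (simp only: mult_ac)
    show ?thesis unfolding pd_symbol_def distrib_right by (rule norm_triangle_mono[OF A B])
  qed
  moreover have "C + \<sigma>_max * C \<ge> 0" using C \<sigma>_max_ge_1 by simp
  ultimately show ?thesis unfolding decaying_symbol_def
    using continuous_pd_symbol[OF sol_continuous continuous_symbol_mult(1)[OF flux_continuous]] C(2) by blast
qed

end

section \<open>The Dirichlet-to-Neumann operator of the layer\<close>

context pml_layer
begin

text \<open>The symbol of the Dirichlet-to-Neumann operator, $-\beta\coth(\beta\widetilde L)$.\<close>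

definition dtn :: "real^2 \<Rightarrow> complex" where
  "dtn \<xi> = - \<beta> \<xi> * cosh (\<beta> \<xi> * of_real Lt) / sinh (\<beta> \<xi> * of_real Lt)"

lemma flux_bottom: "flux h \<xi> = dtn \<xi>"
  by (simp add: flux_def dtn_def)

lemma flux_top: "flux (h + L) \<xi> = - \<beta> \<xi> / sinh (\<beta> \<xi> * of_real Lt)"
  by (simp add: flux_def)

lemma dtn_measurable [measurable]: "dtn \<in> borel_measurable borel"
  using symbol_measurable[OF flux_continuous, of h] by (simp add: flux_bottom)

lemma dtn_bound:
  obtains C where "\<And>\<xi>. norm (dtn \<xi>) \<le> C * jbr \<xi>" "C \<ge> 0"
proof -
  obtain C \<delta> where C: "C \<ge> 0"
    "\<And>t \<xi>. h \<le> t \<Longrightarrow> t \<le> h + L \<Longrightarrow> norm (flux t \<xi>) \<le> C * (jbr \<xi> * exp (- (\<delta> * (t - h) * jbr \<xi>)))"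
    using kernel_bounds by metis
  show ?thesis using C(2)[of h] L_pos by (intro that[OF _ C(1)]) (simp add: flux_bottom)
qed

lemma dtn_weighted_L2: "weighted_L2 (1/2) f \<Longrightarrow> weighted_L2 (- 1 / 2) (\<lambda>\<xi>. dtn \<xi> * f \<xi>)"
  using dtn_bound order_one_multiplier(1)[OF _ dtn_measurable] by metis

lemma slice_integrable: "band_limited f \<Longrightarrow> integrable lborel (\<lambda>\<xi>. sol t \<xi> * f \<xi>)" "band_limited f \<Longrightarrow> integrable lborel (\<lambda>\<xi>. flux t \<xi> * f \<xi>)"
  by (rule wave_symbol_integrable, assumption, rule sol_continuous flux_continuous)+

subsection \<open>Existence\<close>

context
  fixes f :: "real^2 \<Rightarrow> complex"
  assumes f: "weighted_L2 (1/2) f"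
begin

lemma truncated_wave:
  "band_limited (truncate f n)" "C1 (wave sol (truncate f n))" "wave sol (truncate f n) \<in> H1 \<Omega>"
  "square_integrable \<Omega> (wave sol (truncate f n))"
  "i \<in> Basis \<Longrightarrow> is_weak_pd \<Omega> i (wave sol (truncate f n)) (wave (sol_pd i) (truncate f n))"
proof -
  show b: "band_limited (truncate f n)" by (rule band_limited_truncate[OF f])
  note S = sol_wave[OF b]
  show "C1 (wave sol (truncate f n))" "wave sol (truncate f n) \<in> H1 \<Omega>" "square_integrable \<Omega> (wave sol (truncate f n))"
    by (rule S)+
  show "is_weak_pd \<Omega> i (wave sol (truncate f n)) (wave (sol_pd i) (truncate f n))" if "i \<in> Basis"
    using S(5)[OF that] unfolding S(4)[OF that] .
qed

text \<open>Since $H^{1/2}$ data need not give a wave that is $C^1$ up to the boundary, its weak derivatives are found as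
  $L^2$ limits of the classical derivatives for truncated data.\<close>

lemma wave_is_weak_pd:
  assumes i: "i \<in> Basis"
  shows "is_weak_pd \<Omega> i (wave sol f) (wave (sol_pd i) f)"
  unfolding is_weak_pd_def
proof (intro conjI ballI)
  have L2: "square_integrable \<Omega> (wave sol f)" "square_integrable \<Omega> (wave (sol_pd i) f)"
    by (rule decaying_symbol_energy[OF sol_decaying L_pos], blast intro: f)
      (rule decaying_symbol_energy[OF sol_pd_decaying[OF i] L_pos], blast intro: f)
  then show "square_integrable \<Omega> (wave (sol_pd i) f)" by simp
  fix w assume w: "w \<in> test_functions \<Omega>"
  have wL2: "square_integrable \<Omega> w" "square_integrable \<Omega> (pd i w)"
    by (intro test_function_square_integrable test_functions_pd w i layer_measurable)+
  have 1: "(\<lambda>n. LINT x:\<Omega>|lborel. pd i w x * wave sol (truncate f n) x) \<longlonglongrightarrow> (LINT x:\<Omega>|lborel. pd i w x * wave sol f x)"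
    by (rule L2_pairing_convergence[OF wL2(2) truncated_wave(4) L2(1) wave_truncate_converges[OF sol_decaying L_pos f]])
  have 2: "(\<lambda>n. LINT x:\<Omega>|lborel. w x * wave (sol_pd i) (truncate f n) x) \<longlonglongrightarrow> (LINT x:\<Omega>|lborel. w x * wave (sol_pd i) f x)"
    by (rule L2_pairing_convergence[OF wL2(1) weak_pd_L2[OF truncated_wave(5)[OF i]] L2(2) wave_truncate_converges[OF sol_pd_decaying[OF i] L_pos f]])
  have "(LINT x:\<Omega>|lborel. pd i w x * wave sol (truncate f n) x) = - (LINT x:\<Omega>|lborel. w x * wave (sol_pd i) (truncate f n) x)" for n
    using truncated_wave(5)[OF i, of n] w by (simp add: is_weak_pd_def mult.commute)
  then have "(\<lambda>n. - (LINT x:\<Omega>|lborel. w x * wave (sol_pd i) (truncate f n) x)) \<longlonglongrightarrow> (LINT x:\<Omega>|lborel. pd i w x * wave sol f x)"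
    using 1 by simp
  from LIMSEQ_unique[OF this tendsto_minus[OF 2]]
  show "(LINT x:\<Omega>|lborel. wave sol f x * pd i w x) = - (LINT x:\<Omega>|lborel. wave (sol_pd i) f x * w x)"
    by (simp add: mult.commute)
qed

lemma wave_H1: "wave sol f \<in> H1 \<Omega>" "square_integrable \<Omega> (wave sol f)"
proof -
  show "square_integrable \<Omega> (wave sol f)" by (rule decaying_symbol_energy[OF sol_decaying L_pos], blast intro: f)
  then show "wave sol f \<in> H1 \<Omega>" using wave_is_weak_pd unfolding H1_def by blast
qed

lemma truncated_wave_converges: "(\<lambda>n. H1_norm \<Omega> (\<lambda>x. wave sol (truncate f n) x - wave sol f x)) \<longlonglongrightarrow> 0"
  using H1_convergence[OF layer_open truncated_wave(4) truncated_wave(5) wave_H1(2) wave_is_weak_pd]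
    wave_truncate_converges[OF sol_decaying L_pos f] wave_truncate_converges[OF sol_pd_decaying L_pos f] by auto

lemma wave_has_traces:
  "has_trace \<Omega> (wave sol f) h (fourier_distr f)" "has_trace \<Omega> (wave sol f) (h + L) (\<lambda>\<psi>. 0)"
proof -
  have bot: "regular_distr (\<lambda>y. wave sol (truncate f n) (y, h)) = fourier_distr (truncate f n)" for n
    using regular_distr_wave[where a=sol and f="truncate f n" and t=h, OF slice_integrable(1)[OF truncated_wave(1)]] by simp
  have top: "regular_distr (\<lambda>y. wave sol (truncate f n) (y, h + L)) = (\<lambda>_. 0)" for n
    using regular_distr_wave[where a=sol and f="truncate f n" and t="h + L", OF slice_integrable(1)[OF truncated_wave(1)]] by (simp add: fourier_distr_0)
  have z: "((\<lambda>\<psi>. 0) :: (real^2) distr) \<in> sobolev (1/2)" "sobolev_norm (1/2) ((\<lambda>\<psi>. 0) :: (real^2) distr) = 0"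
    using sobolev_fourier_distr(1,3)[OF weighted_L2_0(1), of "1/2"] by (simp_all add: fourier_distr_0 weighted_L2_0)
  show "has_trace \<Omega> (wave sol f) h (fourier_distr f)"
    unfolding has_trace_def
    by (intro conjI exI[of _ "\<lambda>n. wave sol (truncate f n)"] allI truncated_wave(2,3) truncated_wave_converges
        sobolev_fourier_distr(1) f; unfold bot)
      (intro sobolev_fourier_distr(1) fourier_distr_converges truncate_converges weighted_L2_truncate f)+
  show "has_trace \<Omega> (wave sol f) (h + L) (\<lambda>\<psi>. 0)"
    unfolding has_trace_def
    by (intro conjI exI[of _ "\<lambda>n. wave sol (truncate f n)"] allI truncated_wave(2,3) truncated_wave_converges z(1); unfold top)
      (use z in simp_all)
qed

text \<open>Green's identity for truncated data passes to the limit, the form by continuity in $H^1$ and the boundary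
  term in $H^{-1/2}$, because the symbol is of order one.\<close>

lemma wave_green:
  assumes w: "C1 w" "w \<in> H1 \<Omega>" "\<And>y. w (y, h + L) = 0" "(\<lambda>y. w (y, h)) \<in> schwartz"
  shows "form (wave sol f) w = - fourier_distr (\<lambda>\<xi>. dtn \<xi> * f \<xi>) (\<lambda>y. w (y, h))"
proof -
  have "form (wave sol (truncate f n)) w = - fourier_distr (\<lambda>\<xi>. dtn \<xi> * truncate f n \<xi>) (\<lambda>y. w (y, h))" for n
    unfolding green_identity[OF truncated_wave(1) w(1,2)] w(3)
    using fun_cong[OF regular_distr_wave[where a=flux and f="truncate f n" and t=h, OF slice_integrable(2)[OF truncated_wave(1)]], of "\<lambda>y. w (y, h)"] w(4)
    by (simp add: regular_distr_def flux_bottom)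
  then have 1: "(\<lambda>n. - fourier_distr (\<lambda>\<xi>. dtn \<xi> * truncate f n \<xi>) (\<lambda>y. w (y, h))) \<longlonglongrightarrow> form (wave sol f) w"
    using pml_form_converges[OF truncated_wave(3) wave_H1(1) w(2) truncated_wave_converges] by simp
  obtain C where C: "\<And>\<xi>. norm (dtn \<xi>) \<le> C * jbr \<xi>" using dtn_bound by metis
  have "(\<lambda>n. weighted_norm_sq (- 1 / 2) (\<lambda>\<xi>. dtn \<xi> * truncate f n \<xi> - dtn \<xi> * f \<xi>)) \<longlonglongrightarrow> 0"
  proof (rule tendsto_sandwich[OF _ _ tendsto_const])
    show "\<forall>\<^sub>F n in sequentially. weighted_norm_sq (- 1 / 2) (\<lambda>\<xi>. dtn \<xi> * truncate f n \<xi> - dtn \<xi> * f \<xi>) \<le>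
        C\<^sup>2 * weighted_norm_sq (1/2) (\<lambda>\<xi>. truncate f n \<xi> - f \<xi>)"
      unfolding right_diff_distrib[symmetric]
      by (intro always_eventually allI order_one_multiplier(2)[OF _ dtn_measurable C] weighted_L2_diff weighted_L2_truncate f)
    show "(\<lambda>n. C\<^sup>2 * weighted_norm_sq (1/2) (\<lambda>\<xi>. truncate f n \<xi> - f \<xi>)) \<longlonglongrightarrow> 0"
      using tendsto_mult[OF tendsto_const truncate_converges[OF f], of "C\<^sup>2"] by simp
  qed (simp add: weighted_norm_sq_nonneg)
  then have "(\<lambda>n. fourier_distr (\<lambda>\<xi>. dtn \<xi> * truncate f n \<xi>) (\<lambda>y. w (y, h))) \<longlonglongrightarrow> fourier_distr (\<lambda>\<xi>. dtn \<xi> * f \<xi>) (\<lambda>y. w (y, h))"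
    by (intro sobolev_convergence[OF _ _ _ w(4), where r="- 1 / 2"] sobolev_fourier_distr(1) fourier_distr_converges dtn_weighted_L2 weighted_L2_truncate f)
  from LIMSEQ_unique[OF 1 tendsto_minus[OF this]] show ?thesis .
qed

lemma wave_pml_solution:
  "pml_solution s c h L \<sigma>\<^sub>0 m (fourier_distr f) (wave sol f)"
  "has_normal_deriv s c h L \<sigma>\<^sub>0 m (wave sol f) (fourier_distr (\<lambda>\<xi>. dtn \<xi> * f \<xi>))"
proof -
  have "form (wave sol f) w = 0" if w: "w \<in> test_functions \<Omega>" for w
  proof -
    have 0: "w (y, h + L) = 0" "w (y, h) = 0" for y
      by (rule test_function_outside[OF w], simp add: layer_def)+
    have "form (wave sol f) w = - fourier_distr (\<lambda>\<xi>. dtn \<xi> * f \<xi>) (\<lambda>y. w (y, h))"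
      by (rule wave_green[OF test_function_H1[OF w layer_measurable] 0(1)]) (simp add: 0 schwartz_zero)
    then show ?thesis by (simp add: 0 fourier_distr_def ft_def)
  qed
  then show "pml_solution s c h L \<sigma>\<^sub>0 m (fourier_distr f) (wave sol f)"
    unfolding pml_solution_def using wave_H1(1) wave_has_traces by blast
  show "has_normal_deriv s c h L \<sigma>\<^sub>0 m (wave sol f) (fourier_distr (\<lambda>\<xi>. dtn \<xi> * f \<xi>))"
    unfolding has_normal_deriv_def using wave_green sobolev_fourier_distr(1)[OF dtn_weighted_L2[OF f]] by simp
qed

end

subsection \<open>Uniqueness\<close>

text \<open>The radicand avoids the branch cut and $\beta$ stays in the right half-plane.  Smoothness is what keeps the
  product of a symbol with a test function a test function.\<close>

lemma symbol_smooth: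
  assumes H: "H holomorphic_on {z. Re z > 0}" "\<And>\<xi>. d \<xi> = H (\<beta> \<xi>)"
  shows "smooth d"
proof -
  have r: "smooth radicand"
    unfolding radicand_def[abs_def] by (intro smooth_add smooth_const smooth_norm_sq)
  have "smooth (\<lambda>\<xi>. csqrt (radicand \<xi>))"
    by (rule smooth_holomorphic[OF r, of "- \<real>\<^sub>\<le>\<^sub>0"]) (auto simp: radicand_slit holomorphic_on_csqrt closed_nonpos_Reals_complex open_Compl)
  then have "smooth (\<lambda>\<xi>. \<beta> \<xi>)" by (simp add: \<beta>_def)
  then have "smooth (\<lambda>\<xi>. H (\<beta> \<xi>))"
    by (rule smooth_holomorphic[OF _ _ H(1)]) (auto simp: Re_\<beta>_pos open_halfspace_Re_gt)
  then show ?thesis by (simp add: H(2)[abs_def])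
qed

lemma flux_smooth: "smooth (flux h)" "smooth (flux (h + L))"
proof -
  have [holomorphic_intros]: "(\<lambda>z. cosh (z * of_real Lt)) holomorphic_on A" "(\<lambda>z. sinh (z * of_real Lt)) holomorphic_on A" for A
    unfolding cosh_def sinh_def scaleR_conv_of_real by (intro holomorphic_intros)+
  show "smooth (flux h)"
    by (rule symbol_smooth[where H="\<lambda>z. - z * cosh (z * of_real Lt) / sinh (z * of_real Lt)"])
      (auto intro!: holomorphic_intros simp: sinh_nonzero flux_bottom dtn_def)
  show "smooth (flux (h + L))"
    by (rule symbol_smooth[where H="\<lambda>z. - z / sinh (z * of_real Lt)"])
      (auto intro!: holomorphic_intros simp: sinh_nonzero flux_top)
qed

lemma flux_even: "flux t (- \<xi>) = flux t \<xi>"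
  by (simp add: flux_def symbol_\<beta>_def)

text \<open>Waves are inverse transforms, while \<^const>\<open>is_fourier\<close> uses the direct one; the reflection
  $\xi \mapsto -\xi$ exchanges them and leaves the even symbols unchanged.\<close>

lemma test_function_reflect:
  fixes \<eta> :: "real^2 \<Rightarrow> complex"
  assumes "\<eta> \<in> test_functions UNIV"
  shows "band_limited (\<lambda>\<xi>. \<eta> (- \<xi>))"
    "ft 1 (\<lambda>\<xi>. \<eta> (- \<xi>)) = fourier \<eta>"
proof -
  have S: "\<eta> \<in> schwartz" by (rule test_functions_schwartz[OF assms])
  have I: "integrable lborel \<eta>" by (rule schwartz_integrable[OF S])
  have [measurable]: "\<eta> \<in> borel_measurable borel" by (rule schwartz_measurable[OF S])
  obtain R where R: "\<And>x. \<eta> x \<noteq> 0 \<Longrightarrow> norm x \<le> R" using test_function_bounded_support[OF assms] by metis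
  have refl: "integrable lborel (\<lambda>\<xi>. g (- \<xi>))" if "integrable lborel g" for g :: "real^2 \<Rightarrow> complex"
    using lborel_affine_integrable[of "-1" g 0] that by simp
  have "integrable lborel (\<lambda>\<xi>. \<eta> \<xi> * \<eta> \<xi>)"
    by (rule continuous_mult_test_integrable[OF smooth_continuous[OF schwartz_smooth[OF S]] assms])
  from integrable_norm[OF refl[OF this]] have "integrable lborel (\<lambda>\<xi>. (norm (\<eta> (- \<xi>)))\<^sup>2)"
    by (simp add: norm_mult power2_eq_square)
  moreover have "\<exists>R. \<forall>\<xi>. \<eta> (- \<xi>) \<noteq> 0 \<longrightarrow> norm \<xi> \<le> R" using R by (metis norm_minus_cancel)
  ultimately show "band_limited (\<lambda>\<xi>. \<eta> (- \<xi>))" using refl[OF I] by (simp add: band_limited_def)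
  show "ft 1 (\<lambda>\<xi>. \<eta> (- \<xi>)) = fourier \<eta>"
  proof
    fix y
    have "fourier \<eta> y = (LINT x|lborel. exp (\<i> * of_real (- 1 * ((0 + (-1) *\<^sub>R x) \<bullet> y))) * \<eta> (0 + (-1) *\<^sub>R x))"
      unfolding fourier_eq_ft ft_def by (subst lborel_affine_integral[where c="-1" and t=0]) auto
    then show "ft 1 (\<lambda>\<xi>. \<eta> (- \<xi>)) y = fourier \<eta> y" by (simp add: ft_def)
  qed
qed

text \<open>After multiplication by $(t-h)/L$, which vanishes at the bottom, the divergence theorem turns the boundary
  pairing into integrals over the layer.  These are continuous in $H^1$, so the limit is the same for all
  approximating sequences of \<open>v\<close>.\<close>

lemma top_pairing_converges:
  assumes F: "band_limited F" and v: "v \<in> H1 \<Omega>"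
  obtains l where "\<And>u. (\<And>n. C1 (u n)) \<Longrightarrow> (\<And>n. u n \<in> H1 \<Omega>) \<Longrightarrow> (\<lambda>n. H1_norm \<Omega> (\<lambda>x. u n x - v x)) \<longlonglongrightarrow> 0 \<Longrightarrow>
    (\<lambda>n. LINT y|lborel. wave flux F (y, h + L) * u n (y, h + L)) \<longlonglongrightarrow> l"
proof -
  have B3: "(0, 1) \<in> (Basis :: space3 set)" by (simp add: Basis_prod_def)
  define \<theta> where "\<theta> t = complex_of_real ((t - h) / L)" for t
  define a where "a = (\<lambda>t \<xi>. \<theta> t * flux t \<xi>)"
  define a' where "a' = (\<lambda>t \<xi>. \<theta> t * (of_real (\<sigma> t) * (radicand \<xi> * sol t \<xi>)) + of_real (1 / L) * flux t \<xi>)"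
  have c\<theta>: "continuous_on UNIV (\<lambda>p :: real \<times> (real^2). \<theta> (fst p))"
    unfolding \<theta>_def using L_pos by (intro continuous_intros) auto
  note cs = flux_continuous[unfolded case_prod_beta'] continuous_symbol_mult(1)[OF continuous_symbol_mult(2)[OF sol_continuous], unfolded case_prod_beta']
  have ca: "continuous_on UNIV (case_prod a)" unfolding a_def case_prod_beta'
    by (intro continuous_on_mult[OF c\<theta> cs(1)])
  have ca': "continuous_on UNIV (case_prod a')" unfolding a'_def case_prod_beta'
    by (intro continuous_on_add continuous_on_mult[OF c\<theta> cs(2)] continuous_on_mult[OF continuous_on_const cs(1)])
  have "((\<lambda>t. a t \<xi>) has_vector_derivative a' t \<xi>) (at t)" for t \<xi>
    unfolding a_def a'_def
  proof (rule has_vector_derivative_mult[OF _ flux_has_derivative])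
    have "((\<lambda>t. (t - h) / L) has_vector_derivative (1 / L)) (at t)"
      using L_pos by (auto intro!: derivative_eq_intros simp: has_real_derivative_iff_has_vector_derivative[symmetric])
    then show "(\<theta> has_vector_derivative of_real (1 / L)) (at t)"
      unfolding \<theta>_def[abs_def] by (rule bounded_linear.has_vector_derivative[OF bounded_linear_of_real])
  qed
  note W = wave_C1[OF F ca ca' this]
  have pdW: "pd (0, 1) (wave a F) = wave a' F" unfolding W(2)[OF B3] pd_symbol_def[abs_def] by simp
  have aL2: "square_integrable \<Omega> (wave a F)" "square_integrable \<Omega> (wave a' F)"
    by (rule wave_band_limited_L2[OF F ca L_pos], rule wave_band_limited_L2[OF F ca' L_pos])
  have "\<theta> (h + L) = 1" "\<theta> h = 0" using L_pos by (auto simp: \<theta>_def)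
  then have top: "wave a F (y, h + L) = wave flux F (y, h + L)" and bot: "wave a F (y, h) = 0" for y
    unfolding a_def by (simp_all add: wave_cmult[of \<theta>])
  let ?l = "(LINT x:\<Omega>|lborel. wave a F x * weak_pd \<Omega> (0, 1) v x) + (LINT x:\<Omega>|lborel. wave a' F x * v x)"
  show ?thesis
  proof (rule that[of ?l])
    fix u :: "nat \<Rightarrow> space3 \<Rightarrow> complex"
    assume u: "\<And>n. C1 (u n)" "\<And>n. u n \<in> H1 \<Omega>" and lim: "(\<lambda>n. H1_norm \<Omega> (\<lambda>x. u n x - v x)) \<longlonglongrightarrow> 0"
    note wp = C1_H1_weak_pd[OF layer_open u]
    have L2: "square_integrable \<Omega> z" if "z \<in> H1 \<Omega>" for z using that by (simp add: H1_def)
    have conv: "(\<lambda>n. L2_sq \<Omega> (\<lambda>x. u n x - v x)) \<longlonglongrightarrow> 0"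
      "(\<lambda>n. L2_sq \<Omega> (\<lambda>x. pd (0, 1) (u n) x - weak_pd \<Omega> (0, 1) v x)) \<longlonglongrightarrow> 0"
      using lim H1_convergence[where u=u and v=v and k="\<lambda>i n. pd i (u n)", OF layer_open L2[OF u(2)] wp L2[OF v] H1_weak_pd[OF v]] B3 by auto
    have eq: "(LINT y|lborel. wave flux F (y, h + L) * u n (y, h + L)) =
      (LINT x:\<Omega>|lborel. wave a F x * pd (0, 1) (u n) x) + (LINT x:\<Omega>|lborel. wave a' F x * u n x)" for n
    proof -
      have I: "set_integrable lborel \<Omega> (\<lambda>x. wave a F x * pd (0, 1) (u n) x)" "set_integrable lborel \<Omega> (\<lambda>x. wave a' F x * u n x)"
        by (intro square_integrable_product(1) aL2 L2 u weak_pd_L2[OF wp[OF B3]])+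
      have deriv: "((\<lambda>t. wave a F (y, t) * u n (y, t)) has_vector_derivative
          wave a F (y, t) * pd (0, 1) (u n) (y, t) + wave a' F (y, t) * u n (y, t)) (at t)" for y t
        unfolding pdW[symmetric]
        by (rule has_vector_derivative_mult[OF pair_has_vector_derivative[OF W(1)] pair_has_vector_derivative[OF u(1)]])
      have cont: "continuous_on UNIV (\<lambda>t. wave a F (y, t) * pd (0, 1) (u n) (y, t) + wave a' F (y, t) * u n (y, t))" for y
        unfolding pdW[symmetric]
        by (intro continuous_on_add continuous_on_mult C1_line_continuous(3,4)[OF W(1) B3] C1_line_continuous(3,4)[OF u(1) B3])
      from layer_vertical_integral(2)[where p="\<lambda>x. wave a F x * u n x" and q="\<lambda>x. wave a F x * pd (0, 1) (u n) x + wave a' F x * u n x",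
          OF deriv cont set_integral_add(1)[OF I] L_pos]
      show ?thesis unfolding set_integral_add(2)[OF I] by (simp add: top bot)
    qed
    show "(\<lambda>n. LINT y|lborel. wave flux F (y, h + L) * u n (y, h + L)) \<longlonglongrightarrow> ?l"
      unfolding eq
      by (intro tendsto_add L2_pairing_convergence[OF aL2(1) weak_pd_L2[OF wp[OF B3]] weak_pd_L2[OF H1_weak_pd[OF v B3]] conv(2)]
          L2_pairing_convergence[OF aL2(2) L2[OF u(2)] L2[OF v] conv(1)])
  qed
qed

text \<open>Tested with the wave whose bottom data is a multiple of $\hat\eta$, a solution sees only its boundary
  values: the form is symmetric, and Green's identity for the wave extends from the approximating sequences to
  the solution.\<close>

lemma normal_deriv_unique:
  assumes sol: "pml_solution s c h L \<sigma>\<^sub>0 m T v" and nd: "has_normal_deriv s c h L \<sigma>\<^sub>0 m v g"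
  shows "g = fourier_distr (\<lambda>\<xi>. dtn \<xi> * fhat T \<xi>)"
proof -
  have v: "v \<in> H1 \<Omega>" and bot: "has_trace \<Omega> v h T" and top: "has_trace \<Omega> v (h + L) (\<lambda>\<psi>. 0)"
    using sol by (auto simp: pml_solution_def)
  have T: "T \<in> sobolev (1/2)" using bot by (simp add: has_trace_def)
  have g: "g \<in> sobolev (- 1 / 2)" using nd by (simp add: has_normal_deriv_def)
  obtain u where u: "\<And>n. C1 (u n)" "\<And>n. u n \<in> H1 \<Omega>" "\<And>n. regular_distr (\<lambda>y. u n (y, h)) \<in> sobolev (1/2)"
    "(\<lambda>n. H1_norm \<Omega> (\<lambda>x. u n x - v x)) \<longlonglongrightarrow> 0"
    "(\<lambda>n. sobolev_norm (1/2) (\<lambda>\<psi>. regular_distr (\<lambda>y. u n (y, h)) \<psi> - T \<psi>)) \<longlonglongrightarrow> 0"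
    using bot unfolding has_trace_def by blast
  obtain u' where u': "\<And>n. C1 (u' n)" "\<And>n. u' n \<in> H1 \<Omega>" "\<And>n. regular_distr (\<lambda>y. u' n (y, h + L)) \<in> sobolev (1/2)"
    "(\<lambda>n. H1_norm \<Omega> (\<lambda>x. u' n x - v x)) \<longlonglongrightarrow> 0"
    "(\<lambda>n. sobolev_norm (1/2) (\<lambda>\<psi>. regular_distr (\<lambda>y. u' n (y, h + L)) \<psi> - 0)) \<longlonglongrightarrow> 0"
    using top unfolding has_trace_def by blast
  let ?k = "complex_of_real (1 / (gauss_mass TYPE(real^2))\<^sup>2)"
  have k: "?k \<noteq> 0" using gauss_mass_pos[where 'a="real^2"] by simp
  have fT: "is_fourier T (fhat T)" and fg: "is_fourier g (fhat g)" using sobolevD(2) T g by blast+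
  have "AE \<xi> in lborel. fhat g \<xi> = dtn \<xi> * fhat T \<xi>"
  proof (rule AE_eq_if_test_functions)
    show "integrable lborel (\<lambda>\<xi>. fhat g \<xi> * \<psi> \<xi>)" if "\<psi> \<in> schwartz" for \<psi> using fg that by (simp add: is_fourier_def)
    show "integrable lborel (\<lambda>\<xi>. dtn \<xi> * fhat T \<xi> * \<psi> \<xi>)" if "\<psi> \<in> schwartz" for \<psi>
      using schwartz_pairing_bound[OF that] dtn_weighted_L2[OF sobolevD(3)[OF T]] by metis
    fix \<eta> :: "real^2 \<Rightarrow> complex" assume \<eta>: "\<eta> \<in> test_functions UNIV"
    define F where "F = (\<lambda>\<xi>. \<eta> (- \<xi>))"
    have F: "band_limited F" unfolding F_def by (rule test_function_reflect(1)[OF \<eta>])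
    have \<eta>S: "\<eta> \<in> schwartz" by (rule test_functions_schwartz[OF \<eta>])
    define w where "w = wave sol F"
    have wb: "w (y, h) = ?k * fourier \<eta> y" for y
      using test_function_reflect(2)[OF \<eta>] by (simp add: w_def wave_def F_def)
    have wt: "w (y, h + L) = 0" for y by (simp add: w_def wave_def ft_def)
    have f\<eta>: "fourier \<phi> \<in> schwartz" if "\<phi> \<in> schwartz" for \<phi> :: "real^2 \<Rightarrow> complex"
      unfolding fourier_eq_ft using that by (rule schwartz_ft) simp
    have wS: "(\<lambda>y. w (y, h)) \<in> schwartz" unfolding wb by (intro schwartz_cmult f\<eta> \<eta>S)
    have wH: "C1 w" "w \<in> H1 \<Omega>" unfolding w_def by (rule sol_wave[OF F])+
    have flux_slice: "(\<lambda>y. wave flux F (y, t)) = (\<lambda>y. ?k * fourier (\<lambda>\<xi>. flux t \<xi> * \<eta> \<xi>) y)"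
      and flux_test: "(\<lambda>\<xi>. flux t \<xi> * \<eta> \<xi>) \<in> test_functions UNIV" if "smooth (flux t)" for t
    proof -
      show *: "(\<lambda>\<xi>. flux t \<xi> * \<eta> \<xi>) \<in> test_functions UNIV" by (rule test_functions_mult[OF \<eta> that])
      show "(\<lambda>y. wave flux F (y, t)) = (\<lambda>y. ?k * fourier (\<lambda>\<xi>. flux t \<xi> * \<eta> \<xi>) y)"
        unfolding test_function_reflect(2)[OF *, symmetric] by (simp add: wave_def F_def flux_even)
    qed
    have slice_S: "(\<lambda>y. wave flux F (y, t)) \<in> schwartz" if "smooth (flux t)" for t
      unfolding flux_slice[OF that] by (intro schwartz_cmult f\<eta> test_functions_schwartz[OF flux_test[OF that]])
    note top_S = slice_S[OF flux_smooth(2)] and bot_S = slice_S[OF flux_smooth(1)]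
    obtain l where l: "\<And>u. (\<And>n. C1 (u n)) \<Longrightarrow> (\<And>n. u n \<in> H1 \<Omega>) \<Longrightarrow> (\<lambda>n. H1_norm \<Omega> (\<lambda>x. u n x - v x)) \<longlonglongrightarrow> 0 \<Longrightarrow>
      (\<lambda>n. LINT y|lborel. wave flux F (y, h + L) * u n (y, h + L)) \<longlonglongrightarrow> l"
      using top_pairing_converges[OF F v] by blast
    have "(\<lambda>n. LINT y|lborel. wave flux F (y, h + L) * u' n (y, h + L)) \<longlonglongrightarrow> 0"
    proof -
      have z: "((\<lambda>\<psi>. 0) :: (real^2) distr) \<in> sobolev (1/2)" using top unfolding has_trace_def by (rule conjunct1)
      have "(LINT y|lborel. wave flux F (y, h + L) * u' n (y, h + L)) = regular_distr (\<lambda>y. u' n (y, h + L)) (\<lambda>y. wave flux F (y, h + L))" for n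
        using top_S by (simp add: regular_distr_def mult.commute)
      then show ?thesis using sobolev_convergence[OF u'(3) z u'(5) top_S] by simp
    qed
    \<comment> \<open>\<open>u'\<close> identifies the limit, which \<open>u\<close>, chosen for the bottom trace, then shares\<close>
    then have l0: "l = 0" using LIMSEQ_unique[OF l[OF u'(1,2,4)]] by blast
    have lim_top: "(\<lambda>n. LINT y|lborel. wave flux F (y, h + L) * u n (y, h + L)) \<longlonglongrightarrow> 0"
      using l[OF u(1,2,4)] unfolding l0 .
    have lim_bot: "(\<lambda>n. LINT y|lborel. wave flux F (y, h) * u n (y, h)) \<longlonglongrightarrow> T (\<lambda>y. wave flux F (y, h))"
    proof -
      have "(LINT y|lborel. wave flux F (y, h) * u n (y, h)) = regular_distr (\<lambda>y. u n (y, h)) (\<lambda>y. wave flux F (y, h))" for n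
        using bot_S by (simp add: regular_distr_def mult.commute)
      then show ?thesis using sobolev_convergence[OF u(3) T u(5) bot_S] by simp
    qed
    have "(\<lambda>n. form (u n) w) \<longlonglongrightarrow> form v w" by (rule pml_form_converges[OF u(2) v wH(2) u(4)])
    moreover have "form (u n) w = (LINT y|lborel. wave flux F (y, h + L) * u n (y, h + L)) - (LINT y|lborel. wave flux F (y, h) * u n (y, h))" for n
      using green_identity[OF F u(1,2), folded w_def] by (simp only: pml_form_commute[of "u n" w])
    ultimately have "form v w = 0 - T (\<lambda>y. wave flux F (y, h))"
      using LIMSEQ_unique[OF _ tendsto_diff[OF lim_top lim_bot]] by simp
    moreover have "form v w = - g (\<lambda>y. w (y, h))"
      using nd wH wt wS by (simp add: has_normal_deriv_def)
    ultimately have gT: "g (\<lambda>y. w (y, h)) = T (\<lambda>y. wave flux F (y, h))" by simp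
    have lin: "X (\<lambda>y. ?k * \<psi> y) = ?k * X \<psi>" if "X \<in> tempered" "\<psi> \<in> schwartz" for X :: "(real^2) distr" and \<psi>
    proof -
      have "X (\<lambda>y. ?k * \<psi> y + 0 * \<psi> y) = ?k * X \<psi> + 0 * X \<psi>" using that unfolding tempered_def by blast
      then show ?thesis by simp
    qed
    have "g (\<lambda>y. w (y, h)) = ?k * (LINT \<xi>|lborel. fhat g \<xi> * \<eta> \<xi>)"
      unfolding wb lin[OF sobolevD(1)[OF g] f\<eta>[OF \<eta>S]] using fg \<eta>S by (simp add: is_fourier_def)
    moreover have "T (\<lambda>y. wave flux F (y, h)) = ?k * (LINT \<xi>|lborel. fhat T \<xi> * (dtn \<xi> * \<eta> \<xi>))"
    proof -
      have *: "(\<lambda>\<xi>. dtn \<xi> * \<eta> \<xi>) \<in> schwartz" using test_functions_schwartz[OF flux_test[OF flux_smooth(1)]] by (simp add: flux_bottom)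
      show ?thesis unfolding flux_slice[OF flux_smooth(1)] flux_bottom lin[OF sobolevD(1)[OF T] f\<eta>[OF *]]
        using fT * by (simp add: is_fourier_def)
    qed
    ultimately have "(LINT \<xi>|lborel. fhat g \<xi> * \<eta> \<xi>) = (LINT \<xi>|lborel. fhat T \<xi> * (dtn \<xi> * \<eta> \<xi>))"
      using gT by (simp only: mult_left_cancel[OF k])
    then show "(LINT \<xi>|lborel. fhat g \<xi> * \<eta> \<xi>) = (LINT \<xi>|lborel. dtn \<xi> * fhat T \<xi> * \<eta> \<xi>)"
      by (simp add: mult_ac)
  qed
  then have "fourier_distr (fhat g) = fourier_distr (\<lambda>\<xi>. dtn \<xi> * fhat T \<xi>)"
    by (rule fourier_distr_AE_cong[OF _ sobolevD(3)[OF g] dtn_weighted_L2[OF sobolevD(3)[OF T]]])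
  then show ?thesis using sobolev_eq_fourier_distr[OF g] by simp
qed

text \<open>The explicit wave shows that the definite description in \<^const>\<open>B_pml\<close> is satisfied, and
  \<open>normal_deriv_unique\<close> that it is satisfied only once.\<close>

theorem B_pml_eq:
  assumes T: "T \<in> sobolev (1/2)"
  shows "B_pml s c h L \<sigma>\<^sub>0 m T = fourier_distr (\<lambda>\<xi>. dtn \<xi> * fhat T \<xi>)"
  unfolding B_pml_def
proof (rule the_equality)
  note W = wave_pml_solution[OF sobolevD(3)[OF T]]
  show "\<exists>v. pml_solution s c h L \<sigma>\<^sub>0 m T v \<and> has_normal_deriv s c h L \<sigma>\<^sub>0 m v (fourier_distr (\<lambda>\<xi>. dtn \<xi> * fhat T \<xi>))"
    using W sobolev_eq_fourier_distr[OF T] by metis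
qed (use normal_deriv_unique in blast)

end

section \<open>The error estimate\<close>

context pml_layer
begin

text \<open>With $z = \beta\widetilde L$ the difference is $\beta(\coth z - 1) = \beta e^{-z}/\sinh z$.  As
  $|\sinh z| \ge \sinh \mathrm{Re}\,z$, the modulus of $e^{-z}/\sinh z$ is at most $2r/(1-r)$ with
  $r = e^{-2\mathrm{Re}\,z}$.  This is increasing in $r$, and $\mathrm{Re}\,z \ge s_1\widetilde L/c \ge \overline L/c$.\<close>

lemma dtn_difference:
  "norm (- \<beta> \<xi> - dtn \<xi>) \<le> max 1 (norm s / c) * (2 * exp (- 2 * (\<sigma>\<^sub>0 * L / (real m + 1)) / c) /
     (1 - exp (- 2 * (\<sigma>\<^sub>0 * L / (real m + 1)) / c))) * jbr \<xi>"
proof -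
  let ?z = "\<beta> \<xi> * of_real Lt" and ?b = "Re (\<beta> \<xi>) * Lt" and ?l = "\<sigma>\<^sub>0 * L / (real m + 1) / c"
  let ?q = "exp (- (2 * ?l))" and ?r = "exp (- (2 * ?b))"
  have Re_z: "Re ?z = ?b" by simp
  have l: "?l > 0" using \<sigma>\<^sub>0_pos L_pos c_pos by simp
  have "?l \<le> Re s / c * Lt"
  proof -
    have "Lt \<ge> inverse (Re s) * (\<sigma>\<^sub>0 * L / (real m + 1))" using L_pos by (simp add: Lt_def distrib_right)
    then have "Re s / c * (inverse (Re s) * (\<sigma>\<^sub>0 * L / (real m + 1))) \<le> Re s / c * Lt"
      using Re_s c_pos by (intro mult_left_mono) auto
    moreover have "Re s / c * (inverse (Re s) * X) = X / c" for X using Re_s by simp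
    ultimately show ?thesis by (simp only:)
  qed
  also have "\<dots> \<le> ?b" using Re_\<beta>_ge[of \<xi>] Lt_pos by (intro mult_right_mono) auto
  finally have lb: "?l \<le> ?b" .
  have "\<beta> \<xi> * (cosh ?z / sinh ?z - 1) = \<beta> \<xi> * (exp (- ?z) / sinh ?z)"
  proof -
    have "cosh ?z - sinh ?z = exp (- ?z)" by (simp add: cosh_minus_sinh)
    then show ?thesis using sinh_\<beta>_nonzero[of \<xi>] by (simp add: field_simps)
  qed
  then have "norm (- \<beta> \<xi> - dtn \<xi>) = norm (\<beta> \<xi>) * (exp (- ?b) / norm (sinh ?z))"
    unfolding dtn_def by (simp add: norm_mult[symmetric] norm_divide[symmetric] algebra_simps norm_exp_eq_Re)
      (simp add: norm_mult norm_divide norm_exp_eq_Re)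
  also have "\<dots> \<le> (max 1 (norm s / c) * jbr \<xi>) * (2 * ?q / (1 - ?q))"
  proof (rule mult_mono)
    show "norm (\<beta> \<xi>) \<le> max 1 (norm s / c) * jbr \<xi>"
      by (rule power2_le_imp_le) (use norm_\<beta>_sq[of \<xi>] in \<open>simp_all add: power_mult_distrib max_def\<close>)
    have sh: "(exp ?b - exp (- ?b)) / 2 \<le> norm (sinh ?z)" using norm_sinh_ge[of ?z] unfolding Re_z .
    have r: "?r < 1" "?r \<le> ?q" using l lb by auto
    have pos: "0 < exp ?b * (1 - ?r) / 2" using r(1) by simp
    have le: "exp ?b * (1 - ?r) / 2 \<le> norm (sinh ?z)"
      using sh unfolding right_diff_distrib mult_exp_exp by simp
    have "exp (- ?b) / norm (sinh ?z) \<le> exp (- ?b) / (exp ?b * (1 - ?r) / 2)"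
      by (rule divide_left_mono[OF le exp_ge_zero mult_pos_pos[OF order.strict_trans2[OF pos le] pos]])
    also have "\<dots> = 2 * ?r / (1 - ?r)"
    proof -
      have "exp (- ?b) = ?r * exp ?b" unfolding mult_exp_exp by simp
      then show ?thesis by simp
    qed
    also have "\<dots> \<le> 2 * ?q / (1 - ?q)" using r l by (intro frac_le) auto
    finally show "exp (- ?b) / norm (sinh ?z) \<le> 2 * ?q / (1 - ?q)" .
  qed auto
  finally show ?thesis by (simp add: mult_ac)
qed

end

theorem theorem3p3:
  fixes s :: complex and s\<^sub>1 s\<^sub>2 c h L \<sigma>\<^sub>0 Lbar :: real and m :: nat
  assumes "s = Complex s\<^sub>1 s\<^sub>2" and "s\<^sub>1 > 0" and "c > 0" and "L > 0" and "\<sigma>\<^sub>0 > 0" and "m \<ge> 1"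
    and "Lbar = \<sigma>\<^sub>0 * L / (real m + 1)"
  shows "bounded_operator (1/2) (-1/2)
           (\<lambda>\<phi> \<psi>. B_half s c \<phi> \<psi> - B_pml s c h L \<sigma>\<^sub>0 m \<phi> \<psi>) \<and>
         operator_norm (1/2) (-1/2)
           (\<lambda>\<phi> \<psi>. B_half s c \<phi> \<psi> - B_pml s c h L \<sigma>\<^sub>0 m \<phi> \<psi>)
         \<le> max 1 (norm s / c) * (2 * exp (- 2 * Lbar / c) / (1 - exp (- 2 * Lbar / c)))"
proof -
  interpret pml_layer s c h L \<sigma>\<^sub>0 m
    using assms by unfold_locales auto
  let ?A = "\<lambda>\<phi> \<psi>. B_half s c \<phi> \<psi> - B_pml s c h L \<sigma>\<^sub>0 m \<phi> \<psi>"
  define M where "M = max 1 (norm s / c) * (2 * exp (- 2 * Lbar / c) / (1 - exp (- 2 * Lbar / c)))"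
  have "exp (- 2 * Lbar / c) < 1" using assms by simp
  then have M: "M \<ge> 0" unfolding M_def by (intro mult_nonneg_nonneg divide_nonneg_nonneg) auto
  define d where "d \<xi> = - symbol_\<beta> s c \<xi> - dtn \<xi>" for \<xi>
  have d_le: "norm (d \<xi>) \<le> M * jbr \<xi>" for \<xi> unfolding d_def M_def assms(7) by (rule dtn_difference)
  have \<beta>m: "(\<lambda>\<xi>. - symbol_\<beta> s c \<xi>) \<in> borel_measurable borel"
    by (intro borel_measurable_continuous_onI continuous_intros \<beta>_continuous)
  have dm: "d \<in> borel_measurable borel" unfolding d_def[abs_def] using \<beta>m dtn_measurable by (rule borel_measurable_diff)
  have \<beta>_le: "norm (- symbol_\<beta> s c \<xi>) \<le> max 1 (norm s / c) * jbr \<xi>" for \<xi>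
    by (rule power2_le_imp_le) (use norm_\<beta>_sq[of \<xi>] in \<open>simp_all add: power_mult_distrib max_def\<close>)
  have A: "?A T = fourier_distr (\<lambda>\<xi>. d \<xi> * fhat T \<xi>)" if T: "T \<in> sobolev (1/2)" for T
  proof -
    note f = sobolevD(3)[OF T]
    have 1: "weighted_L2 (- 1 / 2) (\<lambda>\<xi>. - symbol_\<beta> s c \<xi> * fhat T \<xi>)" by (rule order_one_multiplier(1)[OF f \<beta>m \<beta>_le])
    have 2: "weighted_L2 (- 1 / 2) (\<lambda>\<xi>. dtn \<xi> * fhat T \<xi>)" by (rule dtn_weighted_L2[OF f])
    have "B_half s c T = fourier_distr (\<lambda>\<xi>. - symbol_\<beta> s c \<xi> * fhat T \<xi>)"
      unfolding B_half_def by (rule fourier_multiplier_eq[OF 1])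
    then show ?thesis
      using fourier_distr_lincomb[OF 1 2, of 1 "-1"] B_pml_eq[OF T] by (simp add: d_def left_diff_distrib)
  qed
  have dL2: "weighted_L2 (- 1 / 2) (\<lambda>\<xi>. d \<xi> * fhat T \<xi>)" "weighted_norm_sq (- 1 / 2) (\<lambda>\<xi>. d \<xi> * fhat T \<xi>) \<le> M\<^sup>2 * weighted_norm_sq (1/2) (fhat T)"
    if T: "T \<in> sobolev (1/2)" for T
    by (rule order_one_multiplier[OF sobolevD(3)[OF T] dm d_le])+
  have norm_le: "sobolev_norm (- 1 / 2) (?A T) \<le> M * sobolev_norm (1/2) T" if T: "T \<in> sobolev (1/2)" for T
  proof -
    have "sqrt (weighted_norm_sq (- 1 / 2) (\<lambda>\<xi>. d \<xi> * fhat T \<xi>)) \<le> sqrt (M\<^sup>2 * weighted_norm_sq (1/2) (fhat T))"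
      by (rule real_sqrt_le_mono[OF dL2(2)[OF T]])
    also have "\<dots> = M * sqrt (weighted_norm_sq (1/2) (fhat T))" using M by (simp add: real_sqrt_mult)
    finally show ?thesis unfolding A[OF T] sobolev_fourier_distr(3)[OF dL2(1)[OF T]] sobolevD(4)[OF T] .
  qed
  have lin: "?A (\<lambda>\<psi>. a * S \<psi> + b * T \<psi>) = (\<lambda>\<psi>. a * ?A S \<psi> + b * ?A T \<psi>)"
    if S: "S \<in> sobolev (1/2)" and T: "T \<in> sobolev (1/2)" for S T a b
  proof -
    note ST = sobolev_lincomb[OF S T, of a b]
    have "?A (\<lambda>\<psi>. a * S \<psi> + b * T \<psi>) = fourier_distr (\<lambda>\<xi>. d \<xi> * fhat (\<lambda>\<psi>. a * S \<psi> + b * T \<psi>) \<xi>)" by (rule A[OF ST(1)])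
    also have "\<dots> = fourier_distr (\<lambda>\<xi>. a * (d \<xi> * fhat S \<xi>) + b * (d \<xi> * fhat T \<xi>))"
    proof (rule fourier_distr_AE_cong[OF _ dL2(1)[OF ST(1)] weighted_L2_lincomb[OF dL2(1)[OF S] dL2(1)[OF T]]])
      show "AE \<xi> in lborel. d \<xi> * fhat (\<lambda>\<psi>. a * S \<psi> + b * T \<psi>) \<xi> = a * (d \<xi> * fhat S \<xi>) + b * (d \<xi> * fhat T \<xi>)"
        using ST(2) by eventually_elim (simp add: algebra_simps)
    qed
    also have "\<dots> = (\<lambda>\<psi>. a * fourier_distr (\<lambda>\<xi>. d \<xi> * fhat S \<xi>) \<psi> + b * fourier_distr (\<lambda>\<xi>. d \<xi> * fhat T \<xi>) \<psi>)"
      by (rule fourier_distr_lincomb[OF dL2(1)[OF S] dL2(1)[OF T]])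
    also have "\<dots> = (\<lambda>\<psi>. a * ?A S \<psi> + b * ?A T \<psi>)"
      using fun_cong[OF A[OF S]] fun_cong[OF A[OF T]] by simp
    finally show ?thesis .
  qed
  have "bounded_operator (1/2) (-1/2) ?A"
    unfolding bounded_operator_def
  proof (intro conjI ballI allI exI[of _ M])
    show "?A T \<in> sobolev (- 1 / 2)" if "T \<in> sobolev (1/2)" for T
      unfolding A[OF that] by (rule sobolev_fourier_distr(1)[OF dL2(1)[OF that]])
  qed (use lin norm_le in blast)+
  moreover have "operator_norm (1/2) (-1/2) ?A \<le> M"
    unfolding operator_norm_def
  proof (rule cSUP_least)
    show "sobolev (1/2) \<noteq> ({} :: (real^2) distr set)"
      using sobolev_fourier_distr(1)[OF weighted_L2_0(1), where 'a="real^2"] by blast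
    fix T :: "(real^2) distr" assume T: "T \<in> sobolev (1/2)"
    have "0 \<le> sobolev_norm (1/2) T" unfolding sobolevD(4)[OF T] by (simp add: weighted_norm_sq_nonneg)
    then show "sobolev_norm (-1/2) (?A T) / sobolev_norm (1/2) T \<le> M"
      using norm_le[OF T] M by (cases "sobolev_norm (1/2) T = 0") (auto simp: divide_le_eq)
  qed
  ultimately show ?thesis unfolding M_def by blast
qed

end
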